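(* Assume (A1): $Q_1(i)\ge 0$, $\widehat Q_1(i)\ge 0$, $N_1(i)>0$, $G_1(i)\ge 0$, $\widehat G_1(i)\ge 0$ for all $i\in\mathcal{M}$. For any given $u_2(\cdot)\in\mathcal{U}_2$, the control $$u_1^*(t)=-\widetilde N_1^{-1}(t,\alpha(t))\Big[S_1(t,\alpha(t))x(t)+\widehat S_1(t,\alpha(t))\widehat x(t)+\Phi(t)\Big]$$ (where $x$ is the corresponding state under $(u_1^*,u_2)$, and $\Phi,\widetilde N_1,S_1,\widehat S_1$ are as defined in the context) is an optimal control for the follower, i.e. it minimizes $J_1(u_1(\cdot),u_2(\cdot))$ over $u_1(\cdot)\in\mathcal{U}_1$, and, with $i=\alpha(0)$, $$J_1(u_1^*(\cdot),u_2(\cdot))=\frac12\langle\widetilde P_1(0,i)x_0,x_0\rangle+\langle\varphi(0),x_0\rangle+\frac12E\bigg[\int_0^T\Big(-|\widetilde N_1^{-\frac12}\Phi|^2+\langle D_2^\top P_1D_2u_2,u_2\rangle+2\langle B_2^\top\varphi+D_2^\top\theta,u_2\rangle\Big)dt\bigg],$$ where in the integral the coefficients $\widetilde N_1,P_1$ are evaluated at $(t,\alpha(t))$ and $B_2,D_2$ at $\alpha(t)$.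
   Context: Probabilistic setting. $T>0$ is finite; on $(\Omega,\mathcal{F},P)$ there are a one-dimensional standard Brownian motion $W$ and an independent Markov chain $\alpha$ with values in a finite set $\mathcal{M}$, generator $(\lambda_{ij})_{i,j\in\mathcal{M}}$ and deterministic initial state $\alpha(0)=i$. $\mathcal{F}_t^\alpha=\sigma\{\alpha(s):s\le t\}$, $\mathcal{F}_t=\sigma\{W(s),\alpha(s):s\le t\}$. For a process $\phi$, $\widehat\phi(t)=E[\phi(t)|\mathcal{F}_t^\alpha]$ (a hat on a coefficient matrix, e.g. $\widehat A(i)$, just denotes another given matrix). For $i\ne j$, $M_{ij}(t)=[M_{ij}](t)-\langle M_{ij}\rangle(t)$ with $[M_{ij}](t)=\sum_{0\le s\le t}1_{\{\alpha(s-)=i\}}1_{\{\alpha(s)=j\}}$, $\langle M_{ij}\rangle(t)=\int_0^t\lambda_{ij}1_{\{\alpha(s-)=i\}}ds$; $M_{ii}\equiv0$. $k\bullet dM=\sum_{i,j}k_{ij}dM_{ij}$. Spaces. $\mathcal{L}^2_{\mathcal{F}}(R^n)$: $R^n$-valued $\mathcal{F}_t$-adapted $x$ with $E\int_0^T|x|^2dt<\infty$. $\mathcal{S}^2_{\mathcal{F}}(R^n)$: $R^n$-valued $\mathcal{F}_t$-adapted càdlàg $y$ with $E\int_0^T|y|^2dt<\infty$. $\mathcal{K}^2_{\mathcal{F}}(R^n)$: collections $\{k_{ij}\}_{i,j\in\mathcal{M}}$ of $R^n$-valued $\mathcal{F}_t$-adapted processes with $\sum_{i,j}E\int_0^T|k_{ij}|^2d[M_{ij}]<\infty$,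 $k_{ii}\equiv0$. $\mathcal{U}_k=\mathcal{L}^2_{\mathcal{F}}(R^{m_k})$, $k=1,2$ (1 = follower, 2 = leader). State. For $u_1\in\mathcal{U}_1,u_2\in\mathcal{U}_2$, $x\in\mathcal{L}^2_{\mathcal{F}}(R^n)$ is the unique solution of (coefficients evaluated at $\alpha(t)$) $$dx=[Ax+\widehat A\widehat x+B_1u_1+B_2u_2]dt+[Cx+\widehat C\widehat x+D_1u_1+D_2u_2]dW,\quad x(0)=x_0,$$ where $A(i),\widehat A(i),B_1(i),B_2(i),C(i),\widehat C(i),D_1(i),D_2(i)$ are constant matrices of suitable dimensions and $x_0\in R^n$. Costs. For $k=1,2$, $$J_k(u_1,u_2)=\tfrac12E\Big[\int_0^T\big(\langle Q_kx,x\rangle+\langle\widehat Q_k\widehat x,\widehat x\rangle+\langle N_ku_k,u_k\rangle\big)dt+\langle G_k(\alpha(T))x(T),x(T)\rangle+\langle\widehat G_k(\alpha(T))\widehat x(T),\widehat x(T)\rangle\Big],$$ with $Q_k,\widehat Q_k,N_k$ evaluated at $\alpha(t)$ and $Q_k(i),\widehat Q_k(i),N_k(i),G_k(i),\widehat G_k(i)$ constant symmetric matrices. Follower's notation (arguments $(t,i)$ or $(i)$ omitted): $\widetilde N_1=N_1+D_1^\top P_1D_1$, $S_1=B_1^\top P_1+D_1^\top P_1C$, $\widehat S_1=B_1^\top\widehat P_1+D_1^\top P_1\widehat C$, and $\widetilde P_1=P_1+\widehat P_1$, where $P_1(\cdot,i),\widehat P_1(\cdot,i)$, $i\in\mathcal{M}$,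 are the solutions (deterministic, differentiable, symmetric $R^{n\times n}$-valued) on $[0,T]$ of the Riccati equations (R1) $\dot P_1=-\big[P_1A+A^\top P_1+C^\top P_1C+Q_1-S_1^\top\widetilde N_1^{-1}S_1+\sum_{j}\lambda_{ij}(P_1(t,j)-P_1(t,i))\big]$, $P_1(T,i)=G_1(i)$; (R2) $\dot{\widehat P}_1=-\big[\widehat P_1(A+\widehat A)+(A+\widehat A)^\top\widehat P_1+P_1\widehat A+\widehat A^\top P_1+C^\top P_1\widehat C+\widehat C^\top P_1C+\widehat C^\top P_1\widehat C+\widehat Q_1-S_1^\top\widetilde N_1^{-1}\widehat S_1-\widehat S_1^\top\widetilde N_1^{-1}S_1-\widehat S_1^\top\widetilde N_1^{-1}\widehat S_1+\sum_j\lambda_{ij}(\widehat P_1(t,j)-\widehat P_1(t,i))\big]$, $\widehat P_1(T,i)=\widehat G_1(i)$. Further coefficients: $\mathbb{A}=A-B_1\widetilde N_1^{-1}S_1$, $\widehat{\mathbb{A}}=\widehat A-B_1\widetilde N_1^{-1}\widehat S_1$, $\mathbb{C}=C-D_1\widetilde N_1^{-1}S_1$, $\widehat{\mathbb{C}}=\widehat C-D_1\widetilde N_1^{-1}\widehat S_1$, $S_2=B_2^\top P_1+D_2^\top P_1C$, $\widehat S_2=B_2^\top\widehat P_1+D_2^\top P_1\widehat C$, $\mathbb{F}_2=S_2-D_2^\top P_1D_1\widetilde N_1^{-1}S_1$, $\widehat{\mathbb{F}}_2=\widehat S_2-D_2^\top P_1D_1\widetilde N_1^{-1}\widehat S_1$.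 $(\varphi,\theta,\eta)\in\mathcal{S}^2_{\mathcal{F}}(R^n)\times\mathcal{L}^2_{\mathcal{F}}(R^n)\times\mathcal{K}^2_{\mathcal{F}}(R^n)$ is the solution of the BSDE (coefficients evaluated at $(t,\alpha(t))$) $$d\varphi=-\big[\mathbb{A}^\top\varphi+\widehat{\mathbb{A}}^\top\widehat\varphi+\mathbb{C}^\top\theta+\widehat{\mathbb{C}}^\top\widehat\theta+\mathbb{F}_2^\top u_2+\widehat{\mathbb{F}}_2^\top\widehat u_2\big]dt+\theta\,dW+\eta\bullet dM,\quad\varphi(T)=0,$$ and $\Phi(t)=B_1^\top(\alpha(t))\varphi(t)+D_1^\top(\alpha(t))\theta(t)+D_1^\top(\alpha(t))P_1(t,\alpha(t))D_2(\alpha(t))u_2(t)$. *)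

theory Defs
  imports "HOL-Probability.Probability"
begin

section \<open>Filtrations and driving processes\<close>

text \<open>Processes are functions of type \<^typ>\<open>real \<Rightarrow> 'w \<Rightarrow> 'e\<close>; only their values at times
  in \<open>[0, T]\<close> matter.  The state space of the chain is a finite type \<open>'s\<close>.\<close>

definition chain_filtration ::
  "'w measure \<Rightarrow> (real \<Rightarrow> 'w \<Rightarrow> 's) \<Rightarrow> real \<Rightarrow> 'w measure" where
  "chain_filtration M \<alpha> t =
     sigma (space M) {\<alpha> s -` B \<inter> space M | s B. 0 \<le> s \<and> s \<le> t}"

definition noise_filtration ::
  "'w measure \<Rightarrow> (real \<Rightarrow> 'w \<Rightarrow> real) \<Rightarrow> real \<Rightarrow> 'w measure" where
  "noise_filtration M W t =
     sigma (space M) {W s -` B \<inter> space M | s B. 0 \<le> s \<and> s \<le> t \<and> B \<in> sets borel}"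

definition joint_filtration ::
  "'w measure \<Rightarrow> (real \<Rightarrow> 'w \<Rightarrow> real) \<Rightarrow> (real \<Rightarrow> 'w \<Rightarrow> 's) \<Rightarrow> real \<Rightarrow> 'w measure" where
  "joint_filtration M W \<alpha> t =
     sigma (space M) (sets (noise_filtration M W t) \<union> sets (chain_filtration M \<alpha> t))"

definition standard_brownian_motion ::
  "'w measure \<Rightarrow> real \<Rightarrow> (real \<Rightarrow> 'w \<Rightarrow> real) \<Rightarrow> bool" where
  "standard_brownian_motion M T W \<longleftrightarrow>
     (\<forall>t\<in>{0..T}. W t \<in> borel_measurable M) \<and>
     (AE \<omega> in M. W 0 \<omega> = 0) \<and>
     (AE \<omega> in M. continuous_on {0..T} (\<lambda>t. W t \<omega>)) \<and>
     (\<forall>s t. 0 \<le> s \<and> s < t \<and> t \<le> T \<longrightarrow>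
        distributed M lborel (\<lambda>\<omega>. W t \<omega> - W s \<omega>) (normal_density 0 (sqrt (t - s))) \<and>
        prob_space.indep_set M (sets (noise_filtration M W s))
          (sets (vimage_algebra (space M) (\<lambda>\<omega>. W t \<omega> - W s \<omega>) borel)))"

definition transition_semigroup ::
  "('s::finite \<Rightarrow> 's \<Rightarrow> real) \<Rightarrow> (real \<Rightarrow> 's \<Rightarrow> 's \<Rightarrow> real) \<Rightarrow> bool" where
  "transition_semigroup gen p \<longleftrightarrow>
     (\<forall>t\<ge>0. \<forall>i j. 0 \<le> p t i j) \<and>
     (\<forall>t\<ge>0. \<forall>i. (\<Sum>j\<in>UNIV. p t i j) = 1) \<and>
     (\<forall>i j. p 0 i j = (if i = j then 1 else 0)) \<and>
     (\<forall>s\<ge>0. \<forall>t\<ge>0. \<forall>i j. p (s + t) i j = (\<Sum>k\<in>UNIV. p s i k * p t k j)) \<and>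
     (\<forall>i j. ((\<lambda>t. p t i j) has_real_derivative gen i j) (at 0 within {0..}))"

text \<open>The left limit \<open>\<alpha>(t-)\<close> is taken in the discrete topology of the finite state space.\<close>

definition left_value :: "(real \<Rightarrow> 'w \<Rightarrow> 's) \<Rightarrow> real \<Rightarrow> 'w \<Rightarrow> 's \<Rightarrow> bool" where
  "left_value \<alpha> t \<omega> i \<longleftrightarrow> (\<forall>\<^sub>F r in at_left t. \<alpha> r \<omega> = i)"

text \<open>The chain is required to be cadlag on every path, not just almost every one: no completeness
  of \<open>M\<close> is assumed, and otherwise coefficients evaluated at \<open>\<alpha>(t)\<close> need not be jointly
  measurable.\<close>

definition markov_chain ::
  "'w measure \<Rightarrow> real \<Rightarrow> ('s::finite \<Rightarrow> 's \<Rightarrow> real) \<Rightarrow> 's \<Rightarrow> (real \<Rightarrow> 'w \<Rightarrow> 's) \<Rightarrow> bool" where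
  "markov_chain M T gen i0 \<alpha> \<longleftrightarrow>
     (\<forall>t\<in>{0..T}. \<alpha> t \<in> measurable M (count_space UNIV)) \<and>
     (AE \<omega> in M. \<alpha> 0 \<omega> = i0) \<and>
     (\<forall>\<omega>\<in>space M. \<forall>t\<in>{0..<T}. \<forall>\<^sub>F r in at_right t. \<alpha> r \<omega> = \<alpha> t \<omega>) \<and>
     (\<forall>\<omega>\<in>space M. \<forall>t\<in>{0<..T}. \<exists>i. left_value \<alpha> t \<omega> i) \<and>
     (\<exists>p. transition_semigroup gen p \<and>
        (\<forall>s t j. 0 \<le> s \<and> s \<le> t \<and> t \<le> T \<longrightarrow>
           (AE \<omega> in M. real_cond_exp M (chain_filtration M \<alpha> s)
              (indicator {\<omega> \<in> space M. \<alpha> t \<omega> = j}) \<omega> = p (t - s) (\<alpha> s \<omega>) j)))"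

section \<open>The martingales of the chain\<close>

definition jump_times ::
  "(real \<Rightarrow> 'w \<Rightarrow> 's) \<Rightarrow> 's \<Rightarrow> 's \<Rightarrow> real \<Rightarrow> 'w \<Rightarrow> real set" where
  "jump_times \<alpha> i j t \<omega> = {s. i \<noteq> j \<and> 0 < s \<and> s \<le> t \<and> left_value \<alpha> s \<omega> i \<and> \<alpha> s \<omega> = j}"

definition chain_bracket ::
  "(real \<Rightarrow> 'w \<Rightarrow> 's) \<Rightarrow> 's \<Rightarrow> 's \<Rightarrow> real \<Rightarrow> 'w \<Rightarrow> real" where
  "chain_bracket \<alpha> i j t \<omega> = real (card (jump_times \<alpha> i j t \<omega>))"

definition chain_compensator ::
  "('s \<Rightarrow> 's \<Rightarrow> real) \<Rightarrow> (real \<Rightarrow> 'w \<Rightarrow> 's) \<Rightarrow> 's \<Rightarrow> 's \<Rightarrow> real \<Rightarrow> 'w \<Rightarrow> real" where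
  "chain_compensator gen \<alpha> i j t \<omega> =
     (LINT s:{0..t}|lborel. gen i j * (if left_value \<alpha> s \<omega> i then 1 else 0))"

definition chain_martingale ::
  "('s \<Rightarrow> 's \<Rightarrow> real) \<Rightarrow> (real \<Rightarrow> 'w \<Rightarrow> 's) \<Rightarrow> 's \<Rightarrow> 's \<Rightarrow> real \<Rightarrow> 'w \<Rightarrow> real" where
  "chain_martingale gen \<alpha> i j t \<omega> =
     (if i = j then 0 else chain_bracket \<alpha> i j t \<omega> - chain_compensator gen \<alpha> i j t \<omega>)"

section \<open>Spaces of processes\<close>

definition jointly_measurable ::
  "'w measure \<Rightarrow> real \<Rightarrow> (real \<Rightarrow> 'w \<Rightarrow> 'e::euclidean_space) \<Rightarrow> bool" where
  "jointly_measurable M T x \<longleftrightarrow>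
     (\<lambda>(t, \<omega>). x t \<omega>) \<in> borel_measurable (restrict_space borel {0..T} \<Otimes>\<^sub>M M)"

definition adapted ::
  "(real \<Rightarrow> 'w measure) \<Rightarrow> real \<Rightarrow> (real \<Rightarrow> 'w \<Rightarrow> 'e::euclidean_space) \<Rightarrow> bool" where
  "adapted F T x \<longleftrightarrow> (\<forall>t\<in>{0..T}. x t \<in> borel_measurable (F t))"

definition time_energy ::
  "'w measure \<Rightarrow> real \<Rightarrow> (real \<Rightarrow> 'w \<Rightarrow> 'e::euclidean_space) \<Rightarrow> ennreal" where
  "time_energy M T x = (\<integral>\<^sup>+\<omega>. (\<integral>\<^sup>+t\<in>{0..T}. ennreal ((norm (x t \<omega>))\<^sup>2) \<partial>lborel) \<partial>M)"

text \<open>\<open>E \<integral>\<^sub>0\<^sup>T |k|\<^sup>2 d[M\<^sub>i\<^sub>j]\<close>: the measure \<open>d[M\<^sub>i\<^sub>j]\<close> counts the times of the jumps from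
  \<open>i\<close> to \<open>j\<close>.\<close>

definition jump_energy ::
  "'w measure \<Rightarrow> real \<Rightarrow> (real \<Rightarrow> 'w \<Rightarrow> 's) \<Rightarrow> 's \<Rightarrow> 's \<Rightarrow>
     (real \<Rightarrow> 'w \<Rightarrow> 'e::euclidean_space) \<Rightarrow> ennreal" where
  "jump_energy M T \<alpha> i j k =
     (\<integral>\<^sup>+\<omega>. (\<integral>\<^sup>+s. ennreal ((norm (k s \<omega>))\<^sup>2) \<partial>count_space (jump_times \<alpha> i j T \<omega>)) \<partial>M)"

definition L2_space ::
  "'w measure \<Rightarrow> (real \<Rightarrow> 'w measure) \<Rightarrow> real \<Rightarrow> (real \<Rightarrow> 'w \<Rightarrow> 'e::euclidean_space) set" where
  "L2_space M F T = {x. jointly_measurable M T x \<and> adapted F T x \<and> time_energy M T x < \<infinity>}"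

definition cadlag_on :: "real \<Rightarrow> (real \<Rightarrow> 'e::euclidean_space) \<Rightarrow> bool" where
  "cadlag_on T f \<longleftrightarrow>
     (\<forall>t\<in>{0..<T}. (f \<longlongrightarrow> f t) (at_right t)) \<and>
     (\<forall>t\<in>{0<..T}. \<exists>l. (f \<longlongrightarrow> l) (at_left t))"

definition S2_space ::
  "'w measure \<Rightarrow> (real \<Rightarrow> 'w measure) \<Rightarrow> real \<Rightarrow> (real \<Rightarrow> 'w \<Rightarrow> 'e::euclidean_space) set" where
  "S2_space M F T = {y \<in> L2_space M F T. AE \<omega> in M. cadlag_on T (\<lambda>t. y t \<omega>)}"

definition K2_space ::
  "'w measure \<Rightarrow> (real \<Rightarrow> 'w measure) \<Rightarrow> real \<Rightarrow> (real \<Rightarrow> 'w \<Rightarrow> 's::finite) \<Rightarrow>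
     ('s \<Rightarrow> 's \<Rightarrow> real \<Rightarrow> 'w \<Rightarrow> 'e::euclidean_space) set" where
  "K2_space M F T \<alpha> = {k.
     (\<forall>i j. jointly_measurable M T (k i j) \<and> adapted F T (k i j)) \<and>
     (\<Sum>i\<in>UNIV. \<Sum>j\<in>UNIV. jump_energy M T \<alpha> i j (k i j)) < \<infinity> \<and>
     (\<forall>i. \<forall>t\<in>{0..T}. \<forall>\<omega>\<in>space M. k i i t \<omega> = 0)}"

text \<open>\<open>xh\<close> is a version of the process \<open>t \<mapsto> E[x(t) | \<F>\<^sub>t\<^sup>\<alpha>]\<close>.  The conditional expectations are
  only determined almost surely for each \<open>t\<close>, so time integrals of them make sense only for a
  jointly measurable version.  The restriction to times with \<open>x(t)\<close> integrable is needed since an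
  element of the \<open>L\<^sup>2\<close> space is integrable at almost every time only.\<close>

definition chain_projection ::
  "'w measure \<Rightarrow> real \<Rightarrow> (real \<Rightarrow> 'w \<Rightarrow> 's) \<Rightarrow>
     (real \<Rightarrow> 'w \<Rightarrow> real^'n) \<Rightarrow> (real \<Rightarrow> 'w \<Rightarrow> real^'n) \<Rightarrow> bool" where
  "chain_projection M T \<alpha> x xh \<longleftrightarrow>
     jointly_measurable M T xh \<and> adapted (chain_filtration M \<alpha>) T xh \<and>
     (\<forall>t\<in>{0..T}. integrable M (x t) \<longrightarrow>
        (AE \<omega> in M. \<forall>m. xh t \<omega> $ m =
           real_cond_exp M (chain_filtration M \<alpha> t) (\<lambda>\<omega>. x t \<omega> $ m) \<omega>))"

section \<open>Stochastic integrals\<close>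

text \<open>Simple integrands \<open>\<Sum>\<^sub>l \<xi>\<^sub>l 1\<^bsub>(\<tau>\<^sub>l, \<tau>\<^sub>l\<^sub>+\<^sub>1]\<^esub>\<close> over a deterministic grid with \<open>n\<close> cells.\<close>

definition simple_integrand ::
  "'w measure \<Rightarrow> (real \<Rightarrow> 'w measure) \<Rightarrow> real \<Rightarrow> nat \<Rightarrow> (nat \<Rightarrow> real) \<Rightarrow>
     (nat \<Rightarrow> 'w \<Rightarrow> 'e::euclidean_space) \<Rightarrow> bool" where
  "simple_integrand M F T n \<tau> \<xi> \<longleftrightarrow>
     0 \<le> \<tau> 0 \<and> \<tau> n \<le> T \<and> (\<forall>l<n. \<tau> l \<le> \<tau> (Suc l)) \<and>
     (\<forall>l<n. \<xi> l \<in> borel_measurable (F (\<tau> l)) \<and> (\<exists>c. \<forall>\<omega>\<in>space M. norm (\<xi> l \<omega>) \<le> c))"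

definition simple_process ::
  "nat \<Rightarrow> (nat \<Rightarrow> real) \<Rightarrow> (nat \<Rightarrow> 'w \<Rightarrow> 'e::euclidean_space) \<Rightarrow> real \<Rightarrow> 'w \<Rightarrow> 'e" where
  "simple_process n \<tau> \<xi> t \<omega> = (\<Sum>l<n. indicator {\<tau> l<..\<tau> (Suc l)} t *\<^sub>R \<xi> l \<omega>)"

definition simple_integral ::
  "(real \<Rightarrow> 'w \<Rightarrow> real) \<Rightarrow> nat \<Rightarrow> (nat \<Rightarrow> real) \<Rightarrow> (nat \<Rightarrow> 'w \<Rightarrow> 'e::euclidean_space) \<Rightarrow>
     real \<Rightarrow> 'w \<Rightarrow> 'e" where
  "simple_integral Z n \<tau> \<xi> t \<omega> =
     (\<Sum>l<n. (Z (min t (\<tau> (Suc l))) \<omega> - Z (min t (\<tau> l)) \<omega>) *\<^sub>R \<xi> l \<omega>)"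

text \<open>\<open>I(t) = \<integral>\<^sub>0\<^sup>t k dZ\<close> for \<open>t \<in> [0, T]\<close>, for a square-integrable martingale \<open>Z\<close>: the usual
  \<open>L\<^sup>2\<close> extension from simple integrands, where \<open>energy k\<close> stands for \<open>E \<integral>\<^sub>0\<^sup>T |k|\<^sup>2 d[Z]\<close>.\<close>

definition has_stochastic_integral ::
  "'w measure \<Rightarrow> (real \<Rightarrow> 'w measure) \<Rightarrow> real \<Rightarrow> ((real \<Rightarrow> 'w \<Rightarrow> 'e) \<Rightarrow> ennreal) \<Rightarrow>
     (real \<Rightarrow> 'w \<Rightarrow> real) \<Rightarrow> (real \<Rightarrow> 'w \<Rightarrow> 'e::euclidean_space) \<Rightarrow> (real \<Rightarrow> 'w \<Rightarrow> 'e) \<Rightarrow> bool" where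
  "has_stochastic_integral M F T energy Z k I \<longleftrightarrow>
     (\<forall>t\<in>{0..T}. I t \<in> borel_measurable M) \<and>
     (\<exists>n \<tau> \<xi>.
        (\<forall>m. simple_integrand M F T (n m) (\<tau> m) (\<xi> m)) \<and>
        (\<lambda>m. energy (\<lambda>t \<omega>. simple_process (n m) (\<tau> m) (\<xi> m) t \<omega> - k t \<omega>)) \<longlonglongrightarrow> 0 \<and>
        (\<forall>t\<in>{0..T}.
           (\<lambda>m. \<integral>\<^sup>+\<omega>. ennreal ((norm (simple_integral Z (n m) (\<tau> m) (\<xi> m) t \<omega> - I t \<omega>))\<^sup>2) \<partial>M)
             \<longlonglongrightarrow> 0))"

definition has_ito_integral ::
  "'w measure \<Rightarrow> (real \<Rightarrow> 'w measure) \<Rightarrow> real \<Rightarrow> (real \<Rightarrow> 'w \<Rightarrow> real) \<Rightarrow>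
     (real \<Rightarrow> 'w \<Rightarrow> 'e::euclidean_space) \<Rightarrow> (real \<Rightarrow> 'w \<Rightarrow> 'e) \<Rightarrow> bool" where
  "has_ito_integral M F T W k I \<longleftrightarrow> has_stochastic_integral M F T (time_energy M T) W k I"

text \<open>For \<open>\<integral> k dM\<^sub>i\<^sub>j\<close> the integrand is merely adapted.  The \<open>L\<^sup>2\<close> extension takes the integral of a
  predictable process that agrees with \<open>k\<close> almost everywhere for \<open>d[M\<^sub>i\<^sub>j] \<otimes> P\<close>.  The pathwise
  difference of the integrals against \<open>d[M\<^sub>i\<^sub>j]\<close> and its compensator would not be a martingale for
  such \<open>k\<close>, and the backward equation below would lose uniqueness.\<close>

definition has_chain_integral ::
  "'w measure \<Rightarrow> (real \<Rightarrow> 'w measure) \<Rightarrow> real \<Rightarrow> ('s::finite \<Rightarrow> 's \<Rightarrow> real) \<Rightarrow> (real \<Rightarrow> 'w \<Rightarrow> 's) \<Rightarrow>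
     ('s \<Rightarrow> 's \<Rightarrow> real \<Rightarrow> 'w \<Rightarrow> 'e::euclidean_space) \<Rightarrow> (real \<Rightarrow> 'w \<Rightarrow> 'e) \<Rightarrow> bool" where
  "has_chain_integral M F T gen \<alpha> k I \<longleftrightarrow>
     (\<exists>J. (\<forall>i j. has_stochastic_integral M F T (jump_energy M T \<alpha> i j)
                   (chain_martingale gen \<alpha> i j) (k i j) (J i j)) \<and>
          I = (\<lambda>t \<omega>. \<Sum>i\<in>UNIV. \<Sum>j\<in>UNIV. J i j t \<omega>))"

section \<open>Matrices and the data of the follower's problem\<close>

definition symmetric_matrix :: "real^'n^'n \<Rightarrow> bool" where
  "symmetric_matrix X \<longleftrightarrow> transpose X = X"

definition pos_semidef :: "real^'n^'n \<Rightarrow> bool" where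
  "pos_semidef X \<longleftrightarrow> symmetric_matrix X \<and> (\<forall>v. 0 \<le> (X *v v) \<bullet> v)"

definition pos_def :: "real^'n^'n \<Rightarrow> bool" where
  "pos_def X \<longleftrightarrow> symmetric_matrix X \<and> (\<forall>v. v \<noteq> 0 \<longrightarrow> 0 < (X *v v) \<bullet> v)"

definition psd_sqrt :: "real^'n^'n \<Rightarrow> real^'n^'n" where
  "psd_sqrt X = (THE Y. pos_semidef Y \<and> Y ** Y = X)"

text \<open>The coefficients as functions of the regime; a trailing \<open>h\<close> stands for a hat.  The dimensions
  of the state and of the two controls are \<open>'n\<close>, \<open>'m1\<close> (follower) and \<open>'m2\<close> (leader).\<close>

record ('s, 'n::finite, 'm1::finite, 'm2::finite) lq_data =
  cA :: "'s \<Rightarrow> real^'n^'n"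
  cAh :: "'s \<Rightarrow> real^'n^'n"
  cB1 :: "'s \<Rightarrow> real^'m1^'n"
  cB2 :: "'s \<Rightarrow> real^'m2^'n"
  cC :: "'s \<Rightarrow> real^'n^'n"
  cCh :: "'s \<Rightarrow> real^'n^'n"
  cD1 :: "'s \<Rightarrow> real^'m1^'n"
  cD2 :: "'s \<Rightarrow> real^'m2^'n"
  cQ1 :: "'s \<Rightarrow> real^'n^'n"
  cQ1h :: "'s \<Rightarrow> real^'n^'n"
  cN1 :: "'s \<Rightarrow> real^'m1^'m1"
  cG1 :: "'s \<Rightarrow> real^'n^'n"
  cG1h :: "'s \<Rightarrow> real^'n^'n"

text \<open>\<open>xh\<close> is the process \<open>E[x(t) | \<F>\<^sub>t\<^sup>\<alpha>]\<close> entering the equation.\<close>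

definition is_state ::
  "'w measure \<Rightarrow> real \<Rightarrow> (real \<Rightarrow> 'w \<Rightarrow> real) \<Rightarrow> (real \<Rightarrow> 'w \<Rightarrow> 's) \<Rightarrow>
     ('s, 'n::finite, 'm1::finite, 'm2::finite) lq_data \<Rightarrow> real^'n \<Rightarrow>
     (real \<Rightarrow> 'w \<Rightarrow> real^'m1) \<Rightarrow> (real \<Rightarrow> 'w \<Rightarrow> real^'m2) \<Rightarrow>
     (real \<Rightarrow> 'w \<Rightarrow> real^'n) \<Rightarrow> (real \<Rightarrow> 'w \<Rightarrow> real^'n) \<Rightarrow> bool" where
  "is_state M T W \<alpha> d x0 u1 u2 x xh \<longleftrightarrow>
     x \<in> L2_space M (joint_filtration M W \<alpha>) T \<and>
     chain_projection M T \<alpha> x xh \<and>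
     (\<exists>I. has_ito_integral M (joint_filtration M W \<alpha>) T W
            (\<lambda>t \<omega>. cC d (\<alpha> t \<omega>) *v x t \<omega> + cCh d (\<alpha> t \<omega>) *v xh t \<omega>
                  + cD1 d (\<alpha> t \<omega>) *v u1 t \<omega> + cD2 d (\<alpha> t \<omega>) *v u2 t \<omega>) I \<and>
          (\<forall>t\<in>{0..T}. AE \<omega> in M. x t \<omega> = x0
            + (LINT s:{0..t}|lborel. cA d (\<alpha> s \<omega>) *v x s \<omega> + cAh d (\<alpha> s \<omega>) *v xh s \<omega>
                  + cB1 d (\<alpha> s \<omega>) *v u1 s \<omega> + cB2 d (\<alpha> s \<omega>) *v u2 s \<omega>)
            + I t \<omega>))"

definition follower_cost ::
  "'w measure \<Rightarrow> real \<Rightarrow> (real \<Rightarrow> 'w \<Rightarrow> 's) \<Rightarrow> ('s, 'n::finite, 'm1::finite, 'm2::finite) lq_data \<Rightarrow>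
     (real \<Rightarrow> 'w \<Rightarrow> real^'n) \<Rightarrow> (real \<Rightarrow> 'w \<Rightarrow> real^'n) \<Rightarrow> (real \<Rightarrow> 'w \<Rightarrow> real^'m1) \<Rightarrow> real" where
  "follower_cost M T \<alpha> d x xh u1 = 1/2 * (LINT \<omega>|M.
     (LINT t:{0..T}|lborel. (cQ1 d (\<alpha> t \<omega>) *v x t \<omega>) \<bullet> x t \<omega>
        + (cQ1h d (\<alpha> t \<omega>) *v xh t \<omega>) \<bullet> xh t \<omega>
        + (cN1 d (\<alpha> t \<omega>) *v u1 t \<omega>) \<bullet> u1 t \<omega>)
     + (cG1 d (\<alpha> T \<omega>) *v x T \<omega>) \<bullet> x T \<omega>
     + (cG1h d (\<alpha> T \<omega>) *v xh T \<omega>) \<bullet> xh T \<omega>)"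

definition N1_tilde ::
  "('s, 'n::finite, 'm1::finite, 'm2::finite) lq_data \<Rightarrow> (real \<Rightarrow> 's \<Rightarrow> real^'n^'n) \<Rightarrow> real \<Rightarrow> 's \<Rightarrow> real^'m1^'m1" where
  "N1_tilde d P t i = cN1 d i + transpose (cD1 d i) ** P t i ** cD1 d i"

definition S1 ::
  "('s, 'n::finite, 'm1::finite, 'm2::finite) lq_data \<Rightarrow> (real \<Rightarrow> 's \<Rightarrow> real^'n^'n) \<Rightarrow> real \<Rightarrow> 's \<Rightarrow> real^'n^'m1" where
  "S1 d P t i = transpose (cB1 d i) ** P t i + transpose (cD1 d i) ** P t i ** cC d i"

definition S1h ::
  "('s, 'n::finite, 'm1::finite, 'm2::finite) lq_data \<Rightarrow> (real \<Rightarrow> 's \<Rightarrow> real^'n^'n) \<Rightarrow> (real \<Rightarrow> 's \<Rightarrow> real^'n^'n) \<Rightarrow>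
     real \<Rightarrow> 's \<Rightarrow> real^'n^'m1" where
  "S1h d P Ph t i = transpose (cB1 d i) ** Ph t i + transpose (cD1 d i) ** P t i ** cCh d i"

definition S2 ::
  "('s, 'n::finite, 'm1::finite, 'm2::finite) lq_data \<Rightarrow> (real \<Rightarrow> 's \<Rightarrow> real^'n^'n) \<Rightarrow> real \<Rightarrow> 's \<Rightarrow> real^'n^'m2" where
  "S2 d P t i = transpose (cB2 d i) ** P t i + transpose (cD2 d i) ** P t i ** cC d i"

definition S2h ::
  "('s, 'n::finite, 'm1::finite, 'm2::finite) lq_data \<Rightarrow> (real \<Rightarrow> 's \<Rightarrow> real^'n^'n) \<Rightarrow> (real \<Rightarrow> 's \<Rightarrow> real^'n^'n) \<Rightarrow>
     real \<Rightarrow> 's \<Rightarrow> real^'n^'m2" where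
  "S2h d P Ph t i = transpose (cB2 d i) ** Ph t i + transpose (cD2 d i) ** P t i ** cCh d i"

definition riccati1 ::
  "('s::finite, 'n::finite, 'm1::finite, 'm2::finite) lq_data \<Rightarrow> ('s \<Rightarrow> 's \<Rightarrow> real) \<Rightarrow> real \<Rightarrow>
     (real \<Rightarrow> 's \<Rightarrow> real^'n^'n) \<Rightarrow> bool" where
  "riccati1 d gen T P \<longleftrightarrow>
     (\<forall>i. P T i = cG1 d i) \<and>
     (\<forall>i. \<forall>t\<in>{0..T}. symmetric_matrix (P t i) \<and>
       ((\<lambda>s. P s i) has_vector_derivative
         - (P t i ** cA d i + transpose (cA d i) ** P t i
            + transpose (cC d i) ** P t i ** cC d i + cQ1 d i
            - transpose (S1 d P t i) ** matrix_inv (N1_tilde d P t i) ** S1 d P t i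
            + (\<Sum>j\<in>UNIV. gen i j *\<^sub>R (P t j - P t i)))) (at t within {0..T}))"

definition riccati2 ::
  "('s::finite, 'n::finite, 'm1::finite, 'm2::finite) lq_data \<Rightarrow> ('s \<Rightarrow> 's \<Rightarrow> real) \<Rightarrow> real \<Rightarrow>
     (real \<Rightarrow> 's \<Rightarrow> real^'n^'n) \<Rightarrow> (real \<Rightarrow> 's \<Rightarrow> real^'n^'n) \<Rightarrow> bool" where
  "riccati2 d gen T P Ph \<longleftrightarrow>
     (\<forall>i. Ph T i = cG1h d i) \<and>
     (\<forall>i. \<forall>t\<in>{0..T}. symmetric_matrix (Ph t i) \<and>
       ((\<lambda>s. Ph s i) has_vector_derivative
         - (Ph t i ** (cA d i + cAh d i) + transpose (cA d i + cAh d i) ** Ph t i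
            + P t i ** cAh d i + transpose (cAh d i) ** P t i
            + transpose (cC d i) ** P t i ** cCh d i
            + transpose (cCh d i) ** P t i ** cC d i
            + transpose (cCh d i) ** P t i ** cCh d i + cQ1h d i
            - transpose (S1 d P t i) ** matrix_inv (N1_tilde d P t i) ** S1h d P Ph t i
            - transpose (S1h d P Ph t i) ** matrix_inv (N1_tilde d P t i) ** S1 d P t i
            - transpose (S1h d P Ph t i) ** matrix_inv (N1_tilde d P t i) ** S1h d P Ph t i
            + (\<Sum>j\<in>UNIV. gen i j *\<^sub>R (Ph t j - Ph t i)))) (at t within {0..T}))"

definition bbA ::
  "('s, 'n::finite, 'm1::finite, 'm2::finite) lq_data \<Rightarrow> (real \<Rightarrow> 's \<Rightarrow> real^'n^'n) \<Rightarrow> real \<Rightarrow> 's \<Rightarrow> real^'n^'n" where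
  "bbA d P t i = cA d i - cB1 d i ** matrix_inv (N1_tilde d P t i) ** S1 d P t i"

definition bbAh ::
  "('s, 'n::finite, 'm1::finite, 'm2::finite) lq_data \<Rightarrow> (real \<Rightarrow> 's \<Rightarrow> real^'n^'n) \<Rightarrow> (real \<Rightarrow> 's \<Rightarrow> real^'n^'n) \<Rightarrow>
     real \<Rightarrow> 's \<Rightarrow> real^'n^'n" where
  "bbAh d P Ph t i = cAh d i - cB1 d i ** matrix_inv (N1_tilde d P t i) ** S1h d P Ph t i"

definition bbC ::
  "('s, 'n::finite, 'm1::finite, 'm2::finite) lq_data \<Rightarrow> (real \<Rightarrow> 's \<Rightarrow> real^'n^'n) \<Rightarrow> real \<Rightarrow> 's \<Rightarrow> real^'n^'n" where
  "bbC d P t i = cC d i - cD1 d i ** matrix_inv (N1_tilde d P t i) ** S1 d P t i"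

definition bbCh ::
  "('s, 'n::finite, 'm1::finite, 'm2::finite) lq_data \<Rightarrow> (real \<Rightarrow> 's \<Rightarrow> real^'n^'n) \<Rightarrow> (real \<Rightarrow> 's \<Rightarrow> real^'n^'n) \<Rightarrow>
     real \<Rightarrow> 's \<Rightarrow> real^'n^'n" where
  "bbCh d P Ph t i = cCh d i - cD1 d i ** matrix_inv (N1_tilde d P t i) ** S1h d P Ph t i"

definition bbF2 ::
  "('s, 'n::finite, 'm1::finite, 'm2::finite) lq_data \<Rightarrow> (real \<Rightarrow> 's \<Rightarrow> real^'n^'n) \<Rightarrow> real \<Rightarrow> 's \<Rightarrow> real^'n^'m2" where
  "bbF2 d P t i = S2 d P t i
     - transpose (cD2 d i) ** P t i ** cD1 d i ** matrix_inv (N1_tilde d P t i) ** S1 d P t i"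

definition bbF2h ::
  "('s, 'n::finite, 'm1::finite, 'm2::finite) lq_data \<Rightarrow> (real \<Rightarrow> 's \<Rightarrow> real^'n^'n) \<Rightarrow> (real \<Rightarrow> 's \<Rightarrow> real^'n^'n) \<Rightarrow>
     real \<Rightarrow> 's \<Rightarrow> real^'n^'m2" where
  "bbF2h d P Ph t i = S2h d P Ph t i
     - transpose (cD2 d i) ** P t i ** cD1 d i ** matrix_inv (N1_tilde d P t i) ** S1h d P Ph t i"

text \<open>The backward equation in integrated form,
  \<open>\<phi>(t) = \<integral>\<^sub>t\<^sup>T f ds - \<integral>\<^sub>t\<^sup>T \<theta> dW - \<integral>\<^sub>t\<^sup>T \<eta> \<bullet> dM\<close>, with \<open>-f\<close> the drift.\<close>

definition is_bsde_solution ::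
  "'w measure \<Rightarrow> real \<Rightarrow> (real \<Rightarrow> 'w \<Rightarrow> real) \<Rightarrow> ('s::finite \<Rightarrow> 's \<Rightarrow> real) \<Rightarrow> (real \<Rightarrow> 'w \<Rightarrow> 's) \<Rightarrow>
     ('s, 'n::finite, 'm1::finite, 'm2::finite) lq_data \<Rightarrow> (real \<Rightarrow> 's \<Rightarrow> real^'n^'n) \<Rightarrow> (real \<Rightarrow> 's \<Rightarrow> real^'n^'n) \<Rightarrow>
     (real \<Rightarrow> 'w \<Rightarrow> real^'m2) \<Rightarrow>
     (real \<Rightarrow> 'w \<Rightarrow> real^'n) \<Rightarrow> (real \<Rightarrow> 'w \<Rightarrow> real^'n) \<Rightarrow>
     ('s \<Rightarrow> 's \<Rightarrow> real \<Rightarrow> 'w \<Rightarrow> real^'n) \<Rightarrow> bool" where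
  "is_bsde_solution M T W gen \<alpha> d P Ph u2 \<phi> \<theta> \<eta> \<longleftrightarrow>
     \<phi> \<in> S2_space M (joint_filtration M W \<alpha>) T \<and>
     \<theta> \<in> L2_space M (joint_filtration M W \<alpha>) T \<and>
     \<eta> \<in> K2_space M (joint_filtration M W \<alpha>) T \<alpha> \<and>
     (\<exists>\<phi>h \<theta>h u2h I J.
        chain_projection M T \<alpha> \<phi> \<phi>h \<and>
        chain_projection M T \<alpha> \<theta> \<theta>h \<and>
        chain_projection M T \<alpha> u2 u2h \<and>
        has_ito_integral M (joint_filtration M W \<alpha>) T W \<theta> I \<and>
        has_chain_integral M (joint_filtration M W \<alpha>) T gen \<alpha> \<eta> J \<and>
        (\<forall>t\<in>{0..T}. AE \<omega> in M. \<phi> t \<omega> =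
           (LINT s:{t..T}|lborel.
               transpose (bbA d P s (\<alpha> s \<omega>)) *v \<phi> s \<omega>
             + transpose (bbAh d P Ph s (\<alpha> s \<omega>)) *v \<phi>h s \<omega>
             + transpose (bbC d P s (\<alpha> s \<omega>)) *v \<theta> s \<omega>
             + transpose (bbCh d P Ph s (\<alpha> s \<omega>)) *v \<theta>h s \<omega>
             + transpose (bbF2 d P s (\<alpha> s \<omega>)) *v u2 s \<omega>
             + transpose (bbF2h d P Ph s (\<alpha> s \<omega>)) *v u2h s \<omega>)
           - (I T \<omega> - I t \<omega>) - (J T \<omega> - J t \<omega>)))"

definition follower_offset ::
  "(real \<Rightarrow> 'w \<Rightarrow> 's) \<Rightarrow> ('s, 'n::finite, 'm1::finite, 'm2::finite) lq_data \<Rightarrow> (real \<Rightarrow> 's \<Rightarrow> real^'n^'n) \<Rightarrow>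
     (real \<Rightarrow> 'w \<Rightarrow> real^'m2) \<Rightarrow> (real \<Rightarrow> 'w \<Rightarrow> real^'n) \<Rightarrow> (real \<Rightarrow> 'w \<Rightarrow> real^'n) \<Rightarrow>
     real \<Rightarrow> 'w \<Rightarrow> real^'m1" where
  "follower_offset \<alpha> d P u2 \<phi> \<theta> t \<omega> =
     transpose (cB1 d (\<alpha> t \<omega>)) *v \<phi> t \<omega> + transpose (cD1 d (\<alpha> t \<omega>)) *v \<theta> t \<omega>
     + (transpose (cD1 d (\<alpha> t \<omega>)) ** P t (\<alpha> t \<omega>) ** cD2 d (\<alpha> t \<omega>)) *v u2 t \<omega>"

end

theory Submission
 imports Defs
begin

text \<open>The proof is a duality argument that avoids Ito's formula with jumps. Let \<open>x\<close>, \<open>u\<close> be the candidate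
 state and control, \<open>xh\<close> the projection of \<open>x\<close> onto the filtration of the chain, and put
 \<open>p = P x + Ph xh + \<phi>\<close> and \<open>q = P (C x + Ch xh + D\<^sub>1 u + D\<^sub>2 u\<^sub>2) + \<theta>\<close>. The Riccati equations and the
 BSDE say that \<open>(p, q)\<close> is an adjoint process: for every follower control \<open>v\<close> with state \<open>y\<close>, the
 symmetric bilinear form \<open>K\<close> of the cost satisfies \<open>K((x, u), (y, v)) = \<kappa>\<close> with a constant \<open>\<kappa>\<close> that does
 not depend on \<open>v\<close>. Hence \<open>K((x, u), (y, v)) = K((x, u), (x, u))\<close>, and since \<open>K\<close> is positive semidefinite,
 \<open>J(v) - J(u) = K((y - x, v - u), (y - x, v - u)) / 2 \<ge> 0\<close>. Pairing \<open>\<phi>\<close> with \<open>x\<close> itself rewrites \<open>\<kappa>\<close>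
 into the stated value.

 The only products of processes that occur are of the form \<open>g(t, \<alpha>(t)) X(t) Y(t)\<close> under an expectation. Given
 the whole path of the chain, \<open>W\<close> is still a Brownian motion, so the Ito isometry weighted by a
 variable depending on the chain alone yields an ordinary differential equation for such expectations,
 into which the generator enters through the Markov property.\<close>

text \<open>Two obstacles shape the proof. The Riccati equations are written with
  \<open>matrix_inv\<close>, whose value at a singular matrix is arbitrary, so the invertibility of
  \<open>N1_tilde\<close> has to be extracted from the first equation, by showing P >= 0. And the
  mean-field terms involve projections that are fixed only up to null sets and, for L2 processes,
  only at almost every time. They are controlled by one fact: for a variable known at time s,
  projecting onto the chain up to s or onto its whole path gives the same result. Hence projection
  commutes with time integrals and kills the noise integral, so the hatted state solves an equation
  without diffusion. Projections are also self-adjoint, which lets a hat move from one factor of an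
  expectation to the other; this is how the hatted coefficients acting on the state become terms
  with the projected adjoint process. The martingale part of \<open>\<phi>\<close> that comes from
  the chain is only ever paired with a noise integral, to which it is orthogonal, so
  \<open>\<eta>\<close> leaves no trace in the duality.\<close>

lemmas lint_add = Bochner_Integration.integrable_add and lint_bound = Bochner_Integration.integrable_bound
 and lint_cong = Bochner_Integration.integrable_cong and lint_diff = Bochner_Integration.integrable_diff
 and lint_sum = Bochner_Integration.integrable_sum and lintegral_add = Bochner_Integration.integral_add
 and lintegral_cong = Bochner_Integration.integral_cong and lintegral_diff = Bochner_Integration.integral_diff
 and lintegral_indicator = Bochner_Integration.integral_indicator and lintegral_sum = Bochner_Integration.integral_sum

abbreviation Bm :: "'a measure => ('a => 'b::topological_space) set" where
 "Bm M \<equiv> borel_measurable M"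

section \<open>Symmetric matrices\<close>

lemma inner_matrix_vector_left:
 fixes A :: "real^'n^'m"
 shows "(A *v x) \<bullet> y = x \<bullet> (transpose A *v y)"
 by (metis dot_lmul_matrix vector_transpose_matrix inner_commute)

lemma inner_symmetric_matrix:
 "symmetric_matrix X ==> (X *v x) \<bullet> y = x \<bullet> (X *v y)"
 by (metis inner_matrix_vector_left symmetric_matrix_def)

lemma matrix_vector_mult_uminus_right:
 fixes A :: "real^'n^'m"
 shows "A *v (- x) = - (A *v x)"
 by (simp add: matrix_vector_mult_def vec_eq_iff sum_negf)

lemma matrix_vector_mult_uminus_left:
 fixes A :: "real^'n^'m"
 shows "(- A) *v x = - (A *v x)"
 by (simp add: matrix_vector_mult_def vec_eq_iff sum_negf)

text \<open>The norm of a matrix is the Frobenius norm, matrices being vectors of vectors, so the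
  bound is Cauchy-Schwarz row by row.\<close>

lemma norm_matrix_vector_mult_le:
 fixes A :: "real^'n^'m"
 shows "norm (A *v x) <= norm A * norm x"
proof -
 have "norm (A *v x) <= L2_set (\<lambda>i. norm (A $ i) * norm x) UNIV"
  unfolding norm_vec_def[of "A *v x"]
  by (rule L2_set_mono) (auto simp: matrix_vector_mul_component Cauchy_Schwarz_ineq2)
 also have "... = norm A * norm x"
  by (simp add: norm_vec_def[of A] L2_set_left_distrib)
 finally show ?thesis .
qed

lemma symmetric_matrix_eqI:
 fixes X :: "real^'n^'n"
 assumes "\<And>x y. (X *v x) \<bullet> y = x \<bullet> (X *v y)"
 shows "symmetric_matrix X"
 unfolding symmetric_matrix_def
proof -
 have "transpose X *v y = X *v y" for y
  using assms by (metis inner_matrix_vector_left vector_eq_ldot)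
 then show "transpose X = X" using matrix_eq by blast
qed

lemma psd_Cauchy_Schwarz:
 fixes X :: "real^'n^'n"
 assumes sym: "symmetric_matrix X" and psd: "\<And>w. 0 <= (X *v w) \<bullet> w"
 shows "((X *v v) \<bullet> w)\<^sup>2 <= ((X *v v) \<bullet> v) * ((X *v w) \<bullet> w)"
proof -
 define a b c where "a = (X *v v) \<bullet> v" and "b = (X *v v) \<bullet> w" and "c = (X *v w) \<bullet> w"
 have key: "0 <= a + 2 * s * b + s\<^sup>2 * c" for s
  using psd[of "v + s *\<^sub>R w"] inner_symmetric_matrix[OF sym, of w v]
  by (simp add: a_def b_def c_def matrix_vector_right_distrib matrix_vector_mult_scaleR inner_add_left
    inner_add_right power2_eq_square inner_commute algebra_simps)
 have "b\<^sup>2 <= a * c"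
 proof (cases "c = 0")
  case True
  \<comment> \<open>With \<open>c = 0\<close> the quadratic in \<open>key\<close> is affine, and at
    this \<open>s\<close> it would equal -1 if \<open>b\<close> were nonzero.\<close>
  then have "b = 0" using key[of "- (a + 1) / (2 * b)"] by (cases "b = 0") (auto simp: field_simps)
  then show ?thesis using True by simp
 next
  case False
  then have "0 < c" using psd[of w] by (simp add: c_def)
  then show ?thesis using key[of "- b / c"] by (simp add: power2_eq_square field_simps)
 qed
 then show ?thesis by (simp add: a_def b_def c_def)
qed

lemma matrix_sub_ldistrib: "A ** (B - C) = A ** B - A ** (C :: real^'n^'m)"
 by (vector matrix_matrix_mult_def sum_subtractf right_diff_distrib)

lemma matrix_sub_rdistrib: "(A - B) ** C = A ** C - B ** (C :: real^'n^'m)"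
 by (vector matrix_matrix_mult_def sum_subtractf left_diff_distrib)

lemma transpose_add: "transpose (A + B) = transpose A + transpose (B :: real^'n^'m)"
 by (simp add: transpose_def vec_eq_iff)

lemma transpose_diff: "transpose (A - B) = transpose A - transpose (B :: real^'n^'m)"
 by (simp add: transpose_def vec_eq_iff)

text \<open>With \<open>D = Y - Z\<close> one has \<open>Y D + D Z = 0\<close>, so the nonnegative numbers \<open>tr (D Y D)\<close> and
 \<open>tr (D Z D)\<close> add up to zero.\<close>

lemma psd_square_root_unique:
 fixes Y Z :: "real^'n^'n"
 assumes Y: "pos_def Y" and Z: "pos_semidef Z" and eq: "Y ** Y = Z ** Z"
 shows "Y = Z"
proof -
 define D where "D = Y - Z"
 have D: "symmetric_matrix D"
  using Y Z unfolding D_def pos_def_def pos_semidef_def symmetric_matrix_def by (simp add: transpose_diff)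
 have "Y ** D + D ** Z = 0"
  unfolding D_def by (simp add: matrix_sub_ldistrib matrix_sub_rdistrib eq)
 then have "D ** (Y ** D) + D ** (D ** Z) = 0"
  by (metis matrix_add_ldistrib matrix_mul_assoc times0_right)
 then have "trace (D ** (Y ** D)) + trace (D ** (D ** Z)) = 0"
  by (metis trace_add trace_0 mat_0)
 moreover have "trace (D ** (D ** Z)) = trace (D ** (Z ** D))"
  by (metis matrix_mul_assoc trace_mul_sym)
 moreover have tr: "trace (D ** (U ** D)) = (\<Sum>i\<in>UNIV. (U *v (D *v axis i 1)) \<bullet> (D *v axis i 1))" for U
 proof -
  have "(D ** (U ** D)) $ i $ i = ((D ** (U ** D)) *v axis i 1) \<bullet> axis i 1" for i
   by (simp add: matrix_vector_mult_basis column_def inner_axis)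
  then show ?thesis
   using inner_symmetric_matrix[OF D] by (simp add: trace_def flip: matrix_vector_mul_assoc)
 qed
 moreover have "0 <= trace (D ** (Z ** D))"
  using Z unfolding tr pos_semidef_def by (intro sum_nonneg) auto
 moreover have nn: "0 <= (Y *v v) \<bullet> v" for v using Y unfolding pos_def_def by (cases "v = 0") (auto intro: less_imp_le)
 ultimately have "(\<Sum>i\<in>UNIV. (Y *v (D *v axis i 1)) \<bullet> (D *v axis i 1)) = 0"
  using sum_nonneg[of UNIV "\<lambda>i. (Y *v (D *v axis i 1)) \<bullet> (D *v axis i 1)"] by simp
 then have "(Y *v (D *v axis i 1)) \<bullet> (D *v axis i 1) = 0" for i
  by (subst (asm) sum_nonneg_eq_0_iff) (auto simp: nn)
 then have "D *v axis i 1 = 0" for i using Y unfolding pos_def_def by (metis less_irrefl)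
 then have "D = 0" by (simp add: matrix_vector_mult_basis column_def vec_eq_iff)
 then show ?thesis by (simp add: D_def)
qed

lemma norm_transpose: "norm (transpose A) = norm (A :: real^'n^'m)"
proof -
 have "(norm (transpose A))\<^sup>2 = (norm A)\<^sup>2"
  by (simp add: power2_norm_eq_inner inner_vec_def transpose_def) (rule sum.swap)
 then show ?thesis by simp
qed

text \<open>Two norms are mixed: \<open>Z\<close> is bounded as an operator, while the product is
  measured in the Frobenius norm. They fit together because \<open>Z\<close> is symmetric, so that
  each row of \<open>D ** Z\<close> is the image under \<open>Z\<close> of a row of
  \<open>D\<close>.\<close>

lemma norm_mult_contraction:
 fixes D Z :: "real^'n^'n"
 assumes Z: "symmetric_matrix Z" "\<And>v. norm (Z *v v) <= r * norm v" and r: "0 <= r"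
 shows "norm (D ** Z) <= r * norm D"
proof -
 have row: "(D ** Z) $ i = Z *v (D $ i)" for i
  using Z(1) unfolding symmetric_matrix_def
  by (simp add: vec_eq_iff matrix_matrix_mult_def matrix_vector_mult_def transpose_def mult.commute)
 have "norm (D ** Z) <= L2_set (\<lambda>i. r * norm (D $ i)) UNIV"
  unfolding norm_vec_def[of "D ** Z"] row by (rule L2_set_mono) (auto simp: Z)
 also have "... = r * norm D" by (simp add: norm_vec_def[of D] L2_set_right_distrib r)
 finally show ?thesis .
qed

text \<open>For a positive semidefinite matrix a bound on the form is a bound on the operator norm:
  apply Cauchy-Schwarz for the form to \<open>v\<close> and \<open>R *v v\<close>.\<close>

lemma psd_contraction:
 fixes R :: "real^'n^'n"
 assumes R: "pos_semidef R" and le: "\<And>v. (R *v v) \<bullet> v <= r * (v \<bullet> v)" and r: "0 <= r"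
 shows "norm (R *v v) <= r * norm v"
proof (cases "R *v v = 0")
 case False
 define w where "w = R *v v"
 have "(w \<bullet> w)\<^sup>2 <= ((R *v v) \<bullet> v) * ((R *v w) \<bullet> w)"
  using R unfolding w_def pos_semidef_def by (intro psd_Cauchy_Schwarz) auto
 also have "... <= (r * (v \<bullet> v)) * (r * (w \<bullet> w))"
  using R r unfolding pos_semidef_def by (intro mult_mono le) auto
 finally have "w \<bullet> w <= r\<^sup>2 * (v \<bullet> v)"
  using False by (simp add: w_def power2_eq_square mult_ac)
 then have "(norm w)\<^sup>2 <= (r * norm v)\<^sup>2" by (simp add: power2_norm_eq_inner power_mult_distrib)
 then show ?thesis unfolding w_def by (rule power2_le_imp_le) (simp add: r)
qed (use r in simp)

text \<open>The constant is the minimum of the form on the unit sphere, attained by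
  compactness.\<close>

lemma pos_def_coercive:
 fixes X :: "real^'n^'n"
 assumes "pos_def X"
 obtains c where "0 < c" "\<And>v. c * (v \<bullet> v) <= (X *v v) \<bullet> v"
proof -
 have "continuous_on (sphere 0 1) (\<lambda>v. (X *v v) \<bullet> v)" by (intro continuous_intros)
 moreover have "sphere (0 :: real^'n) 1 \<noteq> {}" using norm_axis_1 by (metis empty_iff mem_sphere_0)
 ultimately obtain w where "w \<in> sphere 0 1" "\<forall>v\<in>sphere 0 1. (X *v w) \<bullet> w <= (X *v v) \<bullet> v"
  using continuous_attains_inf[OF compact_sphere, of 0 1 "\<lambda>v. (X *v v) \<bullet> v"] by blast
 then have w: "norm w = 1" "\<And>v. norm v = 1 ==> (X *v w) \<bullet> w <= (X *v v) \<bullet> v"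
  by auto
 show ?thesis
 proof
  show "0 < (X *v w) \<bullet> w" using assms w(1) unfolding pos_def_def by (metis norm_zero zero_neq_one)
  fix v :: "real^'n"
  show "(X *v w) \<bullet> w * (v \<bullet> v) <= (X *v v) \<bullet> v"
  proof (cases "v = 0")
   case False
   define u where "u = (1 / norm v) *\<^sub>R v"
   have "norm u = 1" using False by (simp add: u_def)
   then have "(X *v w) \<bullet> w <= (X *v u) \<bullet> u" by (rule w(2))
   also have "... = ((X *v v) \<bullet> v) / (v \<bullet> v)"
    by (simp add: u_def matrix_vector_mult_scaleR power2_eq_square flip: power2_norm_eq_inner)
   finally show ?thesis using False by (simp add: pos_le_divide_eq)
  qed simp
 qed
qed

text \<open>After scaling, \<open>X = I - R\<close> with \<open>\<parallel>R\<parallel> < 1\<close>, and the square root is \<open>I - Z\<close> for the fixed point \<open>Z\<close>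
 of the contraction \<open>Z \<mapsto> (R + Z\<^sup>2) / 2\<close>.\<close>

lemma psd_square_root_exists:
 fixes X :: "real^'n^'n"
 assumes X: "pos_def X"
 obtains Y where "pos_def Y" "Y ** Y = X"
proof -
 obtain c where c: "0 < c" "\<And>v. c * (v \<bullet> v) <= (X *v v) \<bullet> v"
  using pos_def_coercive[OF X] by blast
 \<comment> \<open>The form of \<open>X\<close> lies between those of \<open>c\<close> and
   \<open>a\<close> times the identity, so the form of \<open>R\<close> lies between 0 and
   \<open>r\<close>. Adding \<open>c\<close> to the norm guarantees \<open>0 <= r\<close>.\<close>
 define a where "a = norm X + c"
 have a: "0 < a" using c unfolding a_def by (simp add: add_nonneg_pos)
 define R where "R = mat 1 - (1/a) *\<^sub>R X"
 define r where "r = 1 - c / a"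
 have r: "0 <= r" "r < 1" unfolding r_def using a c by (auto simp: a_def)
 have Rv: "R *v v = v - (1/a) *\<^sub>R (X *v v)" for v
  unfolding R_def by (simp add: matrix_vector_mult_diff_rdistrib scaleR_matrix_vector_assoc)
 have symX: "symmetric_matrix X" using X pos_def_def by blast
 have symR: "symmetric_matrix R"
  using symX unfolding R_def symmetric_matrix_def by (simp add: transpose_diff transpose_scalar)
 have Xle: "(X *v v) \<bullet> v <= a * (v \<bullet> v)" for v
 proof -
  have "(X *v v) \<bullet> v <= norm (X *v v) * norm v" by (rule norm_cauchy_schwarz)
  also have "... <= norm X * norm v * norm v" by (intro mult_right_mono norm_matrix_vector_mult_le) auto
  also have "... = norm X * (v \<bullet> v)" by (simp add: power2_eq_square flip: power2_norm_eq_inner)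
  also have "... <= a * (v \<bullet> v)" using c by (intro mult_right_mono) (auto simp: a_def)
  finally show ?thesis .
 qed
 have Rle: "(R *v v) \<bullet> v <= r * (v \<bullet> v)" for v
  unfolding Rv r_def using a c(2)[of v] by (simp add: inner_diff_left field_simps)
 have "0 <= (R *v v) \<bullet> v" for v
  unfolding Rv using a Xle[of v] by (simp add: inner_diff_left field_simps)
 then have "pos_semidef R" using symR pos_semidef_def by blast
 then have Rnorm: "norm (R *v v) <= r * norm v" for v by (rule psd_contraction[OF _ Rle r(1)])
 \<comment> \<open>The smaller root of q^2 - 2 q + r = 0. It serves twice: as the radius of an
   operator ball that \<open>f\<close> maps into itself, and as the contraction factor of
   \<open>f\<close> on that ball.\<close>
 define q where "q = 1 - sqrt (1 - r)"
 have q: "0 <= q" "q < 1" "(r + q\<^sup>2) / 2 = q"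
  using r by (auto simp: q_def power2_eq_square field_simps)
 define S where "S = {Z :: real^'n^'n. symmetric_matrix Z \<and> (\<forall>v. norm (Z *v v) <= q * norm v)}"
 define f where "f Z = (1/2) *\<^sub>R (R + Z ** Z)" for Z :: "real^'n^'n"
 have fv: "f Z *v v = (1/2) *\<^sub>R (R *v v + Z *v (Z *v v))" for Z v
  by (simp add: f_def matrix_vector_mult_add_rdistrib matrix_vector_mul_assoc scaleR_matrix_vector_assoc[symmetric])
 have "\<exists>!Z\<in>S. f Z = Z"
 proof (rule Banach_fix)
  have "S = {Z. transpose Z = Z} \<inter> (\<Inter>v. {Z. norm (Z *v v) <= q * norm v})"
   by (auto simp: S_def symmetric_matrix_def)
  moreover have "closed {Z :: real^'n^'n. transpose Z = Z}"
   unfolding transpose_def by (intro closed_Collect_eq continuous_intros)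
  moreover have "closed {Z :: real^'n^'n. norm (Z *v v) <= q * norm v}" for v
   unfolding matrix_vector_mult_def by (intro closed_Collect_le continuous_intros)
  ultimately have "closed S" by auto
  then show "uniform_space_class.complete S" by (simp add: complete_eq_closed)
  have "0 \<in> S" using q by (auto simp: S_def symmetric_matrix_def transpose_def vec_eq_iff)
  then show "S \<noteq> {}" by auto
  show "0 <= q" "q < 1" by (fact q)+
  show "f ` S \<subseteq> S"
  proof safe
   fix Z assume Z: "Z \<in> S"
   have "symmetric_matrix (f Z)"
    using Z symR unfolding S_def f_def symmetric_matrix_def
    by (simp add: transpose_add transpose_scalar matrix_transpose_mul)
   moreover have "norm (f Z *v v) <= q * norm v" for v
   proof -
    have "norm (f Z *v v) <= (norm (R *v v) + norm (Z *v (Z *v v))) / 2"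
     unfolding fv using norm_triangle_ineq[of "R *v v" "Z *v (Z *v v)"] by simp
    also have "norm (Z *v (Z *v v)) <= q * norm (Z *v v)" using Z S_def by blast
    also have "... <= q * (q * norm v)" using Z S_def q by (intro mult_left_mono) auto
    also have "(norm (R *v v) + q * (q * norm v)) / 2 <= (r + q\<^sup>2) / 2 * norm v"
     using Rnorm[of v] by (simp add: power2_eq_square field_simps)
    finally show ?thesis using q by simp
   qed
   ultimately show "f Z \<in> S" by (simp add: S_def)
  qed
  fix Z Z' assume Z: "Z \<in> S" and Z': "Z' \<in> S"
  have D: "symmetric_matrix (Z - Z')"
   using Z Z' by (simp add: S_def symmetric_matrix_def transpose_diff)
  have "Z ** Z - Z' ** Z' = Z ** (Z - Z') + (Z - Z') ** Z'"
   by (simp add: matrix_sub_ldistrib matrix_sub_rdistrib)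
  \<comment> \<open>Transposing the first summand brings the bounded factor to the right, where
    \<open>norm_mult_contraction\<close> can use it; the Frobenius norm does not see the
    transposition.\<close>
  also have "Z ** (Z - Z') = transpose ((Z - Z') ** Z)"
   using Z D by (simp add: matrix_transpose_mul S_def symmetric_matrix_def)
  finally have "norm (Z ** Z - Z' ** Z') <= norm ((Z - Z') ** Z) + norm ((Z - Z') ** Z')"
   by (metis norm_transpose norm_triangle_ineq)
  also have "... <= q * norm (Z - Z') + q * norm (Z - Z')"
   using Z Z' q by (intro add_mono norm_mult_contraction) (auto simp: S_def)
  finally show "dist (f Z) (f Z') <= q * dist Z Z'"
   unfolding dist_norm f_def by (simp flip: scaleR_diff_right)
 qed
 then obtain Z where Z: "Z \<in> S" "f Z = Z" by auto
 define Y where "Y = sqrt a *\<^sub>R (mat 1 - Z)"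
 have Yv: "Y *v v = sqrt a *\<^sub>R (v - Z *v v)" for v
  unfolding Y_def by (simp add: matrix_vector_mult_diff_rdistrib flip: scaleR_matrix_vector_assoc)
 have "pos_def Y"
  unfolding pos_def_def
 proof safe
  show "symmetric_matrix Y"
   using Z(1) unfolding Y_def S_def symmetric_matrix_def by (simp add: transpose_diff transpose_scalar)
  fix v :: "real^'n" assume "v \<noteq> 0"
  have "(Z *v v) \<bullet> v <= norm (Z *v v) * norm v" by (rule norm_cauchy_schwarz)
  also have "... <= q * norm v * norm v" using Z(1) by (intro mult_right_mono) (auto simp: S_def)
  also have "... < 1 * norm v * norm v" using q \<open>v \<noteq> 0\<close> by (intro mult_strict_right_mono) auto
  also have "... = v \<bullet> v" by (simp add: power2_eq_square flip: power2_norm_eq_inner)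
  finally show "0 < (Y *v v) \<bullet> v" unfolding Yv using a by (simp add: inner_diff_left)
 qed
 moreover have "(Y ** Y) *v v = X *v v" for v
 proof -
  have "R *v v + Z *v (Z *v v) = 2 *\<^sub>R (Z *v v)"
   using arg_cong[OF fv[of Z v], of "\<lambda>w. 2 *\<^sub>R w"] Z(2) by (simp del: scaleR_half_double)
  then have "Z *v (Z *v v) = 2 *\<^sub>R (Z *v v) - v + (1/a) *\<^sub>R (X *v v)"
   unfolding Rv by (simp add: algebra_simps)
  moreover have "(Y ** Y) *v v = a *\<^sub>R (v - 2 *\<^sub>R (Z *v v) + Z *v (Z *v v))"
   using a by (simp add: matrix_vector_mul_assoc[symmetric] Yv matrix_vector_mult_diff_distrib
     matrix_vector_mult_scaleR algebra_simps scaleR_2)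
  ultimately show ?thesis using a by simp
 qed
 ultimately show ?thesis using that matrix_eq by blast
qed

lemma pos_def_imp_semidef:
 assumes "pos_def X" shows "pos_semidef X"
 unfolding pos_semidef_def
proof (intro conjI allI)
 show "symmetric_matrix X" using assms by (simp add: pos_def_def)
 show "0 <= (X *v v) \<bullet> v" for v using assms by (cases "v = 0") (auto simp: pos_def_def less_imp_le)
qed

text \<open>The definite description denotes because the root constructed above is positive
  definite, and uniqueness asks this of one of the two roots compared.\<close>

lemma psd_sqrt:
 fixes X :: "real^'n^'n"
 assumes "pos_def X"
 shows "pos_semidef (psd_sqrt X)" "psd_sqrt X ** psd_sqrt X = X"
proof -
 have "\<exists>!Y. pos_semidef Y \<and> Y ** Y = X"
  using psd_square_root_exists[OF assms] psd_square_root_unique pos_def_imp_semidef by metis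
 then have "pos_semidef (psd_sqrt X) \<and> psd_sqrt X ** psd_sqrt X = X"
  unfolding psd_sqrt_def by (rule theI')
 then show "pos_semidef (psd_sqrt X)" "psd_sqrt X ** psd_sqrt X = X" by auto
qed

lemma norm_psd_sqrt_vector:
 fixes X :: "real^'n^'n"
 assumes "pos_def X"
 shows "(norm (psd_sqrt X *v v))\<^sup>2 = (X *v v) \<bullet> v"
proof -
 have "(psd_sqrt X *v v) \<bullet> (psd_sqrt X *v v) = (psd_sqrt X *v (psd_sqrt X *v v)) \<bullet> v"
  using inner_symmetric_matrix psd_sqrt(1)[OF assms] unfolding pos_semidef_def by metis
 then show ?thesis
  by (simp add: power2_norm_eq_inner matrix_vector_mul_assoc psd_sqrt(2)[OF assms])
qed

lemma pos_def_matrix_inv: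
 fixes X :: "real^'n^'n"
 assumes "pos_def X"
 shows "X ** matrix_inv X = mat 1" "matrix_inv X ** X = mat 1" "pos_def (matrix_inv X)"
proof -
 have "X *v v = 0 ==> v = 0" for v using assms unfolding pos_def_def by (metis inner_zero_left less_irrefl)
 then obtain B where "B ** X = mat 1" using matrix_left_invertible_ker by blast
 then have "\<exists>B. X ** B = mat 1 \<and> B ** X = mat 1" using matrix_left_right_inverse by blast
 then have "X ** matrix_inv X = mat 1 \<and> matrix_inv X ** X = mat 1"
  unfolding matrix_inv_def by (rule someI_ex)
 then show X: "X ** matrix_inv X = mat 1" "matrix_inv X ** X = mat 1" by auto
 have sym: "symmetric_matrix X" using assms pos_def_def by blast
 have XR: "X *v (matrix_inv X *v v) = v" for v by (simp add: matrix_vector_mul_assoc X)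
 have RX: "matrix_inv X *v (X *v v) = v" for v by (simp add: matrix_vector_mul_assoc X)
 have "symmetric_matrix (matrix_inv X)"
  by (rule symmetric_matrix_eqI) (metis XR inner_symmetric_matrix[OF sym])
 moreover have "0 < (matrix_inv X *v v) \<bullet> v" if "v \<noteq> 0" for v
  using assms that XR unfolding pos_def_def by (metis inner_commute matrix_vector_mult_0_right)
 ultimately show "pos_def (matrix_inv X)" unfolding pos_def_def by blast
qed

section \<open>Positivity of the Riccati solution\<close>

lemma finite_uniform_bound:
 fixes f :: "'s::finite => real"
 obtains L where "0 < L" "\<And>i. f i <= L"
proof
 have "f i <= (\<Sum>j\<in>UNIV. \<bar>f j\<bar>)" for i
  using member_le_sum[of i UNIV "\<lambda>j. \<bar>f j\<bar>"] by simp
 then show "f i <= (\<Sum>j\<in>UNIV. \<bar>f j\<bar>) + 1" for i by (smt (verit))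
 show "0 < (\<Sum>j\<in>UNIV. \<bar>f j\<bar>) + 1" by (simp add: add_nonneg_pos sum_nonneg)
qed

lemma uniformly_coercive:
 fixes X :: "'s::finite => real^'n^'n"
 assumes "\<And>i. pos_def (X i)"
 obtains c where "0 < c" "\<And>i v. c * (v \<bullet> v) <= (X i *v v) \<bullet> v"
proof -
 have "\<forall>i. \<exists>c>0. \<forall>v. c * (v \<bullet> v) <= (X i *v v) \<bullet> v"
  using pos_def_coercive[OF assms] by metis
 then obtain c where c: "\<And>i. 0 < c i" "\<And>i v. c i * (v \<bullet> v) <= (X i *v v) \<bullet> v" by metis
 show ?thesis
 proof
  show "0 < Min (range c)" using c by simp
  fix i and v :: "real^'n"
  have "Min (range c) * (v \<bullet> v) <= c i * (v \<bullet> v)" by (intro mult_right_mono) auto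
  then show "Min (range c) * (v \<bullet> v) <= (X i *v v) \<bullet> v" using c(2)[of i v] by linarith
 qed
qed

definition riccati1_rhs ::
 "('s::finite, 'n::finite, 'm1::finite, 'm2::finite) lq_data => ('s => 's => real) =>
   (real => 's => real^'n^'n) => real => 's => real^'n^'n" where
 "riccati1_rhs d gen P t i = - (P t i ** cA d i + transpose (cA d i) ** P t i
      + transpose (cC d i) ** P t i ** cC d i + cQ1 d i
      - transpose (S1 d P t i) ** matrix_inv (N1_tilde d P t i) ** S1 d P t i
      + (\<Sum>j\<in>UNIV. gen i j *\<^sub>R (P t j - P t i)))"

lemma N1_tilde_form:
 "(N1_tilde d P t i *v u) \<bullet> w = (cN1 d i *v u) \<bullet> w + (P t i *v (cD1 d i *v u)) \<bullet> (cD1 d i *v w)"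
 unfolding N1_tilde_def
 by (simp add: matrix_vector_mult_add_rdistrib inner_add_left inner_matrix_vector_left[of "transpose _"]
   del: transpose_matrix_vector flip: matrix_vector_mul_assoc)

lemma S1_vector:
 "S1 d P t i *v v = transpose (cB1 d i) *v (P t i *v v) + transpose (cD1 d i) *v (P t i *v (cC d i *v v))"
 unfolding S1_def by (simp add: matrix_vector_mult_add_rdistrib del: transpose_matrix_vector flip: matrix_vector_mul_assoc)

lemma N1_tilde_pos_def:
 assumes "symmetric_matrix (P t i)" "symmetric_matrix (cN1 d i)"
  and c: "0 < c" "\<And>u. c * (u \<bullet> u) <= (N1_tilde d P t i *v u) \<bullet> u"
 shows "pos_def (N1_tilde d P t i)"
 unfolding pos_def_def
proof (intro conjI allI impI)
 show "symmetric_matrix (N1_tilde d P t i)"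
  using assms(1,2) unfolding N1_tilde_def symmetric_matrix_def
  by (simp add: transpose_add matrix_transpose_mul matrix_mul_assoc)
 show "0 < (N1_tilde d P t i *v u) \<bullet> u" if "u \<noteq> 0" for u
  using that c(1) c(2)[of u] by (smt (verit) inner_gt_zero_iff mult_pos_pos)
qed

lemma sum_matrix_vector: "(\<Sum>j\<in>J. A j) *v x = (\<Sum>j\<in>J. A j *v (x :: real^'n))"
 by (induction J rule: infinite_finite_induct) (auto simp: matrix_vector_mult_add_rdistrib)

text \<open>Completing the square: with \<open>u = - N^-1 S v\<close> the quadratic form of the Riccati right-hand side
 is that of a Lyapunov equation with the closed-loop coefficients \<open>A + B u\<close>, \<open>C + D u\<close>.\<close>

lemma riccati1_rhs_form:
 fixes d :: "('s::finite, 'n::finite, 'm1::finite, 'm2::finite) lq_data"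
 assumes sym: "symmetric_matrix (P t i)" and N: "pos_def (N1_tilde d P t i)"
  and u: "u = - (matrix_inv (N1_tilde d P t i) *v (S1 d P t i *v v))"
 defines "a \<equiv> cA d i *v v + cB1 d i *v u" and "b \<equiv> cC d i *v v + cD1 d i *v u"
 shows "(riccati1_rhs d gen P t i *v v) \<bullet> v = - (2 * ((P t i *v v) \<bullet> a) + (P t i *v b) \<bullet> b
   + (cQ1 d i *v v) \<bullet> v + (cN1 d i *v u) \<bullet> u
   + (\<Sum>j\<in>UNIV. gen i j * ((P t j *v v) \<bullet> v - (P t i *v v) \<bullet> v)))"
proof -
 define Pm where "Pm = P t i"
 define N where "N = N1_tilde d P t i"
 define S where "S = S1 d P t i"
 have Psym: "(Pm *v x) \<bullet> y = x \<bullet> (Pm *v y)" for x y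
  using inner_symmetric_matrix[OF sym] by (simp add: Pm_def)
 have Nu: "N *v u = - (S *v v)"
  using pos_def_matrix_inv(1)[OF N]
  by (simp add: u N_def S_def matrix_vector_mult_uminus_right matrix_vector_mul_assoc)
   (metis matrix_mul_assoc matrix_mul_lid)
 have SRS: "((transpose S ** matrix_inv N ** S) *v v) \<bullet> v = - (u \<bullet> (S *v v))"
  by (simp add: u N_def S_def inner_matrix_vector_left[of "transpose _"] del: transpose_matrix_vector flip: matrix_vector_mul_assoc)
 have "(N *v u) \<bullet> u = - (u \<bullet> (S *v v))" by (simp add: Nu inner_commute)
 then have SRS2: "- (((transpose S ** matrix_inv N ** S) *v v) \<bullet> v) = 2 * ((S *v v) \<bullet> u) + (N *v u) \<bullet> u"
  unfolding SRS by (simp add: inner_commute)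
 have Su: "(S *v v) \<bullet> u = (Pm *v v) \<bullet> (cB1 d i *v u) + (Pm *v (cC d i *v v)) \<bullet> (cD1 d i *v u)"
  unfolding S_def S1_vector Pm_def
  by (simp add: inner_add_left inner_matrix_vector_left[of "transpose _"] del: transpose_matrix_vector)
 have "(riccati1_rhs d gen P t i *v v) \<bullet> v = - (2 * ((Pm *v v) \<bullet> (cA d i *v v))
   + (Pm *v (cC d i *v v)) \<bullet> (cC d i *v v) + (cQ1 d i *v v) \<bullet> v
   - ((transpose S ** matrix_inv N ** S) *v v) \<bullet> v
   + (\<Sum>j\<in>UNIV. gen i j * ((P t j *v v) \<bullet> v - (P t i *v v) \<bullet> v)))"
 proof -
  have f1: "((Pm ** cA d i) *v v) \<bullet> v = (Pm *v v) \<bullet> (cA d i *v v)"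
   by (simp add: Psym inner_commute flip: matrix_vector_mul_assoc)
  have f2: "((transpose (cA d i) ** Pm) *v v) \<bullet> v = (Pm *v v) \<bullet> (cA d i *v v)"
   by (simp add: inner_matrix_vector_left[of "transpose _"] del: transpose_matrix_vector flip: matrix_vector_mul_assoc)
  have f3: "((transpose (cC d i) ** Pm ** cC d i) *v v) \<bullet> v = (Pm *v (cC d i *v v)) \<bullet> (cC d i *v v)"
   by (simp add: inner_matrix_vector_left[of "transpose _"] del: transpose_matrix_vector flip: matrix_vector_mul_assoc)
  have f4: "((\<Sum>j\<in>UNIV. gen i j *\<^sub>R (P t j - Pm)) *v v) \<bullet> v
    = (\<Sum>j\<in>UNIV. gen i j * ((P t j *v v) \<bullet> v - (Pm *v v) \<bullet> v))"
   by (simp add: sum_matrix_vector inner_sum_left scaleR_matrix_vector_assoc[symmetric]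
     matrix_vector_mult_diff_rdistrib inner_diff_left)
  show ?thesis
   unfolding riccati1_rhs_def Pm_def[symmetric] N_def[symmetric] S_def[symmetric]
    matrix_vector_mult_uminus_left matrix_vector_mult_add_rdistrib matrix_vector_mult_diff_rdistrib
    inner_minus_left inner_add_left inner_diff_left f1 f2 f3 f4
   by simp
 qed
 also have "... = - (2 * ((Pm *v v) \<bullet> a) + (Pm *v b) \<bullet> b
   + (cQ1 d i *v v) \<bullet> v + (cN1 d i *v u) \<bullet> u
   + (\<Sum>j\<in>UNIV. gen i j * ((P t j *v v) \<bullet> v - (P t i *v v) \<bullet> v)))"
 proof -
  have 1: "(N *v u) \<bullet> u = (cN1 d i *v u) \<bullet> u + (Pm *v (cD1 d i *v u)) \<bullet> (cD1 d i *v u)"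
   unfolding N_def Pm_def by (rule N1_tilde_form)
  have 2: "(Pm *v b) \<bullet> b = (Pm *v (cC d i *v v)) \<bullet> (cC d i *v v)
   + 2 * ((Pm *v (cC d i *v v)) \<bullet> (cD1 d i *v u)) + (Pm *v (cD1 d i *v u)) \<bullet> (cD1 d i *v u)"
   using Psym[of "cD1 d i *v u" "cC d i *v v"]
   by (simp add: b_def matrix_vector_right_distrib inner_add_left inner_add_right inner_commute)
  have 3: "(Pm *v v) \<bullet> a = (Pm *v v) \<bullet> (cA d i *v v) + (Pm *v v) \<bullet> (cB1 d i *v u)"
   by (simp add: a_def inner_add_right)
  show ?thesis using SRS2 Su 1 2 3 by linarith
 qed
 finally show ?thesis unfolding Pm_def .
qed

text \<open>A last-violation argument backward from \<open>T\<close>. All forms are shifted up by a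
  small multiple of exp(\<kappa> (T - t)). At the last time \<open>y\<close> where a shifted form
  fails to be positive on a unit vector \<open>v\<close>, it vanishes at \<open>v\<close> and is
  nonnegative elsewhere and in the other regimes. So \<open>v\<close> is an eigenvector of
  \<open>P y i\<close> with eigenvalue - r, and the closed-loop form of the equation bounds the
  derivative of the unshifted form by \<open>K1 * r\<close>, which is beaten by the derivative of
  the shift. The shifted form would then be negative just after \<open>y\<close>. Letting the shift
  tend to 0 gives the claim.\<close>

lemma riccati1_psd:
 fixes d :: "('s::finite, 'n::finite, 'm1::finite, 'm2::finite) lq_data"
 assumes T: "0 < T" and ric: "riccati1 d gen T P"
  and gen: "\<And>i j. i \<noteq> j ==> 0 <= gen i j"
  and Q: "\<And>i. pos_semidef (cQ1 d i)" and N: "\<And>i. pos_def (cN1 d i)" and G: "\<And>i. pos_semidef (cG1 d i)"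
  and t: "t \<in> {0..T}"
 shows "0 <= (P t i *v v) \<bullet> v"
proof -
 have sym: "\<And>i t. t \<in> {0..T} ==> symmetric_matrix (P t i)"
  and der: "\<And>i t. t \<in> {0..T} ==> ((\<lambda>s. P s i) has_vector_derivative riccati1_rhs d gen P t i) (at t within {0..T})"
  using ric unfolding riccati1_def riccati1_rhs_def by blast+
 have PT: "P T i = cG1 d i" for i using ric unfolding riccati1_def by blast
 have contP: "continuous_on {0..T} (\<lambda>s. P s i)" for i
  using der by (meson continuous_on_eq_continuous_within has_vector_derivative_continuous)
 obtain c where c: "0 < c" "\<And>i v. c * (v \<bullet> v) <= (cN1 d i *v v) \<bullet> v"
  using uniformly_coercive[of "cN1 d", OF N] by blast
 obtain L where L: "0 < L" "\<And>i. max (max (norm (cA d i)) (norm (cC d i))) (max (norm (cB1 d i)) (norm (cD1 d i))) <= L"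
  using finite_uniform_bound[of "\<lambda>i. max (max (norm (cA d i)) (norm (cC d i))) (max (norm (cB1 d i)) (norm (cD1 d i)))"]
  by metis
 have "continuous_on {0..T} (\<lambda>s. S1 d P s i)" for i
  unfolding S1_def matrix_matrix_mult_def by (intro continuous_intros contP)
 then have "\<exists>k. \<forall>s\<in>{0..T}. norm (S1 d P s i) <= k" for i
  using compact_imp_bounded[OF compact_continuous_image[OF _ compact_Icc]]
  by (fastforce simp: bounded_iff)
 then obtain k0 where k0: "\<And>i s. s \<in> {0..T} ==> norm (S1 d P s i) <= k0 i" by metis
 obtain k where k: "0 < k" "\<And>i. k0 i <= k" using finite_uniform_bound[of k0] by metis
 \<comment> \<open>\<open>U\<close> bounds the minimizing control for a unit vector when
   \<open>N1_tilde\<close> is coercive with constant c/2. The closed-loop coefficients are then at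
   most L + L U; the two summands of \<open>K1\<close> come from the drift and the diffusion, and
   the extra 1 in \<kappa> makes the final inequality strict.\<close>
 define U where "U = 2 * k / c"
 define K1 where "K1 = 2 * (L + L * U) + (L + L * U)\<^sup>2"
 have U0: "0 <= U" unfolding U_def using k c by simp
 have K10: "0 <= K1" unfolding K1_def using L U0 by simp
 define \<kappa> where "\<kappa> = K1 + 1"

 \<comment> \<open>The bound on \<open>g\<close> protects \<open>N1_tilde\<close> at the critical
   time: the forms of \<open>P\<close> are there at least - r, so the quadratic term in
   \<open>D1\<close> takes away at most r L^2 <= c/2 from the coercivity of
   \<open>N1\<close>.\<close>
 have shifted: "0 <= (P t i *v w) \<bullet> w + g * exp (\<kappa> * (T - t))"
  if eps: "0 < g" "g * exp (\<kappa> * T) * L\<^sup>2 <= c / 2" and t: "t \<in> {0..T}" and w: "norm w = 1" for g t i w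
 proof -
  define r where "r s = g * exp (\<kappa> * (T - s))" for s
  have r0: "0 < r s" for s using eps by (simp add: r_def)
  have rle: "r s * L\<^sup>2 <= c / 2" if "s \<in> {0..T}" for s
  proof -
   have "\<kappa> * (T - s) <= \<kappa> * T" using that K10 by (intro mult_left_mono) (auto simp: \<kappa>_def)
   then have "r s * L\<^sup>2 <= g * exp (\<kappa> * T) * L\<^sup>2"
    unfolding r_def using eps by (intro mult_right_mono mult_left_mono) auto
   then show ?thesis using eps by linarith
  qed
  define f where "f s i v = (P s i *v v) \<bullet> v + r s" for s i v
  \<comment> \<open>The times at which the shifted form of regime \<open>i\<close> is nonpositive at
    some unit vector. Being the projection of a compact set, it is compact, and the union over the
    finitely many regimes has a last element unless it is empty.\<close>
  define Bi where "Bi i = fst ` {z \<in> {0..T} \<times> sphere (0::real^'n) 1. f (fst z) i (snd z) <= 0}" for i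
  define B where "B = (\<Union>i. Bi i)"
  have compB: "compact (Bi i)" for i
  proof -
   have fc: "continuous_on ({0..T} \<times> sphere 0 1) (\<lambda>z. f (fst z) i (snd z))"
   proof -
    have "continuous_on ({0..T} \<times> sphere (0::real^'n) 1) (\<lambda>z. P (fst z) i)"
     by (rule continuous_on_compose2[OF contP]) (auto intro!: continuous_intros)
    then have "continuous_on ({0..T} \<times> sphere 0 1) (\<lambda>z. P (fst z) i *v snd z)"
     unfolding matrix_vector_mult_def by (intro continuous_intros) auto
    then show ?thesis unfolding f_def r_def by (intro continuous_intros)
   qed
   have "compact ({0..T} \<times> sphere (0::real^'n) 1)" by (intro compact_Times) auto
   moreover have "closed ({0..T} \<times> sphere (0::real^'n) 1)" by (intro closed_Times) auto
   ultimately have "compact {z \<in> {0..T} \<times> sphere (0::real^'n) 1. f (fst z) i (snd z) <= 0}"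
    using closed_Int_compact continuous_closed_preimage[OF fc, of "{..0}"]
    by (smt (verit) Collect_cong Int_commute atMost_iff closed_atMost compact_Int_closed Int_def mem_Collect_eq vimage_eq inf.absorb_iff2 inf_le1)
   then show ?thesis unfolding Bi_def by (intro compact_continuous_image continuous_intros)
  qed
  have "B = {}"
  proof (rule ccontr)
   assume "B \<noteq> {}"
   moreover have "compact B" unfolding B_def using compB by (intro compact_UN) auto
   ultimately obtain y where y: "y \<in> B" "\<And>s. s \<in> B ==> s <= y"
    using compact_attains_sup by metis
   then obtain i v where iv: "y \<in> {0..T}" "norm v = 1" "f y i v <= 0" by (auto simp: B_def Bi_def)
   have "0 <= (P T i *v v) \<bullet> v" unfolding PT using G[of i] by (simp add: pos_semidef_def)
   then have "f T i v > 0" unfolding f_def using r0[of T] by linarith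
   then have "y < T" using iv by (cases "y = T") auto
   have pos: "0 < f s j w" if "s \<in> {y<..T}" "norm w = 1" for s j w
   proof (rule ccontr)
    assume "\<not> 0 < f s j w"
    then have "(s, w) \<in> {z \<in> {0..T} \<times> sphere 0 1. f (fst z) j (snd z) <= 0}"
     using that iv by auto
    then have "s \<in> B" unfolding B_def Bi_def by force
    then show False using y(2) that by fastforce
   qed
   have nonneg: "0 <= f y j w" if "norm w = 1" for j w
   proof -
    have "continuous_on {0..T} (\<lambda>s. P s j *v w)"
     unfolding matrix_vector_mult_def by (intro continuous_intros contP)
    then have "continuous_on {0..T} (\<lambda>s. f s j w)" unfolding f_def r_def by (intro continuous_intros)
    then have "continuous_on (closure {y<..T}) (\<lambda>s. f s j w)"
     using \<open>y < T\<close> iv by (auto elim!: continuous_on_subset)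
    then show ?thesis
     by (rule continuous_ge_on_closure) (use \<open>y < T\<close> pos that in \<open>auto intro!: less_imp_le\<close>)
   qed
   have lower: "- r y * (w \<bullet> w) <= (P y j *v w) \<bullet> w" for j w
   proof (cases "w = 0")
    case False
    define w1 where "w1 = (1 / norm w) *\<^sub>R w"
    have "norm w1 = 1" using False by (simp add: w1_def)
    then have "0 <= (P y j *v w1) \<bullet> w1 + r y" using nonneg f_def by auto
    also have "(P y j *v w1) \<bullet> w1 = ((P y j *v w) \<bullet> w) / (w \<bullet> w)"
     by (simp add: w1_def matrix_vector_mult_scaleR power2_eq_square flip: power2_norm_eq_inner)
    finally have "- r y <= ((P y j *v w) \<bullet> w) / (w \<bullet> w)" by linarith
    then show ?thesis using False by (simp add: pos_le_divide_eq)
   qed simp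
   have vv: "v \<bullet> v = 1" using iv by (simp add: norm_eq_1)
   have f0: "f y i v = 0" using nonneg[OF iv(2), of i] iv(3) by linarith
   \<comment> \<open>The shifted matrix has a nonnegative form that vanishes at \<open>v\<close>, so
     Cauchy-Schwarz puts \<open>v\<close> into its kernel.\<close>
   define E where "E = P y i + r y *\<^sub>R mat 1"
   have Ev: "E *v w = P y i *v w + r y *\<^sub>R w" for w
    unfolding E_def by (simp add: matrix_vector_mult_add_rdistrib scaleR_matrix_vector_assoc[symmetric])
   have "symmetric_matrix E"
    using sym[OF iv(1), of i] unfolding E_def symmetric_matrix_def by (simp add: transpose_add transpose_scalar)
   moreover have "0 <= (E *v w) \<bullet> w" for w using lower[of w i] by (simp add: Ev inner_add_left)
   moreover have "(E *v v) \<bullet> v = 0" using f0 vv by (simp add: Ev inner_add_left f_def)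
   ultimately have "((E *v v) \<bullet> (E *v v))\<^sup>2 <= 0" using psd_Cauchy_Schwarz[of E v "E *v v"] by simp
   then have "E *v v = 0" by simp
   then have Pv: "P y i *v v = - r y *\<^sub>R v" by (simp add: Ev eq_neg_iff_add_eq_0)
   have coerc: "c / 2 * (u \<bullet> u) <= (N1_tilde d P y i *v u) \<bullet> u" for u
   proof -
    have "norm (cD1 d i *v u) <= L * norm u"
     by (rule order_trans[OF norm_matrix_vector_mult_le]) (use L(2)[of i] in \<open>auto intro!: mult_right_mono\<close>)
    then have "(norm (cD1 d i *v u))\<^sup>2 <= (L * norm u)\<^sup>2" by (intro power_mono) auto
    then have "(cD1 d i *v u) \<bullet> (cD1 d i *v u) <= L\<^sup>2 * (u \<bullet> u)"
     by (simp add: power2_norm_eq_inner power_mult_distrib)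
    then have "r y * ((cD1 d i *v u) \<bullet> (cD1 d i *v u)) <= r y * (L\<^sup>2 * (u \<bullet> u))"
     using r0[of y] by (intro mult_left_mono) auto
    also have "... <= c / 2 * (u \<bullet> u)"
     using mult_right_mono[OF rle[OF iv(1)], of "u \<bullet> u"] by (simp add: mult.assoc)
    finally show ?thesis
     using lower[of "cD1 d i *v u" i] c(2)[of u i] unfolding N1_tilde_form by simp
   qed
   have Npd: "pos_def (N1_tilde d P y i)"
    using N1_tilde_pos_def[OF sym[OF iv(1)] _ _ coerc] N[of i] c(1) unfolding pos_def_def by auto
   define u where "u = - (matrix_inv (N1_tilde d P y i) *v (S1 d P y i *v v))"
   have Nu: "N1_tilde d P y i *v u = - (S1 d P y i *v v)"
    using pos_def_matrix_inv(1)[OF Npd]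
    by (simp add: u_def matrix_vector_mult_uminus_right matrix_vector_mul_assoc)
     (metis matrix_mul_assoc matrix_mul_lid)
   have "norm (S1 d P y i *v v) <= norm (S1 d P y i) * norm v" by (rule norm_matrix_vector_mult_le)
   then have Sv: "norm (S1 d P y i *v v) <= k" using k0[OF iv(1), of i] k(2)[of i] iv(2) by simp
   have uU: "norm u <= U"
   proof (cases "u = 0")
    case False
    have "c / 2 * (norm u * norm u) <= - ((S1 d P y i *v v) \<bullet> u)"
     using coerc[of u] Nu by (simp add: power2_eq_square flip: power2_norm_eq_inner)
    also have "... <= norm (S1 d P y i *v v) * norm u"
     using Cauchy_Schwarz_ineq2[of "S1 d P y i *v v" u] by linarith
    also have "... <= k * norm u" by (intro mult_right_mono Sv) auto
    finally have "c / 2 * norm u <= k" using False by simp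
    then show ?thesis unfolding U_def using c by (simp add: field_simps)
   qed (use U0 in simp)
   define a where "a = cA d i *v v + cB1 d i *v u"
   define b where "b = cC d i *v v + cD1 d i *v u"
   have ab: "norm a <= L + L * U" "norm b <= L + L * U"
   proof -
    have le: "norm (X *v v + Y *v u) <= L + L * U" if "norm X <= L" "norm Y <= L"
     for X :: "real^'n^'n" and Y :: "real^'m1^'n"
    proof -
     have "norm (X *v v) <= L" using norm_matrix_vector_mult_le[of X v] iv that by simp
     moreover have "norm (Y *v u) <= L * U"
      by (rule order_trans[OF norm_matrix_vector_mult_le]) (use that uU L in \<open>auto intro!: mult_mono\<close>)
     ultimately show ?thesis using norm_triangle_ineq[of "X *v v" "Y *v u"] by linarith
    qed
    show "norm a <= L + L * U" "norm b <= L + L * U"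
     unfolding a_def b_def using L(2)[of i] by (auto intro!: le)
   qed
   have rhs: "(riccati1_rhs d gen P y i *v v) \<bullet> v <= K1 * r y"
   proof -
    have "(P y i *v v) \<bullet> a = - r y * (v \<bullet> a)" unfolding Pv by simp
    moreover have "\<bar>v \<bullet> a\<bar> <= L + L * U" using Cauchy_Schwarz_ineq2[of v a] iv ab by simp
    ultimately have 1: "- (r y * (L + L * U)) <= (P y i *v v) \<bullet> a"
     using mult_left_mono[of "v \<bullet> a" "L + L * U" "r y"] r0[of y] by simp
    have "b \<bullet> b <= (L + L * U)\<^sup>2"
     using ab(2) unfolding power2_norm_eq_inner[symmetric] by (intro power_mono) auto
    then have "- (r y * (L + L * U)\<^sup>2) <= - r y * (b \<bullet> b)" using r0[of y] by simp
    then have 2: "- (r y * (L + L * U)\<^sup>2) <= (P y i *v b) \<bullet> b" using lower[of b i] by linarith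
    have 3: "0 <= (cQ1 d i *v v) \<bullet> v" using Q[of i] pos_semidef_def by blast
    have "0 <= c * (u \<bullet> u)" using c by simp
    then have 4: "0 <= (cN1 d i *v u) \<bullet> u" using c(2)[of u i] by linarith
    \<comment> \<open>The shift is the same in all regimes, and at \<open>v\<close> regime
      \<open>i\<close> attains the smallest value, so the coupling terms with nonnegative rates have
      the favourable sign.\<close>
    have 5: "0 <= gen i j * ((P y j *v v) \<bullet> v - (P y i *v v) \<bullet> v)" for j
    proof (cases "j = i")
     case False
     have "(P y i *v v) \<bullet> v <= (P y j *v v) \<bullet> v" using lower[of v j] f0 vv by (simp add: f_def)
     then show ?thesis using gen[of i j] False by simp
    qed simp
    show ?thesis
     unfolding riccati1_rhs_form[where P = P and t = y and i = i and gen = gen, OF sym[OF iv(1)] Npd u_def] a_def[symmetric] b_def[symmetric]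
     using 1 2 3 4 sum_nonneg[of UNIV "\<lambda>j. gen i j * ((P y j *v v) \<bullet> v - (P y i *v v) \<bullet> v)"] 5
     by (simp add: K1_def algebra_simps)
   qed
   have "((\<lambda>s. f s i v) has_real_derivative
     (riccati1_rhs d gen P y i *v v) \<bullet> v + - \<kappa> * r y) (at y within {0..T})"
   proof -
    have "bounded_linear (\<lambda>X :: real^'n^'n. (X *v v) \<bullet> v)"
     by (intro bounded_linear_compose[OF bounded_linear_inner_left] linear_conv_bounded_linear[THEN iffD1] linearI)
      (auto simp: matrix_vector_mult_add_rdistrib scaleR_matrix_vector_assoc)
    from bounded_linear.has_vector_derivative[OF this der[OF iv(1), of i]]
    have "((\<lambda>s. (P s i *v v) \<bullet> v) has_real_derivative (riccati1_rhs d gen P y i *v v) \<bullet> v) (at y within {0..T})"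
     by (simp add: has_real_derivative_iff_has_vector_derivative)
    moreover have "(r has_real_derivative - \<kappa> * r y) (at y within {0..T})"
     unfolding r_def by (auto intro!: derivative_eq_intros)
    ultimately show ?thesis unfolding f_def by (rule DERIV_add)
   qed
   moreover have "(riccati1_rhs d gen P y i *v v) \<bullet> v + - \<kappa> * r y < 0"
    using rhs r0[of y] by (simp add: \<kappa>_def algebra_simps)
   ultimately obtain e where e: "e > 0" "\<And>h. h > 0 ==> y + h \<in> {0..T} ==> h < e ==> f (y + h) i v < f y i v"
    using has_real_derivative_neg_dec_right by blast
   define h where "h = min (e / 2) (T - y)"
   have "h > 0" "h < e" "y + h \<in> {y<..T}" using e(1) \<open>y < T\<close> by (auto simp: h_def min_def)
   then show False using e(2)[of h] pos[of "y + h" v i] iv f0 by force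
  qed
  then have "\<not> f t i w <= 0"
   using t w unfolding B_def Bi_def by force
  then show ?thesis unfolding f_def r_def by linarith
 qed

 show ?thesis
 proof (cases "v = 0")
  case False
  define w where "w = (1 / norm v) *\<^sub>R v"
  have w: "norm w = 1" using False by (simp add: w_def)
  \<comment> \<open>The largest shift that the smallness condition in \<open>shifted\<close>
    permits.\<close>
  define g0 where "g0 = c / 2 / (exp (\<kappa> * T) * L\<^sup>2)"
  have e0: "0 < g0" using c L by (simp add: g0_def)
  have "- (e * exp (\<kappa> * (T - t))) <= (P t i *v w) \<bullet> w" if "0 < e" "e < g0" for e
  proof -
   have "e * (exp (\<kappa> * T) * L\<^sup>2) <= c / 2"
    using that L by (simp add: g0_def field_simps)
   then show ?thesis using shifted[of e, OF that(1) _ t w, of i] by (simp add: mult.assoc)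
  qed
  then have "\<forall>\<^sub>F e in at_right 0. - (e * exp (\<kappa> * (T - t))) <= (P t i *v w) \<bullet> w"
   using e0 by (auto simp: eventually_at_right_field)
  moreover have "((\<lambda>e. - (e * exp (\<kappa> * (T - t)))) \<longlongrightarrow> - (0 * exp (\<kappa> * (T - t)))) (at_right 0)"
   by (intro tendsto_intros)
  ultimately have "0 <= (P t i *v w) \<bullet> w"
   using tendsto_upperbound[of "\<lambda>e. - (e * exp (\<kappa> * (T - t)))" _ "at_right 0"] by simp
  also have "... = ((P t i *v v) \<bullet> v) / (v \<bullet> v)"
   by (simp add: w_def matrix_vector_mult_scaleR power2_eq_square flip: power2_norm_eq_inner)
  finally show ?thesis using False by (simp add: zero_le_divide_iff) (metis inner_gt_zero_iff linorder_not_le)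
 qed simp
qed

text \<open>Since P >= 0, \<open>N1_tilde\<close> dominates \<open>N1\<close>, and the coercivity
  constant of the finitely many \<open>N1\<close> serves at all times.\<close>

lemma N1_tilde_coercive:
 fixes d :: "('s::finite, 'n::finite, 'm1::finite, 'm2::finite) lq_data"
 assumes T: "0 < T" and ric: "riccati1 d gen T P"
  and gen: "\<And>i j. i \<noteq> j ==> 0 <= gen i j"
  and Q: "\<And>i. pos_semidef (cQ1 d i)" and N: "\<And>i. pos_def (cN1 d i)" and G: "\<And>i. pos_semidef (cG1 d i)"
 shows "t \<in> {0..T} ==> pos_def (N1_tilde d P t i)"
  and "\<exists>c>0. \<forall>t\<in>{0..T}. \<forall>i v. c * (v \<bullet> v) <= (N1_tilde d P t i *v v) \<bullet> v"
proof -
 obtain c where c: "0 < c" "\<And>i v. c * (v \<bullet> v) <= (cN1 d i *v v) \<bullet> v"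
  using uniformly_coercive[of "cN1 d", OF N] by blast
 have *: "c * (v \<bullet> v) <= (N1_tilde d P t i *v v) \<bullet> v" if "t \<in> {0..T}" for t i v
  using c(2)[of v i] riccati1_psd[OF T ric gen Q N G that, of i "cD1 d i *v v"]
  unfolding N1_tilde_form by linarith
 then show "\<exists>c>0. \<forall>t\<in>{0..T}. \<forall>i v. c * (v \<bullet> v) <= (N1_tilde d P t i *v v) \<bullet> v"
  using c(1) by blast
 assume t: "t \<in> {0..T}"
 then have "symmetric_matrix (P t i)" using ric unfolding riccati1_def by blast
 then show "pos_def (N1_tilde d P t i)"
  using N1_tilde_pos_def[OF _ _ c(1) *[OF t]] N[of i] unfolding pos_def_def by blast
qed

section \<open>Continuity of matrix-valued functions and of their inverses\<close>

lemma continuous_on_matrix_mult: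
 fixes A :: "'a::topological_space => real^'n^'m" and B :: "'a => real^'k^'n"
 assumes "continuous_on S A" "continuous_on S B"
 shows "continuous_on S (\<lambda>t. A t ** B t)"
 unfolding matrix_matrix_mult_def using assms by (intro continuous_intros) auto

lemma continuous_on_matrix_vector_mult:
 fixes A :: "'a::topological_space => real^'n^'m" and v :: "'a => real^'n"
 assumes "continuous_on S A" "continuous_on S v"
 shows "continuous_on S (\<lambda>t. A t *v v t)"
 unfolding matrix_vector_mult_def using assms by (intro continuous_intros) auto

lemma continuous_on_transpose:
 fixes A :: "'a::topological_space => real^'n^'m"
 assumes "continuous_on S A"
 shows "continuous_on S (\<lambda>t. transpose (A t))"
 unfolding transpose_def using assms by (intro continuous_intros) auto

text \<open>Resolvent identity: the difference of the inverses at s and t, applied to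
  \<open>w\<close>, is the inverse at s applied to (X t - X s) u, where u is the inverse at t
  applied to \<open>w\<close>. Coercivity bounds all the inverses by 1/c.\<close>

lemma continuous_on_matrix_inv:
 fixes X :: "real => real^'n^'n"
 assumes cont: "continuous_on S X" and pd: "\<And>t. t \<in> S ==> pos_def (X t)"
  and c: "0 < c" "\<And>t v. t \<in> S ==> c * (v \<bullet> v) <= (X t *v v) \<bullet> v"
 shows "continuous_on S (\<lambda>t. matrix_inv (X t))"
proof -
 have XR: "X t *v (matrix_inv (X t) *v w) = w" "matrix_inv (X t) *v (X t *v w) = w" if "t \<in> S" for t w
  using pos_def_matrix_inv[OF pd[OF that]] by (simp_all add: matrix_vector_mul_assoc)
 have Rle: "norm (matrix_inv (X t) *v w) <= norm w / c" if "t \<in> S" for t w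
 proof -
  define u where "u = matrix_inv (X t) *v w"
  have "c * (norm u * norm u) <= w \<bullet> u"
   using c(2)[OF that, of u] XR[OF that, of w] by (simp add: u_def power2_eq_square flip: power2_norm_eq_inner)
  also have "... <= norm w * norm u" by (rule norm_cauchy_schwarz)
  finally have "norm u = 0 \<or> c * norm u <= norm w" by (metis mult.assoc mult_le_cancel_right_pos norm_ge_zero order_le_less)
  then show ?thesis unfolding u_def[symmetric] using c(1) by (auto simp: field_simps)
 qed
 have vec: "continuous_on S (\<lambda>t. matrix_inv (X t) *v w)" for w
  unfolding continuous_on_def
 proof
  fix t assume t: "t \<in> S"
  define u where "u = matrix_inv (X t) *v w"
  have "((\<lambda>s. X s *v u) \<longlongrightarrow> X t *v u) (at t within S)"
   using continuous_on_matrix_vector_mult[OF cont continuous_on_const] t by (auto simp: continuous_on_def)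
  then have "((\<lambda>s. norm (X t *v u - X s *v u) / c) \<longlongrightarrow> norm (X t *v u - X t *v u) / c) (at t within S)"
   using c(1) by (intro tendsto_intros) auto
  then have lim: "((\<lambda>s. norm (X t *v u - X s *v u) / c) \<longlongrightarrow> 0) (at t within S)" by simp
  have "norm (matrix_inv (X s) *v w - u) <= norm (X t *v u - X s *v u) / c" if "s \<in> S" for s
  proof -
   have "matrix_inv (X s) *v w - u = matrix_inv (X s) *v (X t *v u - X s *v u)"
    using XR[OF t] XR[OF that] by (simp add: matrix_vector_mult_diff_distrib u_def)
   then show ?thesis using Rle[OF that] by simp
  qed
  then have "\<forall>\<^sub>F s in at t within S. norm (matrix_inv (X s) *v w - u) <= norm (X t *v u - X s *v u) / c"
   by (simp add: eventually_at_filter)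
  then have "((\<lambda>s. norm (matrix_inv (X s) *v w - u)) \<longlongrightarrow> 0) (at t within S)"
   by (intro tendsto_sandwich[OF _ _ tendsto_const lim]) auto
  then have "((\<lambda>s. matrix_inv (X s) *v w - u) \<longlongrightarrow> 0) (at t within S)"
   by (rule tendsto_norm_zero_cancel)
  then show "((\<lambda>s. matrix_inv (X s) *v w) \<longlongrightarrow> matrix_inv (X t) *v w) (at t within S)"
   unfolding u_def by (rule LIM_zero_cancel)
 qed
 have "(\<chi> i j. (matrix_inv (X t) *v axis j 1) $ i) = matrix_inv (X t)" for t
  by (simp add: vec_eq_iff matrix_vector_mult_basis column_def)
 moreover have "continuous_on S (\<lambda>t. \<chi> i j. (matrix_inv (X t) *v axis j 1) $ i)"
  by (intro continuous_intros vec)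
 ultimately show ?thesis by simp
qed

section \<open>Square-integrable functions\<close>

definition sq_integrable :: "'a measure => ('a => real) => bool" where
 "sq_integrable N f \<longleftrightarrow> f \<in> Bm N \<and> integrable N (\<lambda>x. (f x)\<^sup>2)"

lemma nonneg_tendsto_zero:
 fixes f :: "'a => real"
 assumes "\<And>m. 0 <= f m" "\<And>m. f m <= g m" "(g \<longlongrightarrow> 0) F"
 shows "(f \<longlongrightarrow> 0) F"
 by (rule tendsto_sandwich[of "\<lambda>_. 0" f F g 0]) (use assms in auto)

lemma sq_integrable_measurable [measurable_dest]: "sq_integrable N f ==> f \<in> Bm N"
 by (simp add: sq_integrable_def)

lemma sq_integrable_mult:
 assumes f: "sq_integrable N f" and g: "sq_integrable N g"
 shows "integrable N (\<lambda>x. f x * g x)"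
proof (rule lint_bound)
 show "integrable N (\<lambda>x. (f x)\<^sup>2 + (g x)\<^sup>2)" using f g by (simp add: sq_integrable_def)
 show "(\<lambda>x. f x * g x) \<in> Bm N" using f g by (auto simp: sq_integrable_def)
 have le: "\<bar>a * b\<bar> <= a\<^sup>2 + b\<^sup>2" for a b :: real
 proof -
  have "2 * \<bar>a * b\<bar> <= a\<^sup>2 + b\<^sup>2"
   using sum_squares_bound[of "\<bar>a\<bar>" "\<bar>b\<bar>"] by (simp add: abs_mult mult.assoc)
  then show ?thesis using abs_ge_zero[of "a * b"] by linarith
 qed
 then show "AE x in N. norm (f x * g x) <= norm ((f x)\<^sup>2 + (g x)\<^sup>2)"
  unfolding real_norm_def by (intro AE_I2 order_trans[OF le abs_ge_self])
qed

lemma sq_integrable_bounded_mult: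
 assumes f: "sq_integrable N f" and h: "h \<in> Bm N" "\<And>x. x \<in> space N ==> \<bar>h x\<bar> <= C"
 shows "sq_integrable N (\<lambda>x. h x * f x)"
 unfolding sq_integrable_def
proof
 show "(\<lambda>x. h x * f x) \<in> Bm N" using f h by (auto simp: sq_integrable_def)
 show "integrable N (\<lambda>x. (h x * f x)\<^sup>2)"
 proof (rule lint_bound)
  show "integrable N (\<lambda>x. C\<^sup>2 * (f x)\<^sup>2)" using f by (simp add: sq_integrable_def)
  show "(\<lambda>x. (h x * f x)\<^sup>2) \<in> Bm N" using f h by (auto simp: sq_integrable_def)
  have "(h x)\<^sup>2 <= C\<^sup>2" if "x \<in> space N" for x
   using power_mono[OF h(2)[OF that], of 2] by simp
  then show "AE x in N. norm ((h x * f x)\<^sup>2) <= norm (C\<^sup>2 * (f x)\<^sup>2)"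
   by (auto simp: power_mult_distrib intro!: mult_right_mono)
 qed
qed

lemma sq_integrable_cmult: "sq_integrable N f ==> sq_integrable N (\<lambda>x. c * f x)"
 by (auto simp: sq_integrable_def power_mult_distrib)

lemma sq_integrable_add:
 assumes f: "sq_integrable N f" and g: "sq_integrable N g"
 shows "sq_integrable N (\<lambda>x. f x + g x)"
 using f g sq_integrable_mult[OF f g] by (auto simp: sq_integrable_def power2_sum mult.assoc)

lemma sq_integrable_diff:
 assumes f: "sq_integrable N f" and g: "sq_integrable N g"
 shows "sq_integrable N (\<lambda>x. f x - g x)"
 using sq_integrable_add[OF f sq_integrable_cmult[OF g, of "-1"]] by simp

lemma sq_integrable_zero: "sq_integrable N (\<lambda>x. 0)"
 by (simp add: sq_integrable_def)

lemma sq_integrable_sum: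
 "(\<And>i. i \<in> I ==> sq_integrable N (f i)) ==> sq_integrable N (\<lambda>x. \<Sum>i\<in>I. f i x)"
 by (induction I rule: infinite_finite_induct) (auto intro: sq_integrable_add sq_integrable_zero)

lemma sq_integrable_cong_AE:
 assumes "sq_integrable N f" "g \<in> Bm N" "AE x in N. f x = g x"
 shows "sq_integrable N g"
proof -
 have "integrable N (\<lambda>x. (f x)\<^sup>2) \<longleftrightarrow> integrable N (\<lambda>x. (g x)\<^sup>2)"
  using assms by (intro integrable_cong_AE) (auto simp: sq_integrable_def)
 then show ?thesis using assms by (simp add: sq_integrable_def)
qed

lemma sq_integrable_bounded:
 assumes "finite_measure N" "f \<in> Bm N" "\<And>x. x \<in> space N ==> \<bar>f x\<bar> <= C"
 shows "sq_integrable N f"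
proof -
 interpret finite_measure N by fact
 have "(f x)\<^sup>2 <= C\<^sup>2" if "x \<in> space N" for x using power_mono[OF assms(3)[OF that], of 2] by simp
 then have "integrable N (\<lambda>x. (f x)\<^sup>2)"
  using assms(2) by (intro integrable_const_bound[where B = "C\<^sup>2"]) auto
 then show ?thesis using assms(2) by (simp add: sq_integrable_def)
qed

lemma sq_integrable_imp_integrable:
 assumes "finite_measure N" "sq_integrable N f"
 shows "integrable N f"
 using sq_integrable_mult[OF assms(2) sq_integrable_bounded[OF assms(1), of "\<lambda>_. 1" 1]] by simp

lemma Cauchy_Schwarz_integral:
 assumes f: "sq_integrable N f" and g: "sq_integrable N g"
 shows "(\<integral>x. f x * g x \<partial>N)\<^sup>2 <= (\<integral>x. (f x)\<^sup>2 \<partial>N) * (\<integral>x. (g x)\<^sup>2 \<partial>N)"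
proof -
 define a b c where "a = (\<integral>x. (f x)\<^sup>2 \<partial>N)" and "b = (\<integral>x. f x * g x \<partial>N)" and "c = (\<integral>x. (g x)\<^sup>2 \<partial>N)"
 have ac: "0 <= a" "0 <= c" unfolding a_def c_def by (auto intro: integral_nonneg_AE)
 have q: "0 <= a + 2 * s * b + s\<^sup>2 * c" for s
 proof -
  have "0 <= (\<integral>x. (f x + s * g x)\<^sup>2 \<partial>N)" by (auto intro: integral_nonneg_AE)
  also have "... = (\<integral>x. (f x)\<^sup>2 + 2 * s * (f x * g x) + s\<^sup>2 * (g x)\<^sup>2 \<partial>N)"
   by (intro lintegral_cong) (auto simp: power2_eq_square algebra_simps)
  also have "... = a + 2 * s * b + s\<^sup>2 * c"
   unfolding a_def b_def c_def using f g sq_integrable_mult[OF f g]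
   by (subst lintegral_add | simp add: sq_integrable_def)+
  finally show ?thesis .
 qed
 have "b\<^sup>2 <= a * c"
 proof (cases "c = 0")
  case True
  have "b = 0"
  proof (rule ccontr)
   assume "b \<noteq> 0"
   then show False using q[of "- (a + 1) / (2 * b)"] True ac by (simp add: field_simps)
  qed
  then show ?thesis using ac by simp
 next
  case False
  then have "c > 0" using ac by simp
  then show ?thesis using q[of "- b / c"] by (simp add: field_simps power2_eq_square)
 qed
 then show ?thesis by (simp add: a_def b_def c_def)
qed

text \<open>The distance is an extended integral, as in the definition of the stochastic integrals,
  so membership of the limit in L2 is part of the conclusion: some term of the sequence is at
  distance below 1.\<close>

lemma sq_integrable_limit:
 assumes f: "\<And>m. sq_integrable N (f m)" and g: "g \<in> Bm N"
  and lim: "(\<lambda>m. \<integral>\<^sup>+x. ennreal ((f m x - g x)\<^sup>2) \<partial>N) \<longlonglongrightarrow> 0"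
 shows "sq_integrable N g" and "(\<lambda>m. \<integral>x. (f m x - g x)\<^sup>2 \<partial>N) \<longlonglongrightarrow> 0"
proof -
 have [measurable]: "f m \<in> Bm N" for m using f by (simp add: sq_integrable_def)
 note [measurable] = g
 obtain m where "(\<integral>\<^sup>+x. ennreal ((f m x - g x)\<^sup>2) \<partial>N) < 1"
  using order_tendstoD(2)[OF lim, of 1] by (auto simp: eventually_sequentially)
 then have "(\<integral>\<^sup>+x. ennreal ((f m x - g x)\<^sup>2) \<partial>N) < \<infinity>"
  using ennreal_one_less_top less_trans by fastforce
 then have "integrable N (\<lambda>x. (f m x - g x)\<^sup>2)"
  by (auto simp: integrable_iff_bounded)
 then have "sq_integrable N (\<lambda>x. f m x - g x)" by (simp add: sq_integrable_def)
 from sq_integrable_diff[OF f[of m] this] show g2: "sq_integrable N g" by simp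
 have "(\<integral>\<^sup>+x. ennreal ((f m x - g x)\<^sup>2) \<partial>N) = ennreal (\<integral>x. (f m x - g x)\<^sup>2 \<partial>N)" for m
  using sq_integrable_diff[OF f[of m] g2] by (intro nn_integral_eq_integral) (auto simp: sq_integrable_def)
 then have "(\<lambda>m. ennreal (\<integral>x. (f m x - g x)\<^sup>2 \<partial>N)) \<longlonglongrightarrow> ennreal 0" using lim by simp
 then show "(\<lambda>m. \<integral>x. (f m x - g x)\<^sup>2 \<partial>N) \<longlonglongrightarrow> 0"
  by (subst (asm) tendsto_ennreal_iff) (auto intro: integral_nonneg_AE)
qed

lemma sq_integral_mult_vanish:
 assumes a: "\<And>m. sq_integrable N (a m)" and b: "\<And>m. sq_integrable N (b m)"
  and a0: "(\<lambda>m. \<integral>x. (a m x)\<^sup>2 \<partial>N) \<longlonglongrightarrow> 0" and bB: "(\<lambda>m. \<integral>x. (b m x)\<^sup>2 \<partial>N) \<longlonglongrightarrow> B"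
 shows "(\<lambda>m. \<integral>x. a m x * b m x \<partial>N) \<longlonglongrightarrow> 0"
proof -
 have "(\<lambda>m. (\<integral>x. (a m x)\<^sup>2 \<partial>N) * (\<integral>x. (b m x)\<^sup>2 \<partial>N)) \<longlonglongrightarrow> 0 * B"
  by (intro tendsto_mult a0 bB)
 then have "(\<lambda>m. (\<integral>x. (a m x)\<^sup>2 \<partial>N) * (\<integral>x. (b m x)\<^sup>2 \<partial>N)) \<longlonglongrightarrow> 0" by simp
 then have "(\<lambda>m. (\<integral>x. a m x * b m x \<partial>N)\<^sup>2) \<longlonglongrightarrow> 0"
  by (rule nonneg_tendsto_zero[rotated 2]) (auto intro: Cauchy_Schwarz_integral a b)
 then have "(\<lambda>m. sqrt ((\<integral>x. a m x * b m x \<partial>N)\<^sup>2)) \<longlonglongrightarrow> sqrt 0" by (rule tendsto_real_sqrt)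
 then show ?thesis by (simp add: tendsto_rabs_zero_iff)
qed

text \<open>Expand the product around the limits; each of the three error terms has a factor tending
  to 0 in L2. The bounded weight \<open>h\<close> is carried along so that expectations can be
  weighted by functions of the chain.\<close>

lemma sq_integrable_limit_mult:
 assumes f: "\<And>m. sq_integrable N (f m)" "f' \<in> Bm N"
   "(\<lambda>m. \<integral>\<^sup>+x. ennreal ((f m x - f' x)\<^sup>2) \<partial>N) \<longlonglongrightarrow> 0"
  and g: "\<And>m. sq_integrable N (g m)" "g' \<in> Bm N"
   "(\<lambda>m. \<integral>\<^sup>+x. ennreal ((g m x - g' x)\<^sup>2) \<partial>N) \<longlonglongrightarrow> 0"
  and h: "h \<in> Bm N" "\<And>x. x \<in> space N ==> \<bar>h x\<bar> <= C"
 shows "(\<lambda>m. \<integral>x. h x * (f m x * g m x) \<partial>N) \<longlonglongrightarrow> (\<integral>x. h x * (f' x * g' x) \<partial>N)"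
proof -
 note f' = sq_integrable_limit[OF f] and g' = sq_integrable_limit[OF g]
 have bm: "sq_integrable N a ==> sq_integrable N (\<lambda>x. h x * a x)" for a
  using sq_integrable_bounded_mult[OF _ h] .
 have int: "integrable N (\<lambda>x. h x * (a x * b x))" if "sq_integrable N a" "sq_integrable N b" for a b
  using sq_integrable_mult[OF bm[OF that(1)] that(2)] by (simp add: mult.assoc)
 note df = sq_integrable_diff[OF f(1) f'(1)] and dg = sq_integrable_diff[OF g(1) g'(1)]
 have 1: "(\<lambda>m. \<integral>x. (f m x - f' x) * (h x * (g m x - g' x)) \<partial>N) \<longlonglongrightarrow> 0"
 proof (rule sq_integral_mult_vanish[OF df bm[OF dg] f'(2), where B = 0])
  have "(\<lambda>m. C\<^sup>2 * (\<integral>x. (g m x - g' x)\<^sup>2 \<partial>N)) \<longlonglongrightarrow> C\<^sup>2 * 0" by (intro tendsto_intros g'(2))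
  moreover have "(\<integral>x. (h x * (g m x - g' x))\<^sup>2 \<partial>N) <= C\<^sup>2 * (\<integral>x. (g m x - g' x)\<^sup>2 \<partial>N)" for m
  proof -
   have "(\<integral>x. (h x * (g m x - g' x))\<^sup>2 \<partial>N) <= (\<integral>x. C\<^sup>2 * (g m x - g' x)\<^sup>2 \<partial>N)"
   proof (rule integral_mono)
    show "integrable N (\<lambda>x. (h x * (g m x - g' x))\<^sup>2)" using bm[OF dg] by (simp add: sq_integrable_def)
    show "integrable N (\<lambda>x. C\<^sup>2 * (g m x - g' x)\<^sup>2)" using dg by (simp add: sq_integrable_def)
    fix x assume "x \<in> space N"
    then have "(h x)\<^sup>2 <= C\<^sup>2" using power_mono[OF h(2), of x 2] by simp
    then show "(h x * (g m x - g' x))\<^sup>2 <= C\<^sup>2 * (g m x - g' x)\<^sup>2"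
     by (auto simp: power_mult_distrib intro!: mult_right_mono)
   qed
   then show ?thesis by simp
  qed
  ultimately show "(\<lambda>m. \<integral>x. (h x * (g m x - g' x))\<^sup>2 \<partial>N) \<longlonglongrightarrow> 0"
   by (intro nonneg_tendsto_zero[of "\<lambda>m. \<integral>x. (h x * (g m x - g' x))\<^sup>2 \<partial>N"
      "\<lambda>m. C\<^sup>2 * (\<integral>x. (g m x - g' x)\<^sup>2 \<partial>N)"]) (auto intro: integral_nonneg_AE)
 qed
 have 2: "(\<lambda>m. \<integral>x. (f m x - f' x) * (h x * g' x) \<partial>N) \<longlonglongrightarrow> 0"
  by (rule sq_integral_mult_vanish[OF df bm[OF g'(1)] f'(2) tendsto_const])
 have 3: "(\<lambda>m. \<integral>x. (g m x - g' x) * (h x * f' x) \<partial>N) \<longlonglongrightarrow> 0"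
  by (rule sq_integral_mult_vanish[OF dg bm[OF f'(1)] g'(2) tendsto_const])
 have eq: "(\<integral>x. h x * (f m x * g m x) \<partial>N) = (\<integral>x. (f m x - f' x) * (h x * (g m x - g' x)) \<partial>N)
   + (\<integral>x. (f m x - f' x) * (h x * g' x) \<partial>N) + (\<integral>x. (g m x - g' x) * (h x * f' x) \<partial>N)
   + (\<integral>x. h x * (f' x * g' x) \<partial>N)" for m
 proof -
  have "(\<integral>x. h x * (f m x * g m x) \<partial>N) = (\<integral>x. (f m x - f' x) * (h x * (g m x - g' x))
   + (f m x - f' x) * (h x * g' x) + (g m x - g' x) * (h x * f' x) + h x * (f' x * g' x) \<partial>N)"
   by (intro lintegral_cong) (auto simp: algebra_simps)
  also have "... = (\<integral>x. (f m x - f' x) * (h x * (g m x - g' x)) \<partial>N)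
   + (\<integral>x. (f m x - f' x) * (h x * g' x) \<partial>N) + (\<integral>x. (g m x - g' x) * (h x * f' x) \<partial>N)
   + (\<integral>x. h x * (f' x * g' x) \<partial>N)"
   using sq_integrable_mult[OF df bm[OF dg], of m m] sq_integrable_mult[OF df bm[OF g'(1)], of m]
    sq_integrable_mult[OF dg bm[OF f'(1)], of m] int[OF f'(1) g'(1)]
   by (simp add: lintegral_add)
  finally show ?thesis .
 qed
 show ?thesis unfolding eq using tendsto_add[OF tendsto_add[OF tendsto_add[OF 1 2] 3] tendsto_const] by simp
qed

lemma integral_product_sums:
 assumes a: "\<And>l. l < n ==> sq_integrable N (a l)" and b: "\<And>k. k < m ==> sq_integrable N (b k)"
  and h: "h \<in> Bm N" "\<And>x. x \<in> space N ==> \<bar>h x\<bar> <= C"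
 shows "(\<integral>x. h x * ((\<Sum>l<n. a l x) * (\<Sum>k<m. b k x)) \<partial>N) = (\<Sum>l<(n::nat). \<Sum>k<(m::nat). \<integral>x. h x * (a l x * b k x) \<partial>N)"
proof -
 have int: "integrable N (\<lambda>x. h x * (a l x * b k x))" if "l < n" "k < m" for l k
  using sq_integrable_mult[OF sq_integrable_bounded_mult[OF a[OF that(1)] h] b[OF that(2)]] by (simp only: mult.assoc)
 have "(\<integral>x. h x * ((\<Sum>l<n. a l x) * (\<Sum>k<m. b k x)) \<partial>N) = (\<integral>x. (\<Sum>l<n. \<Sum>k<m. h x * (a l x * b k x)) \<partial>N)"
  unfolding sum_product by (simp only: sum_distrib_left)
 also have "... = (\<Sum>l<n. \<integral>x. (\<Sum>k<m. h x * (a l x * b k x)) \<partial>N)"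
  by (rule lintegral_sum) (auto intro!: lint_sum int)
 also have "... = (\<Sum>l<n. \<Sum>k<m. \<integral>x. h x * (a l x * b k x) \<partial>N)"
  by (intro sum.cong refl lintegral_sum) (auto intro!: int)
 finally show ?thesis .
qed

section \<open>Processes on a finite horizon\<close>

text \<open>Lebesgue measure on [0, T] as a finite measure of its own: its product with the
  probability measure is finite, and Fubini applies without indicators of the horizon.\<close>

definition clock :: "real => real measure" where
 "clock T = restrict_space lborel {0..T}"

definition running :: "(real => 'w => 'e::euclidean_space) => real => 'w => 'e" where
 "running f t w = (LINT s:{0..t}|lborel. f s w)"

lemma space_clock [simp]: "space (clock T) = {0..T}"
 by (simp add: clock_def space_restrict_space)

lemma sets_clock: "sets (clock T) = sets (restrict_space borel {0..T})"
 unfolding clock_def by (rule sets_restrict_space_cong) simp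

lemma measurable_clock_id [measurable]: "(\<lambda>t. t) \<in> Bm (clock T)"
 unfolding clock_def by (rule measurable_restrict_space1) simp

lemma finite_measure_clock: "finite_measure (clock T)"
proof (cases "0 <= T")
 case True
 then show ?thesis unfolding clock_def by (intro finite_measureI) (auto simp: emeasure_restrict_space space_restrict_space)
next
 case False
 then show ?thesis by (intro finite_measureI) (simp add: clock_def emeasure_restrict_space space_restrict_space)
qed

lemma integral_clock: "integral\<^sup>L (clock T) f = (LINT s:{0..T}|lborel. f s)"
 for f :: "real => 'e::euclidean_space"
 unfolding clock_def set_lebesgue_integral_def by (rule integral_restrict_space) simp

lemma nn_integral_clock: "integral\<^sup>N (clock T) f = (\<integral>\<^sup>+s\<in>{0..T}. f s \<partial>lborel)"
 unfolding clock_def by (rule nn_integral_restrict_space) simp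

lemma set_integral_upto_clock:
 fixes f :: "real => 'e::euclidean_space"
 assumes "t \<in> {0..T}"
 shows "(LINT s:{0..t}|lborel. f s) = (\<integral>s. indicator {0..t} s *\<^sub>R f s \<partial>clock T)"
 unfolding integral_clock set_lebesgue_integral_def
 using assms by (intro lintegral_cong) (auto split: split_indicator)

lemma integral_clock_point:
 fixes f :: "real => real"
 shows "(\<integral>s. indicator {r} s * f s \<partial>clock T) = 0"
 unfolding integral_clock set_lebesgue_integral_def
proof -
 have "AE s in lborel. indicator {0..T} s *\<^sub>R (indicator {r} s * f s) = 0"
  using AE_lborel_singleton[of r] by eventually_elim (auto split: split_indicator)
 then show "(LINT s|lborel. indicator {0..T} s *\<^sub>R (indicator {r} s * f s)) = 0"
  by (rule integral_eq_zero_AE)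
qed

locale horizon = prob_space M for M :: "'w measure" +
 fixes T :: real
 assumes T_pos: "0 < T"
begin

abbreviation Q :: "(real \<times> 'w) measure" where "Q \<equiv> clock T \<Otimes>\<^sub>M M"

sublocale clock: finite_measure "clock T" by (rule finite_measure_clock)

sublocale pair: pair_sigma_finite "clock T" M ..

lemma finite_measure_Q: "finite_measure Q"
 by (intro finite_measure_pair_measure finite_measure_clock finite_measure_axioms)

sublocale Q: finite_measure Q by (rule finite_measure_Q)

abbreviation mean :: "('w => real) => real" (binder "\<E>" 10) where
 "mean X \<equiv> expectation X"

lemmas sq_imp_integrable = sq_integrable_imp_integrable[OF finite_measure_axioms]

lemma sq_integrable_const: "sq_integrable M (\<lambda>w. c)"
 by (simp add: sq_integrable_def)

lemma sq_integrable_indicator: "A \<in> events ==> sq_integrable M (indicator A)"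
 by (rule sq_integrable_bounded[OF finite_measure_axioms, where C = 1]) (auto split: split_indicator)

lemma integrable_Q_add:
 fixes f g :: "real => 'w => real"
 assumes "integrable Q (\<lambda>(s, w). f s w)" "integrable Q (\<lambda>(s, w). g s w)"
 shows "integrable Q (\<lambda>(s, w). f s w + g s w)"
 using lint_add[OF assms] by (simp add: case_prod_unfold)

lemma measure_clock: "measure (clock T) {0..T} = T"
 using T_pos by (simp add: clock_def measure_restrict_space)

lemma jointly_measurable_iff:
 "jointly_measurable M T f \<longleftrightarrow> (\<lambda>(t, w). f t w) \<in> Bm Q"
proof -
 have "sets (restrict_space borel {0..T} \<Otimes>\<^sub>M M) = sets Q"
  by (intro sets_pair_measure_cong sets_clock[symmetric] refl)
 then show ?thesis unfolding jointly_measurable_def by (simp cong: measurable_cong_sets)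
qed

definition sq_process :: "(real => 'w => real) => bool" where
 "sq_process f \<longleftrightarrow> sq_integrable Q (\<lambda>(t, w). f t w)"

text \<open>The expected time integral up to \<open>t\<close>, taken over the product space, so that
  integrability is a single condition and both orders of integration are at hand.\<close>

definition mean_integral :: "real => (real => 'w => real) => real" where
 "mean_integral t g = (\<integral>z. indicator {0..t} (fst z) * g (fst z) (snd z) \<partial>Q)"

text \<open>The martingale property as orthogonality of increments to the square-integrable past. In
  this form it passes to L2 limits and can be used without computing conditional
  expectations.\<close>

definition l2_martingale :: "(real => 'w measure) => (real => 'w => real) => bool" where
 "l2_martingale H Z \<longleftrightarrow> (\<forall>t\<in>{0..T}. sq_integrable M (Z t)) \<and>
   (\<forall>s t \<eta>. 0 <= s --> s <= t --> t <= T --> \<eta> \<in> Bm (H s) --> sq_integrable M \<eta> -->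
    (\<E> w. \<eta> w * (Z t w - Z s w)) = 0)"

lemma measurable_section_time:
 assumes "case_prod f \<in> Bm Q" "t \<in> {0..T}"
 shows "f t \<in> Bm M"
 using measurable_compose[OF measurable_Pair1'[of t "clock T" M] assms(1)] assms(2) by simp

lemma measurable_section_path:
 assumes "case_prod f \<in> Bm Q" "w \<in> space M"
 shows "(\<lambda>t. f t w) \<in> Bm (clock T)"
 using measurable_compose[OF measurable_Pair2'[of w M "clock T"] assms(1)] assms(2) by simp

lemma integrable_upto:
 fixes g :: "real => 'w => real"
 assumes "integrable Q (case_prod g)"
 shows "integrable Q (\<lambda>z. indicator {0..t} (fst z) * g (fst z) (snd z))"
proof (rule lint_bound[OF assms])
 have [measurable]: "case_prod g \<in> Bm Q" using assms by auto
 have "(\<lambda>z. g (fst z) (snd z)) \<in> Bm Q" using \<open>case_prod g \<in> Bm Q\<close> by (simp add: case_prod_unfold)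
 then show "(\<lambda>z. indicator {0..t} (fst z) * g (fst z) (snd z)) \<in> Bm Q" by measurable
qed (auto split: split_indicator)

lemma mean_integral_add:
 assumes "integrable Q (case_prod f)" "integrable Q (case_prod g)"
 shows "mean_integral t (\<lambda>s w. f s w + g s w) = mean_integral t f + mean_integral t g"
 unfolding mean_integral_def distrib_left
 by (rule lintegral_add) (intro integrable_upto assms)+

lemma mean_integral_fst:
 assumes "integrable Q (case_prod g)"
 shows "mean_integral t g = (\<integral>s. indicator {0..t} s * expectation (g s) \<partial>clock T)"
proof -
 have "mean_integral t g = (\<integral>s. \<integral>w. indicator {0..t} s * g s w \<partial>M \<partial>clock T)"
  unfolding mean_integral_def using pair.integral_fst'[OF integrable_upto[OF assms]] by simp
 then show ?thesis by simp
qed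

text \<open>Equal means at almost every time suffice. This is how identities valid only after
  projecting at a fixed time enter time integrals.\<close>

lemma mean_integral_cong:
 assumes "integrable Q (case_prod f)" "integrable Q (case_prod g)"
  and "AE s in clock T. s <= t --> expectation (f s) = expectation (g s)"
 shows "mean_integral t f = mean_integral t g"
proof -
 have [measurable]: "(\<lambda>s. expectation (f s)) \<in> Bm (clock T)"
   "(\<lambda>s. expectation (g s)) \<in> Bm (clock T)"
  using assms(1,2) by (auto intro!: borel_measurable_lebesgue_integral borel_measurable_integrable)
 show ?thesis
  unfolding mean_integral_fst[OF assms(1)] mean_integral_fst[OF assms(2)]
  by (rule integral_cong_AE) (use assms(3) in \<open>auto split: split_indicator elim: eventually_mono\<close>)
qed

lemma sq_process_measurable: "sq_process f ==> case_prod f \<in> Bm Q"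
 by (simp add: sq_process_def sq_integrable_def)

lemma sq_process_mult:
 assumes "sq_process f" "sq_process g"
 shows "integrable Q (\<lambda>(t, w). f t w * g t w)"
 using sq_integrable_mult[OF assms[unfolded sq_process_def]] by (simp add: case_prod_unfold)

lemma sq_process_add: "sq_process f ==> sq_process g ==> sq_process (\<lambda>t w. f t w + g t w)"
 using sq_integrable_add[of Q "case_prod f" "case_prod g"] by (simp add: sq_process_def case_prod_unfold)

lemma sq_process_diff: "sq_process f ==> sq_process g ==> sq_process (\<lambda>t w. f t w - g t w)"
 using sq_integrable_diff[of Q "case_prod f" "case_prod g"] by (simp add: sq_process_def case_prod_unfold)

lemma sq_process_cmult: "sq_process f ==> sq_process (\<lambda>t w. c * f t w)"
 using sq_integrable_cmult[of Q "case_prod f" c] by (simp add: sq_process_def case_prod_unfold)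

lemma sq_process_sum: "(\<And>i. i \<in> I ==> sq_process (f i)) ==> sq_process (\<lambda>t w. \<Sum>i\<in>I. f i t w)"
 using sq_integrable_sum[of I Q "\<lambda>i. case_prod (f i)"] by (simp add: sq_process_def case_prod_unfold)

lemma sq_process_bounded_mult:
 assumes "sq_process f" "case_prod h \<in> Bm Q" "\<And>t w. t \<in> {0..T} ==> w \<in> space M ==> \<bar>h t w\<bar> <= C"
 shows "sq_process (\<lambda>t w. h t w * f t w)"
 using sq_integrable_bounded_mult[of Q "case_prod f" "case_prod h" C] assms
 by (auto simp: sq_process_def case_prod_unfold space_pair_measure)

lemma sq_process_const:
 assumes "sq_integrable M h"
 shows "sq_process (\<lambda>t. h)"
proof -
 have [measurable]: "h \<in> Bm M" using assms by (simp add: sq_integrable_def)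
 have "integrable Q (\<lambda>z. (h (snd z))\<^sup>2)"
  by (rule pair.Fubini_integrable) (use assms in \<open>auto simp: sq_integrable_def\<close>)
 then show ?thesis by (simp add: sq_process_def sq_integrable_def case_prod_unfold)
qed

lemma sq_process_sections:
 assumes "sq_process f"
 shows "AE s in clock T. sq_integrable M (f s)"
  and "AE w in M. sq_integrable (clock T) (\<lambda>s. f s w)"
proof -
 have int: "integrable Q (\<lambda>(s, w). (f s w)\<^sup>2)"
  using assms by (simp add: sq_process_def sq_integrable_def case_prod_unfold)
 note m = sq_process_measurable[OF assms]
 show "AE s in clock T. sq_integrable M (f s)"
  using pair.AE_integrable_fst[OF int] AE_space
  by eventually_elim (use measurable_section_time[OF m] in \<open>auto simp: sq_integrable_def\<close>)
 show "AE w in M. sq_integrable (clock T) (\<lambda>s. f s w)"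
  using pair.AE_integrable_snd[OF int] AE_space
  by eventually_elim (use measurable_section_path[OF m] in \<open>auto simp: sq_integrable_def\<close>)
qed

lemma running_clock:
 fixes f :: "real => 'w => real"
 shows "t \<in> {0..T} ==> running f t w = (\<integral>s. indicator {0..t} s * f s w \<partial>clock T)"
 unfolding running_def by (subst set_integral_upto_clock[of t T]) auto

lemma running_measurable:
 fixes f :: "real => 'w => real"
 assumes "case_prod f \<in> Bm Q"
 shows "case_prod (running f) \<in> Bm Q"
proof -
 have "(\<lambda>w. case_prod f (snd w, snd (fst w))) \<in> Bm (Q \<Otimes>\<^sub>M clock T)"
  by (rule measurable_compose[OF _ assms]) measurable
 then have [measurable]: "(\<lambda>w. f (snd w) (snd (fst w))) \<in> Bm (Q \<Otimes>\<^sub>M clock T)" by simp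
 have eq: "indicator {0..fst (fst w)} (snd w) = (if 0 <= snd w \<and> snd w <= fst (fst w) then 1 else (0::real))"
  for w :: "(real \<times> 'w) \<times> real"
  by (auto split: split_indicator)
 have "(\<lambda>z. \<integral>s. indicator {0..fst z} s * f s (snd z) \<partial>clock T) \<in> Bm Q"
  by (rule clock.borel_measurable_lebesgue_integral) (simp add: case_prod_unfold eq)
 then show ?thesis
  by (rule measurable_cong[THEN iffD1, rotated]) (auto simp: space_pair_measure running_clock)
qed

lemma running_sq_bound:
 assumes f: "sq_process f" and t: "t \<in> {0..T}"
 shows "sq_integrable M (running f t)"
  and "(\<E> w. (running f t w)\<^sup>2) <= T * (\<integral>z. (f (fst z) (snd z))\<^sup>2 \<partial>Q)"
proof -
 have int: "integrable Q (\<lambda>(s, w). (f s w)\<^sup>2)"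
  using f by (simp add: sq_process_def sq_integrable_def case_prod_unfold)
 have m: "running f t \<in> Bm M"
  by (rule measurable_section_time[OF running_measurable[OF sq_process_measurable[OF f]] t])
 have bd: "AE w in M. (running f t w)\<^sup>2 <= T * (\<integral>s. (f s w)\<^sup>2 \<partial>clock T)"
  using sq_process_sections(2)[OF f]
 proof eventually_elim
  case (elim w)
  have ind: "sq_integrable (clock T) (indicator {0..t})"
   by (rule sq_integrable_bounded[where C = 1]) (auto simp: finite_measure_clock split: split_indicator)
  have "(running f t w)\<^sup>2 <= (\<integral>s. (indicator {0..t} s :: real)\<^sup>2 \<partial>clock T) * (\<integral>s. (f s w)\<^sup>2 \<partial>clock T)"
   unfolding running_clock[OF t] by (rule Cauchy_Schwarz_integral[OF ind elim])
  also have "... <= T * (\<integral>s. (f s w)\<^sup>2 \<partial>clock T)"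
  proof (rule mult_right_mono)
   have "(\<integral>s. (indicator {0..t} s :: real)\<^sup>2 \<partial>clock T) <= (\<integral>s. 1 \<partial>clock T)"
    using ind by (intro integral_mono) (auto simp: sq_integrable_def split: split_indicator)
   then show "(\<integral>s. (indicator {0..t} s :: real)\<^sup>2 \<partial>clock T) <= T" by (simp add: measure_clock)
  qed auto
  finally show ?case .
 qed
 have "integrable M (\<lambda>w. T * (\<integral>s. (f s w)\<^sup>2 \<partial>clock T))"
  using pair.integrable_snd[OF int] by simp
 then have i2: "integrable M (\<lambda>w. (running f t w)\<^sup>2)"
  by (rule lint_bound) (use m bd T_pos in \<open>auto elim!: eventually_mono\<close>)
 then show "sq_integrable M (running f t)" using m by (simp add: sq_integrable_def)
 have "(\<E> w. (running f t w)\<^sup>2) <= (\<integral>w. T * (\<integral>s. (f s w)\<^sup>2 \<partial>clock T) \<partial>M)"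
  using pair.integrable_snd[OF int] by (intro integral_mono_AE i2 bd) simp
 also have "... = T * (\<integral>z. (f (fst z) (snd z))\<^sup>2 \<partial>Q)"
  using pair.integral_snd[OF int] by (simp add: case_prod_unfold)
 finally show "(\<E> w. (running f t w)\<^sup>2) <= T * (\<integral>z. (f (fst z) (snd z))\<^sup>2 \<partial>Q)" .
qed

lemma sq_process_running:
 assumes f: "sq_process f"
 shows "sq_process (running f)"
proof -
 note m = running_measurable[OF sq_process_measurable[OF f]]
 have m2: "(\<lambda>z. (running f (fst z) (snd z))\<^sup>2) \<in> Bm Q"
  using m by (simp add: case_prod_unfold)
 have "integrable Q (\<lambda>z. (running f (fst z) (snd z))\<^sup>2)"
 proof (rule pair.Fubini_integrable[OF m2])
  show "AE s in clock T. integrable M (\<lambda>w. (running f (fst (s, w)) (snd (s, w)))\<^sup>2)"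
   using running_sq_bound(1)[OF f] by (intro AE_I2) (simp add: sq_integrable_def)
  show "integrable (clock T) (\<lambda>s. (\<E> w. norm ((running f (fst (s, w)) (snd (s, w)))\<^sup>2)))"
  proof (rule clock.integrable_const_bound)
   show "AE s in clock T. norm ((\<E> w. norm ((running f (fst (s, w)) (snd (s, w)))\<^sup>2)))
    <= T * (\<integral>z. (f (fst z) (snd z))\<^sup>2 \<partial>Q)"
    using running_sq_bound(2)[OF f] by (intro AE_I2) (simp add: integral_nonneg_AE)
   have "(\<lambda>s. (\<E> w. (running f s w)\<^sup>2)) \<in> Bm (clock T)"
    using m2 by (intro borel_measurable_lebesgue_integral) (simp add: case_prod_unfold)
   then show "(\<lambda>s. (\<E> w. norm ((running f (fst (s, w)) (snd (s, w)))\<^sup>2))) \<in> Bm (clock T)"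
    by simp
  qed
 qed
 then show ?thesis using m by (simp add: sq_process_def sq_integrable_def case_prod_unfold)
qed

lemma expectation_running:
 assumes f: "sq_process f" and h: "sq_integrable M h" and t: "t \<in> {0..T}"
 shows "(\<E> w. h w * running f t w) = mean_integral t (\<lambda>s w. h w * f s w)"
proof -
 have int: "integrable Q (\<lambda>(s, w). h w * f s w)" by (rule sq_process_mult[OF sq_process_const[OF h] f])
 have "integrable Q (\<lambda>(s, w). indicator {0..t} s * (h w * f s w))"
  using integrable_upto[OF int, of t] by (simp add: case_prod_unfold)
 from pair.integral_snd[OF this]
 have "mean_integral t (\<lambda>s w. h w * f s w) = (\<integral>w. (\<integral>s. indicator {0..t} s * (h w * f s w) \<partial>clock T) \<partial>M)"
  by (simp add: mean_integral_def case_prod_unfold)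
 also have "... = (\<E> w. h w * running f t w)"
 proof (rule lintegral_cong[OF refl])
  fix w
  have "(\<integral>s. indicator {0..t} s * (h w * f s w) \<partial>clock T) = (\<integral>s. h w * (indicator {0..t} s * f s w) \<partial>clock T)"
   by (simp add: mult.left_commute)
  then show "(\<integral>s. indicator {0..t} s * (h w * f s w) \<partial>clock T) = h w * running f t w"
   by (simp add: running_clock[OF t])
 qed
 finally show ?thesis by simp
qed

lemma clock_integrable_upto:
 fixes f :: "real => real"
 assumes "integrable (clock T) f"
 shows "integrable (clock T) (\<lambda>s. indicator {0..t} s * f s)"
proof -
 have "{0..t} \<inter> space (clock T) \<in> sets (clock T)"
  by (simp add: sets_clock sets_restrict_space_iff Int_commute)
 from integrable_mult_indicator[OF this assms] have "integrable (clock T) (\<lambda>s. indicator ({0..t} \<inter> {0..T}) s *\<^sub>R f s)" by simp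
 then show ?thesis
  by (rule lint_cong[THEN iffD1, rotated -1]) (auto split: split_indicator)
qed

lemma clock_integral_triangle:
 fixes f g :: "real => real" and t :: real
 assumes f: "integrable (clock T) f" and g: "integrable (clock T) g"
 defines "l \<equiv> \<lambda>s r. indicator {0..t} s * indicator {0..t} r * (if r <= s then 1 else 0) * (f s * g r)"
 shows "integrable (clock T \<Otimes>\<^sub>M clock T) (\<lambda>(s, r). f s * g r)"
  and "integrable (clock T \<Otimes>\<^sub>M clock T) (\<lambda>(s, r). l s r)"
  and "(\<integral>r. l s r \<partial>clock T) = indicator {0..t} s * (f s * (\<integral>r. indicator {0..s} r * g r \<partial>clock T))"
  and "integrable (clock T) (\<lambda>s. indicator {0..t} s * (f s * (\<integral>r. indicator {0..s} r * g r \<partial>clock T)))"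
proof -
 interpret cc: pair_sigma_finite "clock T" "clock T" ..
 have [measurable]: "f \<in> Bm (clock T)" "g \<in> Bm (clock T)" using f g by auto
 show fg: "integrable (clock T \<Otimes>\<^sub>M clock T) (\<lambda>(s, r). f s * g r)"
  by (rule cc.Fubini_integrable) (use f g in \<open>auto simp: abs_mult\<close>)
 show l: "integrable (clock T \<Otimes>\<^sub>M clock T) (\<lambda>(s, r). l s r)"
  by (rule lint_bound[OF fg]) (auto simp: l_def split: split_indicator)
 show eq: "(\<integral>r. l s r \<partial>clock T) = indicator {0..t} s * (f s * (\<integral>r. indicator {0..s} r * g r \<partial>clock T))" for s
 proof -
  have "(\<integral>r. l s r \<partial>clock T) = (\<integral>r. (indicator {0..t} s * f s) * (indicator {0..s} r * g r) \<partial>clock T)"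
   by (intro lintegral_cong) (auto simp: l_def split: split_indicator)
  then show ?thesis by (simp add: mult.assoc)
 qed
 show "integrable (clock T) (\<lambda>s. indicator {0..t} s * (f s * (\<integral>r. indicator {0..s} r * g r \<partial>clock T)))"
  using cc.integrable_fst[OF l] by (simp add: eq)
qed

text \<open>Integration by parts from Fubini: the square over [0, t] is cut into the triangles
  \<open>r <= s\<close> and \<open>s < r\<close>. Each inner integral is a primitive; in the second
  triangle it misses the end point, which is a null set.\<close>

lemma clock_integral_product:
 fixes f g :: "real => real"
 assumes f: "integrable (clock T) f" and g: "integrable (clock T) g" and t: "t \<in> {0..T}"
 defines "F \<equiv> \<lambda>t. \<integral>s. indicator {0..t} s * f s \<partial>clock T" and "G \<equiv> \<lambda>t. \<integral>s. indicator {0..t} s * g s \<partial>clock T"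
 shows "F t * G t = (\<integral>s. indicator {0..t} s * (f s * G s + F s * g s) \<partial>clock T)"
proof -
 interpret cc: pair_sigma_finite "clock T" "clock T" ..
 have [measurable]: "f \<in> Bm (clock T)" "g \<in> Bm (clock T)" using f g by auto
 note fg = clock_integral_triangle(1)[OF f g]
 define l where "l s r = indicator {0..t} s * indicator {0..t} r * (if r <= s then 1 else 0) * (f s * g r)" for s r :: real
 define u where "u s r = indicator {0..t} s * indicator {0..t} r * (if s < r then 1 else 0) * (f s * g r)" for s r :: real
 have l: "integrable (clock T \<Otimes>\<^sub>M clock T) (\<lambda>(s, r). l s r)"
  unfolding l_def by (rule clock_integral_triangle(2)[OF f g])
 have u: "integrable (clock T \<Otimes>\<^sub>M clock T) (\<lambda>(s, r). u s r)"
  by (rule lint_bound[OF fg]) (auto simp: u_def split: split_indicator)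
 have ll: "(\<integral>z. case_prod l z \<partial>(clock T \<Otimes>\<^sub>M clock T)) = (\<integral>s. indicator {0..t} s * (f s * G s) \<partial>clock T)"
  unfolding cc.integral_fst[OF l, symmetric] unfolding l_def G_def clock_integral_triangle(3)[OF f g] ..
 have uu: "(\<integral>z. case_prod u z \<partial>(clock T \<Otimes>\<^sub>M clock T)) = (\<integral>r. indicator {0..t} r * (F r * g r) \<partial>clock T)"
 proof -
  have "(\<integral>s. u s r \<partial>clock T) = indicator {0..t} r * (F r * g r)" if r: "r \<in> {0..T}" for r
  proof -
   have i1: "integrable (clock T) (\<lambda>s. indicator {0..r} s * f s)" "integrable (clock T) (\<lambda>s. indicator {r} s * f s)"
    by (auto intro!: lint_bound[OF f] split: split_indicator)
   have "(\<integral>s. u s r \<partial>clock T) = (\<integral>s. (indicator {0..t} r * g r) * (indicator {0..r} s * f s - indicator {r} s * f s) \<partial>clock T)"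
    using r by (intro lintegral_cong) (auto simp: u_def split: split_indicator)
   also have "... = (indicator {0..t} r * g r) * (F r - 0)"
    unfolding integral_mult_right_zero by (subst lintegral_diff[OF i1]) (simp add: F_def integral_clock_point)
   finally show ?thesis by simp
  qed
  then show ?thesis
   unfolding cc.integral_snd[OF u, symmetric] by (intro lintegral_cong) auto
 qed
 have it: "integrable (clock T) (\<lambda>s. indicator {0..t} s * f s)" "integrable (clock T) (\<lambda>s. indicator {0..t} s * g s)"
  by (intro clock_integrable_upto f g)+
 have "F t * G t = (\<integral>z. case_prod (\<lambda>s r. (indicator {0..t} s * f s) * (indicator {0..t} r * g r)) z \<partial>(clock T \<Otimes>\<^sub>M clock T))"
 proof -
  have "integrable (clock T \<Otimes>\<^sub>M clock T) (\<lambda>(s, r). (indicator {0..t} s * f s) * (indicator {0..t} r * g r))"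
   by (rule cc.Fubini_integrable) (use it it[THEN integrable_abs] in \<open>auto simp: abs_mult\<close>)
  from cc.integral_fst[OF this] show ?thesis by (simp add: F_def G_def)
 qed
 also have "... = (\<integral>z. case_prod l z + case_prod u z \<partial>(clock T \<Otimes>\<^sub>M clock T))"
  by (intro lintegral_cong) (auto simp: l_def u_def split: split_indicator)
 also have "... = (\<integral>s. indicator {0..t} s * (f s * G s) \<partial>clock T) + (\<integral>r. indicator {0..t} r * (F r * g r) \<partial>clock T)"
  using l u by (simp add: ll uu)
 also have "... = (\<integral>s. indicator {0..t} s * (f s * G s + F s * g s) \<partial>clock T)"
 proof -
  have "integrable (clock T) (\<lambda>s. indicator {0..t} s * (f s * G s))"
   "integrable (clock T) (\<lambda>r. indicator {0..t} r * (F r * g r))"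
   using clock_integral_triangle(4)[OF f g] clock_integral_triangle(4)[OF g f] by (simp_all add: F_def G_def mult.commute)
  then show ?thesis unfolding distrib_left by (rule lintegral_add[symmetric])
 qed
 finally show ?thesis .
qed

lemma l2_martingale_sq: "l2_martingale H Z ==> t \<in> {0..T} ==> sq_integrable M (Z t)"
 by (simp add: l2_martingale_def)

lemma l2_martingale_orth:
 assumes "l2_martingale H Z" "0 <= s" "s <= t" "t <= T" "h \<in> Bm (H s)" "sq_integrable M h"
 shows "(\<E> w. h w * Z t w) = (\<E> w. h w * Z s w)"
proof -
 have "(\<E> w. h w * (Z t w - Z s w)) = 0" using assms by (simp add: l2_martingale_def)
 moreover have "(\<E> w. h w * (Z t w - Z s w))
   = (\<E> w. h w * Z t w) - (\<E> w. h w * Z s w)"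
  unfolding right_diff_distrib using assms l2_martingale_sq[OF assms(1)]
  by (intro lintegral_diff sq_integrable_mult) auto
 ultimately show ?thesis by simp
qed

lemma expectation_product_sums:
 assumes "sq_integrable M a1" "sq_integrable M a2" "sq_integrable M a3"
  "sq_integrable M b1" "sq_integrable M b2" "sq_integrable M b3"
 shows "(\<E> w. (a1 w + a2 w + a3 w) * (b1 w + b2 w + b3 w)) =
  (\<E> w. a1 w * b1 w) + (\<E> w. a1 w * b2 w) + (\<E> w. a1 w * b3 w)
  + ((\<E> w. a2 w * b1 w) + (\<E> w. a2 w * b2 w) + (\<E> w. a2 w * b3 w))
  + ((\<E> w. a3 w * b1 w) + (\<E> w. a3 w * b2 w) + (\<E> w. a3 w * b3 w))"
proof -
 have i: "integrable M (\<lambda>w. a w * b w)" if "a \<in> {a1, a2, a3}" "b \<in> {b1, b2, b3}" for a b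
  using that assms by (auto intro: sq_integrable_mult)
 show ?thesis unfolding distrib_left distrib_right
  by (simp add: i lintegral_add algebra_simps)
qed

lemma mean_integral_running_product:
 assumes b: "sq_process b" and c: "sq_process c" and t: "t \<in> {0..T}"
 shows "(\<E> w. running b t w * running c t w)
  = mean_integral t (\<lambda>s w. b s w * running c s w + running b s w * c s w)"
proof -
 have int: "integrable Q (\<lambda>(s, w). b s w * running c s w + running b s w * c s w)"
  using lint_add[OF sq_process_mult[OF b sq_process_running[OF c]] sq_process_mult[OF sq_process_running[OF b] c]]
  by (simp add: case_prod_unfold)
 have int': "integrable Q (\<lambda>(s, w). indicator {0..t} s * (b s w * running c s w + running b s w * c s w))"
  using integrable_upto[OF int, of t] by (simp add: case_prod_unfold)
 have "mean_integral t (\<lambda>s w. b s w * running c s w + running b s w * c s w)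
  = (\<integral>w. (\<integral>s. indicator {0..t} s * (b s w * running c s w + running b s w * c s w) \<partial>clock T) \<partial>M)"
  using pair.integral_snd[OF int'] by (simp add: mean_integral_def case_prod_unfold)
 also have "... = (\<E> w. running b t w * running c t w)"
 proof (rule integral_cong_AE)
  show "(\<lambda>w. \<integral>s. indicator {0..t} s * (b s w * running c s w + running b s w * c s w) \<partial>clock T) \<in> Bm M"
   using pair.integrable_snd[OF int'] by auto
  show "(\<lambda>w. running b t w * running c t w) \<in> Bm M"
   using sq_integrable_mult[OF running_sq_bound(1)[OF b t] running_sq_bound(1)[OF c t]] by auto
  show "AE w in M. (\<integral>s. indicator {0..t} s * (b s w * running c s w + running b s w * c s w) \<partial>clock T)
    = running b t w * running c t w"
   using sq_process_sections(2)[OF b] sq_process_sections(2)[OF c]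
  proof eventually_elim
   case (elim w)
   then have "integrable (clock T) (\<lambda>s. b s w)" "integrable (clock T) (\<lambda>s. c s w)"
    by (auto intro: sq_integrable_imp_integrable finite_measure_clock)
   from clock_integral_product[OF this t]
   have "running b t w * running c t w = (\<integral>s. indicator {0..t} s *
     (b s w * (\<integral>r. indicator {0..s} r * c r w \<partial>clock T) + (\<integral>r. indicator {0..s} r * b r w \<partial>clock T) * c s w) \<partial>clock T)"
    by (simp add: running_clock[OF t])
   also have "... = (\<integral>s. indicator {0..t} s * (b s w * running c s w + running b s w * c s w) \<partial>clock T)"
    by (intro lintegral_cong) (auto simp: running_clock)
   finally show ?case by simp
  qed
 qed
 finally show ?thesis by simp
qed

text \<open>Only orthogonality of the increments of \<open>U\<close> and \<open>V\<close> to the past is used, so no stochastic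
 integral with respect to \<open>U\<close> or \<open>V\<close> appears.\<close>

lemma expectation_product:
 assumes b: "sq_process b" "\<And>s. s \<in> {0..T} ==> b s \<in> Bm (H s)"
  and c: "sq_process c" "\<And>s. s \<in> {0..T} ==> c s \<in> Bm (H s)"
  and X: "sq_process X" and Y: "sq_process Y"
  and X0: "sq_integrable M X0" "X0 \<in> Bm (H 0)"
  and Y0: "sq_integrable M Y0" "Y0 \<in> Bm (H 0)"
  and U: "l2_martingale H U" "AE w in M. U 0 w = 0"
  and V: "l2_martingale H V" "AE w in M. V 0 w = 0"
  and Xeq: "\<And>t. t \<in> {0..T} ==> AE w in M. X t w = X0 w + running b t w + U t w"
  and Yeq: "\<And>t. t \<in> {0..T} ==> AE w in M. Y t w = Y0 w + running c t w + V t w"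
  and t: "t \<in> {0..T}"
 shows "(\<E> w. X t w * Y t w) = (\<E> w. X0 w * Y0 w)
  + mean_integral t (\<lambda>s w. b s w * Y s w + X s w * c s w) + (\<E> w. U t w * V t w)"
proof -
 have Ut: "sq_integrable M (U s)" "sq_integrable M (V s)" if "s \<in> {0..T}" for s
  using U V that by (auto intro: l2_martingale_sq)
 have start: "(\<E> w. h w * Z t w) = 0"
  if "l2_martingale H Z" "AE w in M. Z 0 w = 0" "sq_integrable M h" "h \<in> Bm (H 0)" for Z h
 proof -
  have "(\<E> w. h w * Z t w) = (\<E> w. h w * Z 0 w)"
   using that t by (intro l2_martingale_orth[of H]) auto
  also have "... = 0" by (rule integral_eq_zero_AE) (use that(2) in \<open>auto elim: eventually_mono\<close>)
  finally show ?thesis .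
 qed
 \<comment> \<open>Tested against \<open>b s\<close>, the martingale at time s may be replaced by
   its value at the final time \<open>t\<close>. Then it no longer depends on the integration
   variable and leaves the time integral as a factor.\<close>
 have drift: "mean_integral t (\<lambda>s w. b s w * Y s w) =
   (\<E> w. running b t w * Y0 w) + mean_integral t (\<lambda>s w. b s w * running c s w)
   + (\<E> w. running b t w * V t w)"
  if b: "sq_process b" "\<And>s. s \<in> {0..T} ==> b s \<in> Bm (H s)" and c: "sq_process c" and Y: "sq_process Y"
   and Y0: "sq_integrable M Y0" and V: "l2_martingale H V"
   and Yeq: "\<And>t. t \<in> {0..T} ==> AE w in M. Y t w = Y0 w + running c t w + V t w" for b c Y Y0 V
 proof -
  have Vt: "sq_integrable M (V t)" using V t by (auto intro: l2_martingale_sq)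
  have i1: "integrable Q (\<lambda>(s, w). b s w * Y0 w)" by (rule sq_process_mult[OF b(1) sq_process_const[OF Y0]])
  have i2: "integrable Q (\<lambda>(s, w). b s w * running c s w)" by (rule sq_process_mult[OF b(1) sq_process_running[OF c]])
  have i3: "integrable Q (\<lambda>(s, w). b s w * V t w)" by (rule sq_process_mult[OF b(1) sq_process_const[OF Vt]])
  have i12: "integrable Q (\<lambda>(s, w). b s w * Y0 w + b s w * running c s w)"
   by (rule integrable_Q_add[OF i1 i2])
  have i123: "integrable Q (\<lambda>(s, w). b s w * Y0 w + b s w * running c s w + b s w * V t w)"
   by (rule integrable_Q_add[OF i12 i3])
  have "mean_integral t (\<lambda>s w. b s w * Y s w) =
   mean_integral t (\<lambda>s w. b s w * Y0 w + b s w * running c s w + b s w * V t w)"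
  proof (rule mean_integral_cong[OF sq_process_mult[OF b(1) Y] i123])
   show "AE s in clock T. s <= t --> (\<E> w. b s w * Y s w)
     = (\<E> w. b s w * Y0 w + b s w * running c s w + b s w * V t w)"
    using sq_process_sections(1)[OF b(1)] sq_process_sections(1)[OF Y] AE_space
   proof eventually_elim
    case (elim s)
    then have s: "s \<in> {0..T}" by simp
    have Vs: "sq_integrable M (V s)" using V s by (auto intro: l2_martingale_sq)
    have Cs: "sq_integrable M (running c s)" by (rule running_sq_bound(1)[OF c s])
    show ?case
    proof
     assume "s <= t"
     have "(\<E> w. b s w * Y s w) = (\<E> w. b s w * Y0 w + b s w * running c s w + b s w * V s w)"
     proof (rule integral_cong_AE)
      show "AE w in M. b s w * Y s w = b s w * Y0 w + b s w * running c s w + b s w * V s w"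
       using Yeq[OF s] by eventually_elim (simp add: algebra_simps)
     qed (use elim Y0 Vs Cs in \<open>auto intro!: borel_measurable_times borel_measurable_add simp: sq_integrable_def\<close>)
     also have "... = (\<E> w. b s w * Y0 w) + (\<E> w. b s w * running c s w) + (\<E> w. b s w * V s w)"
      using elim Y0 Vs Cs by (simp add: sq_integrable_mult)
     also have "(\<E> w. b s w * V s w) = (\<E> w. b s w * V t w)"
      using l2_martingale_orth[OF V, of s t "b s"] b(2)[OF s] elim s t \<open>s <= t\<close> by simp
     finally show "(\<E> w. b s w * Y s w)
       = (\<E> w. b s w * Y0 w + b s w * running c s w + b s w * V t w)"
      using elim Y0 Vt Cs by (simp add: sq_integrable_mult)
    qed
   qed
  qed
  also have "... = mean_integral t (\<lambda>s w. b s w * Y0 w) + mean_integral t (\<lambda>s w. b s w * running c s w)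
    + mean_integral t (\<lambda>s w. b s w * V t w)"
   by (simp add: mean_integral_add[OF i12 i3] mean_integral_add[OF i1 i2])
  finally show ?thesis
   using expectation_running[OF b(1) Y0 t] expectation_running[OF b(1) Vt t] by (simp add: mult.commute)
 qed
 note bs = running_sq_bound(1)[OF b(1) t] and cs = running_sq_bound(1)[OF c(1) t]
 have "(\<E> w. X t w * Y t w) =
  (\<E> w. (X0 w + running b t w + U t w) * (Y0 w + running c t w + V t w))"
 proof (rule integral_cong_AE)
  show "AE w in M. X t w * Y t w = (X0 w + running b t w + U t w) * (Y0 w + running c t w + V t w)"
   using Xeq[OF t] Yeq[OF t] by eventually_elim simp
  show "(\<lambda>w. X t w * Y t w) \<in> Bm M"
   using measurable_section_time[OF sq_process_measurable[OF X] t] measurable_section_time[OF sq_process_measurable[OF Y] t] by simp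
  show "(\<lambda>w. (X0 w + running b t w + U t w) * (Y0 w + running c t w + V t w)) \<in> Bm M"
   using X0 Y0 bs cs Ut[OF t] by (auto intro!: borel_measurable_times borel_measurable_add simp: sq_integrable_def)
 qed
 also have "... = (\<E> w. X0 w * Y0 w) + (\<E> w. X0 w * running c t w) + (\<E> w. X0 w * V t w)
  + ((\<E> w. running b t w * Y0 w) + (\<E> w. running b t w * running c t w) + (\<E> w. running b t w * V t w))
  + ((\<E> w. U t w * Y0 w) + (\<E> w. U t w * running c t w) + (\<E> w. U t w * V t w))"
  by (rule expectation_product_sums[OF X0(1) bs Ut(1)[OF t] Y0(1) cs Ut(2)[OF t]])
 finally have lhs: "(\<E> w. X t w * Y t w) = ..." .
 have 0: "(\<E> w. X0 w * V t w) = 0" "(\<E> w. U t w * Y0 w) = 0"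
  using start[OF V X0] start[OF U Y0] by (simp_all add: mult.commute)
 have d1: "mean_integral t (\<lambda>s w. b s w * Y s w) =
   (\<E> w. running b t w * Y0 w) + mean_integral t (\<lambda>s w. b s w * running c s w)
   + (\<E> w. running b t w * V t w)"
  by (rule drift[OF b c(1) Y Y0(1) V(1) Yeq])
 have "mean_integral t (\<lambda>s w. c s w * X s w) =
   (\<E> w. running c t w * X0 w) + mean_integral t (\<lambda>s w. c s w * running b s w)
   + (\<E> w. running c t w * U t w)"
  by (rule drift[OF c b(1) X X0(1) U(1) Xeq])
 then have d2: "mean_integral t (\<lambda>s w. c s w * X s w) =
   (\<E> w. X0 w * running c t w) + mean_integral t (\<lambda>s w. c s w * running b s w)
   + (\<E> w. U t w * running c t w)"
  by (simp add: mult.commute)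
 have m: "mean_integral t (\<lambda>s w. b s w * Y s w + X s w * c s w) =
  mean_integral t (\<lambda>s w. b s w * Y s w) + mean_integral t (\<lambda>s w. c s w * X s w)"
  using mean_integral_add[OF sq_process_mult[OF b(1) Y] sq_process_mult[OF c(1) X]] by (simp add: mult.commute)
 have r: "(\<E> w. running b t w * running c t w) =
  mean_integral t (\<lambda>s w. b s w * running c s w) + mean_integral t (\<lambda>s w. c s w * running b s w)"
  using mean_integral_running_product[OF b(1) c(1) t]
   mean_integral_add[OF sq_process_mult[OF b(1) sq_process_running[OF c(1)]] sq_process_mult[OF c(1) sq_process_running[OF b(1)]]]
  by (simp add: mult.commute)
 show ?thesis using lhs m d1 d2 r 0 by linarith
qed

end

section \<open>Filtrations and Brownian increments\<close>

text \<open>\<open>mixed_filtration M W \<alpha> s T\<close> is the Brownian filtration enlarged by the whole path of the chain;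
 \<open>W\<close> remains a Brownian motion for it.\<close>

definition mixed_filtration ::
 "'w measure => (real => 'w => real) => (real => 'w => 's) => real => real => 'w measure" where
 "mixed_filtration M W \<alpha> s r =
   sigma (space M) (sets (noise_filtration M W s) \<union> sets (chain_filtration M \<alpha> r))"

lemma joint_eq_mixed: "joint_filtration M W \<alpha> t = mixed_filtration M W \<alpha> t t"
 by (simp add: joint_filtration_def mixed_filtration_def)

lemma space_filtrations [simp]:
 "space (noise_filtration M W s) = space M" "space (chain_filtration M \<alpha> s) = space M"
 "space (mixed_filtration M W \<alpha> s r) = space M" "space (joint_filtration M W \<alpha> s) = space M"
 by (simp_all add: noise_filtration_def chain_filtration_def mixed_filtration_def joint_filtration_def space_measure_of_conv)

lemma sets_noise_filtration: "sets (noise_filtration M W t) =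
  sigma_sets (space M) {W s -` B \<inter> space M | s B. 0 <= s \<and> s <= t \<and> B \<in> sets borel}"
 unfolding noise_filtration_def by (rule sets_measure_of) auto

lemma sets_chain_filtration: "sets (chain_filtration M \<alpha> t) =
  sigma_sets (space M) {\<alpha> s -` B \<inter> space M | s B. 0 <= s \<and> s <= t}"
 unfolding chain_filtration_def by (rule sets_measure_of) auto

lemma sets_mixed_filtration: "sets (mixed_filtration M W \<alpha> s r) =
  sigma_sets (space M) (sets (noise_filtration M W s) \<union> sets (chain_filtration M \<alpha> r))"
 unfolding mixed_filtration_def
 by (rule sets_measure_of) (use sets.sets_into_space in fastforce)

text \<open>Intersections of a noise event and a chain event are stable under intersection, unlike
  the union of the two families, so they are the generator on which independence and Dynkin-class
  arguments can be checked.\<close>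

lemma sets_mixed_filtration_Int: "sets (mixed_filtration M W \<alpha> s r) =
  sigma_sets (space M) {a \<inter> b | a b. a \<in> sets (noise_filtration M W s) \<and> b \<in> sets (chain_filtration M \<alpha> r)}"
  (is "_ = sigma_sets _ ?I")
 unfolding sets_mixed_filtration
proof (rule sigma_sets_eqI)
 fix x assume "x \<in> sets (noise_filtration M W s) \<union> sets (chain_filtration M \<alpha> r)"
 then have "x \<in> ?I"
 proof
  assume x: "x \<in> sets (noise_filtration M W s)"
  then have "x = x \<inter> space M" using sets.sets_into_space by fastforce
  then show ?thesis using x sets.top[of "chain_filtration M \<alpha> r"] by auto
 next
  assume x: "x \<in> sets (chain_filtration M \<alpha> r)"
  then have "x = space M \<inter> x" using sets.sets_into_space by fastforce
  then show ?thesis using x sets.top[of "noise_filtration M W s"] by auto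
 qed
 then show "x \<in> sigma_sets (space M) ?I" by (rule sigma_sets.Basic)
next
 fix x assume "x \<in> ?I"
 then obtain a b where x: "x = a \<inter> b" "a \<in> sets (noise_filtration M W s)" "b \<in> sets (chain_filtration M \<alpha> r)"
  by auto
 have "a \<in> sets (mixed_filtration M W \<alpha> s r)" "b \<in> sets (mixed_filtration M W \<alpha> s r)"
  using x unfolding sets_mixed_filtration by auto
 then have "a \<inter> b \<in> sets (mixed_filtration M W \<alpha> s r)" by (rule sets.Int)
 then show "x \<in> sigma_sets (space M) (sets (noise_filtration M W s) \<union> sets (chain_filtration M \<alpha> r))"
  using x unfolding sets_mixed_filtration by simp
qed

lemma noise_filtration_mono: "s <= t ==> sets (noise_filtration M W s) \<subseteq> sets (noise_filtration M W t)"
 unfolding sets_noise_filtration by (rule sigma_sets_mono') fastforce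

lemma chain_filtration_mono: "s <= t ==> sets (chain_filtration M \<alpha> s) \<subseteq> sets (chain_filtration M \<alpha> t)"
 unfolding sets_chain_filtration by (rule sigma_sets_mono') fastforce

lemma mixed_filtration_mono:
 "s <= s' ==> r <= r' ==> sets (mixed_filtration M W \<alpha> s r) \<subseteq> sets (mixed_filtration M W \<alpha> s' r')"
 unfolding sets_mixed_filtration
 using noise_filtration_mono chain_filtration_mono by (metis sigma_sets_mono' Un_mono)

lemma noise_subset_mixed: "sets (noise_filtration M W s) \<subseteq> sets (mixed_filtration M W \<alpha> s r)"
 unfolding sets_mixed_filtration by auto

lemma chain_subset_mixed: "sets (chain_filtration M \<alpha> r) \<subseteq> sets (mixed_filtration M W \<alpha> s r)"
 unfolding sets_mixed_filtration by auto

lemma noise_measurable: "0 <= s ==> s <= t ==> W s \<in> Bm (noise_filtration M W t)"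
 by (rule measurableI) (auto simp: sets_noise_filtration intro!: sigma_sets.Basic)

lemma chain_measurable: "0 <= s ==> s <= t ==> \<alpha> s \<in> measurable (chain_filtration M \<alpha> t) (count_space UNIV)"
 by (rule measurableI) (auto simp: sets_chain_filtration intro!: sigma_sets.Basic)

lemma measurable_larger:
 assumes "f \<in> measurable N1 L" "space N1 = space N2" "sets N1 \<subseteq> sets N2"
 shows "f \<in> measurable N2 L"
 using assms unfolding measurable_def by auto

lemma Int_stable_products: "Int_stable {a \<inter> b | a b. a \<in> sets A \<and> b \<in> sets B}"
proof (rule Int_stableI)
 fix x y assume "x \<in> {a \<inter> b | a b. a \<in> sets A \<and> b \<in> sets B}" "y \<in> {a \<inter> b | a b. a \<in> sets A \<and> b \<in> sets B}"
 then obtain a b a' b' where "x = a \<inter> b" "a \<in> sets A" "b \<in> sets B" "y = a' \<inter> b'" "a' \<in> sets A" "b' \<in> sets B"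
  by auto
 then have "x \<inter> y = (a \<inter> a') \<inter> (b \<inter> b')" "a \<inter> a' \<in> sets A" "b \<inter> b' \<in> sets B" by auto
 then show "x \<inter> y \<in> {a \<inter> b | a b. a \<in> sets A \<and> b \<in> sets B}" by blast
qed

lemma (in prob_space) indep_set_imp_indep_var:
 fixes X Y :: "'a => real"
 assumes "indep_set (sets H) (sets K)" and sp: "space H = space M" "space K = space M"
  and X: "X \<in> Bm H" and Y: "Y \<in> Bm K"
 shows "indep_var borel X borel Y"
proof -
 have ev: "sets H \<subseteq> events" "sets K \<subseteq> events" using indep_setD_ev1 indep_setD_ev2 assms(1) by blast+
 have gen: "sigma_sets (space M) {Z -` B \<inter> space M | B. B \<in> sets borel} \<subseteq> sets L"
  if "Z \<in> Bm L" "space L = space M" for Z :: "'a => real" and L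
 proof -
  have "{Z -` B \<inter> space M | B. B \<in> sets borel} \<subseteq> sets L" using measurable_sets[OF that(1)] that(2) by auto
  from sets.sigma_sets_subset[OF this] show ?thesis by (simp only: that(2))
 qed
 have "X \<in> Bm M" "Y \<in> Bm M"
  using measurable_from_subalg[OF _ X] measurable_from_subalg[OF _ Y] ev sp by (auto simp: subalgebra_def)
 then show ?thesis
  unfolding indep_var_eq using assms(1) gen[OF X sp(1)] gen[OF Y sp(2)] unfolding indep_sets2_eq by blast
qed

locale regime_noise = horizon M T for M :: "'w measure" and T +
 fixes W :: "real => 'w => real" and \<alpha> :: "real => 'w => 's::finite"
  and gen :: "'s => 's => real" and i0 :: 's
 assumes brownian: "standard_brownian_motion M T W"
  and markov: "markov_chain M T gen i0 \<alpha>"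
  and indep: "indep_set (sets (noise_filtration M W T)) (sets (chain_filtration M \<alpha> T))"
begin

abbreviation "joint \<equiv> joint_filtration M W \<alpha>"
abbreviation "mixed \<equiv> mixed_filtration M W \<alpha>"
abbreviation "chain \<equiv> chain_filtration M \<alpha>"
abbreviation "noise \<equiv> noise_filtration M W"
abbreviation "L2 \<equiv> L2_space M joint T"

lemma W_measurable: "t \<in> {0..T} ==> W t \<in> Bm M"
 using brownian by (simp add: standard_brownian_motion_def)

lemma \<alpha>_measurable: "t \<in> {0..T} ==> \<alpha> t \<in> measurable M (count_space UNIV)"
 using markov by (simp add: markov_chain_def)

lemma noise_events: "t <= T ==> sets (noise t) \<subseteq> events"
 using indep_setD_ev1[OF indep] noise_filtration_mono by blast

lemma chain_events: "t <= T ==> sets (chain t) \<subseteq> events"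
 using indep_setD_ev2[OF indep] chain_filtration_mono by blast

lemma mixed_events: "s <= T ==> r <= T ==> sets (mixed s r) \<subseteq> events"
 unfolding sets_mixed_filtration using noise_events chain_events
 by (intro sets.sigma_sets_subset) auto

lemma subalgebra_chain: "t <= T ==> subalgebra M (chain t)"
 using chain_events by (simp add: subalgebra_def)

lemma subalgebra_mixed: "s <= T ==> r <= T ==> subalgebra M (mixed s r)"
 using mixed_events by (simp add: subalgebra_def)

lemma subalgebra_joint: "s <= T ==> subalgebra M (joint s)"
 using subalgebra_mixed by (simp add: joint_eq_mixed)

text \<open>On a generator a \<inter> b, the event b of the chain factors off first, because a
  together with the increment belongs to the noise; then the increment separates from a by the
  Brownian property.\<close>

lemma mixed_increment_indep:
 assumes st: "0 <= s" "s < t" "t <= T"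
 shows "indep_set (sets (mixed s T)) (sets (vimage_algebra (space M) (\<lambda>w. W t w - W s w) borel))"
proof -
 define D where "D = (\<lambda>w. W t w - W s w)"
 let ?I = "{a \<inter> b | a b. a \<in> sets (noise s) \<and> b \<in> sets (chain T)}"
 let ?V = "sets (vimage_algebra (space M) D borel)"
 have ind: "indep_set (sets (noise s)) ?V"
  using brownian st by (auto simp: standard_brownian_motion_def D_def)
 have D: "D \<in> Bm (noise t)"
  unfolding D_def using st by (intro borel_measurable_diff noise_measurable) auto
 have V: "?V \<subseteq> sets (noise t)"
 proof -
  have "{D -` A \<inter> space M | A. A \<in> sets borel} \<subseteq> sets (noise t)"
  proof safe
   fix A :: "real set" assume "A \<in> sets borel"
   from measurable_sets[OF D this] show "D -` A \<inter> space M \<in> sets (noise t)" by simp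
  qed
  from sets.sigma_sets_subset[OF this] show ?thesis by (simp only: sets_vimage_algebra space_filtrations)
 qed
 have "indep_set ?I ?V"
 proof (rule indep_setI)
  show "?I \<subseteq> events" using noise_events[of s] chain_events[of T] st by auto
  show "?V \<subseteq> events" using V noise_events[of t] st by auto
  fix x v assume "x \<in> ?I" and v: "v \<in> ?V"
  then obtain a b where x: "x = a \<inter> b" "a \<in> sets (noise s)" "b \<in> sets (chain T)" by auto
  have aT: "a \<in> sets (noise T)" "a \<inter> v \<in> sets (noise T)"
   using x v V noise_filtration_mono[of s T M W] noise_filtration_mono[of t T M W] st by auto
  have "prob (x \<inter> v) = prob ((a \<inter> v) \<inter> b)" by (simp add: x Int_ac)
  also have "... = prob (a \<inter> v) * prob b" by (rule indep_setD[OF indep aT(2) x(3)])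
  also have "prob (a \<inter> v) = prob a * prob v" by (rule indep_setD[OF ind x(2) v])
  also have "prob a * prob v * prob b = prob (a \<inter> b) * prob v"
   using indep_setD[OF indep aT(1) x(3)] by simp
  finally show "prob (x \<inter> v) = prob x * prob v" by (simp add: x)
 qed
 moreover have "Int_stable ?I" by (rule Int_stable_products)
 moreover have "Int_stable ?V" by (auto intro: Int_stableI)
 ultimately have "indep_set (sigma_sets (space M) ?I) (sigma_sets (space M) ?V)"
  by (rule indep_set_sigma_sets)
 moreover have "sigma_sets (space M) ?V = ?V"
  using sets.sigma_sets_eq[of "vimage_algebra (space M) D borel"] by simp
 ultimately show ?thesis unfolding sets_mixed_filtration_Int D_def by simp
qed

lemma increment_moments:
 assumes st: "0 <= s" "s <= t" "t <= T"
 shows "sq_integrable M (\<lambda>w. W t w - W s w)"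
  and "(\<E> w. W t w - W s w) = 0"
  and "(\<E> w. (W t w - W s w)\<^sup>2) = t - s"
proof -
 have "sq_integrable M (\<lambda>w. W t w - W s w) \<and> (\<E> w. W t w - W s w) = 0
   \<and> (\<E> w. (W t w - W s w)\<^sup>2) = t - s"
 proof (cases "s = t")
  case True then show ?thesis by (simp add: sq_integrable_zero)
 next
  case False
  then have "s < t" using st by simp
  then have D: "distributed M lborel (\<lambda>w. W t w - W s w) (normal_density 0 (sqrt (t - s)))"
   using brownian st by (auto simp: standard_brownian_motion_def)
  have sg: "0 < sqrt (t - s)" using \<open>s < t\<close> by simp
  have 0: "(\<E> w. W t w - W s w) = 0" by (rule normal_distributed_expectation[OF sg D])
  have "variance (\<lambda>w. W t w - W s w) = (sqrt (t - s))\<^sup>2" by (rule normal_distributed_variance[OF sg D])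
  moreover have "integrable M (\<lambda>w. (W t w - W s w)\<^sup>2)"
   using integrable_normal_moment[OF sg, of 0 2] by (subst distributed_integrable[OF D, symmetric]) auto
  moreover have "(\<lambda>w. W t w - W s w) \<in> Bm M" using W_measurable st by auto
  ultimately show ?thesis using 0 st by (simp add: sq_integrable_def)
 qed
 then show "sq_integrable M (\<lambda>w. W t w - W s w)"
  "(\<E> w. W t w - W s w) = 0" "(\<E> w. (W t w - W s w)\<^sup>2) = t - s" by auto
qed

lemma expectation_mixed_increment:
 assumes st: "0 <= s" "s <= t" "t <= T" and h: "h \<in> Bm (mixed s T)" "integrable M h"
 shows "integrable M (\<lambda>w. h w * (W t w - W s w))"
  and "(\<E> w. h w * (W t w - W s w)) = 0"
  and "(\<E> w. h w * (W t w - W s w)\<^sup>2) = expectation h * (t - s)"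
proof -
 define D where "D w = W t w - W s w" for w
 note mom = increment_moments[OF st, folded D_def]
 have Dint: "integrable M D" "integrable M (\<lambda>w. (D w)\<^sup>2)"
   apply (rule sq_imp_integrable[OF mom(1)])
  using mom(1) by (simp add: sq_integrable_def)
 have "integrable M (\<lambda>w. h w * D w) \<and> (\<E> w. h w * D w) = 0
   \<and> (\<E> w. h w * (D w)\<^sup>2) = expectation h * (t - s)"
 proof (cases "s = t")
  case False
  have iv: "indep_var borel h borel D"
  proof (rule indep_set_imp_indep_var)
   show "indep_set (sets (mixed s T)) (sets (vimage_algebra (space M) D borel))"
    unfolding D_def using st False by (intro mixed_increment_indep) auto
  qed (auto intro: h measurable_vimage_algebra1)
  have "indep_var borel ((\<lambda>x. x) \<circ> h) borel ((\<lambda>x. x\<^sup>2) \<circ> D)" by (rule indep_var_compose[OF iv]) auto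
  then have iv2: "indep_var borel h borel (\<lambda>w. (D w)\<^sup>2)" by (simp add: comp_def)
  show ?thesis
   using indep_var_integrable[OF iv h(2) Dint(1)] indep_var_lebesgue_integral[OF iv h(2) Dint(1)]
    indep_var_lebesgue_integral[OF iv2 h(2) Dint(2)] by (simp only: mom(2,3)) simp
 qed (simp add: D_def)
 then show "integrable M (\<lambda>w. h w * (W t w - W s w))"
  "(\<E> w. h w * (W t w - W s w)) = 0"
  "(\<E> w. h w * (W t w - W s w)\<^sup>2) = expectation h * (t - s)"
  by (auto simp: D_def)
qed

lemma mixed_measurable_M: "f \<in> Bm (mixed s r) ==> s <= T ==> r <= T ==> f \<in> Bm M"
 by (rule measurable_larger[of f "mixed s r" borel M, OF _ _ mixed_events]) simp_all

lemma W_mixed_measurable: "0 <= s ==> s <= t ==> W s \<in> Bm (mixed t r)"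
 by (rule measurable_larger[OF noise_measurable _ noise_subset_mixed]) simp_all

lemma mixed_measurable_mono:
 "f \<in> Bm (mixed s r) ==> s <= s' ==> r <= r' ==> f \<in> Bm (mixed s' r')"
 by (rule measurable_larger[OF _ _ mixed_filtration_mono]) simp_all

text \<open>Cutting at \<open>c\<close>, at the smaller and at the larger right end writes the
  product as two products of increments over adjacent intervals plus the square of the increment
  over the overlap. The weight is known at \<open>c\<close>, the later of the two left ends, so the
  mixed products have mean zero and the square contributes the length of the overlap.\<close>

lemma increment_product_ordered:
 assumes ord: "0 <= a" "a <= c" and ab: "a <= b" "b <= T" and cd: "c < d" "d <= T"
  and h: "h \<in> Bm (mixed c T)" "\<And>w. w \<in> space M ==> \<bar>h w\<bar> <= C"
 shows "(\<E> w. h w * ((W b w - W a w) * (W d w - W c w)))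
  = expectation h * measure lborel ({a<..b} \<inter> {c<..d})"
proof -
 have hM: "h \<in> Bm M" using mixed_measurable_M[OF h(1)] cd by simp
 have inc: "sq_integrable M (\<lambda>w. W t w - W s w)" if "0 <= s" "s <= t" "t <= T" for s t
  using increment_moments(1)[OF that] .
 have bm: "sq_integrable M (\<lambda>w. h w * f w)" if "sq_integrable M f" for f
  by (rule sq_integrable_bounded_mult[OF that hM h(2)])
 have prod0: "integrable M (\<lambda>w. h w * ((W v w - W u w) * (W t w - W s w)))
   \<and> (\<E> w. h w * ((W v w - W u w) * (W t w - W s w))) = 0"
  if "0 <= u" "u <= v" "v <= s" "c <= s" "s <= t" "t <= T" for u v s t
 proof -
  have "(\<lambda>w. h w * (W v w - W u w)) \<in> Bm (mixed s T)"
   using that by (intro borel_measurable_times borel_measurable_diff W_mixed_measurable mixed_measurable_mono[OF h(1)]) auto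
  moreover have "integrable M (\<lambda>w. h w * (W v w - W u w))"
   using bm[OF inc, of u v] that by (intro sq_imp_integrable) auto
  ultimately show ?thesis
   using expectation_mixed_increment(1,2)[of s t "\<lambda>w. h w * (W v w - W u w)"] that ord by (simp add: mult.assoc)
 qed
 show ?thesis
 proof (cases "b <= c")
  case True
  then have "{a<..b} \<inter> {c<..d} = {}" by auto
  then show ?thesis using prod0[of a b c d] True assms by simp
 next
  case False
  define m x where "m = min b d" and "x = max b d"
  have mx: "c < m" "m <= x" "x <= T" using False cd ab by (auto simp: m_def x_def)
  have "{a<..b} \<inter> {c<..d} = {c<..m}" using ord False cd by (auto simp: m_def)
  then have ms: "measure lborel ({a<..b} \<inter> {c<..d}) = m - c" using mx by simp
  have i1: "integrable M (\<lambda>w. h w * ((W c w - W a w) * (W d w - W c w)))"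
   "(\<E> w. h w * ((W c w - W a w) * (W d w - W c w))) = 0"
   using prod0[of a c c d] assms by auto
  have i2: "integrable M (\<lambda>w. h w * ((W m w - W c w) * (W x w - W m w)))"
   "(\<E> w. h w * ((W m w - W c w) * (W x w - W m w))) = 0"
   using prod0[of c m m x] assms mx by auto
  have i3: "integrable M (\<lambda>w. h w * (W m w - W c w)\<^sup>2)"
   using sq_integrable_mult[OF bm[OF inc] inc, of c m c m] mx ord by (simp add: power2_eq_square mult.assoc)
  have hi: "integrable M h" using h(2) by (intro integrable_const_bound[where B = C] hM) auto
  have e3: "(\<E> w. h w * (W m w - W c w)\<^sup>2) = expectation h * (m - c)"
   using mx ord by (intro expectation_mixed_increment(3) h hi) auto
  have "(W b w - W a w) * (W d w - W c w) = (W c w - W a w) * (W d w - W c w)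
    + (W m w - W c w)\<^sup>2 + (W m w - W c w) * (W x w - W m w)" for w
   by (cases "b <= d") (auto simp: m_def x_def min_def max_def power2_eq_square algebra_simps)
  then have "(\<E> w. h w * ((W b w - W a w) * (W d w - W c w))) =
    (\<E> w. h w * ((W c w - W a w) * (W d w - W c w)) + h w * (W m w - W c w)\<^sup>2
     + h w * ((W m w - W c w) * (W x w - W m w)))"
   by (simp add: distrib_left)
  also have "... = expectation h * (m - c)"
   using i1 i2 i3 e3 by simp
  finally show ?thesis unfolding ms .
 qed
qed

text \<open>Measurability of \<open>p\<close> and \<open>q\<close> is demanded only for
  nondegenerate intervals: when a grid is cut off at time \<open>t\<close>, the cells beyond
  \<open>t\<close> collapse to a point at which their integrands are not yet known.\<close>

lemma expectation_increment_product:
 assumes ab: "0 <= a" "a <= b" "b <= T" and cd: "0 <= c" "c <= d" "d <= T"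
  and p: "a < b ==> p \<in> Bm (mixed a T)" "\<And>w. w \<in> space M ==> \<bar>p w\<bar> <= Cp"
  and q: "c < d ==> q \<in> Bm (mixed c T)" "\<And>w. w \<in> space M ==> \<bar>q w\<bar> <= Cq"
  and z: "z \<in> Bm (chain T)" "\<And>w. w \<in> space M ==> \<bar>z w\<bar> <= C"
 shows "(\<E> w. z w * (((W b w - W a w) * p w) * ((W d w - W c w) * q w)))
  = (\<E> w. z w * (p w * q w)) * measure lborel ({a<..b} \<inter> {c<..d})"
proof (cases "a = b \<or> c = d")
 case False
 then have ab': "a < b" and cd': "c < d" using ab cd by auto
 define h where "h w = z w * (p w * q w)" for w
 have zm: "z \<in> Bm (mixed s T)" for s
  by (rule measurable_larger[OF z(1) _ chain_subset_mixed]) simp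
 have hm: "h \<in> Bm (mixed (max a c) T)"
  unfolding h_def
  by (intro borel_measurable_times zm mixed_measurable_mono[OF p(1)[OF ab']] mixed_measurable_mono[OF q(1)[OF cd']]) auto
 have hb: "\<bar>h w\<bar> <= C * (Cp * Cq)" if "w \<in> space M" for w
  unfolding h_def abs_mult using p(2)[OF that] q(2)[OF that] z(2)[OF that]
  by (intro mult_mono) (auto intro: order_trans[OF abs_ge_zero] mult_nonneg_nonneg)
 have "(\<E> w. h w * ((W b w - W a w) * (W d w - W c w)))
  = expectation h * measure lborel ({a<..b} \<inter> {c<..d})"
 proof (cases "a <= c")
  case True
  then have "h \<in> Bm (mixed c T)" using hm by (simp add: max_def)
  then show ?thesis
   by (rule increment_product_ordered[of a c b d h "C * (Cp * Cq)", rotated 6])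
    (use True hb ab cd cd' in auto)
 next
  case False
  then have "(\<E> w. h w * ((W d w - W c w) * (W b w - W a w)))
   = expectation h * measure lborel ({c<..d} \<inter> {a<..b})"
   using hm hb ab cd ab' by (intro increment_product_ordered) (auto simp: max_def)
  then show ?thesis by (simp add: Int_commute mult.commute)
 qed
 then show ?thesis unfolding h_def by (simp only: mult_ac)
qed auto

end

section \<open>Stochastic integrals\<close>

lemma borel_measurable_component:
 fixes f :: "'a => real^'n"
 assumes "f \<in> Bm N"
 shows "(\<lambda>x. f x $ j) \<in> Bm N"
 by (rule measurable_compose[OF assms borel_measurable_continuous_onI]) (intro continuous_intros)

context horizon begin

definition filtration :: "(real => 'w measure) => bool" where
 "filtration H \<longleftrightarrow> (\<forall>s\<in>{0..T}. subalgebra M (H s)) \<and>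
   (\<forall>s t. 0 <= s --> s <= t --> t <= T --> sets (H s) \<subseteq> sets (H t))"

lemma filtration_measurable_M:
 assumes "filtration H" "s \<in> {0..T}" "f \<in> Bm (H s)"
 shows "f \<in> Bm M"
 by (rule measurable_from_subalg[OF _ assms(3)]) (use assms in \<open>auto simp: filtration_def\<close>)

lemma filtration_measurable_mono:
 assumes "filtration H" "0 <= s" "s <= t" "t <= T" "f \<in> Bm (H s)"
 shows "f \<in> Bm (H t)"
 by (rule measurable_larger[OF assms(5)]) (use assms in \<open>auto simp: filtration_def subalgebra_def\<close>)

text \<open>The convergence half of \<open>has_stochastic_integral\<close> for scalar integrands.
  The martingale property of the limit depends on this half alone; closeness of the integrands
  matters for the isometry and is stated separately there.\<close>

definition approximates ::
 "(real => 'w measure) => (real => 'w => real) => (nat => nat) => (nat => nat => real) =>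
   (nat => nat => 'w => real) => (real => 'w => real) => bool" where
 "approximates F Z n \<tau> \<xi> I \<longleftrightarrow> (\<forall>m. simple_integrand M F T (n m) (\<tau> m) (\<xi> m)) \<and>
   (\<forall>t\<in>{0..T}. I t \<in> Bm M) \<and>
   (\<forall>t\<in>{0..T}. (\<lambda>m. \<integral>\<^sup>+w. ennreal ((simple_integral Z (n m) (\<tau> m) (\<xi> m) t w - I t w)\<^sup>2) \<partial>M) \<longlonglongrightarrow> 0)"

lemma simple_integrand_grid:
 assumes "simple_integrand M F T n t x" "l <= n"
 shows "0 <= t l" "t l <= T"
proof -
 have mono: "t a <= t b" if "a <= b" "b <= n" for a b
  using that(2,1)
 proof (induction b)
  case (Suc b)
  then show ?case using assms(1) unfolding simple_integrand_def
   by (cases "a = Suc b") (auto intro: order_trans[of "t a" "t b"])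
 qed simp
 show "0 <= t l" "t l <= T"
  using mono[of 0 l] mono[of l n] assms unfolding simple_integrand_def by auto
qed

lemma simple_integrand_mono: "simple_integrand M F T n t x ==> l < n ==> t l <= t (Suc l)"
 by (simp add: simple_integrand_def)

lemma tendsto_zero_ennreal_mono:
 fixes f g :: "nat => ennreal"
 assumes "\<And>m. f m <= g m" "g \<longlonglongrightarrow> 0"
 shows "f \<longlonglongrightarrow> 0"
 by (rule tendsto_sandwich[OF _ _ tendsto_const assms(2)]) (use assms(1) in auto)

lemma stochastic_integral_component:
 fixes k :: "real => 'w => real^'n"
 assumes "has_stochastic_integral M F T energy Z k I"
 obtains n u x where "\<And>j. approximates F Z n u (\<lambda>m l w. x m l w $ j) (\<lambda>t w. I t w $ j)"
  "(\<lambda>m. energy (\<lambda>t w. simple_process (n m) (u m) (x m) t w - k t w)) \<longlonglongrightarrow> 0"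
proof -
 obtain n u x where I: "\<forall>t\<in>{0..T}. I t \<in> Bm M"
  and si: "\<forall>m. simple_integrand M F T (n m) (u m) (x m)"
  and e: "(\<lambda>m. energy (\<lambda>t w. simple_process (n m) (u m) (x m) t w - k t w)) \<longlonglongrightarrow> 0"
  and lim: "\<forall>t\<in>{0..T}. (\<lambda>m. \<integral>\<^sup>+w. ennreal ((norm (simple_integral Z (n m) (u m) (x m) t w - I t w))\<^sup>2) \<partial>M) \<longlonglongrightarrow> 0"
  using assms unfolding has_stochastic_integral_def by blast
 have "approximates F Z n u (\<lambda>m l w. x m l w $ j) (\<lambda>t w. I t w $ j)" for j
  unfolding approximates_def
 proof (intro conjI allI ballI)
  fix m
  have sm: "simple_integrand M F T (n m) (u m) (x m)" using si by blast
  have "(\<lambda>w. x m l w $ j) \<in> Bm (F (u m l))" "\<exists>c. \<forall>w\<in>space M. norm (x m l w $ j) <= c"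
   if "l < n m" for l
  proof -
   have "x m l \<in> Bm (F (u m l))" "\<exists>c. \<forall>w\<in>space M. norm (x m l w) <= c"
    using sm that by (auto simp: simple_integrand_def)
   then show "(\<lambda>w. x m l w $ j) \<in> Bm (F (u m l))"
    by (intro borel_measurable_component)
   show "\<exists>c. \<forall>w\<in>space M. norm (x m l w $ j) <= c"
    using \<open>\<exists>c. \<forall>w\<in>space M. norm (x m l w) <= c\<close> component_le_norm_cart
    by (metis order_trans real_norm_def)
  qed
  with sm show "simple_integrand M F T (n m) (u m) (\<lambda>l w. x m l w $ j)"
   unfolding simple_integrand_def by blast
 next
  fix t assume "t \<in> {0..T}"
  then show "(\<lambda>w. I t w $ j) \<in> Bm M"
   using I by (intro borel_measurable_component) blast
 next
  fix t assume t: "t \<in> {0..T}"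
  show "(\<lambda>m. \<integral>\<^sup>+w. ennreal ((simple_integral Z (n m) (u m) (\<lambda>l w. x m l w $ j) t w - I t w $ j)\<^sup>2) \<partial>M) \<longlonglongrightarrow> 0"
  proof (rule tendsto_zero_ennreal_mono[OF _ bspec[OF lim t]])
   fix m
   show "(\<integral>\<^sup>+w. ennreal ((simple_integral Z (n m) (u m) (\<lambda>l w. x m l w $ j) t w - I t w $ j)\<^sup>2) \<partial>M)
    <= (\<integral>\<^sup>+w. ennreal ((norm (simple_integral Z (n m) (u m) (x m) t w - I t w))\<^sup>2) \<partial>M)"
   proof (intro nn_integral_mono ennreal_leI)
    fix w
    have "simple_integral Z (n m) (u m) (\<lambda>l w. x m l w $ j) t w - I t w $ j
     = (simple_integral Z (n m) (u m) (x m) t w - I t w) $ j"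
     by (simp add: simple_integral_def)
    then show "(simple_integral Z (n m) (u m) (\<lambda>l w. x m l w $ j) t w - I t w $ j)\<^sup>2
     <= (norm (simple_integral Z (n m) (u m) (x m) t w - I t w))\<^sup>2"
     using component_le_norm_cart power_mono by (metis abs_ge_zero power2_abs)
   qed
  qed
 qed
 then show ?thesis using that e by blast
qed

text \<open>Integrands are adapted to \<open>F\<close>, but the martingale property is claimed for a
  possibly larger filtration \<open>H\<close>. With \<open>H\<close> containing the whole path of
  the chain, noise integrals become orthogonal to every square-integrable function of the
  chain.\<close>

lemma simple_integral_martingale:
 assumes H: "filtration H" and FH: "\<And>s. s \<in> {0..T} ==> subalgebra (H s) (F s)"
  and Z: "l2_martingale H Z" and ad: "\<And>l. l < n ==> sq_integrable M (\<lambda>w. Z (y l) w)"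
  and si: "simple_integrand M F T n y x"
 shows "l2_martingale H (simple_integral Z n y (x :: nat => 'w => real))"
 unfolding l2_martingale_def
proof (intro conjI ballI allI impI)
 note grid = simple_integrand_grid[OF si] and mono = simple_integrand_mono[OF si]
 have xF: "x l \<in> Bm (F (y l))" if "l < n" for l using si that by (simp add: simple_integrand_def)
 have xH: "x l \<in> Bm (H (y l))" if "l < n" for l
  using measurable_from_subalg[OF FH xF[OF that]] grid[of l] that by simp
 have xM: "x l \<in> Bm M" if "l < n" for l
  using filtration_measurable_M[OF H _ xH[OF that]] grid[of l] that by simp
 obtain C where C: "\<And>l w. l < n ==> w \<in> space M ==> \<bar>x l w\<bar> <= C l"
  using si unfolding simple_integrand_def by (metis real_norm_def)
 have Zsq: "sq_integrable M (Z t)" if "t \<in> {0..T}" for t using l2_martingale_sq[OF Z that] .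
 have cell: "sq_integrable M (\<lambda>w. (Z (min t (y (Suc l))) w - Z (min t (y l)) w) *\<^sub>R x l w)"
  if "l < n" "t \<in> {0..T}" for l t
 proof -
  have "sq_integrable M (\<lambda>w. x l w * (Z (min t (y (Suc l))) w - Z (min t (y l)) w))"
   using that grid[of l] grid[of "Suc l"] xM C
   by (intro sq_integrable_bounded_mult[where C = "C l"] sq_integrable_diff Zsq) (auto simp: min_def)
  then show ?thesis by (simp add: mult.commute)
 qed
 show sq: "sq_integrable M (simple_integral Z n y x t)" if "t \<in> {0..T}" for t
  unfolding simple_integral_def using cell that by (intro sq_integrable_sum) auto
 fix s t h assume st: "0 <= s" "s <= t" "t <= T" and h: "h \<in> Bm (H s)" "sq_integrable M h"
 define inc where "inc l w = (Z (min t (y (Suc l))) w - Z (min t (y l)) w) - (Z (min s (y (Suc l))) w - Z (min s (y l)) w)" for l w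
 have zero: "(\<E> w. h w * (inc l w * x l w)) = 0" if l: "l < n" for l
 proof -
  have hx: "sq_integrable M (\<lambda>w. x l w * h w)"
   by (rule sq_integrable_bounded_mult[OF h(2) xM[OF l] C[OF l]])
  note g = grid[of l] grid[of "Suc l"] mono[OF l]
  have orth: "(\<E> w. h w * ((Z v w - Z u w) * x l w)) = 0"
   if "0 <= u" "u <= v" "v <= T" "y l <= u" "s <= u" for u v
  proof -
   have "(\<lambda>w. x l w * h w) \<in> Bm (H u)"
    using that st g l by (intro borel_measurable_times filtration_measurable_mono[OF H _ _ _ xH[OF l]] filtration_measurable_mono[OF H _ _ _ h(1)]) auto
   then have "(\<E> w. (x l w * h w) * (Z v w - Z u w)) = 0"
    using Z hx that unfolding l2_martingale_def by simp
   then show ?thesis by (simp only: mult_ac)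
  qed
  \<comment> \<open>The contribution of a cell between s and t is the increment of \<open>Z\<close>
    over the intersection of the cell with that interval. Its left end is late enough for both
    \<open>h\<close> and \<open>x l\<close> to be known.\<close>
  show ?thesis
  proof (cases "max s (y l) <= min t (y (Suc l))")
   case True
   then have "inc l = (\<lambda>w. Z (min t (y (Suc l))) w - Z (max s (y l)) w)"
    using st g by (auto simp: inc_def min_def max_def fun_eq_iff)
   then show ?thesis using orth[of "max s (y l)" "min t (y (Suc l))"] True st g l by simp
  next
   case False
   then have "inc l = (\<lambda>w. 0)" using st g l by (auto simp: inc_def min_def max_def fun_eq_iff)
   then show ?thesis by simp
  qed
 qed
 have "(\<E> w. h w * (simple_integral Z n y x t w - simple_integral Z n y x s w))
  = (\<E> w. \<Sum>l<n. h w * (inc l w * x l w))"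
  by (intro lintegral_cong)
   (auto simp: simple_integral_def inc_def sum_distrib_left sum_subtractf[symmetric] algebra_simps)
 also have "... = (\<Sum>l<n. (\<E> w. h w * (inc l w * x l w)))"
 proof (rule lintegral_sum)
  fix l assume "l \<in> {..<n}"
  then have "sq_integrable M (\<lambda>w. inc l w * x l w)"
   using sq_integrable_diff[OF cell[of l t] cell[of l s]] st by (simp add: inc_def left_diff_distrib)
  then show "integrable M (\<lambda>w. h w * (inc l w * x l w))" by (rule sq_integrable_mult[OF h(2)])
 qed
 also have "... = 0" using zero by simp
 finally show "(\<E> w. h w * (simple_integral Z n y x t w - simple_integral Z n y x s w)) = 0" .
qed

lemma l2_martingale_limit:
 assumes S: "\<And>m. l2_martingale H (S m)" and I: "\<And>t. t \<in> {0..T} ==> I t \<in> Bm M"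
  and lim: "\<And>t. t \<in> {0..T} ==> (\<lambda>m. \<integral>\<^sup>+w. ennreal ((S m t w - I t w)\<^sup>2) \<partial>M) \<longlonglongrightarrow> 0"
  and H: "filtration H"
 shows "l2_martingale H I"
 unfolding l2_martingale_def
proof (intro conjI ballI allI impI)
 show sq: "sq_integrable M (I t)" if "t \<in> {0..T}" for t
  using sq_integrable_limit(1)[OF l2_martingale_sq[OF S that] I[OF that] lim[OF that]] .
 fix s t h assume st: "0 <= s" "s <= t" "t <= T" and h: "h \<in> Bm (H s)" "sq_integrable M h"
 have conv: "(\<lambda>m. (\<E> w. h w * S m r w)) \<longlonglongrightarrow> (\<E> w. h w * I r w)" if r: "r \<in> {0..T}" for r
  using sq_integrable_limit_mult[of M "\<lambda>m. h" h "\<lambda>m. S m r" "I r" "\<lambda>_. 1" 1]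
   h(2) l2_martingale_sq[OF S r] I[OF r] lim[OF r] by (simp add: sq_integrable_measurable)
 have "(\<lambda>m. (\<E> w. h w * S m t w) - (\<E> w. h w * S m s w))
  \<longlonglongrightarrow> (\<E> w. h w * I t w) - (\<E> w. h w * I s w)"
  using st by (intro tendsto_diff conv) auto
 moreover have "(\<E> w. h w * S m t w) - (\<E> w. h w * S m s w) = 0" for m
  using l2_martingale_orth[OF S st h] by simp
 ultimately have "(\<E> w. h w * I t w) - (\<E> w. h w * I s w) = 0"
  by (simp add: LIMSEQ_const_iff)
 moreover have "(\<E> w. h w * (I t w - I s w)) = (\<E> w. h w * I t w) - (\<E> w. h w * I s w)"
  unfolding right_diff_distrib using st h sq
  by (intro lintegral_diff sq_integrable_mult) auto
 ultimately show "(\<E> w. h w * (I t w - I s w)) = 0" by simp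
qed

lemma approximates_martingale:
 assumes H: "filtration H" and FH: "\<And>s. s \<in> {0..T} ==> subalgebra (H s) (F s)"
  and Z: "l2_martingale H Z" and ap: "approximates F Z n t x I"
 shows "l2_martingale H I" and "AE w in M. I 0 w = 0"
proof -
 have si: "simple_integrand M F T (n m) (t m) (x m)" for m using ap by (simp add: approximates_def)
 have S: "l2_martingale H (simple_integral Z (n m) (t m) (x m))" for m
  by (rule simple_integral_martingale[OF H FH Z _ si])
   (use l2_martingale_sq[OF Z] simple_integrand_grid[OF si] in auto)
 show I: "l2_martingale H I"
  by (rule l2_martingale_limit[OF S _ _ H]) (use ap in \<open>auto simp: approximates_def\<close>)
 have "simple_integral Z (n m) (t m) (x m) 0 = (\<lambda>w. 0)" for m
 proof -
  have "min 0 (t m l) = 0" if "l <= n m" for l using simple_integrand_grid[OF si that] by simp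
  then show ?thesis by (auto simp: simple_integral_def fun_eq_iff intro!: sum.neutral)
 qed
 moreover have "(\<lambda>m. \<integral>\<^sup>+w. ennreal ((simple_integral Z (n m) (t m) (x m) 0 w - I 0 w)\<^sup>2) \<partial>M) \<longlonglongrightarrow> 0"
  using ap T_pos by (auto simp: approximates_def)
 ultimately have "(\<integral>\<^sup>+w. ennreal ((I 0 w)\<^sup>2) \<partial>M) = 0" by (simp add: LIMSEQ_const_iff)
 moreover have "I 0 \<in> Bm M" using ap T_pos by (auto simp: approximates_def)
 ultimately have "AE w in M. ennreal ((I 0 w)\<^sup>2) = 0" by (subst (asm) nn_integral_0_iff_AE) auto
 then show "AE w in M. I 0 w = 0" by eventually_elim (simp add: ennreal_eq_0_iff)
qed

lemma time_energy_eq: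
 fixes f :: "real => 'w => 'e::euclidean_space"
 assumes "(\<lambda>z. f (fst z) (snd z)) \<in> Bm Q"
 shows "time_energy M T f = (\<integral>\<^sup>+z. ennreal ((norm (f (fst z) (snd z)))\<^sup>2) \<partial>Q)"
proof -
 have "(\<lambda>(t, w). ennreal ((norm (f t w))\<^sup>2)) \<in> Bm Q" using assms by (simp add: case_prod_unfold)
 from pair.nn_integral_snd[OF this]
 show ?thesis unfolding time_energy_def nn_integral_clock[symmetric] by (simp add: case_prod_unfold)
qed

lemma simple_process_sq:
 assumes F: "\<And>s. s \<in> {0..T} ==> subalgebra M (F s)"
  and si: "simple_integrand M F T n u (x :: nat => 'w => real)"
 shows "sq_process (simple_process n u x)"
proof -
 note grid = simple_integrand_grid[OF si]
 have xM: "x l \<in> Bm M" if "l < n" for l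
  using measurable_from_subalg[OF F, of "u l" "x l"] grid[of l] si that by (simp add: simple_integrand_def)
 obtain C where C: "\<And>l w. l < n ==> w \<in> space M ==> \<bar>x l w\<bar> <= C l"
  using si unfolding simple_integrand_def by (metis real_norm_def)
 have "sq_process (\<lambda>t w. \<Sum>l<n. indicator {u l<..u (Suc l)} t * x l w)"
 proof (rule sq_process_sum)
  fix l assume "l \<in> {..<n}"
  then have l: "l < n" by simp
  have "sq_process (\<lambda>t. x l)"
   by (intro sq_process_const sq_integrable_bounded[OF finite_measure_axioms xM[OF l] C[OF l]])
  then show "sq_process (\<lambda>t w. indicator {u l<..u (Suc l)} t * x l w)"
   by (rule sq_process_bounded_mult[where C = 1]) (auto split: split_indicator)
 qed
 then show ?thesis by (simp add: simple_process_def[abs_def])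
qed

lemma integral_Q_product:
 fixes f :: "real => real" and g :: "'w => real"
 assumes f: "integrable (clock T) f" and g: "integrable M g"
 shows "(\<integral>z. f (fst z) * g (snd z) \<partial>Q) = integral\<^sup>L (clock T) f * expectation g"
proof -
 have "integrable Q (\<lambda>z. f (fst z) * g (snd z))"
  using f g by (intro pair.Fubini_integrable) (auto simp: abs_mult)
 from pair.integral_fst'[OF this] show ?thesis by simp
qed

lemma clock_overlap:
 assumes t: "t \<in> {0..T}" and "0 <= a" "0 <= c"
 shows "(\<integral>s. (indicator {0..t} s :: real) * (indicator {a<..b} s * indicator {c<..d} s) \<partial>clock T)
  = measure lborel ({min t a<..min t b} \<inter> {min t c<..min t d})"
proof -
 have iff: "s \<in> {0..T} \<and> s \<in> {0..t} \<and> s \<in> {a<..b} \<and> s \<in> {c<..d}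
   \<longleftrightarrow> s \<in> {min t a<..min t b} \<inter> {min t c<..min t d}" for s
 proof -
  have "0 <= t" "t <= T" using t by auto
  then show ?thesis using assms(2,3)
   unfolding Int_iff greaterThanAtMost_iff atLeastAtMost_iff min_less_iff_disj min_le_iff_disj min.bounded_iff
   by linarith
 qed
 have prod: "indicator A x * (indicator B x * (indicator C x * indicator D x)) = (indicator E x :: real)"
  if "x \<in> A \<and> x \<in> B \<and> x \<in> C \<and> x \<in> D \<longleftrightarrow> x \<in> E" for A B C D E and x :: real
  using that by (auto simp: indicator_def)
 have "(\<integral>s. (indicator {0..t} s :: real) * (indicator {a<..b} s * indicator {c<..d} s) \<partial>clock T)
  = (\<integral>s. indicator ({min t a<..min t b} \<inter> {min t c<..min t d}) s \<partial>lborel)"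
  unfolding integral_clock set_lebesgue_integral_def
 proof (rule lintegral_cong[OF refl])
  fix s show "indicator {0..T} s *\<^sub>R (indicator {0..t} s * (indicator {a<..b} s * indicator {c<..d} s))
   = (indicator ({min t a<..min t b} \<inter> {min t c<..min t d}) s :: real)"
   unfolding real_scaleR_def by (rule prod, rule iff)
 qed
 then show ?thesis by (simp only: lintegral_indicator space_lborel space_borel Int_UNIV_right)
qed

end

section \<open>The Ito isometry weighted by functions of the chain\<close>

context regime_noise begin

lemma filtration_joint: "filtration joint"
 unfolding filtration_def
proof (intro conjI ballI allI impI)
 show "subalgebra M (joint s)" if "s \<in> {0..T}" for s using subalgebra_joint that by simp
 show "sets (joint s) \<subseteq> sets (joint t)" if "s <= t" for s t
  unfolding joint_eq_mixed using that by (intro mixed_filtration_mono)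
qed

lemma filtration_enlarged: "filtration (\<lambda>s. mixed s T)"
 unfolding filtration_def
proof (intro conjI ballI allI impI)
 show "subalgebra M (mixed s T)" if "s \<in> {0..T}" for s using subalgebra_mixed that by simp
 show "sets (mixed s T) \<subseteq> sets (mixed t T)" if "s <= t" for s t
  using that by (intro mixed_filtration_mono) auto
qed

lemma joint_subalgebra_enlarged: "s \<in> {0..T} ==> subalgebra (mixed s T) (joint s)"
 using mixed_filtration_mono[of s s s T M W \<alpha>] by (simp add: subalgebra_def joint_eq_mixed)

text \<open>Subtracting the initial value turns everything into a statement about increments, and
  integrals see nothing else.\<close>

lemma W_shifted_martingale: "l2_martingale (\<lambda>s. mixed s T) (\<lambda>t w. W t w - W 0 w)"
 unfolding l2_martingale_def
proof (intro conjI ballI allI impI)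
 show "sq_integrable M (\<lambda>w. W t w - W 0 w)" if "t \<in> {0..T}" for t
  using increment_moments(1)[of 0 t] that by simp
 fix s t h assume st: "0 <= s" "s <= t" "t <= T" and h: "h \<in> Bm (mixed s T)" "sq_integrable M h"
 show "(\<E> w. h w * (W t w - W 0 w - (W s w - W 0 w))) = 0"
  using expectation_mixed_increment(2)[OF st h(1) sq_imp_integrable[OF h(2)]] by simp
qed

lemma simple_integral_W_shift: "simple_integral (\<lambda>t w. W t w - W 0 w) n u x = simple_integral W n u x"
 by (simp add: simple_integral_def fun_eq_iff)

lemma approximates_W_shift: "approximates F (\<lambda>t w. W t w - W 0 w) n u x I \<longleftrightarrow> approximates F W n u x I"
 by (simp add: approximates_def simple_integral_W_shift)

lemma noise_cell_sq:
 assumes si: "simple_integrand M joint T n u (x :: nat => 'w => real)" and l: "l < n" and t: "t \<in> {0..T}"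
 shows "x l \<in> Bm (mixed (u l) T)" "sq_integrable M (x l)"
  "sq_integrable M (\<lambda>w. (W (min t (u (Suc l))) w - W (min t (u l)) w) * x l w)"
proof -
 have g: "0 <= u l" "u l <= u (Suc l)" "u (Suc l) <= T" "u l <= T"
  using simple_integrand_grid[OF si] simple_integrand_mono[OF si l] l by (auto simp: less_imp_le)
 obtain c where c: "\<And>w. w \<in> space M ==> \<bar>x l w\<bar> <= c"
  using si l unfolding simple_integrand_def by (metis real_norm_def)
 have "x l \<in> Bm (joint (u l))" using si l by (simp add: simple_integrand_def)
 then show m: "x l \<in> Bm (mixed (u l) T)" using g by (simp add: joint_eq_mixed mixed_measurable_mono)
 have xM: "x l \<in> Bm M" by (rule mixed_measurable_M[OF m]) (use g in auto)
 then show "sq_integrable M (x l)" by (rule sq_integrable_bounded[OF finite_measure_axioms _ c])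
 have "sq_integrable M (\<lambda>w. W (min t (u (Suc l))) w - W (min t (u l)) w)"
  using g t by (intro increment_moments(1)) (auto simp: min_def)
 from sq_integrable_bounded_mult[OF this xM c]
 show "sq_integrable M (\<lambda>w. (W (min t (u (Suc l))) w - W (min t (u l)) w) * x l w)" by (simp only: mult.commute)
qed

text \<open>The weight \<open>y\<close> may depend on the whole path of the chain, since its product
  with integrand values is still known to the enlarged filtration, from which later increments of
  \<open>W\<close> are independent. Two cells contribute the length of their overlap up to
  \<open>t\<close>, which is what the time integral of the simple processes gives.\<close>

lemma simple_ito_isometry:
 assumes si: "simple_integrand M joint T n u (x :: nat => 'w => real)"
  and si': "simple_integrand M joint T n' u' (x' :: nat => 'w => real)"
  and y: "y \<in> Bm (chain T)" "\<And>w. w \<in> space M ==> \<bar>y w\<bar> <= C"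
  and t: "t \<in> {0..T}"
 shows "(\<E> w. y w * (simple_integral W n u x t w * simple_integral W n' u' x' t w))
  = mean_integral t (\<lambda>s w. y w * (simple_process n u x s w * simple_process n' u' x' s w))"
proof -
 have yM: "y \<in> Bm M"
  by (rule measurable_from_subalg[OF subalgebra_chain y(1)]) simp
 note c = noise_cell_sq[OF si _ t] and c' = noise_cell_sq[OF si' _ t]
 have ind: "integrable (clock T) (\<lambda>s. indicator {0..t} s * (indicator {a<..b} s * indicator {a'<..b'} s) :: real)" for a b a' b'
  by (rule clock.integrable_const_bound[where B = 1]) (auto split: split_indicator)
 have cell: "(\<E> w. y w * (((W (min t (u (Suc l))) w - W (min t (u l)) w) * x l w)
    * ((W (min t (u' (Suc k))) w - W (min t (u' k)) w) * x' k w)))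
  = (\<integral>z. (indicator {0..t} (fst z) * y (snd z)) * ((indicator {u l<..u (Suc l)} (fst z) * x l (snd z))
    * (indicator {u' k<..u' (Suc k)} (fst z) * x' k (snd z))) \<partial>Q)" if l: "l < n" and k: "k < n'" for l k
 proof -
  have g: "0 <= u l" "u l <= u (Suc l)" "u (Suc l) <= T" "0 <= u' k" "u' k <= u' (Suc k)" "u' (Suc k) <= T"
   using simple_integrand_grid[OF si] simple_integrand_grid[OF si'] simple_integrand_mono[OF si l] simple_integrand_mono[OF si' k] l k
   by (auto simp: less_imp_le)
  obtain b b' where b: "\<And>w. w \<in> space M ==> \<bar>x l w\<bar> <= b" "\<And>w. w \<in> space M ==> \<bar>x' k w\<bar> <= b'"
   using si si' l k unfolding simple_integrand_def by (metis real_norm_def)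
  have integrable: "integrable M (\<lambda>w. y w * (x l w * x' k w))"
   using sq_integrable_mult[OF sq_integrable_bounded_mult[OF c(2)[OF l] yM y(2)] c'(2)[OF k]] by (simp only: mult.assoc)
  have "(\<E> w. y w * (((W (min t (u (Suc l))) w - W (min t (u l)) w) * x l w)
    * ((W (min t (u' (Suc k))) w - W (min t (u' k)) w) * x' k w)))
   = (\<E> w. y w * (x l w * x' k w))
    * measure lborel ({min t (u l)<..min t (u (Suc l))} \<inter> {min t (u' k)<..min t (u' (Suc k))})"
  proof (rule expectation_increment_product[where Cp = b and Cq = b' and C = C])
   show "0 <= min t (u l)" "min t (u l) <= min t (u (Suc l))" "min t (u (Suc l)) <= T"
    "0 <= min t (u' k)" "min t (u' k) <= min t (u' (Suc k))" "min t (u' (Suc k)) <= T"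
    using g t by (auto intro: min.mono simp: min_le_iff_disj)
   show "x l \<in> Bm (mixed (min t (u l)) T)" if "min t (u l) < min t (u (Suc l))"
    using c(1)[OF l] that g by (auto simp: min_def split: if_splits)
   show "x' k \<in> Bm (mixed (min t (u' k)) T)" if "min t (u' k) < min t (u' (Suc k))"
    using c'(1)[OF k] that g by (auto simp: min_def split: if_splits)
  qed (fact b y)+
  also have "... = (\<integral>z. (indicator {0..t} (fst z) * (indicator {u l<..u (Suc l)} (fst z) * indicator {u' k<..u' (Suc k)} (fst z)))
    * (y (snd z) * (x l (snd z) * x' k (snd z))) \<partial>Q)"
   unfolding clock_overlap[OF t g(1,4), symmetric]
   by (subst integral_Q_product[OF ind]) (simp_all add: integrable mult.commute)
  finally show ?thesis by (simp only: mult_ac)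
 qed
 have "(\<E> w. y w * (simple_integral W n u x t w * simple_integral W n' u' x' t w))
  = (\<Sum>l<n. \<Sum>k<n'. \<integral>z. (indicator {0..t} (fst z) * y (snd z)) * ((indicator {u l<..u (Suc l)} (fst z) * x l (snd z))
    * (indicator {u' k<..u' (Suc k)} (fst z) * x' k (snd z))) \<partial>Q)"
  unfolding simple_integral_def real_scaleR_def
  by (rule trans[OF integral_product_sums[OF c(3) c'(3) yM y(2)]]) (auto intro!: sum.cong cell)
 also have "... = (\<integral>z. (indicator {0..t} (fst z) * y (snd z)) * (simple_process n u x (fst z) (snd z) * simple_process n' u' x' (fst z) (snd z)) \<partial>Q)"
  unfolding simple_process_def real_scaleR_def
 proof (rule integral_product_sums[symmetric, where C = C])
  show "(\<lambda>z. indicator {0..t} (fst z) * y (snd z)) \<in> Bm Q" using yM by simp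
  show "\<bar>indicator {0..t} (fst z) * y (snd z)\<bar> <= C" if "z \<in> space Q" for z
   using y(2)[of "snd z"] that by (auto simp: space_pair_measure split: split_indicator intro: order_trans[OF abs_ge_zero])
  have "sq_process (\<lambda>s w. indicator {a<..b} s * h w)" if "sq_integrable M h" for a b h
   by (rule sq_process_bounded_mult[OF sq_process_const[OF that], where C = 1]) (auto split: split_indicator)
  note i = this[unfolded sq_process_def case_prod_unfold]
  show "sq_integrable Q (\<lambda>z. indicator {u l<..u (Suc l)} (fst z) * x l (snd z))" if "l < n" for l by (rule i[OF c(2)[OF that]])
  show "sq_integrable Q (\<lambda>z. indicator {u' k<..u' (Suc k)} (fst z) * x' k (snd z))" if "k < n'" for k by (rule i[OF c'(2)[OF that]])
 qed
 finally show ?thesis by (simp only: mean_integral_def mult.assoc)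
qed

lemma simple_noise_sq:
 assumes si: "simple_integrand M joint T n u (x :: nat => 'w => real)" and t: "t \<in> {0..T}"
 shows "sq_integrable M (simple_integral W n u x t)"
 unfolding simple_integral_def real_scaleR_def by (intro sq_integrable_sum noise_cell_sq(3)[OF si _ t]) simp

lemma ito_isometry:
 assumes ap: "approximates joint W n u x I" "sq_process k"
   "(\<lambda>m. time_energy M T (\<lambda>t w. simple_process (n m) (u m) (x m) t w - k t w)) \<longlonglongrightarrow> 0"
  and ap': "approximates joint W n' u' x' I'" "sq_process k'"
   "(\<lambda>m. time_energy M T (\<lambda>t w. simple_process (n' m) (u' m) (x' m) t w - k' t w)) \<longlonglongrightarrow> 0"
  and y: "y \<in> Bm (chain T)" "\<And>w. w \<in> space M ==> \<bar>y w\<bar> <= C"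
  and t: "t \<in> {0..T}"
 shows "(\<E> w. y w * (I t w * I' t w)) = mean_integral t (\<lambda>s w. y w * (k s w * k' s w))"
proof -
 have yM [measurable]: "y \<in> Bm M"
  by (rule measurable_from_subalg[OF subalgebra_chain y(1)]) simp
 have si: "simple_integrand M joint T (n m) (u m) (x m)" "simple_integrand M joint T (n' m) (u' m) (x' m)" for m
  using ap(1) ap'(1) by (auto simp: approximates_def)
 have proc: "(\<lambda>m. \<integral>\<^sup>+z. ennreal ((simple_process (n m) (u m) (x m) (fst z) (snd z) - k (fst z) (snd z))\<^sup>2) \<partial>Q) \<longlonglongrightarrow> 0
   \<and> (\<forall>m. sq_integrable Q (\<lambda>z. simple_process (n m) (u m) (x m) (fst z) (snd z)))"
  if "approximates joint W n u x I" "sq_process k"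
   "(\<lambda>m. time_energy M T (\<lambda>t w. simple_process (n m) (u m) (x m) t w - k t w)) \<longlonglongrightarrow> 0" for n u x I k
 proof -
  have sp: "sq_process (simple_process (n m) (u m) (x m))" for m
   using that(1) subalgebra_joint by (intro simple_process_sq[of joint]) (auto simp: approximates_def)
  have "time_energy M T (\<lambda>t w. simple_process (n m) (u m) (x m) t w - k t w) =
    (\<integral>\<^sup>+z. ennreal ((simple_process (n m) (u m) (x m) (fst z) (snd z) - k (fst z) (snd z))\<^sup>2) \<partial>Q)" for m
   using sq_process_measurable[OF sq_process_diff[OF sp that(2)], of m]
   by (subst time_energy_eq) (simp_all add: case_prod_unfold)
  then show ?thesis using that(3) sp by (simp add: sq_process_def case_prod_unfold)
 qed
 note p = proc[OF ap] and p' = proc[OF ap']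
 have kQ: "(\<lambda>z. k (fst z) (snd z)) \<in> Bm Q" "(\<lambda>z. k' (fst z) (snd z)) \<in> Bm Q"
  using sq_process_measurable[OF ap(2)] sq_process_measurable[OF ap'(2)] by (simp_all add: case_prod_unfold)
 have "(\<lambda>m. \<integral>z. (indicator {0..t} (fst z) * y (snd z)) * (simple_process (n m) (u m) (x m) (fst z) (snd z) * simple_process (n' m) (u' m) (x' m) (fst z) (snd z)) \<partial>Q)
  \<longlonglongrightarrow> (\<integral>z. (indicator {0..t} (fst z) * y (snd z)) * (k (fst z) (snd z) * k' (fst z) (snd z)) \<partial>Q)"
 proof (rule sq_integrable_limit_mult[where C = "\<bar>C\<bar>"])
  show "(\<lambda>z. indicator {0..t} (fst z) * y (snd z)) \<in> Bm Q" by simp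
  fix z assume "z \<in> space Q"
  then have "\<bar>y (snd z)\<bar> <= C" using y(2) by (auto simp: space_pair_measure)
  then show "\<bar>indicator {0..t} (fst z) * y (snd z)\<bar> <= \<bar>C\<bar>" by (auto split: split_indicator)
 qed (use p p' kQ in auto)
 then have R: "(\<lambda>m. mean_integral t (\<lambda>s w. y w * (simple_process (n m) (u m) (x m) s w * simple_process (n' m) (u' m) (x' m) s w)))
  \<longlonglongrightarrow> mean_integral t (\<lambda>s w. y w * (k s w * k' s w))"
  by (simp add: mean_integral_def mult.assoc)
 have L: "(\<lambda>m. (\<E> w. y w * (simple_integral W (n m) (u m) (x m) t w * simple_integral W (n' m) (u' m) (x' m) t w)))
  \<longlonglongrightarrow> (\<E> w. y w * (I t w * I' t w))"
  by (rule sq_integrable_limit_mult[OF simple_noise_sq[OF si(1) t] _ _ simple_noise_sq[OF si(2) t] _ _ yM y(2)])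
   (use ap(1) ap'(1) t in \<open>auto simp: approximates_def\<close>)
 have "(\<E> w. y w * (simple_integral W (n m) (u m) (x m) t w * simple_integral W (n' m) (u' m) (x' m) t w))
  = mean_integral t (\<lambda>s w. y w * (simple_process (n m) (u m) (x m) s w * simple_process (n' m) (u' m) (x' m) s w))" for m
  by (rule simple_ito_isometry[OF si y t])
 with L have "(\<lambda>m. mean_integral t (\<lambda>s w. y w * (simple_process (n m) (u m) (x m) s w * simple_process (n' m) (u' m) (x' m) s w)))
  \<longlonglongrightarrow> (\<E> w. y w * (I t w * I' t w))" by simp
 from LIMSEQ_unique[OF this R] show ?thesis .
qed

end

section \<open>The Markov chain\<close>

locale semigroup =
 fixes gen :: "'s::finite => 's => real" and p :: "real => 's => 's => real"
 assumes semi: "transition_semigroup gen p"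
begin

lemma p_nonneg: "0 <= t ==> 0 <= p t i j"
 and p_sum: "0 <= t ==> (\<Sum>j\<in>UNIV. p t i j) = 1"
 and p_zero: "p 0 i j = (if i = j then 1 else 0)"
 and p_add: "0 <= s ==> 0 <= t ==> p (s + t) i j = (\<Sum>k\<in>UNIV. p s i k * p t k j)"
 and p_gen: "((\<lambda>t. p t i j) has_real_derivative gen i j) (at 0 within {0..})"
 using semi by (auto simp: transition_semigroup_def)

lemma p_le_1: "0 <= t ==> p t i j <= 1"
 using p_sum[of t i] member_le_sum[of j UNIV "p t i"] p_nonneg by simp

lemma p_quotient: "((\<lambda>h. (p h i j - p 0 i j) / h) \<longlongrightarrow> gen i j) (at_right 0)"
 using p_gen[of i j] by (simp add: has_field_derivative_iff at_within_Ici_at_right)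

lemma gen_row_sum: "(\<Sum>j\<in>UNIV. gen i j) = 0"
proof -
 have "((\<lambda>h. \<Sum>j\<in>UNIV. (p h i j - p 0 i j) / h) \<longlongrightarrow> (\<Sum>j\<in>UNIV. gen i j)) (at_right 0)"
  by (intro tendsto_sum p_quotient)
 moreover have "\<forall>\<^sub>F h in at_right 0. (\<Sum>j\<in>UNIV. (p h i j - p 0 i j) / h) = 0"
  using eventually_at_right_less[of 0]
  by eventually_elim (simp add: sum_subtractf p_sum flip: sum_divide_distrib)
 ultimately have "((\<lambda>h. 0) \<longlongrightarrow> (\<Sum>j\<in>UNIV. gen i j)) (at_right (0::real))"
  by (rule Lim_transform_eventually)
 then show ?thesis by (simp add: tendsto_const_iff)
qed

lemma gen_nonneg: "i \<noteq> j ==> 0 <= gen i j"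
proof (rule tendsto_lowerbound[OF p_quotient])
 assume "i \<noteq> j"
 show "\<forall>\<^sub>F h in at_right 0. 0 <= (p h i j - p 0 i j) / h"
  using eventually_at_right_less[of 0] by eventually_elim (simp add: p_zero \<open>i \<noteq> j\<close> p_nonneg)
qed simp

lemma p_increment_right:
 assumes "0 <= t" "0 < h"
 shows "(p (t + h) i j - p t i j) / h = (\<Sum>k\<in>UNIV. p t i k * ((p h k j - p 0 k j) / h))"
proof -
 have "(\<Sum>k\<in>UNIV. p t i k * p 0 k j) = p t i j" using p_add[of t 0 i j] assms by simp
 then have "p (t + h) i j - p t i j = (\<Sum>k\<in>UNIV. p t i k * (p h k j - p 0 k j))"
  using p_add[of t h i j] assms by (simp add: right_diff_distrib sum_subtractf)
 then show ?thesis by (simp add: sum_divide_distrib)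
qed

lemma p_tendsto_zero: "((\<lambda>h. p h i j) \<longlongrightarrow> p 0 i j) (at_right 0)"
 using has_field_derivative_imp_has_derivative[OF p_gen[of i j], THEN has_derivative_continuous]
 by (simp add: continuous_within at_within_Ici_at_right)

text \<open>Write p(t) = p(t - h) p(h): the entries of p(t - h) are at most 1, so the distance to
  p(t) is controlled by that of p(h) from the identity, uniformly in t.\<close>

lemma p_left_continuous:
 assumes "0 < t"
 shows "((\<lambda>h. p (t - h) i j) \<longlongrightarrow> p t i j) (at_right 0)"
proof -
 have "((\<lambda>h. \<Sum>k\<in>UNIV. \<bar>p h k j - p 0 k j\<bar>) \<longlongrightarrow> (\<Sum>k\<in>UNIV. \<bar>p 0 k j - p 0 k j\<bar>)) (at_right 0)"
  by (intro tendsto_intros p_tendsto_zero)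
 then have lim: "((\<lambda>h. \<Sum>k\<in>UNIV. \<bar>p h k j - p 0 k j\<bar>) \<longlongrightarrow> 0) (at_right 0)" by simp
 have "\<forall>\<^sub>F h in at_right 0. h < t" using assms by (rule eventually_at_right_real[THEN eventually_mono]) auto
 with eventually_at_right_less[of 0]
 have "\<forall>\<^sub>F h in at_right 0. norm (p (t - h) i j - p t i j) <= (\<Sum>k\<in>UNIV. \<bar>p h k j - p 0 k j\<bar>)"
 proof eventually_elim
  case (elim h)
  have "p t i j - p (t - h) i j = (\<Sum>k\<in>UNIV. p (t - h) i k * ((p h k j - p 0 k j) / h)) * h"
   using p_increment_right[of "t - h" h i j] elim by (simp add: field_simps)
  then have "\<bar>p t i j - p (t - h) i j\<bar> = \<bar>\<Sum>k\<in>UNIV. p (t - h) i k * (p h k j - p 0 k j)\<bar>"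
   using elim by (simp add: sum_distrib_right)
  also have "... <= (\<Sum>k\<in>UNIV. \<bar>p (t - h) i k * (p h k j - p 0 k j)\<bar>)" by (rule sum_abs)
  also have "... <= (\<Sum>k\<in>UNIV. \<bar>p h k j - p 0 k j\<bar>)"
   unfolding abs_mult using elim p_nonneg p_le_1 by (intro sum_mono mult_left_le_one_le) auto
  finally show ?case by simp
 qed
 then have "((\<lambda>h. norm (p (t - h) i j - p t i j)) \<longlongrightarrow> 0) (at_right 0)"
  by (intro tendsto_sandwich[OF _ _ tendsto_const lim]) auto
 then have "((\<lambda>h. p (t - h) i j - p t i j) \<longlongrightarrow> 0) (at_right 0)" by (rule tendsto_norm_zero_cancel)
 then show ?thesis by (rule LIM_zero_cancel)
qed

text \<open>The definition of a semigroup gives the derivative at 0 only. The right derivative at t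
  follows from p(t + h) = p(t) p(h); for the left one the factor p(t - h) varies with h, which is
  where left continuity enters.\<close>

lemma p_forward_equation:
 assumes t: "0 <= t"
 shows "((\<lambda>t. p t i j) has_real_derivative (\<Sum>k\<in>UNIV. p t i k * gen k j)) (at t within {0..})"
proof -
 let ?D = "\<Sum>k\<in>UNIV. p t i k * gen k j" and ?q = "\<lambda>s. (p s i j - p t i j) / (s - t)"
 have "((\<lambda>h. \<Sum>k\<in>UNIV. p t i k * ((p h k j - p 0 k j) / h)) \<longlongrightarrow> ?D) (at_right 0)"
  by (intro tendsto_intros p_quotient)
 then have "((\<lambda>h. ?q (h + t)) \<longlongrightarrow> ?D) (at_right 0)"
 proof (rule Lim_transform_eventually)
  show "\<forall>\<^sub>F h in at_right 0. (\<Sum>k\<in>UNIV. p t i k * ((p h k j - p 0 k j) / h)) = ?q (h + t)"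
   using eventually_at_right_less[of 0]
   by eventually_elim (use p_increment_right[OF t, of _ i j] in \<open>simp add: add.commute\<close>)
 qed
 then have right: "(?q \<longlongrightarrow> ?D) (at_right t)" by (subst filterlim_at_right_to_0)
 show ?thesis
 proof (cases "t = 0")
  case True
  then show ?thesis using right by (simp add: has_field_derivative_iff at_within_Ici_at_right)
 next
  case False
  then have t0: "0 < t" using t by simp
  have "((\<lambda>h. \<Sum>k\<in>UNIV. p (t - h) i k * ((p h k j - p 0 k j) / h)) \<longlongrightarrow> ?D) (at_right 0)"
   by (intro tendsto_intros p_quotient p_left_continuous t0)
  then have "((\<lambda>h. ?q (t - h)) \<longlongrightarrow> ?D) (at_right 0)"
  proof (rule Lim_transform_eventually)
   have "\<forall>\<^sub>F h in at_right 0. h < t" using t0 by (rule eventually_at_right_real[THEN eventually_mono]) auto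
   with eventually_at_right_less[of 0]
   show "\<forall>\<^sub>F h in at_right 0. (\<Sum>k\<in>UNIV. p (t - h) i k * ((p h k j - p 0 k j) / h)) = ?q (t - h)"
   proof eventually_elim
    case (elim h)
    have "(\<Sum>k\<in>UNIV. p (t - h) i k * ((p h k j - p 0 k j) / h)) = (p t i j - p (t - h) i j) / h"
     using p_increment_right[of "t - h" h i j] elim by simp
    also have "... = ?q (t - h)" using elim by (simp add: field_simps)
    finally show ?case .
   qed
  qed
  then have "((\<lambda>x. ?q (- x)) \<longlongrightarrow> ?D) (at_right (- t))"
   by (subst filterlim_at_right_to_0) simp
  then have left: "(?q \<longlongrightarrow> ?D) (at_left t)" by (subst filterlim_at_left_to_right)
  have "(?q \<longlongrightarrow> ?D) (at t)" using left right by (rule filterlim_split_at)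
  then have "(?q \<longlongrightarrow> ?D) (at t within {0..})" by (rule tendsto_within_subset) simp
  then show ?thesis by (simp add: has_field_derivative_iff)
 qed
qed

lemma p_continuous: "continuous_on {0..} (\<lambda>t. p t i j)"
 using p_forward_equation by (intro DERIV_continuous_on) auto

lemma p_lipschitz:
 assumes "0 <= s" "0 <= t"
 shows "\<bar>p t i j - p s i j\<bar> <= (\<Sum>k\<in>UNIV. \<bar>gen k j\<bar>) * \<bar>t - s\<bar>"
proof -
 have "norm (p t i j - p s i j) <= (\<Sum>k\<in>UNIV. \<bar>gen k j\<bar>) * norm (t - s)"
 proof (rule field_differentiable_bound[of "{0..}" "\<lambda>t. p t i j"])
  fix r :: real assume r: "r \<in> {0..}"
  then show "((\<lambda>t. p t i j) has_field_derivative (\<Sum>k\<in>UNIV. p r i k * gen k j)) (at r within {0..})"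
   by (intro p_forward_equation) simp
  have "\<bar>\<Sum>k\<in>UNIV. p r i k * gen k j\<bar> <= (\<Sum>k\<in>UNIV. \<bar>p r i k * gen k j\<bar>)" by (rule sum_abs)
  also have "... <= (\<Sum>k\<in>UNIV. \<bar>gen k j\<bar>)"
   unfolding abs_mult using r p_nonneg p_le_1 by (intro sum_mono mult_left_le_one_le) auto
  finally show "norm (\<Sum>k\<in>UNIV. p r i k * gen k j) <= (\<Sum>k\<in>UNIV. \<bar>gen k j\<bar>)" by simp
 qed (use assms in auto)
 then show ?thesis by simp
qed

text \<open>Fundamental theorem of calculus for r -> sum over j of p (r - s) k j * g r j; the
  forward equation moves the generator onto \<open>g\<close>.\<close>

lemma semigroup_dynkin:
 fixes g g' :: "real => 's => real"
 assumes st: "0 <= s" "s <= t" "t <= T"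
  and g: "\<And>r j. r \<in> {0..T} ==> ((\<lambda>r. g r j) has_real_derivative g' r j) (at r within {0..T})"
  and g': "\<And>j. continuous_on {0..T} (\<lambda>r. g' r j)"
 shows "(\<Sum>j\<in>UNIV. p (t - s) k j * g t j) = g s k +
  (LINT r:{s..t}|lborel. (\<Sum>j\<in>UNIV. p (r - s) k j * (g' r j + (\<Sum>l\<in>UNIV. gen j l * g r l))))"
proof -
 let ?F = "\<lambda>r. \<Sum>j\<in>UNIV. p (r - s) k j * g r j"
 let ?f = "\<lambda>r. \<Sum>j\<in>UNIV. p (r - s) k j * (g' r j + (\<Sum>l\<in>UNIV. gen j l * g r l))"
 have gc: "continuous_on {0..T} (\<lambda>r. g r j)" for j using g by (intro DERIV_continuous_on)
 have pc: "continuous_on {s..t} (\<lambda>r. p (r - s) k j)" for j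
  by (rule continuous_on_compose2[OF p_continuous]) (auto intro!: continuous_intros)
 have "(LINT r:{s..t}|lborel. ?f r) = ?F t - ?F s"
  unfolding set_lebesgue_integral_def
 proof (rule integral_FTC_atLeastAtMost[OF st(2)])
  fix r assume "s <= r" "r <= t"
  then have r: "r \<in> {s..t}" "0 <= r - s" "r \<in> {0..T}" using st by auto
  have "((\<lambda>r. p (r - s) k j) has_real_derivative (\<Sum>l\<in>UNIV. p (r - s) k l * gen l j)) (at r within {s..t})" for j
  proof -
   have "((\<lambda>r. p r k j) has_real_derivative (\<Sum>l\<in>UNIV. p (r - s) k l * gen l j)) (at (r - s) within (\<lambda>r. r - s) ` {s..t})"
    by (rule DERIV_subset[OF p_forward_equation[OF r(2)]]) auto
   moreover have "((\<lambda>r. r - s) has_real_derivative 1) (at r within {s..t})"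
    by (auto intro!: derivative_eq_intros)
   ultimately show ?thesis using DERIV_image_chain[of "\<lambda>r. p r k j" _ "\<lambda>r. r - s" r "{s..t}" 1] by (simp add: comp_def)
  qed
  moreover have "((\<lambda>r. g r j) has_real_derivative g' r j) (at r within {s..t})" for j
   by (rule DERIV_subset[OF g[OF r(3)]]) (use st in auto)
  ultimately have "(?F has_real_derivative (\<Sum>j\<in>UNIV. (\<Sum>l\<in>UNIV. p (r - s) k l * gen l j) * g r j + g' r j * p (r - s) k j)) (at r within {s..t})"
   by (intro DERIV_sum DERIV_mult)
  moreover have "(\<Sum>j\<in>UNIV. (\<Sum>l\<in>UNIV. p (r - s) k l * gen l j) * g r j + g' r j * p (r - s) k j) = ?f r"
  proof -
   have "(\<Sum>j\<in>UNIV. (\<Sum>l\<in>UNIV. p (r - s) k l * gen l j) * g r j) = (\<Sum>l\<in>UNIV. p (r - s) k l * (\<Sum>j\<in>UNIV. gen l j * g r j))"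
    unfolding sum_distrib_right sum_distrib_left by (subst sum.swap) (simp add: mult.assoc)
   then show ?thesis by (simp add: sum.distrib distrib_left mult.commute)
  qed
  ultimately show "(?F has_vector_derivative ?f r) (at r within {s..t})"
   by (simp add: has_real_derivative_iff_has_vector_derivative)
 next
  have "continuous_on {s..t} (\<lambda>r. g r j)" for j by (rule continuous_on_subset[OF gc]) (use st in auto)
  moreover have "continuous_on {s..t} (\<lambda>r. g' r j)" for j by (rule continuous_on_subset[OF g']) (use st in auto)
  ultimately show "continuous_on {s..t} ?f" using pc by (intro continuous_intros)
 qed
 moreover have "?F s = g s k"
 proof -
  have "?F s = (\<Sum>j\<in>UNIV. if k = j then g s j else 0)" by (intro sum.cong) (auto simp: p_zero)
  then show ?thesis by simp
 qed
 ultimately show ?thesis by simp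
qed

end

section \<open>Orthogonality to sub-sigma-algebras and conditional expectation\<close>

context horizon begin

lemma orthogonal_to_subalgebra:
 assumes H: "subalgebra M H" and Z: "sq_integrable M Z"
  and sets: "\<And>A. A \<in> sets H ==> (\<E> w. indicator A w * Z w) = 0"
  and h: "h \<in> Bm H" "sq_integrable M h"
 shows "(\<E> w. h w * Z w) = 0"
proof -
 interpret F: finite_measure_subalgebra M H using H by unfold_locales
 have Zi: "integrable M Z" by (rule sq_imp_integrable[OF Z])
 have "AE w in M. real_cond_exp M H Z w = 0"
  by (rule F.real_cond_exp_charact[OF _ Zi]) (use sets in \<open>auto simp: set_lebesgue_integral_def\<close>)
 then have "(\<E> w. h w * real_cond_exp M H Z w) = 0"
  by (intro integral_eq_zero_AE) (auto elim: eventually_mono)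
 moreover have "(\<E> w. h w * real_cond_exp M H Z w) = (\<E> w. h w * Z w)"
  using Zi by (intro F.real_cond_exp_intg(2) sq_integrable_mult h Z) auto
 ultimately show ?thesis by simp
qed

lemma sq_integrable_cond_exp:
 assumes H: "subalgebra M H" and X: "sq_integrable M X"
 shows "sq_integrable M (real_cond_exp M H X)"
  and "(\<E> w. (real_cond_exp M H X w)\<^sup>2) <= (\<E> w. (X w)\<^sup>2)"
  and "z \<in> Bm H ==> sq_integrable M z ==>
   (\<E> w. z w * real_cond_exp M H X w) = (\<E> w. z w * X w)"
proof -
 interpret F: finite_measure_subalgebra M H using H by unfold_locales
 have Xi: "integrable M X" "integrable M (\<lambda>w. (X w)\<^sup>2)"
  using sq_imp_integrable[OF X] X by (auto simp: sq_integrable_def)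
 have c: "convex_on UNIV (\<lambda>x::real. x\<^sup>2)" using convex_power2 by simp
 have "integrable M (\<lambda>w. (real_cond_exp M H X w)\<^sup>2)"
  by (rule F.integrable_convex_cond_exp[OF Xi(1), of UNIV]) (use Xi c in auto)
 then show sq: "sq_integrable M (real_cond_exp M H X)" by (simp add: sq_integrable_def)
 have "AE w in M. (real_cond_exp M H X w)\<^sup>2 <= real_cond_exp M H (\<lambda>w. (X w)\<^sup>2) w"
  by (rule F.real_cond_exp_jensens_inequality(2)[OF Xi(1), of UNIV]) (use Xi c in auto)
 then have "(\<E> w. (real_cond_exp M H X w)\<^sup>2) <= expectation (real_cond_exp M H (\<lambda>w. (X w)\<^sup>2))"
  using sq F.real_cond_exp_int(1)[OF Xi(2)] by (intro integral_mono_AE) (auto simp: sq_integrable_def)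
 also have "... = (\<E> w. (X w)\<^sup>2)" by (rule F.real_cond_exp_int(2)[OF Xi(2)])
 finally show "(\<E> w. (real_cond_exp M H X w)\<^sup>2) <= (\<E> w. (X w)\<^sup>2)" .
 show "(\<E> w. z w * real_cond_exp M H X w) = (\<E> w. z w * X w)"
  if "z \<in> Bm H" "sq_integrable M z"
  using that X Xi by (intro F.real_cond_exp_intg(2) sq_integrable_mult) auto
qed

lemma orthogonal_generator:
 fixes Z :: "'w => real"
 assumes Z: "integrable M Z" and G: "Int_stable G" "G \<subseteq> events" "space M \<in> G"
  and gen: "\<And>A. A \<in> G ==> (\<E> w. indicator A w * Z w) = 0"
  and A: "A \<in> sigma_sets (space M) G"
 shows "(\<E> w. indicator A w * Z w) = 0"
proof -
 have sub: "G \<subseteq> Pow (space M)" using G(2) sets.sets_into_space by blast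
 have ev: "B \<in> events" if "B \<in> sigma_sets (space M) G" for B
  using sets.sigma_sets_subset[OF G(2)] that by blast
 have int: "integrable M (\<lambda>w. indicator B w * Z w)" if "B \<in> events" for B
  using integrable_mult_indicator[OF that Z] by simp
 show ?thesis
  using A
 proof (induction rule: sigma_sets_induct_disjoint[OF G(1) sub, consumes 1, case_names basic empty compl union])
  case (basic A) then show ?case by (rule gen)
 next
  case empty then show ?case by simp
 next
  case (compl A)
  have "(\<E> w. indicator (space M - A) w * Z w) = (\<E> w. indicator (space M) w * Z w - indicator A w * Z w)"
   by (intro lintegral_cong) (auto split: split_indicator)
  also have "... = 0"
   using int[OF ev[OF compl(1)]] int[of "space M"] gen[OF G(3)] compl(2) by simp
  finally show ?case .
 next
  case (union A)
  have Ae: "A i \<in> events" for i using ev union by blast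
  have "(LINT w:(\<Union>i. A i)|M. Z w) = (\<Sum>i. (LINT w:(A i)|M. Z w))"
  proof (rule lebesgue_integral_countable_add[OF Ae])
   show "A i \<inter> A j = {}" if "i \<noteq> j" for i j using union(1) that by (auto simp: disjoint_family_on_def)
   have "(\<Union>i. A i) \<in> events" using Ae by auto
   then show "set_integrable M (\<Union>i. A i) Z" using int by (simp add: set_integrable_def)
  qed
  then show ?case using union(3) by (simp add: set_lebesgue_integral_def)
 qed
qed

end

section \<open>The Markov property with respect to noise and chain together\<close>

context regime_noise begin

text \<open>Given the path of the chain up to time \<open>s\<close>, its future is independent of the noise, so that
 projecting an adapted variable onto the whole path of the chain gives the projection onto the path up to \<open>s\<close>.\<close>

lemma expectation_adapted_chain:
 assumes s: "s \<in> {0..T}" and b: "b \<in> Bm (joint s)" "sq_integrable M b"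
  and y: "y \<in> Bm (chain T)" "sq_integrable M y"
 shows "(\<E> w. b w * y w) = (\<E> w. b w * real_cond_exp M (chain s) y w)"
proof -
 have sub: "subalgebra M (chain s)" using s by (intro subalgebra_chain) auto
 define z where "z = real_cond_exp M (chain s) y"
 note ce = sq_integrable_cond_exp[OF sub y(2), folded z_def]
 have zm: "z \<in> Bm (chain s)" unfolding z_def by simp
 define Z where "Z w = y w - z w" for w
 have Zsq: "sq_integrable M Z" unfolding Z_def by (intro sq_integrable_diff y ce(1))
 have Zi: "integrable M Z" by (rule sq_imp_integrable[OF Zsq])
 have Zm: "Z \<in> Bm (chain T)"
  unfolding Z_def using s by (intro borel_measurable_diff y(1) measurable_larger[OF zm _ chain_filtration_mono]) auto
 let ?I = "{a \<inter> b | a b. a \<in> sets (noise s) \<and> b \<in> sets (chain s)}"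
 have ind: "sq_integrable M (indicator B)" if "B \<in> events" for B
  using that by (rule sq_integrable_indicator)
 have gen0: "(\<E> w. indicator A w * Z w) = 0" if AI: "A \<in> ?I" for A
 proof -
  obtain a c where A: "A = a \<inter> c" and a: "a \<in> sets (noise s)" and c: "c \<in> sets (chain s)" using AI by blast
  have aT: "a \<in> sets (noise T)" using a noise_filtration_mono[of s T M W] s by auto
  have ce': "c \<in> events" using c chain_events[of s] s by auto
  have "(\<E> w. indicator c w * Z w) = (\<E> w. indicator c w * y w) - (\<E> w. indicator c w * z w)"
   unfolding Z_def right_diff_distrib using ind[OF ce'] y ce(1)
   by (intro lintegral_diff sq_integrable_mult) auto
  also have "... = 0" using ce(3)[of "indicator c"] c ind[OF ce'] by simp
  finally have c0: "(\<E> w. indicator c w * Z w) = 0" .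
  have cZ: "(\<lambda>w. indicator c w * Z w) \<in> Bm (chain T)"
   using c chain_filtration_mono[of s T M \<alpha>] s by (intro borel_measurable_times Zm borel_measurable_indicator) auto
  have cZi: "integrable M (\<lambda>w. indicator c w * Z w)" by (rule sq_integrable_mult[OF ind[OF ce'] Zsq])
  \<comment> \<open>\<open>Z\<close> cut off to \<open>c\<close> depends on the chain alone and has
    mean zero, \<open>z\<close> being the projection of \<open>y\<close>; the event \<open>a\<close>
    belongs to the independent noise.\<close>
  have iv: "indep_var borel (indicator a :: 'w => real) borel (\<lambda>w. indicator c w * Z w)"
   by (rule indep_set_imp_indep_var[OF indep]) (use aT cZ in auto)
  have ae: "a \<in> events" using aT noise_events[of T] by auto
  have "(\<E> w. indicator a w * (indicator c w * Z w)) = expectation (indicator a) * (\<E> w. indicator c w * Z w)"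
   by (rule indep_var_lebesgue_integral[OF iv _ cZi])
    (use sq_imp_integrable[OF ind[OF ae]] in simp)
  then have "(\<E> w. indicator a w * (indicator c w * Z w)) = 0" using c0 by simp
  then show ?thesis unfolding A by (simp only: indicator_inter_arith mult.assoc)
 qed
 have "(\<E> w. b w * Z w) = 0"
 proof (rule orthogonal_to_subalgebra[OF subalgebra_joint Zsq _ b])
  fix A assume "A \<in> sets (joint s)"
  then have A: "A \<in> sigma_sets (space M) ?I" unfolding joint_eq_mixed sets_mixed_filtration_Int .
  show "(\<E> w. indicator A w * Z w) = 0"
  proof (rule orthogonal_generator[OF Zi _ _ _ gen0 A])
   show "Int_stable ?I" by (rule Int_stable_products)
   show "?I \<subseteq> events" using noise_events[of s] chain_events[of s] s by auto
   show "space M \<in> ?I" using sets.top[of "noise s"] sets.top[of "chain s"] by fastforce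
  qed
 qed (use s in auto)
 moreover have "(\<E> w. b w * Z w) = (\<E> w. b w * y w) - (\<E> w. b w * z w)"
  unfolding Z_def right_diff_distrib using b(2) y ce(1)
  by (intro lintegral_diff sq_integrable_mult) auto
 ultimately show ?thesis by (simp add: z_def)
qed

definition transition :: "real => 's => 's => real" where
 "transition = (SOME p. transition_semigroup gen p \<and>
    (\<forall>s t j. 0 <= s \<and> s <= t \<and> t <= T -->
      (AE w in M. real_cond_exp M (chain_filtration M \<alpha> s)
       (indicator {w \<in> space M. \<alpha> t w = j}) w = p (t - s) (\<alpha> s w) j)))"

lemma transition:
 "transition_semigroup gen transition"
 "0 <= s ==> s <= t ==> t <= T ==> AE w in M. real_cond_exp M (chain s)
       (indicator {w \<in> space M. \<alpha> t w = j}) w = transition (t - s) (\<alpha> s w) j"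
proof -
 have "\<exists>p. transition_semigroup gen p \<and>
    (\<forall>s t j. 0 <= s \<and> s <= t \<and> t <= T -->
      (AE w in M. real_cond_exp M (chain_filtration M \<alpha> s)
       (indicator {w \<in> space M. \<alpha> t w = j}) w = p (t - s) (\<alpha> s w) j))"
  using markov unfolding markov_chain_def by blast
 from someI_ex[OF this, folded transition_def]
 show "transition_semigroup gen transition"
  "0 <= s ==> s <= t ==> t <= T ==> AE w in M. real_cond_exp M (chain s)
       (indicator {w \<in> space M. \<alpha> t w = j}) w = transition (t - s) (\<alpha> s w) j" by auto
qed

sublocale semi: semigroup gen transition by unfold_locales (rule transition(1))

abbreviation at_state :: "real => 's => 'w set" where
 "at_state t j \<equiv> {w \<in> space M. \<alpha> t w = j}"

lemma at_state_chain: "0 <= s ==> s <= t ==> at_state s j \<in> sets (chain t)"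
proof -
 assume st: "0 <= s" "s <= t"
 have "\<alpha> s -` {j} \<inter> space (chain t) \<in> sets (chain t)"
  by (rule measurable_sets[OF chain_measurable[OF st]]) simp
 moreover have "\<alpha> s -` {j} \<inter> space (chain t) = at_state s j" by auto
 ultimately show ?thesis by simp
qed

lemma at_state_event: "t \<in> {0..T} ==> at_state t j \<in> events"
 using at_state_chain[of t T j] chain_events[of T] by auto

text \<open>The Markov property is postulated for the filtration of the chain. It extends to events
  that also involve the past of the noise because, against such an event, an indicator of the future
  chain may be replaced by its projection onto the past of the chain.\<close>

lemma joint_transition:
 assumes st: "0 <= s" "s <= t" "t <= T" and b: "b \<in> sets (joint s)"
 shows "prob (b \<inter> at_state t j) = (\<Sum>k\<in>UNIV. transition (t - s) k j * prob (b \<inter> at_state s k))"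
proof -
 have b': "b \<in> events" using subalgebra_joint[of s] b st by (auto simp: subalgebra_def)
 have e: "at_state t j \<in> events" "\<And>k. at_state s k \<in> events" using at_state_event st by auto
 have ind: "sq_integrable M (indicator B)" if "B \<in> events" for B
  using that by (rule sq_integrable_indicator)
 have "prob (b \<inter> at_state t j) = (\<E> w. indicator b w * indicator (at_state t j) w)"
  using b' e by (simp add: indicator_inter_arith[symmetric])
 also have "... = (\<E> w. indicator b w * real_cond_exp M (chain s) (indicator (at_state t j)) w)"
  using b st at_state_chain[of t T j] by (intro expectation_adapted_chain ind b' e) auto
 also have "... = (\<integral>w. (\<Sum>k\<in>UNIV. transition (t - s) k j * indicator (b \<inter> at_state s k) w) \<partial>M)"
 proof (rule integral_cong_AE)
  show "(\<lambda>w. indicator b w * real_cond_exp M (chain s) (indicator (at_state t j)) w) \<in> Bm M"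
   using b' by simp
  show "(\<lambda>w. \<Sum>k\<in>UNIV. transition (t - s) k j * indicator (b \<inter> at_state s k) w) \<in> Bm M"
   using b' e by (intro borel_measurable_sum borel_measurable_times borel_measurable_const borel_measurable_indicator sets.Int) auto
  show "AE w in M. indicator b w * real_cond_exp M (chain s) (indicator (at_state t j)) w
    = (\<Sum>k\<in>UNIV. transition (t - s) k j * indicator (b \<inter> at_state s k) w)"
   using transition(2)[OF st, of j] AE_space
  proof eventually_elim
   case (elim w)
   have "(\<Sum>k\<in>UNIV. transition (t - s) k j * indicator (b \<inter> at_state s k) w)
    = (\<Sum>k\<in>UNIV. if k = \<alpha> s w then transition (t - s) k j * indicator b w else 0)"
    using elim by (intro sum.cong) (auto split: split_indicator)
   then show ?case using elim by simp
  qed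
 qed
 also have "... = (\<Sum>k\<in>UNIV. transition (t - s) k j * prob (b \<inter> at_state s k))"
  using b' e by (subst lintegral_sum)
   (auto intro!: integrable_mult_right integrable_real_indicator simp: emeasure_eq_measure)
 finally show ?thesis .
qed

lemma expectation_transition:
 assumes st: "0 <= s" "s <= t" "t <= T" and h: "h \<in> Bm (joint s)" "integrable M h"
 shows "(\<E> w. h w * indicator (at_state t j) w)
  = (\<Sum>k\<in>UNIV. transition (t - s) k j * (\<E> w. h w * indicator (at_state s k) w))"
proof -
 interpret F: finite_measure_subalgebra M "joint s"
  using subalgebra_joint[of s] st by unfold_locales auto
 have e: "at_state t j \<in> events" "\<And>k. at_state s k \<in> events" using at_state_event st by auto
 have eF: "at_state s k \<in> sets (joint s)" for k
  using at_state_chain[of s s k] chain_subset_mixed st unfolding joint_eq_mixed by blast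
 define g where "g w = (\<Sum>k\<in>UNIV. transition (t - s) k j * indicator (at_state s k) w)" for w
 have g: "g \<in> Bm (joint s)" unfolding g_def
  using eF by (intro borel_measurable_sum borel_measurable_times borel_measurable_const borel_measurable_indicator) auto
 have ind: "integrable M (indicator E :: 'w => real)" if "E \<in> events" for E
  using that by (simp add: integrable_real_indicator emeasure_eq_measure)
 have "AE w in M. real_cond_exp M (joint s) (indicator (at_state t j)) w = g w"
 proof (rule F.real_cond_exp_charact[OF _ ind[OF e(1)] _ g])
  show "integrable M g" unfolding g_def
   using e by (intro lint_sum integrable_mult_right ind)
  fix A assume A: "A \<in> sets (joint s)"
  then have AM: "A \<in> events" using subalgebra_joint[of s] st by (auto simp: subalgebra_def)
  have "(\<integral>w\<in>A. g w \<partial>M) = (\<integral>w. (\<Sum>k\<in>UNIV. transition (t - s) k j * indicator (A \<inter> at_state s k) w) \<partial>M)"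
   unfolding set_lebesgue_integral_def g_def
   by (intro lintegral_cong) (auto simp: sum_distrib_left indicator_inter_arith mult_ac)
  also have "... = (\<Sum>k\<in>UNIV. transition (t - s) k j * prob (A \<inter> at_state s k))"
   using AM e by (subst lintegral_sum) (auto intro!: integrable_mult_right ind)
  also have "... = prob (A \<inter> at_state t j)" by (rule joint_transition[OF st A, symmetric])
  also have "... = (\<integral>w\<in>A. indicator (at_state t j) w \<partial>M)"
   using AM e by (simp add: set_lebesgue_integral_def indicator_inter_arith[symmetric])
  finally show "(\<integral>w\<in>A. indicator (at_state t j) w \<partial>M) = (\<integral>w\<in>A. g w \<partial>M)" by simp
 qed
 then have ae: "AE w in M. h w * real_cond_exp M (joint s) (indicator (at_state t j)) w = h w * g w"
  by eventually_elim simp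
 have int: "integrable M (\<lambda>w. h w * indicator E w)" if "E \<in> events" for E
  using integrable_mult_indicator[OF that h(2)] by (simp add: mult.commute)
 have "(\<E> w. h w * indicator (at_state t j) w)
  = (\<E> w. h w * real_cond_exp M (joint s) (indicator (at_state t j)) w)"
  by (rule F.real_cond_exp_intg(2)[symmetric, OF int[OF e(1)] h(1)]) (use e in simp)
 also have "... = (\<E> w. h w * g w)"
  using h(2) measurable_from_subalg[OF F.subalg g] by (intro integral_cong_AE ae) auto
 also have "... = (\<E> w. \<Sum>k\<in>UNIV. transition (t - s) k j * (h w * indicator (at_state s k) w))"
  unfolding g_def sum_distrib_left by (simp only: mult_ac)
 also have "... = (\<Sum>k\<in>UNIV. transition (t - s) k j * (\<E> w. h w * indicator (at_state s k) w))"
  using int e by (subst lintegral_sum) auto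
 finally show ?thesis .
qed

lemma expectation_state_function:
 fixes f :: "'s => real"
 assumes t: "t \<in> {0..T}" and h: "integrable M h"
 shows "(\<E> w. h w * f (\<alpha> t w)) = (\<Sum>j\<in>UNIV. f j * (\<E> w. h w * indicator (at_state t j) w))"
  and "integrable M (\<lambda>w. h w * f (\<alpha> t w))"
proof -
 have int: "integrable M (\<lambda>w. h w * indicator (at_state t j) w)" for j
  using integrable_mult_indicator[OF at_state_event[OF t] h] by (simp add: mult.commute)
 have eq: "h w * f (\<alpha> t w) = (\<Sum>j\<in>UNIV. f j * (h w * indicator (at_state t j) w))" if "w \<in> space M" for w
 proof -
  have "(\<Sum>j\<in>UNIV. f j * (h w * indicator (at_state t j) w)) = (\<Sum>j\<in>UNIV. if j = \<alpha> t w then f j * h w else 0)"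
   using that by (intro sum.cong) (auto split: split_indicator)
  then show ?thesis by simp
 qed
 have "integrable M (\<lambda>w. \<Sum>j\<in>UNIV. f j * (h w * indicator (at_state t j) w))" using int by auto
 then show "integrable M (\<lambda>w. h w * f (\<alpha> t w))"
  by (rule lint_cong[OF refl, THEN iffD1, rotated]) (use eq in auto)
 have "(\<E> w. h w * f (\<alpha> t w)) = (\<E> w. \<Sum>j\<in>UNIV. f j * (h w * indicator (at_state t j) w))"
  by (rule lintegral_cong[OF refl]) (rule eq)
 then show "(\<E> w. h w * f (\<alpha> t w)) = (\<Sum>j\<in>UNIV. f j * (\<E> w. h w * indicator (at_state t j) w))"
  using int by (simp add: lintegral_sum)
qed

lemma expectation_transition_function:
 fixes f :: "'s => real"
 assumes st: "0 <= s" "s <= t" "t <= T" and h: "h \<in> Bm (joint s)" "integrable M h"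
 shows "(\<E> w. h w * f (\<alpha> t w))
  = (\<Sum>k\<in>UNIV. (\<Sum>j\<in>UNIV. transition (t - s) k j * f j) * (\<E> w. h w * indicator (at_state s k) w))"
proof -
 have "(\<E> w. h w * f (\<alpha> t w)) = (\<Sum>j\<in>UNIV. f j *
   (\<Sum>k\<in>UNIV. transition (t - s) k j * (\<E> w. h w * indicator (at_state s k) w)))"
  using st by (simp add: expectation_state_function(1)[OF _ h(2)] expectation_transition[OF st h])
 also have "... = (\<Sum>k\<in>UNIV. (\<Sum>j\<in>UNIV. transition (t - s) k j * f j) * (\<E> w. h w * indicator (at_state s k) w))"
  unfolding sum_distrib_left sum_distrib_right by (subst sum.swap) (simp add: mult_ac)
 finally show ?thesis .
qed

end

section \<open>Jumps of the chain\<close>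

lemma left_value_unique:
 assumes "left_value \<alpha> s w i" "left_value \<alpha> s w j"
 shows "i = j"
proof -
 have "\<forall>\<^sub>F r in at_left s. i = j"
  using assms unfolding left_value_def by eventually_elim simp
 then show ?thesis by simp
qed

lemma left_value_constant:
 assumes "left_value \<alpha> s w i" "a < s" "\<And>r. a < r ==> r < s ==> \<alpha> r w = c"
 shows "i = c"
proof -
 have "\<forall>\<^sub>F r in at_left s. r \<in> {a<..<s}" using assms(2) by (rule eventually_at_left_real)
 then have "\<forall>\<^sub>F r in at_left s. i = c"
  using assms(1) unfolding left_value_def by eventually_elim (use assms(3) in auto)
 then show ?thesis by simp
qed

definition jumps_in ::
 "(real => 'w => 's) => 's => 's => real => real => 'w => real set" where
 "jumps_in \<alpha> i j a b w = {s. i \<noteq> j \<and> a < s \<and> s <= b \<and> left_value \<alpha> s w i \<and> \<alpha> s w = j}"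

lemma jump_times_eq: "jump_times \<alpha> i j t w = jumps_in \<alpha> i j 0 t w"
 by (simp add: jump_times_def jumps_in_def)

lemma jumps_in_split:
 assumes "a <= b" "b <= c"
 shows "jumps_in \<alpha> i j a c w = jumps_in \<alpha> i j a b w \<union> jumps_in \<alpha> i j b c w"
  and "jumps_in \<alpha> i j a b w \<inter> jumps_in \<alpha> i j b c w = {}"
 using assms by (auto simp: jumps_in_def)

text \<open>On a short interval a cadlag path has at most one jump, so that jumps can be read off from a
 sufficiently fine grid.\<close>

lemma jumps_in_cell:
 assumes ij: "i \<noteq> j" and ab: "a < b"
  and left: "\<And>s. a <= s ==> s <= b ==> s < r ==> \<alpha> s w = c"
  and right: "\<And>s. a <= s ==> s <= b ==> r <= s ==> \<alpha> s w = \<alpha> r w"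
 shows "finite (jumps_in \<alpha> i j a b w)"
  and "card (jumps_in \<alpha> i j a b w) = (if \<alpha> a w = i \<and> \<alpha> b w = j then 1 else 0)"
proof -
 have "finite (jumps_in \<alpha> i j a b w) \<and> card (jumps_in \<alpha> i j a b w) = (if \<alpha> a w = i \<and> \<alpha> b w = j then 1 else 0)"
 proof (cases "a < r \<and> r <= b")
  case True
  then have ends: "\<alpha> a w = c" "\<alpha> b w = \<alpha> r w" using left[of a] right[of b] ab by auto
  have only: "s = r" if "s \<in> jumps_in \<alpha> i j a b w" for s
  proof (rule ccontr)
   assume "s \<noteq> r"
   have s: "a < s" "s <= b" "left_value \<alpha> s w i" "\<alpha> s w = j" using that by (auto simp: jumps_in_def)
   show False
   proof (cases "s < r")
    case True
    have "i = c" by (rule left_value_constant[OF s(3) s(1)]) (use True s left in auto)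
    moreover have "j = c" using left[of s] s True by auto
    ultimately show False using ij by simp
   next
    case False
    then have "r < s" using \<open>s \<noteq> r\<close> by simp
    have "\<alpha> x w = \<alpha> r w" if "r < x" "x < s" for x
     by (rule right) (use that s \<open>a < r \<and> r <= b\<close> in linarith)+
    with s(3) \<open>r < s\<close> have "i = \<alpha> r w" by (rule left_value_constant)
    moreover have "\<alpha> s w = \<alpha> r w" by (rule right) (use s \<open>r < s\<close> in linarith)+
    ultimately show False using ij s(4) by simp
   qed
  qed
  have lv: "left_value \<alpha> r w c"
  proof -
   have "\<forall>\<^sub>F x in at_left r. x \<in> {a<..<r}" using True by (intro eventually_at_left_real) auto
   then show ?thesis unfolding left_value_def by eventually_elim (use left True in auto)
  qed
  have mem: "r \<in> jumps_in \<alpha> i j a b w \<longleftrightarrow> c = i \<and> \<alpha> r w = j"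
   using True ij lv left_value_unique[OF lv] unfolding jumps_in_def by blast
  have "jumps_in \<alpha> i j a b w = (if c = i \<and> \<alpha> r w = j then {r} else {})"
  proof (cases "c = i \<and> \<alpha> r w = j")
   case True
   then have "r \<in> jumps_in \<alpha> i j a b w" using mem by blast
   then have "jumps_in \<alpha> i j a b w = {r}" using only by blast
   then show ?thesis using True by simp
  next
   case False
   then have "jumps_in \<alpha> i j a b w = {}" using only mem by blast
   then show ?thesis using False by simp
  qed
  then show ?thesis using ends by simp
 next
  case False
  define e where "e = (if r <= a then \<alpha> r w else c)"
  have const: "\<alpha> s w = e" if "a <= s" "s <= b" for s
   using that left[of s] right[of s] False by (auto simp: e_def)
  have "jumps_in \<alpha> i j a b w = {}"
  proof (rule ccontr)
   assume "jumps_in \<alpha> i j a b w \<noteq> {}"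
   then obtain s where s: "a < s" "s <= b" "left_value \<alpha> s w i" "\<alpha> s w = j" by (auto simp: jumps_in_def)
   have "i = e" by (rule left_value_constant[OF s(3) s(1)]) (use s const in auto)
   moreover have "j = e" using const[of s] s by auto
   ultimately show False using ij by simp
  qed
  moreover have "\<alpha> a w = e" "\<alpha> b w = e" by (rule const; use ab in simp)+
  ultimately show ?thesis using ij by simp
 qed
 then show "finite (jumps_in \<alpha> i j a b w)"
  "card (jumps_in \<alpha> i j a b w) = (if \<alpha> a w = i \<and> \<alpha> b w = j then 1 else 0)" by auto
qed

text \<open>The path is sampled at the next point strictly to the right of t on a grid of mesh 1/(n
  + 1), cut off at \<open>T\<close>. By right continuity in the discrete topology the sampled value
  is eventually the value at t. The sigma-algebra is kept general: the lemma is applied to all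
  events and to those of the chain.\<close>

lemma measurable_cadlag_chain:
 fixes \<alpha> :: "real => 'w => 's::finite"
 assumes m: "\<And>t. t \<in> {0..T} ==> \<alpha> t \<in> measurable N (count_space UNIV)"
  and right: "\<And>w t. w \<in> space N ==> t \<in> {0..<T} ==> \<forall>\<^sub>F r in at_right t. \<alpha> r w = \<alpha> t w"
  and T: "0 < T"
 shows "(\<lambda>z. indicator {w \<in> space N. \<alpha> (fst z) w = i} (snd z) :: real) \<in> Bm (clock T \<Otimes>\<^sub>M N)"
proof -
 define u where "u n t = min T ((of_int \<lfloor>real (Suc n) * t\<rfloor> + 1) / real (Suc n))" for n and t :: real
 define f where "f t w = (indicator {w \<in> space N. \<alpha> t w = i} w :: real)" for t w
 have fm: "f t \<in> Bm N" if "t \<in> {0..T}" for t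
 proof -
  have "{w \<in> space N. \<alpha> t w = i} = \<alpha> t -` {i} \<inter> space N" by auto
  then have "{w \<in> space N. \<alpha> t w = i} \<in> sets N" using measurable_sets[OF m[OF that], of "{i}"] by simp
  then show ?thesis unfolding f_def by simp
 qed
 have u: "u n t \<in> {0..T}" if "t \<in> {0..T}" for n t
 proof -
  have "0 <= (of_int \<lfloor>real (Suc n) * t\<rfloor> + 1) / real (Suc n)" using that by (intro divide_nonneg_nonneg) auto
  then show ?thesis using T by (simp add: u_def)
 qed
 have meas: "(\<lambda>z. f (u n (fst z)) (snd z)) \<in> Bm (clock T \<Otimes>\<^sub>M N)" for n
 proof -
  \<comment> \<open>\<open>k\<close> ranges over all integers, so the sampling time is clamped to
    [0, T], where \<open>fm\<close> applies.\<close>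
  define g where "g k w = f (max 0 (min T ((of_int k + 1) / real (Suc n)))) w" for k :: int and w
  have "(\<lambda>z. g \<lfloor>real (Suc n) * fst z\<rfloor> (snd z)) \<in> Bm (clock T \<Otimes>\<^sub>M N)"
  proof (rule measurable_compose_countable)
   fix k :: int
   have "g k \<in> Bm N" unfolding g_def using T by (intro fm) auto
   then show "(\<lambda>z. g k (snd z)) \<in> Bm (clock T \<Otimes>\<^sub>M N)" by simp
  next
   show "(\<lambda>z. \<lfloor>real (Suc n) * fst z\<rfloor>) \<in> measurable (clock T \<Otimes>\<^sub>M N) (count_space UNIV)"
    by measurable
  qed
  moreover have "g \<lfloor>real (Suc n) * fst z\<rfloor> (snd z) = f (u n (fst z)) (snd z)" if "z \<in> space (clock T \<Otimes>\<^sub>M N)" for z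
   using u[of "fst z" n] that unfolding g_def u_def by (auto simp: space_pair_measure)
  ultimately show ?thesis by (simp cong: measurable_cong)
 qed
 have "(\<lambda>z. f (fst z) (snd z)) \<in> Bm (clock T \<Otimes>\<^sub>M N)"
 proof (rule borel_measurable_LIMSEQ_real[OF _ meas])
  fix z assume "z \<in> space (clock T \<Otimes>\<^sub>M N)"
  then have z: "fst z \<in> {0..T}" "snd z \<in> space N" by (auto simp: space_pair_measure)
  define v where "v n = (of_int \<lfloor>real (Suc n) * fst z\<rfloor> + 1) / real (Suc n)" for n
  have v: "fst z < v n" "v n <= fst z + inverse (real (Suc n))" for n
  proof -
   have "real (Suc n) * fst z < of_int \<lfloor>real (Suc n) * fst z\<rfloor> + 1"
    "of_int \<lfloor>real (Suc n) * fst z\<rfloor> + 1 <= real (Suc n) * fst z + 1" by linarith+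
   then show "fst z < v n" "v n <= fst z + inverse (real (Suc n))"
    unfolding v_def by (auto simp: field_simps simp del: of_nat_Suc)
  qed
  have uv: "u n (fst z) = min T (v n)" for n by (simp add: u_def v_def)
  have "\<forall>\<^sub>F n in sequentially. \<alpha> (u n (fst z)) (snd z) = \<alpha> (fst z) (snd z)"
  proof (cases "fst z = T")
   case True
   have "u n (fst z) = fst z" for n using True v(1)[of n] uv[of n] by (simp add: min_def)
   then show ?thesis by simp
  next
   case False
   then obtain b where b: "b > fst z" "\<And>s. s > fst z ==> s < b ==> \<alpha> s (snd z) = \<alpha> (fst z) (snd z)"
    using right[OF z(2), of "fst z"] z(1) unfolding eventually_at_right_field by auto
   have "\<forall>\<^sub>F n in sequentially. inverse (real (Suc n)) < b - fst z"
    using b(1) by (intro order_tendstoD(2)[OF LIMSEQ_inverse_real_of_nat]) simp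
   then show ?thesis
   proof eventually_elim
    case (elim n)
    then show ?case using b(2)[of "u n (fst z)"] v[of n] False z(1) by (simp add: uv min_less_iff_disj del: of_nat_Suc)
   qed
  qed
  then have "\<forall>\<^sub>F n in sequentially. f (u n (fst z)) (snd z) = f (fst z) (snd z)"
   by eventually_elim (simp add: f_def indicator_def)
  then show "(\<lambda>n. f (u n (fst z)) (snd z)) \<longlonglongrightarrow> f (fst z) (snd z)" by (rule tendsto_eventually)
 qed
 then show ?thesis by (simp add: f_def)
qed

context regime_noise begin

lemma path_right: "w \<in> space M ==> t \<in> {0..<T} ==> \<forall>\<^sub>F r in at_right t. \<alpha> r w = \<alpha> t w"
 and path_left: "w \<in> space M ==> t \<in> {0<..T} ==> \<exists>i. left_value \<alpha> t w i"
 using markov by (auto simp: markov_chain_def)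

lemma at_state_process: "(\<lambda>z. indicator (at_state (fst z) i) (snd z) :: real) \<in> Bm Q"
 by (rule measurable_cadlag_chain[OF \<alpha>_measurable path_right T_pos])

lemma at_state_process_chain:
 "(\<lambda>z. indicator (at_state (fst z) i) (snd z) :: real) \<in> Bm (clock T \<Otimes>\<^sub>M chain T)"
 using measurable_cadlag_chain[of T \<alpha> "chain T" i] chain_measurable[of _ T \<alpha> M] path_right T_pos by simp

text \<open>Around each time r there is an interval on which the path is constant before r and
  constant from r on; a Lebesgue number of this cover of [0, T] gives a uniform \<open>d\<close>.
  The possible jump time r of the chosen interval may lie outside the cell from a to b.\<close>

lemma path_mesh:
 assumes w: "w \<in> space M"
 obtains d where "0 < d" "\<And>a b. 0 <= a ==> a < b ==> b <= T ==> b - a < d ==>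
  \<exists>r c. (\<forall>s. a <= s --> s <= b --> s < r --> \<alpha> s w = c) \<and> (\<forall>s. a <= s --> s <= b --> r <= s --> \<alpha> s w = \<alpha> r w)"
proof -
 have "\<exists>e c. 0 < e \<and> (\<forall>s\<in>{0..T}. r - e < s --> s < r --> \<alpha> s w = c)
   \<and> (\<forall>s\<in>{0..T}. r <= s --> s < r + e --> \<alpha> s w = \<alpha> r w)" if r: "r \<in> {0..T}" for r
 proof -
  have "\<exists>e>0. \<forall>s\<in>{0..T}. r <= s --> s < r + e --> \<alpha> s w = \<alpha> r w"
  proof (cases "r = T")
   case True then show ?thesis by (intro exI[of _ 1]) auto
  next
   case False
   then have "r \<in> {0..<T}" using r by simp
   from path_right[OF w this] obtain b where b: "b > r" "\<And>s. s > r ==> s < b ==> \<alpha> s w = \<alpha> r w"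
    unfolding eventually_at_right_field by blast
   then show ?thesis by (intro exI[of _ "b - r"]) (auto simp: le_less)
  qed
  then obtain e1 where e1: "0 < e1" "\<forall>s\<in>{0..T}. r <= s --> s < r + e1 --> \<alpha> s w = \<alpha> r w" by blast
  have "\<exists>e c. 0 < e \<and> (\<forall>s\<in>{0..T}. r - e < s --> s < r --> \<alpha> s w = c)"
  proof (cases "r = 0")
   case True then show ?thesis by (intro exI[of _ 1]) auto
  next
   case False
   then have "r \<in> {0<..T}" using r by simp
   from path_left[OF w this] obtain i where "left_value \<alpha> r w i" by blast
   then obtain b where b: "b < r" "\<And>s. s > b ==> s < r ==> \<alpha> s w = i"
    unfolding left_value_def eventually_at_left_field by blast
   then show ?thesis by (intro exI[of _ "r - b"] exI[of _ i]) auto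
  qed
  then obtain e2 c where e2: "0 < e2" "\<forall>s\<in>{0..T}. r - e2 < s --> s < r --> \<alpha> s w = c" by blast
  show ?thesis
   by (intro exI[of _ "min e1 e2"] exI[of _ c]) (use e1 e2 in auto)
 qed
 then obtain e c where ec: "\<And>r. r \<in> {0..T} ==> 0 < e r"
  "\<And>r s. r \<in> {0..T} ==> s \<in> {0..T} ==> r - e r < s ==> s < r ==> \<alpha> s w = c r"
  "\<And>r s. r \<in> {0..T} ==> s \<in> {0..T} ==> r <= s ==> s < r + e r ==> \<alpha> s w = \<alpha> r w"
  by metis
 define C where "C = (\<lambda>r. {r - e r<..<r + e r}) ` {0..T}"
 obtain d where d: "0 < d" "\<And>S. S \<subseteq> {0..T} ==> diameter S < d ==> \<exists>B\<in>C. S \<subseteq> B"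
 proof (rule Lebesgue_number_lemma[of "{0..T}" C])
  show "compact {0..T}" by simp
  show "C \<noteq> {}" using T_pos by (auto simp: C_def)
  show "{0..T} \<subseteq> \<Union>C" using ec(1) by (force simp: C_def)
  show "open B" if "B \<in> C" for B using that by (auto simp: C_def)
 qed blast
 show ?thesis
 proof (rule that[OF d(1)])
  fix a b assume ab: "0 <= a" "a < b" "b <= T" "b - a < d"
  have "diameter {a..b} < d" using ab by (simp add: diameter_closed_interval)
  then obtain r where r: "r \<in> {0..T}" "{a..b} \<subseteq> {r - e r<..<r + e r}"
   using d(2)[of "{a..b}"] ab by (auto simp: C_def)
  show "\<exists>r c. (\<forall>s. a <= s --> s <= b --> s < r --> \<alpha> s w = c) \<and> (\<forall>s. a <= s --> s <= b --> r <= s --> \<alpha> s w = \<alpha> r w)"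
  proof (intro exI[of _ r] exI[of _ "c r"] conjI allI impI)
   fix s assume s: "a <= s" "s <= b"
   then have in_ball: "s \<in> {r - e r<..<r + e r}" "s \<in> {0..T}" using r(2) ab by auto
   show "s < r ==> \<alpha> s w = c r" using ec(2)[OF r(1) in_ball(2)] in_ball by auto
   show "r <= s ==> \<alpha> s w = \<alpha> r w" using ec(3)[OF r(1) in_ball(2)] in_ball by auto
  qed
 qed
qed

definition grid :: "real => real => nat => nat => real" where
 "grid s t n k = s + real k * ((t - s) / real n)"

lemma grid_props:
 assumes "s <= t" "0 < n"
 shows "grid s t n 0 = s" "grid s t n n = t" "grid s t n (Suc k) = grid s t n k + (t - s) / real n"
  "k <= l ==> grid s t n k <= grid s t n l" "s <= grid s t n k" "k <= n ==> grid s t n k <= t"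
proof -
 have d: "0 <= (t - s) / real n" using assms by simp
 show "grid s t n 0 = s" "grid s t n n = t" "grid s t n (Suc k) = grid s t n k + (t - s) / real n"
  using assms by (auto simp: grid_def field_simps)
 show mono: "grid s t n k <= grid s t n l" if "k <= l" for k l
  unfolding grid_def using that d by (intro add_left_mono mult_right_mono) auto
 show "s <= grid s t n k" using mono[of 0 k] assms by (simp add: grid_def)
 show "k <= n ==> grid s t n k <= t" using mono[of k n] \<open>grid s t n n = t\<close> by simp
qed

definition grid_count :: "'s => 's => real => real => nat => 'w => real" where
 "grid_count i j s t n w =
   (\<Sum>k<n. indicator (at_state (grid s t n k) i \<inter> at_state (grid s t n (Suc k)) j) w)"

text \<open>Once the mesh is below the \<open>d\<close> of the path, every cell holds at most one
  jump, and the values at its two ends reveal it. The count on the grid is then exact, not just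
  close.\<close>

lemma jumps_finite_count:
 assumes w: "w \<in> space M" and st: "0 <= s" "s < t" "t <= T" and ij: "i \<noteq> j"
 shows "finite (jumps_in \<alpha> i j s t w)"
  and "\<forall>\<^sub>F n in sequentially. grid_count i j s t n w = real (card (jumps_in \<alpha> i j s t w))"
proof -
 obtain d where d: "0 < d" "\<And>a b. 0 <= a ==> a < b ==> b <= T ==> b - a < d ==>
  \<exists>r c. (\<forall>s. a <= s --> s <= b --> s < r --> \<alpha> s w = c) \<and> (\<forall>s. a <= s --> s <= b --> r <= s --> \<alpha> s w = \<alpha> r w)"
  using path_mesh[OF w] by blast
 have cell: "finite (jumps_in \<alpha> i j a b w) \<and> card (jumps_in \<alpha> i j a b w) = (if \<alpha> a w = i \<and> \<alpha> b w = j then 1 else 0)"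
  if ab: "0 <= a" "a < b" "b <= T" "b - a < d" for a b
 proof -
  obtain r c where "\<And>s. a <= s ==> s <= b ==> s < r ==> \<alpha> s w = c" "\<And>s. a <= s ==> s <= b ==> r <= s ==> \<alpha> s w = \<alpha> r w"
   using d(2)[OF ab] by blast
  from jumps_in_cell[of i j a b r \<alpha> w c, OF ij ab(2) this] show ?thesis by blast
 qed
 have count: "finite (jumps_in \<alpha> i j s t w) \<and> grid_count i j s t n w = real (card (jumps_in \<alpha> i j s t w))"
  if n: "0 < n" "(t - s) / real n < d" for n
 proof -
  let ?u = "grid s t n"
  note g = grid_props[OF less_imp_le[OF st(2)] n(1)]
  have "finite (jumps_in \<alpha> i j s (?u m) w) \<and>
    (\<Sum>k<m. indicator (at_state (?u k) i \<inter> at_state (?u (Suc k)) j) w) = real (card (jumps_in \<alpha> i j s (?u m) w))"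
   if "m <= n" for m
   using that
  proof (induction m)
   case 0
   have "jumps_in \<alpha> i j s s w = {}" by (auto simp: jumps_in_def)
   then show ?case using g(1) by simp
  next
   case (Suc m)
   have le: "s <= ?u m" "?u m < ?u (Suc m)" "?u (Suc m) <= t" "?u (Suc m) - ?u m < d"
    using g(5)[of m] g(3)[of m] g(6)[of "Suc m"] Suc.prems n st by auto
   have c: "finite (jumps_in \<alpha> i j (?u m) (?u (Suc m)) w)"
    "card (jumps_in \<alpha> i j (?u m) (?u (Suc m)) w) = (if \<alpha> (?u m) w = i \<and> \<alpha> (?u (Suc m)) w = j then 1 else 0)"
    using cell[of "?u m" "?u (Suc m)"] le st by auto
   have IH: "finite (jumps_in \<alpha> i j s (?u m) w)"
    "(\<Sum>k<m. indicator (at_state (?u k) i \<inter> at_state (?u (Suc k)) j) w) = real (card (jumps_in \<alpha> i j s (?u m) w))"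
    using Suc by auto
   note sp = jumps_in_split[OF le(1) less_imp_le[OF le(2)], of \<alpha> i j w]
   have "card (jumps_in \<alpha> i j s (?u (Suc m)) w) = card (jumps_in \<alpha> i j s (?u m) w) + card (jumps_in \<alpha> i j (?u m) (?u (Suc m)) w)"
    unfolding sp(1) by (rule card_Un_disjoint[OF IH(1) c(1) sp(2)])
   moreover have "finite (jumps_in \<alpha> i j s (?u (Suc m)) w)" unfolding sp(1) using IH(1) c(1) by simp
   moreover have "(\<Sum>k<Suc m. indicator (at_state (?u k) i \<inter> at_state (?u (Suc k)) j) w)
    = real (card (jumps_in \<alpha> i j s (?u m) w)) + (if \<alpha> (?u m) w = i \<and> \<alpha> (?u (Suc m)) w = j then 1 else 0)"
    using w IH(2) by (simp add: indicator_def)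
   ultimately show ?case using c(2) by simp
  qed
  from this[of n] show ?thesis using g(2) by (simp add: grid_count_def)
 qed
 have "(\<lambda>n. (t - s) / real n) \<longlonglongrightarrow> 0" by (rule lim_const_over_n)
 then have ev: "\<forall>\<^sub>F n in sequentially. (t - s) / real n < d" using d(1) by (rule order_tendstoD)
 with eventually_gt_at_top[of 0]
 have *: "\<forall>\<^sub>F n in sequentially. finite (jumps_in \<alpha> i j s t w) \<and> grid_count i j s t n w = real (card (jumps_in \<alpha> i j s t w))"
  by eventually_elim (rule count)
 then show "finite (jumps_in \<alpha> i j s t w)" using eventually_happens'[OF sequentially_bot] by blast
 show "\<forall>\<^sub>F n in sequentially. grid_count i j s t n w = real (card (jumps_in \<alpha> i j s t w))"
  using * by eventually_elim blast
qed

end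

section \<open>The compensated jump martingales\<close>

lemma sum_sq_indicator:
 "(\<Sum>k<n. indicator (E k) w :: real)\<^sup>2 = (\<Sum>k<(n::nat). \<Sum>l<n. indicator (E k \<inter> E l) w)"
 by (simp add: power2_eq_square sum_product indicator_inter_arith)

context regime_noise begin

lemma transition_step:
 assumes "0 <= r" "r <= r'" "r' <= T" and A: "A \<in> sets (joint r)"
 shows "prob (A \<inter> (at_state r i \<inter> at_state r' j)) = transition (r' - r) i j * prob (A \<inter> at_state r i)"
proof -
 have e: "at_state r i \<in> sets (joint r)"
  using at_state_chain[of r r i] chain_subset_mixed assms unfolding joint_eq_mixed by blast
 have "prob ((A \<inter> at_state r i) \<inter> at_state r' j)
  = (\<Sum>k\<in>UNIV. transition (r' - r) k j * prob ((A \<inter> at_state r i) \<inter> at_state r k))"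
  using assms A e by (intro joint_transition) auto
 also have "... = (\<Sum>k\<in>UNIV. if k = i then transition (r' - r) k j * prob (A \<inter> at_state r i) else 0)"
 proof (intro sum.cong refl)
  fix k
  have "(A \<inter> at_state r i) \<inter> at_state r k = (if k = i then A \<inter> at_state r i else {})" by auto
  then show "transition (r' - r) k j * prob ((A \<inter> at_state r i) \<inter> at_state r k)
   = (if k = i then transition (r' - r) k j * prob (A \<inter> at_state r i) else 0)" by (simp only: split: if_split) simp
 qed
 finally show ?thesis by (simp add: Int_assoc)
qed

definition jump_count :: "'s => 's => real => real => 'w => real" where
 "jump_count i j s t w = real (card (jumps_in \<alpha> i j s t w))"

lemma grid_cell_chain:
 assumes st: "0 <= s" "s < t" and k: "k < n"
 shows "at_state (grid s t n k) i \<inter> at_state (grid s t n (Suc k)) j \<in> sets (chain (grid s t n (Suc k)))"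
proof -
 have n: "0 < n" using k by simp
 note g = grid_props[OF less_imp_le[OF st(2)] n]
 have "0 <= grid s t n k" "0 <= grid s t n (Suc k)" "grid s t n k <= grid s t n (Suc k)"
  using g(5)[of k] g(5)[of "Suc k"] g(4)[of k "Suc k"] st by auto
 then show ?thesis by (intro sets.Int at_state_chain) auto
qed

lemma grid_count_measurable:
 assumes st: "0 <= s" "s < t"
 shows "grid_count i j s t n \<in> Bm (chain t)"
 unfolding grid_count_def[abs_def]
proof (intro borel_measurable_sum borel_measurable_indicator)
 fix k assume "k \<in> {..<n}"
 then have "k < n" by simp
 have "grid s t n (Suc k) <= t" using grid_props(6)[of s t n "Suc k"] st \<open>k < n\<close> by simp
 then show "at_state (grid s t n k) i \<inter> at_state (grid s t n (Suc k)) j \<in> sets (chain t)"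
  using grid_cell_chain[OF st \<open>k < n\<close>] chain_filtration_mono by blast
qed

text \<open>A bound independent of the grid. One cell sees the transition with probability at most
  p, two different cells with at most p^2 by the Markov property, so the second moment is at most n
  p + (n p)^2. The Lipschitz bound for the transition probabilities gives n p <=
  \<open>c\<close>.\<close>

lemma grid_count_second_moment:
 assumes st: "0 <= s" "s < t" "t <= T" and ij: "i \<noteq> j"
 defines "c \<equiv> (\<Sum>k\<in>UNIV. \<bar>gen k j\<bar>) * (t - s)"
 shows "sq_integrable M (grid_count i j s t n)"
  and "(\<E> w. (grid_count i j s t n w)\<^sup>2) <= c + c\<^sup>2"
proof -
 define E where "E k = at_state (grid s t n k) i \<inter> at_state (grid s t n (Suc k)) j" for k
 have Ee: "E k \<in> events" if "k < n" for k
 proof -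
  have "grid s t n (Suc k) <= T" using grid_props(6)[of s t n "Suc k"] st that by simp
  then show ?thesis using grid_cell_chain[OF st(1,2) that] chain_events unfolding E_def by blast
 qed
 have meas: "grid_count i j s t n \<in> Bm M"
  by (rule measurable_from_subalg[OF subalgebra_chain grid_count_measurable]) (use st in auto)
 have le_n: "\<bar>grid_count i j s t n w\<bar> <= real n" for w
 proof -
  have "(\<Sum>k<n. indicator (E k) w :: real) <= (\<Sum>k<n. 1)" by (intro sum_mono) (auto split: split_indicator)
  moreover have "0 <= (\<Sum>k<n. indicator (E k) w :: real)" by (intro sum_nonneg) auto
  ultimately show ?thesis by (simp add: grid_count_def E_def)
 qed
 show "sq_integrable M (grid_count i j s t n)"
  by (rule sq_integrable_bounded[OF finite_measure_axioms meas le_n])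
 show "(\<E> w. (grid_count i j s t n w)\<^sup>2) <= c + c\<^sup>2"
 proof (cases "n = 0")
  case True
  have "0 <= c" unfolding c_def using st by (intro mult_nonneg_nonneg sum_nonneg) auto
  then show ?thesis using True by (simp add: grid_count_def)
 next
  case False
  then have n: "0 < n" by simp
  note g = grid_props[OF less_imp_le[OF st(2)] n]
  define d where "d = (t - s) / real n"
  define p where "p = transition d i j"
  have d: "0 <= d" using st by (simp add: d_def)
  have p0: "0 <= p" using semi.p_nonneg[OF d] by (simp add: p_def)
  have "\<bar>transition d i j - transition 0 i j\<bar> <= (\<Sum>k\<in>UNIV. \<bar>gen k j\<bar>) * \<bar>d - 0\<bar>"
   using d by (intro semi.p_lipschitz) auto
  then have "p <= (\<Sum>k\<in>UNIV. \<bar>gen k j\<bar>) * d" using ij d by (simp add: p_def semi.p_zero)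
  then have "real n * p <= real n * ((\<Sum>k\<in>UNIV. \<bar>gen k j\<bar>) * d)" by (intro mult_left_mono) auto
  also have "... = c" using n by (simp add: c_def d_def)
  finally have np: "real n * p <= c" .
  have bounds: "0 <= grid s t n k" "grid s t n k <= grid s t n (Suc k)" "grid s t n (Suc k) <= T" if "k < n" for k
   using g(5)[of k] g(4)[of k "Suc k"] g(6)[of "Suc k"] st that by auto
  have diff: "grid s t n (Suc k) - grid s t n k = d" for k using g(3)[of k] by (simp add: d_def)
  have step: "prob (A \<inter> E k) <= p * prob A" if k: "k < n" and A: "A \<in> sets (joint (grid s t n k))" for A k
  proof -
   have "prob (A \<inter> E k) = p * prob (A \<inter> at_state (grid s t n k) i)"
    unfolding E_def using transition_step[OF bounds[OF k] A] diff by (simp add: p_def)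
   also have "... <= p * prob A"
   proof (intro mult_left_mono p0 finite_measure_mono)
    have "grid s t n k <= T" using bounds[OF k] by simp
    then show "A \<in> events" using A subalgebra_joint by (auto simp: subalgebra_def)
   qed auto
   finally show ?thesis .
  qed
  have single: "prob (E k) <= p" if k: "k < n" for k
  proof -
   have "space M \<in> sets (joint (grid s t n k))" using sets.top[of "joint (grid s t n k)"] by simp
   from step[OF k this] have "prob (space M \<inter> E k) <= p" by (simp add: prob_space)
   moreover have "space M \<inter> E k = E k" by (auto simp: E_def)
   ultimately show ?thesis by simp
  qed
  have pair: "prob (E k \<inter> E l) <= p\<^sup>2" if kl: "k < l" "l < n" for k l
  proof -
   have "E k \<in> sets (chain (grid s t n (Suc k)))" unfolding E_def using kl st by (intro grid_cell_chain) auto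
   moreover have "grid s t n (Suc k) <= grid s t n l" using g(4)[of "Suc k" l] kl by simp
   ultimately have "E k \<in> sets (joint (grid s t n l))"
    using chain_filtration_mono chain_subset_mixed unfolding joint_eq_mixed by blast
   then have "prob (E k \<inter> E l) <= p * prob (E k)" by (rule step[OF kl(2)])
   also have "... <= p * p" using single[of k] kl p0 by (intro mult_left_mono) auto
   finally show ?thesis by (simp add: power2_eq_square)
  qed
  have pair': "prob (E k \<inter> E l) <= (if k = l then p else 0) + p\<^sup>2" if "k < n" "l < n" for k l
   using single[of k] pair[of k l] pair[of l k] that
   by (cases k l rule: linorder_cases) (auto simp: Int_commute add_increasing2)
  have "(\<E> w. (grid_count i j s t n w)\<^sup>2) = (\<E> w. \<Sum>k<n. \<Sum>l<n. indicator (E k \<inter> E l) w)"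
   unfolding grid_count_def E_def[symmetric] sum_sq_indicator ..
  also have "... = (\<Sum>k<n. \<Sum>l<n. prob (E k \<inter> E l))"
  proof -
   have "integrable M (indicator (E k \<inter> E l) :: 'w => real)" if "k < n" "l < n" for k l
    using Ee that by (intro integrable_real_indicator) (auto simp: emeasure_eq_measure)
   then show ?thesis
    using Ee by (subst lintegral_sum, force)
     (intro sum.cong refl, subst lintegral_sum, auto)
  qed
  also have "... <= (\<Sum>k<n. \<Sum>l<n. (if k = l then p else 0) + p\<^sup>2)"
   by (intro sum_mono pair') auto
  also have "... = real n * p + (real n * p)\<^sup>2"
  proof -
   have "(\<Sum>l<n. (if k = l then p else 0) + p\<^sup>2) = p + real n * p\<^sup>2" if "k < n" for k
    using that by (simp add: sum.distrib)
   then show ?thesis by (simp add: distrib_left power2_eq_square)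
  qed
  also have "... <= c + c\<^sup>2" using np p0 n by (intro add_mono power_mono) auto
  finally show ?thesis .
 qed
qed

lemma jump_count_measurable:
 assumes st: "0 <= s" "s < t" "t <= T" and ij: "i \<noteq> j"
 shows "jump_count i j s t \<in> Bm (chain t)"
proof (rule borel_measurable_LIMSEQ_real[OF _ grid_count_measurable[OF st(1,2)]])
 fix w assume "w \<in> space (chain t)"
 then have "w \<in> space M" by simp
 from jumps_finite_count(2)[OF this st ij]
 show "(\<lambda>n. grid_count i j s t n w) \<longlonglongrightarrow> jump_count i j s t w"
  by (simp add: jump_count_def tendsto_eventually)
qed

text \<open>Fatou along the grid counts, whose second moments are uniformly bounded.\<close>

lemma jump_count_sq:
 assumes st: "0 <= s" "s < t" "t <= T" and ij: "i \<noteq> j"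
 shows "sq_integrable M (jump_count i j s t)"
proof -
 have m: "jump_count i j s t \<in> Bm M"
  by (rule measurable_from_subalg[OF subalgebra_chain jump_count_measurable]) (use st ij in auto)
 define B where "B = (\<Sum>k\<in>UNIV. \<bar>gen k j\<bar>) * (t - s) + ((\<Sum>k\<in>UNIV. \<bar>gen k j\<bar>) * (t - s))\<^sup>2"
 note g = grid_count_second_moment[OF st ij, folded B_def]
 have nn: "(\<integral>\<^sup>+w. ennreal ((grid_count i j s t n w)\<^sup>2) \<partial>M) <= ennreal B" for n
 proof -
  have "(\<integral>\<^sup>+w. ennreal ((grid_count i j s t n w)\<^sup>2) \<partial>M) = ennreal ((\<E> w. (grid_count i j s t n w)\<^sup>2))"
   using g(1)[of n] by (intro nn_integral_eq_integral) (auto simp: sq_integrable_def)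
  then show ?thesis using g(2)[of n] by (simp add: ennreal_leI)
 qed
 have "(\<integral>\<^sup>+w. ennreal ((jump_count i j s t w)\<^sup>2) \<partial>M)
  = (\<integral>\<^sup>+w. liminf (\<lambda>n. ennreal ((grid_count i j s t n w)\<^sup>2)) \<partial>M)"
 proof (rule nn_integral_cong)
  fix w assume "w \<in> space M"
  from jumps_finite_count(2)[OF this st ij]
  have "\<forall>\<^sub>F n in sequentially. ennreal ((grid_count i j s t n w)\<^sup>2) = ennreal ((jump_count i j s t w)\<^sup>2)"
   by eventually_elim (simp add: jump_count_def)
  then have "(\<lambda>n. ennreal ((grid_count i j s t n w)\<^sup>2)) \<longlonglongrightarrow> ennreal ((jump_count i j s t w)\<^sup>2)"
   by (rule tendsto_eventually)
  then show "ennreal ((jump_count i j s t w)\<^sup>2) = liminf (\<lambda>n. ennreal ((grid_count i j s t n w)\<^sup>2))"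
   by (intro lim_imp_Liminf[symmetric]) auto
 qed
 also have "... <= liminf (\<lambda>n. \<integral>\<^sup>+w. ennreal ((grid_count i j s t n w)\<^sup>2) \<partial>M)"
  using g(1) by (intro nn_integral_liminf) (auto simp: sq_integrable_def)
 also have "... <= ennreal B"
  by (rule Liminf_le) (use nn in auto)
 finally have "(\<integral>\<^sup>+w. ennreal ((jump_count i j s t w)\<^sup>2) \<partial>M) < \<infinity>"
  using le_less_trans by fastforce
 then have "integrable M (\<lambda>w. (jump_count i j s t w)\<^sup>2)" using m by (simp add: integrable_iff_bounded)
 then show ?thesis using m by (simp add: sq_integrable_def)
qed

text \<open>Grid count and jump count agree from some n on for each path, but no dominating function
  is at hand. Instead, Cauchy-Schwarz bounds the difference of the means by the bounded second
  moments and the probability that the counts still differ.\<close>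

lemma grid_count_mean_limit:
 assumes st: "0 <= s" "s < t" "t <= T" and ij: "i \<noteq> j" and A: "A \<in> events"
 shows "(\<lambda>n. (\<E> w. indicator A w * grid_count i j s t n w)) \<longlonglongrightarrow> (\<E> w. indicator A w * jump_count i j s t w)"
proof -
 define D where "D n w = grid_count i j s t n w - jump_count i j s t w" for n w
 define S where "S n = {w \<in> space M. D n w \<noteq> 0}" for n
 define B where "B = (\<Sum>k\<in>UNIV. \<bar>gen k j\<bar>) * (t - s) + ((\<Sum>k\<in>UNIV. \<bar>gen k j\<bar>) * (t - s))\<^sup>2"
 note g = grid_count_second_moment[OF st ij, folded B_def]
 note N = jump_count_sq[OF st ij]
 have Dsq: "sq_integrable M (D n)" for n
  using sq_integrable_diff[OF g(1) N] by (simp add: D_def[abs_def])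
 have [measurable]: "D n \<in> Bm M" for n using Dsq by (simp add: sq_integrable_def)
 have S: "S n \<in> events" for n unfolding S_def by measurable
 define C where "C = 2 * B + 2 * (\<E> w. (jump_count i j s t w)\<^sup>2)"
 have D2: "(\<E> w. (D n w)\<^sup>2) <= C" for n
 proof -
  have i: "integrable M (\<lambda>w. (grid_count i j s t n w)\<^sup>2)" "integrable M (\<lambda>w. (jump_count i j s t w)\<^sup>2)"
   using g(1) N by (auto simp: sq_integrable_def)
  have "(a - b)\<^sup>2 <= 2 * a\<^sup>2 + 2 * b\<^sup>2" for a b :: real
   using sum_squares_bound[of a "-b"] by (simp add: power2_diff)
  then have "(\<E> w. (D n w)\<^sup>2) <= (\<E> w. 2 * (grid_count i j s t n w)\<^sup>2 + 2 * (jump_count i j s t w)\<^sup>2)"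
   using Dsq i by (intro integral_mono) (auto simp: D_def sq_integrable_def)
  also have "... = 2 * (\<E> w. (grid_count i j s t n w)\<^sup>2) + 2 * (\<E> w. (jump_count i j s t w)\<^sup>2)"
   using i by simp
  also have "... <= C" unfolding C_def using g(2)[of n] by simp
  finally show ?thesis .
 qed
 have "(\<lambda>n. prob (S n)) \<longlonglongrightarrow> 0"
 proof -
  have "(\<lambda>n. (\<E> w. indicator (S n) w :: real)) \<longlonglongrightarrow> (\<E> w. 0 :: real)"
  proof (rule integral_dominated_convergence[where w = "\<lambda>_. 1"])
   show "AE w in M. (\<lambda>n. indicator (S n) w :: real) \<longlonglongrightarrow> 0"
   proof (rule AE_I2)
    fix w assume "w \<in> space M"
    from jumps_finite_count(2)[OF this st ij]
    have "\<forall>\<^sub>F n in sequentially. indicator (S n) w = (0::real)"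
     by eventually_elim (simp add: S_def D_def jump_count_def)
    then show "(\<lambda>n. indicator (S n) w :: real) \<longlonglongrightarrow> 0" by (rule tendsto_eventually)
   qed
  qed (use S in \<open>auto split: split_indicator\<close>)
  then show ?thesis using S by simp
 qed
 then have "(\<lambda>n. prob (S n) * C) \<longlonglongrightarrow> 0" by (rule tendsto_mult_left_zero)
 moreover have "((\<E> w. indicator A w * D n w))\<^sup>2 <= prob (S n) * C" for n
 proof -
  have ASq: "sq_integrable M (indicator (A \<inter> S n))"
   using A S by (intro sq_integrable_indicator) auto
  have "(\<E> w. indicator A w * D n w) = (\<E> w. indicator (A \<inter> S n) w * D n w)"
   by (intro lintegral_cong) (auto simp: S_def split: split_indicator)
  then have "((\<E> w. indicator A w * D n w))\<^sup>2
   <= (\<E> w. (indicator (A \<inter> S n) w)\<^sup>2) * (\<E> w. (D n w)\<^sup>2)"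
   using Cauchy_Schwarz_integral[OF ASq Dsq] by simp
  also have "(\<E> w. (indicator (A \<inter> S n) w :: real)\<^sup>2) = prob (A \<inter> S n)"
  proof -
   have "(\<lambda>w. (indicator (A \<inter> S n) w :: real)\<^sup>2) = indicator (A \<inter> S n)" by (auto split: split_indicator)
   then show ?thesis using A S by simp
  qed
  also have "prob (A \<inter> S n) * (\<E> w. (D n w)\<^sup>2) <= prob (S n) * C"
   using S D2[of n] by (intro mult_mono finite_measure_mono) (auto intro: integral_nonneg_AE order_trans[OF _ D2])
  finally show ?thesis .
 qed
 ultimately have "(\<lambda>n. ((\<E> w. indicator A w * D n w))\<^sup>2) \<longlonglongrightarrow> 0"
  by (intro nonneg_tendsto_zero[of "\<lambda>n. ((\<E> w. indicator A w * D n w))\<^sup>2" "\<lambda>n. prob (S n) * C"]) auto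
 from tendsto_real_sqrt[OF this] have "(\<lambda>n. (\<E> w. indicator A w * D n w)) \<longlonglongrightarrow> 0"
  by (simp add: tendsto_rabs_zero_iff)
 moreover have "(\<E> w. indicator A w * D n w) =
   (\<E> w. indicator A w * grid_count i j s t n w) - (\<E> w. indicator A w * jump_count i j s t w)" for n
 proof -
  have "sq_integrable M (indicator A)"
   using A by (intro sq_integrable_indicator) auto
  then show ?thesis unfolding D_def right_diff_distrib
   using sq_integrable_mult g(1) N by (intro lintegral_diff) auto
 qed
 ultimately show ?thesis by (simp add: LIM_zero_cancel)
qed

text \<open>On a cell of length h, comparing the primitive with its tangent at the left end costs at
  most K h^2; the n cells add up to an error of order 1/n.\<close>

lemma lipschitz_left_riemann:
 fixes q :: "real => real"
 assumes st: "s < t" and q: "\<And>a b. s <= a ==> a <= b ==> b <= t ==> \<bar>q b - q a\<bar> <= K * (b - a)"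
 shows "(\<lambda>n. \<Sum>k<n. ((t - s) / real n) * q (grid s t n k)) \<longlonglongrightarrow> (LINT r:{s..t}|lborel. q r)"
proof -
 have K0: "0 <= K"
 proof -
  have "0 <= \<bar>q t - q s\<bar>" by simp
  also have "... <= K * (t - s)" using q[of s t] st by simp
  finally show ?thesis using st by (simp add: zero_le_mult_iff)
 qed
 have "lipschitz_on K {s..t} q"
 proof (rule lipschitz_onI)
  fix x y assume "x \<in> {s..t}" "y \<in> {s..t}"
  then show "dist (q x) (q y) <= K * dist x y"
   using q[of x y] q[of y x] by (cases x y rule: linorder_cases) (auto simp: dist_real_def abs_minus_commute)
 qed (rule K0)
 then have cont: "continuous_on {s..t} q" by (rule lipschitz_on_continuous_on)
 define F where "F r = integral {s..r} q" for r
 have F: "(F has_real_derivative q r) (at r within {s..t})" if "r \<in> {s..t}" for r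
  using integral_has_vector_derivative[OF cont that]
  by (simp add: F_def[abs_def] has_real_derivative_iff_has_vector_derivative)
 have "set_integrable lborel {s..t} q"
  by (rule borel_integrable_atLeastAtMost'[OF cont])
 from set_borel_integral_eq_integral(2)[OF this]
 have val: "(LINT r:{s..t}|lborel. q r) = F t - F s" by (simp add: F_def)
 have bound: "\<bar>(\<Sum>k<n. ((t - s) / real n) * q (grid s t n k)) - (F t - F s)\<bar> <= K * (t - s)\<^sup>2 / real n" if n: "0 < n" for n
 proof -
  note g = grid_props[OF less_imp_le[OF st] n]
  have tel: "F t - F s = (\<Sum>k<n. F (grid s t n (Suc k)) - F (grid s t n k))"
   using sum_lessThan_telescope[of "\<lambda>k. F (grid s t n k)" n] g by simp
  have cell: "\<bar>((t - s) / real n) * q (grid s t n k) - (F (grid s t n (Suc k)) - F (grid s t n k))\<bar> <= K * ((t - s) / real n)\<^sup>2"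
   if k: "k < n" for k
  proof -
   let ?a = "grid s t n k" and ?b = "grid s t n (Suc k)"
   have ab: "?a < ?b" "s <= ?a" "?b <= t" "?b - ?a = (t - s) / real n"
    using g(3)[of k] g(5)[of k] g(6)[of "Suc k"] k st n by auto
   have "norm ((F ?b - q ?a * ?b) - (F ?a - q ?a * ?a)) <= K * (?b - ?a) * norm (?b - ?a)"
   proof (rule field_differentiable_bound[of "{?a..?b}" "\<lambda>r. F r - q ?a * r" "\<lambda>r. q r - q ?a"])
    fix r assume r: "r \<in> {?a..?b}"
    have "(F has_real_derivative q r) (at r within {?a..?b})"
     by (rule DERIV_subset[OF F]) (use r ab in auto)
    then show "((\<lambda>r. F r - q ?a * r) has_real_derivative q r - q ?a) (at r within {?a..?b})"
     by (auto intro!: derivative_eq_intros)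
    have "\<bar>q r - q ?a\<bar> <= K * (r - ?a)" using q r ab by auto
    also have "... <= K * (?b - ?a)" using r K0 by (intro mult_left_mono) auto
    finally show "norm (q r - q ?a) <= K * (?b - ?a)" by simp
   qed (use ab in auto)
   then have "\<bar>q ?a * (?b - ?a) - (F ?b - F ?a)\<bar> <= K * (?b - ?a) * \<bar>?b - ?a\<bar>"
    by (simp add: right_diff_distrib abs_minus_commute algebra_simps)
   then show ?thesis using st by (simp add: ab(4) power2_eq_square mult_ac abs_of_pos)
  qed
  have "\<bar>(\<Sum>k<n. ((t - s) / real n) * q (grid s t n k)) - (F t - F s)\<bar>
   = \<bar>\<Sum>k<n. ((t - s) / real n) * q (grid s t n k) - (F (grid s t n (Suc k)) - F (grid s t n k))\<bar>"
   unfolding tel by (simp add: sum_subtractf)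
  also have "... <= (\<Sum>k<n. K * ((t - s) / real n)\<^sup>2)"
   by (rule order_trans[OF sum_abs]) (intro sum_mono cell, simp)
  also have "... = K * (t - s)\<^sup>2 / real n" using n by (simp add: power2_eq_square field_simps)
  finally show ?thesis .
 qed
 have "(\<lambda>n. K * (t - s)\<^sup>2 / real n) \<longlonglongrightarrow> 0" by (rule lim_const_over_n)
 then have "(\<lambda>n. (\<Sum>k<n. ((t - s) / real n) * q (grid s t n k)) - (F t - F s)) \<longlonglongrightarrow> 0"
 proof (rule Lim_null_comparison[rotated])
  show "\<forall>\<^sub>F n in sequentially. norm ((\<Sum>k<n. ((t - s) / real n) * q (grid s t n k)) - (F t - F s)) <= K * (t - s)\<^sup>2 / real n"
   using eventually_gt_at_top[of 0] by eventually_elim (use bound in simp)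
 qed
 then show ?thesis unfolding val by (rule LIM_zero_cancel)
qed

text \<open>With step h, the cell starting at r contributes p(h) i j times the probability of
  \<open>A\<close> together with state \<open>i\<close> at r. The mean count is thus p(h) i j / h,
  which tends to the rate, times a left Riemann sum of a Lipschitz function.\<close>

lemma expectation_jump_count:
 assumes st: "0 <= s" "s < t" "t <= T" and ij: "i \<noteq> j" and A: "A \<in> sets (joint s)"
 shows "(\<E> w. indicator A w * jump_count i j s t w)
  = (LINT r:{s..t}|lborel. gen i j * prob (A \<inter> at_state r i))"
proof -
 have Ae: "A \<in> events" using A subalgebra_joint[of s] st by (auto simp: subalgebra_def)
 define q where "q r = prob (A \<inter> at_state r i)" for r
 have q: "q r = (\<Sum>m\<in>UNIV. transition (r - s) m i * prob (A \<inter> at_state s m))" if "s <= r" "r <= t" for r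
  unfolding q_def using that st A by (intro joint_transition) auto
 define L where "L = (\<Sum>k\<in>UNIV. \<bar>gen k i\<bar>)"
 define K where "K = (\<Sum>m\<in>(UNIV::'s set). L * prob (A \<inter> at_state s m))"
 have lip: "\<bar>q b - q a\<bar> <= K * (b - a)" if ab: "s <= a" "a <= b" "b <= t" for a b
 proof -
  have "\<bar>q b - q a\<bar> = \<bar>\<Sum>m\<in>UNIV. (transition (b - s) m i - transition (a - s) m i) * prob (A \<inter> at_state s m)\<bar>"
   using ab by (simp add: q left_diff_distrib sum_subtractf)
  also have "... <= (\<Sum>m\<in>UNIV. \<bar>transition (b - s) m i - transition (a - s) m i\<bar> * prob (A \<inter> at_state s m))"
   by (rule order_trans[OF sum_abs]) (simp add: abs_mult)
  also have "... <= (\<Sum>m\<in>(UNIV::'s set). (L * (b - a)) * prob (A \<inter> at_state s m))"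
   using ab semi.p_lipschitz[of "a - s" "b - s", where j = i, folded L_def] by (intro sum_mono mult_right_mono) auto
  also have "... = K * (b - a)"
   unfolding K_def sum_distrib_right by (simp only: mult_ac)
  finally show ?thesis .
 qed
 have mean: "(\<E> w. indicator A w * grid_count i j s t n w)
  = (transition ((t - s) / real n) i j / ((t - s) / real n)) * (\<Sum>k<n. ((t - s) / real n) * q (grid s t n k))" if n: "0 < n" for n
 proof -
  note g = grid_props[OF less_imp_le[OF st(2)] n]
  define E where "E k = at_state (grid s t n k) i \<inter> at_state (grid s t n (Suc k)) j" for k
  have Ee: "E k \<in> events" if "k < n" for k
  proof -
   have "grid s t n (Suc k) <= T" using g(6)[of "Suc k"] st that by simp
   then show ?thesis using grid_cell_chain[OF st(1,2) that] chain_events unfolding E_def by blast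
  qed
  have "(\<E> w. indicator A w * grid_count i j s t n w) = (\<E> w. \<Sum>k<n. indicator (A \<inter> E k) w)"
   unfolding grid_count_def E_def[symmetric] sum_distrib_left indicator_inter_arith ..
  also have "... = (\<Sum>k<n. prob (A \<inter> E k))"
   using Ee Ae by (subst lintegral_sum) (auto intro!: integrable_real_indicator simp: emeasure_eq_measure)
  also have "... = (\<Sum>k<n. transition ((t - s) / real n) i j * q (grid s t n k))"
  proof (intro sum.cong refl)
   fix k assume "k \<in> {..<n}"
   then have k: "0 <= grid s t n k" "grid s t n k <= grid s t n (Suc k)" "grid s t n (Suc k) <= T" "s <= grid s t n k"
    using g(5)[of k] g(4)[of k "Suc k"] g(6)[of "Suc k"] st by auto
   have "A \<in> sets (joint (grid s t n k))"
    using A mixed_filtration_mono[OF k(4) k(4), of M W \<alpha>] unfolding joint_eq_mixed by auto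
   from transition_step[OF k(1-3) this]
   show "prob (A \<inter> E k) = transition ((t - s) / real n) i j * q (grid s t n k)"
    using g(3)[of k] by (simp add: E_def q_def)
  qed
  also have "... = (transition ((t - s) / real n) i j / ((t - s) / real n)) * (\<Sum>k<n. ((t - s) / real n) * q (grid s t n k))"
   using st n by (simp add: sum_distrib_left)
  finally show ?thesis .
 qed
 have "(\<lambda>n. (transition ((t - s) / real n) i j / ((t - s) / real n)) * (\<Sum>k<n. ((t - s) / real n) * q (grid s t n k)))
  \<longlonglongrightarrow> gen i j * (LINT r:{s..t}|lborel. q r)"
 proof (intro tendsto_mult lipschitz_left_riemann[OF st(2) lip])
  have lim: "filterlim (\<lambda>n. (t - s) / real n) (at_right 0) sequentially"
   unfolding filterlim_at
  proof
   show "\<forall>\<^sub>F n in sequentially. (t - s) / real n \<in> {0<..} \<and> (t - s) / real n \<noteq> 0"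
    using eventually_gt_at_top[of 0] by eventually_elim (use st in auto)
   show "(\<lambda>n. (t - s) / real n) \<longlonglongrightarrow> 0" by (rule lim_const_over_n)
  qed
  from filterlim_compose[OF semi.p_quotient[of i j] lim]
  show "(\<lambda>n. transition ((t - s) / real n) i j / ((t - s) / real n)) \<longlonglongrightarrow> gen i j"
   using ij by (simp add: semi.p_zero)
 qed
 then have "(\<lambda>n. (\<E> w. indicator A w * grid_count i j s t n w)) \<longlonglongrightarrow> gen i j * (LINT r:{s..t}|lborel. q r)"
 proof (rule Lim_transform_eventually)
  show "\<forall>\<^sub>F n in sequentially. (transition ((t - s) / real n) i j / ((t - s) / real n)) * (\<Sum>k<n. ((t - s) / real n) * q (grid s t n k))
   = (\<E> w. indicator A w * grid_count i j s t n w)"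
   using eventually_gt_at_top[of 0] by eventually_elim (rule mean[symmetric])
 qed
 from LIMSEQ_unique[OF grid_count_mean_limit[OF st ij Ae] this]
 show ?thesis by (simp add: q_def)
qed

end

context horizon begin

lemma set_integral_clock_Icc:
 fixes h :: "real => real"
 assumes "0 <= s" "t <= T"
 shows "(LINT r:{s..t}|lborel. h r) = (\<integral>r. indicator {s..t} r * h r \<partial>clock T)"
 unfolding integral_clock set_lebesgue_integral_def
 using assms by (intro lintegral_cong) (auto split: split_indicator)

lemma running_additive:
 fixes h :: "real => real"
 assumes h: "integrable (clock T) h" and st: "0 <= s" "s <= t" "t <= T"
 shows "(LINT r:{0..t}|lborel. h r) = (LINT r:{0..s}|lborel. h r) + (LINT r:{s..t}|lborel. h r)"
proof -
 have i: "integrable (clock T) (\<lambda>r. indicator A r * h r)" if "A \<in> sets borel" for A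
 proof (rule lint_bound[OF h])
  have "h \<in> Bm (clock T)" using h by auto
  moreover have "(indicator A :: real => real) \<in> Bm (clock T)"
   using that by (intro measurable_compose[OF measurable_clock_id borel_measurable_indicator])
  ultimately show "(\<lambda>r. indicator A r * h r) \<in> Bm (clock T)" by simp
 qed (auto split: split_indicator)
 have "(\<integral>r. indicator {s..t} r * h r \<partial>clock T)
  = (\<integral>r. indicator {0..t} r * h r - indicator {0..s} r * h r + indicator {s} r * h r \<partial>clock T)"
  using st by (intro lintegral_cong) (auto split: split_indicator)
 also have "... = (\<integral>r. indicator {0..t} r * h r \<partial>clock T) - (\<integral>r. indicator {0..s} r * h r \<partial>clock T)"
  using i integral_clock_point[where r = s and f = h and T = T] by simp
 finally show ?thesis
  using st by (simp add: set_integral_clock_Icc)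
qed

end

context regime_noise begin

text \<open>Evaluated at the current state instead of the left value used by
  \<open>chain_compensator\<close>, so that it is jointly measurable by right continuity. On each
  path the two differ at finitely many times.\<close>

definition intensity :: "'s => 's => real => 'w => real" where
 "intensity i j s w = gen i j * indicator (at_state s i) w"

lemma intensity_sq: "sq_process (intensity i j)"
proof -
 have "sq_process (\<lambda>s w. 1)"
  using sq_process_const[OF sq_integrable_bounded[OF finite_measure_axioms, of "\<lambda>_. 1" 1]] by simp
 then have "sq_process (\<lambda>s w. indicator (at_state s i) w * 1)"
  by (rule sq_process_bounded_mult[where C = 1]) (use at_state_process[of i] in \<open>auto simp: case_prod_unfold split: split_indicator\<close>)
 from sq_process_cmult[OF this, of "gen i j"] show ?thesis by (simp add: intensity_def[abs_def])
qed

lemma chain_compensator_eq: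
 assumes w: "w \<in> space M" and t: "t \<in> {0..T}"
 shows "chain_compensator gen \<alpha> i j t w = running (intensity i j) t w"
proof -
 \<comment> \<open>Time 0 is excepted as well: the left value there looks at negative times, where
   the path is arbitrary.\<close>
 define X where "X = {0} \<union> (\<Union>k. \<Union>l. if k = l then {} else jumps_in \<alpha> k l 0 T w)"
 have "finite X"
  unfolding X_def using jumps_finite_count(1)[OF w, of 0 T] T_pos by auto
 have eq: "left_value \<alpha> s w i \<longleftrightarrow> \<alpha> s w = i" if s: "s \<in> {0..t}" "s \<notin> X" for s
 proof -
  have "s \<noteq> 0" using s(2) by (auto simp: X_def)
  then have s0: "s \<in> {0<..T}" using s(1) t by auto
  then obtain c where c: "left_value \<alpha> s w c" using path_left[OF w] by blast
  have "c = \<alpha> s w"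
  proof (rule ccontr)
   assume ne: "c \<noteq> \<alpha> s w"
   then have "s \<in> jumps_in \<alpha> c (\<alpha> s w) 0 T w" using c s0 by (auto simp: jumps_in_def)
   then have "s \<in> X" unfolding X_def using ne by (intro UnI2 UN_I[of c] UN_I[of "\<alpha> s w"]) auto
   then show False using s(2) by simp
  qed
  then show ?thesis using c left_value_unique[OF c] by blast
 qed
 show ?thesis
  unfolding chain_compensator_def running_def set_lebesgue_integral_def
 proof (rule integral_discrete_difference[of X])
  show "countable X" using \<open>finite X\<close> by (rule countable_finite)
  fix s assume "s \<notin> X"
  then show "indicator {0..t} s *\<^sub>R (gen i j * (if left_value \<alpha> s w i then 1 else 0)) = indicator {0..t} s *\<^sub>R intensity i j s w"
   using eq[of s] w by (cases "s \<in> {0..t}") (simp_all add: intensity_def)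
 qed auto
qed

lemma chain_bracket_eq: "chain_bracket \<alpha> i j t w = jump_count i j 0 t w"
 by (simp add: chain_bracket_def jump_times_eq jump_count_def)

lemma jump_count_trivial: "jump_count i j s s w = 0"
proof -
 have "jumps_in \<alpha> i j s s w = {}" by (auto simp: jumps_in_def)
 then show ?thesis by (simp add: jump_count_def)
qed

lemma jump_count_additive:
 assumes w: "w \<in> space M" and st: "0 <= s" "s < t" "t <= T" and ij: "i \<noteq> j"
 shows "jump_count i j 0 t w = jump_count i j 0 s w + jump_count i j s t w"
proof (cases "s = 0")
 case False
 then have s: "0 < s" using st by simp
 have f: "finite (jumps_in \<alpha> i j 0 s w)" "finite (jumps_in \<alpha> i j s t w)"
  using jumps_finite_count(1)[OF w] s st ij by auto
 show ?thesis
  unfolding jump_count_def jumps_in_split(1)[OF st(1) less_imp_le[OF st(2)]]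
  using card_Un_disjoint[OF f jumps_in_split(2)[OF st(1) less_imp_le[OF st(2)]]] by simp
qed (simp add: jump_count_trivial)

lemma chain_martingale_eq:
 assumes "w \<in> space M" "t \<in> {0..T}" "i \<noteq> j"
 shows "chain_martingale gen \<alpha> i j t w = jump_count i j 0 t w - running (intensity i j) t w"
 using assms by (simp add: chain_martingale_def chain_bracket_eq chain_compensator_eq)

lemma jump_count_initial_measurable:
 assumes "t \<in> {0..T}" "i \<noteq> j"
 shows "jump_count i j 0 t \<in> Bm (chain T)" "sq_integrable M (jump_count i j 0 t)"
proof -
 have "jump_count i j 0 t \<in> Bm (chain T) \<and> sq_integrable M (jump_count i j 0 t)"
 proof (cases "t = 0")
  case True
  have "jump_count i j 0 0 = (\<lambda>w. 0)" by (simp add: fun_eq_iff jump_count_trivial)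
  then show ?thesis using True by (simp add: sq_integrable_zero)
 next
  case False
  then have t: "0 < t" "t <= T" using assms by auto
  have "jump_count i j 0 t \<in> Bm (chain T)"
   by (rule measurable_larger[OF jump_count_measurable _ chain_filtration_mono]) (use t assms in auto)
  then show ?thesis using jump_count_sq[of 0 t i j] t assms by simp
 qed
 then show "jump_count i j 0 t \<in> Bm (chain T)" "sq_integrable M (jump_count i j 0 t)" by auto
qed

lemma running_intensity_measurable:
 assumes t: "t \<in> {0..T}"
 shows "running (intensity i j) t \<in> Bm (chain T)"
proof -
 have "(\<lambda>x. indicator (at_state (snd x) i) (fst x) :: real) \<in> Bm (chain T \<Otimes>\<^sub>M clock T)"
  using measurable_compose[OF measurable_pair_swap' at_state_process_chain[of i]] by (simp add: case_prod_unfold)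
 then have m: "(\<lambda>x. indicator {0..t} (snd x) * intensity i j (snd x) (fst x)) \<in> Bm (chain T \<Otimes>\<^sub>M clock T)"
  unfolding intensity_def by measurable
 have "(\<lambda>w. \<integral>s. indicator {0..t} s * intensity i j s w \<partial>clock T) \<in> Bm (chain T)"
  by (rule clock.borel_measurable_lebesgue_integral) (use m in \<open>simp add: case_prod_unfold\<close>)
 then show ?thesis by (simp add: running_clock[OF t, abs_def])
qed

lemma chain_martingale_measurable:
 assumes t: "t \<in> {0..T}"
 shows "chain_martingale gen \<alpha> i j t \<in> Bm (chain T)"
proof (cases "i = j")
 case True
 then show ?thesis by (simp add: chain_martingale_def[abs_def])
next
 case False
 have "(\<lambda>w. jump_count i j 0 t w - running (intensity i j) t w) \<in> Bm (chain T)"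
  by (intro borel_measurable_diff jump_count_initial_measurable(1) running_intensity_measurable t False)
 then show ?thesis
  by (rule measurable_cong[THEN iffD1, rotated]) (simp add: chain_martingale_eq[OF _ t False])
qed

lemma chain_martingale_sq:
 assumes t: "t \<in> {0..T}"
 shows "sq_integrable M (chain_martingale gen \<alpha> i j t)"
proof (cases "i = j")
 case True
 then show ?thesis by (simp add: chain_martingale_def[abs_def] sq_integrable_zero)
next
 case False
 have "sq_integrable M (\<lambda>w. jump_count i j 0 t w - running (intensity i j) t w)"
  by (intro sq_integrable_diff jump_count_initial_measurable(2) running_sq_bound(1) intensity_sq t False)
 then show ?thesis
 proof (rule sq_integrable_cong_AE)
  show "chain_martingale gen \<alpha> i j t \<in> Bm M"
   by (rule measurable_from_subalg[OF subalgebra_chain chain_martingale_measurable[OF t]]) simp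
 qed (simp add: chain_martingale_eq[OF _ t False])
qed

lemma chain_l2_martingale: "l2_martingale joint (chain_martingale gen \<alpha> i j)"
 unfolding l2_martingale_def
proof (intro conjI ballI allI impI)
 show "sq_integrable M (chain_martingale gen \<alpha> i j t)" if "t \<in> {0..T}" for t
  by (rule chain_martingale_sq[OF that])
 fix s t h assume st: "0 <= s" "s <= t" "t <= T" and h: "h \<in> Bm (joint s)" "sq_integrable M h"
 show "(\<E> w. h w * (chain_martingale gen \<alpha> i j t w - chain_martingale gen \<alpha> i j s w)) = 0"
 proof (cases "i = j \<or> s = t")
  case True
  then show ?thesis by (auto simp: chain_martingale_def)
 next
  case False
  then have ij: "i \<noteq> j" and lt: "s < t" using st by auto
  have s': "s \<in> {0..T}" and t': "t \<in> {0..T}" using st by auto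
  show ?thesis
  proof (rule orthogonal_to_subalgebra[OF _ _ _ h])
   show "subalgebra M (joint s)" using st by (intro subalgebra_joint) auto
   show "sq_integrable M (\<lambda>w. chain_martingale gen \<alpha> i j t w - chain_martingale gen \<alpha> i j s w)"
    by (intro sq_integrable_diff chain_martingale_sq s' t')
   fix A assume A: "A \<in> sets (joint s)"
   have Ae: "A \<in> events" using A subalgebra_joint[of s] st by (auto simp: subalgebra_def)
   have Asq: "sq_integrable M (indicator A)"
    using Ae by (intro sq_integrable_indicator) auto
   have comp: "(\<E> w. indicator A w * running (intensity i j) r w)
    = (LINT x:{0..r}|lborel. gen i j * prob (A \<inter> at_state x i))" if r: "r \<in> {0..T}" for r
   proof -
    have int: "integrable Q (\<lambda>(x, w). indicator A w * intensity i j x w)"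
     by (rule sq_process_mult[OF sq_process_const[OF Asq] intensity_sq])
    have "(\<E> w. indicator A w * running (intensity i j) r w)
     = (\<integral>x. indicator {0..r} x * (\<E> w. indicator A w * intensity i j x w) \<partial>clock T)"
     using expectation_running[OF intensity_sq Asq r] mean_integral_fst[OF int, of r] by simp
    also have "... = (\<integral>x. indicator {0..r} x * (gen i j * prob (A \<inter> at_state x i)) \<partial>clock T)"
    proof (rule lintegral_cong[OF refl])
     fix x assume "x \<in> space (clock T)"
     then have "at_state x i \<in> events" by (intro at_state_event) simp
     moreover have "(\<lambda>w. indicator A w * intensity i j x w) = (\<lambda>w. gen i j * indicator (A \<inter> at_state x i) w)"
      by (auto simp: intensity_def fun_eq_iff split: split_indicator)
     ultimately show "indicator {0..r} x * (\<E> w. indicator A w * intensity i j x w)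
      = indicator {0..r} x * (gen i j * prob (A \<inter> at_state x i))" using Ae by simp
    qed
    also have "... = (LINT x:{0..r}|lborel. gen i j * prob (A \<inter> at_state x i))"
     using r by (intro set_integral_clock_Icc[symmetric]) auto
    finally show ?thesis .
   qed
   have hint: "integrable (clock T) (\<lambda>x. gen i j * prob (A \<inter> at_state x i))"
   proof -
    have int: "integrable Q (\<lambda>(x, w). indicator A w * intensity i j x w)"
     by (rule sq_process_mult[OF sq_process_const[OF Asq] intensity_sq])
    have "integrable (clock T) (\<lambda>x. (\<E> w. indicator A w * intensity i j x w))"
     by (rule pair.integrable_fst[OF int])
    moreover have "(\<E> w. indicator A w * intensity i j x w) = gen i j * prob (A \<inter> at_state x i)"
     if "x \<in> space (clock T)" for x
    proof -
     have "at_state x i \<in> events" using that by (intro at_state_event) simp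
     moreover have "(\<lambda>w. indicator A w * intensity i j x w) = (\<lambda>w. gen i j * indicator (A \<inter> at_state x i) w)"
      by (auto simp: intensity_def fun_eq_iff split: split_indicator)
     ultimately show ?thesis using Ae by simp
    qed
    ultimately show ?thesis using lint_cong[OF refl] by (metis (no_types, lifting))
   qed
   have "(\<E> w. indicator A w * (chain_martingale gen \<alpha> i j t w - chain_martingale gen \<alpha> i j s w))
    = (\<E> w. indicator A w * jump_count i j s t w
      - (indicator A w * running (intensity i j) t w - indicator A w * running (intensity i j) s w))"
    by (rule lintegral_cong[OF refl])
     (simp add: chain_martingale_eq[OF _ s' ij] chain_martingale_eq[OF _ t' ij] jump_count_additive[OF _ st(1) lt st(3) ij] algebra_simps)
   also have "... = (\<E> w. indicator A w * jump_count i j s t w)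
    - ((\<E> w. indicator A w * running (intensity i j) t w) - (\<E> w. indicator A w * running (intensity i j) s w))"
    using sq_integrable_mult[OF Asq jump_count_sq[OF st(1) lt st(3) ij]]
     sq_integrable_mult[OF Asq running_sq_bound(1)[OF intensity_sq t']] sq_integrable_mult[OF Asq running_sq_bound(1)[OF intensity_sq s']]
    by simp
   also have "... = 0"
    unfolding comp[OF s'] comp[OF t'] expectation_jump_count[OF st(1) lt st(3) ij A]
    using running_additive[OF hint st] by simp
   finally show "(\<E> w. indicator A w * (chain_martingale gen \<alpha> i j t w - chain_martingale gen \<alpha> i j s w)) = 0" .
  qed
 qed
qed

lemma simple_noise_adapted:
 assumes si: "simple_integrand M joint T n u (x :: nat => 'w => real)" and t: "t \<in> {0..T}"
 shows "simple_integral W n u x t \<in> Bm (joint t)"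
 unfolding simple_integral_def real_scaleR_def
proof (rule borel_measurable_sum)
 fix l assume "l \<in> {..<n}"
 then have l: "l < n" by simp
 note g = simple_integrand_grid[OF si, of l] simple_integrand_grid[OF si, of "Suc l"] simple_integrand_mono[OF si l]
 show "(\<lambda>w. (W (min t (u (Suc l))) w - W (min t (u l)) w) * x l w) \<in> Bm (joint t)"
 proof (cases "u l <= t")
  case True
  have "x l \<in> Bm (joint (u l))" using si l by (simp add: simple_integrand_def)
  then have "x l \<in> Bm (mixed t t)"
   using True by (simp add: joint_eq_mixed mixed_measurable_mono)
  moreover have "W (min t (u k)) \<in> Bm (mixed t t)" if "k <= n" for k
   using simple_integrand_grid[OF si that] t by (intro W_mixed_measurable) auto
  ultimately show ?thesis using l unfolding joint_eq_mixed by (intro borel_measurable_times borel_measurable_diff) auto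
 qed (use g in simp)
qed

text \<open>For an integrand \<open>p\<close> known at time \<open>a\<close>, the variable \<open>p (Z\<^sub>b - Z\<^sub>a)\<close> is known at time \<open>a\<close> in the
 enlarged filtration, in which the noise integral is still a martingale; so the latter may be
 replaced by its value at time \<open>a\<close>.\<close>

lemma chain_noise_orthogonal_simple:
 assumes si: "simple_integrand M joint T n u (x :: nat => 'w => real)"
  and si': "simple_integrand M joint T n' u' (x' :: nat => 'w => real)"
  and t: "t \<in> {0..T}"
 shows "(\<E> w. simple_integral (chain_martingale gen \<alpha> i j) n u x t w * simple_integral W n' u' x' t w) = 0"
proof -
 let ?Z = "chain_martingale gen \<alpha> i j" and ?S = "simple_integral W n' u' x'"
 have S: "l2_martingale (\<lambda>s. mixed s T) ?S"
  using simple_integral_martingale[OF filtration_enlarged joint_subalgebra_enlarged W_shifted_martingale _ si']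
   l2_martingale_sq[OF W_shifted_martingale] simple_integrand_grid[OF si'] by (simp add: simple_integral_W_shift)
 have cell: "sq_integrable M (\<lambda>w. (?Z (min t (u (Suc l))) w - ?Z (min t (u l)) w) * x l w) \<and>
  (\<E> w. ((?Z (min t (u (Suc l))) w - ?Z (min t (u l)) w) * x l w) * ?S t w) = 0" if l: "l < n" for l
 proof -
  define a b where "a = min t (u l)" and "b = min t (u (Suc l))"
  have ab: "a \<in> {0..T}" "b \<in> {0..T}" "a <= b" "a <= t"
   using simple_integrand_grid[OF si, of l] simple_integrand_grid[OF si, of "Suc l"] simple_integrand_mono[OF si l] l t
   by (auto simp: a_def b_def min_def)
  obtain c where c: "\<And>w. w \<in> space M ==> \<bar>x l w\<bar> <= c"
   using si l unfolding simple_integrand_def by (metis real_norm_def)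
  have x: "x l \<in> Bm M" using noise_cell_sq(2)[OF si l t] by (rule sq_integrable_measurable)
  have dZ: "sq_integrable M (\<lambda>w. ?Z b w - ?Z a w)" by (intro sq_integrable_diff chain_martingale_sq ab)
  then have sq: "sq_integrable M (\<lambda>w. x l w * (?Z b w - ?Z a w))" by (rule sq_integrable_bounded_mult[OF _ x c])
  have "(\<E> w. (x l w * (?Z b w - ?Z a w)) * ?S t w) = 0"
  proof (cases "u l <= t")
   case True
   have xa: "x l \<in> Bm (joint a)" using si l True by (simp add: simple_integrand_def a_def)
   have "x l \<in> Bm (mixed a T)" by (rule measurable_from_subalg[OF joint_subalgebra_enlarged[OF ab(1)] xa])
   moreover have "?Z r \<in> Bm (mixed a T)" if "r \<in> {0..T}" for r
    by (rule measurable_larger[OF chain_martingale_measurable[OF that] _ chain_subset_mixed]) simp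
   ultimately have "(\<lambda>w. x l w * (?Z b w - ?Z a w)) \<in> Bm (mixed a T)" using ab by simp
   then have "(\<E> w. (x l w * (?Z b w - ?Z a w)) * ?S t w) = (\<E> w. (x l w * (?Z b w - ?Z a w)) * ?S a w)"
    using ab t by (intro l2_martingale_orth[OF S] sq) auto
   also have "... = (\<E> w. (x l w * ?S a w) * (?Z b w - ?Z a w))" by (simp only: mult_ac)
   also have "... = 0"
   proof -
    have "(\<lambda>w. x l w * ?S a w) \<in> Bm (joint a)"
     by (intro borel_measurable_times xa simple_noise_adapted[OF si' ab(1)])
    moreover have "sq_integrable M (\<lambda>w. x l w * ?S a w)"
     by (rule sq_integrable_bounded_mult[OF l2_martingale_sq[OF S ab(1)] x c])
    ultimately show ?thesis using chain_l2_martingale[of i j] ab unfolding l2_martingale_def by simp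
   qed
   finally show ?thesis .
  next
   case False
   then have "a = b" using simple_integrand_mono[OF si l] by (simp add: a_def b_def)
   then show ?thesis by simp
  qed
  then show ?thesis using sq unfolding a_def b_def by (simp only: mult.commute)
 qed
 have "(\<E> w. simple_integral ?Z n u x t w * ?S t w)
  = (\<Sum>l<n. (\<E> w. ((?Z (min t (u (Suc l))) w - ?Z (min t (u l)) w) * x l w) * ?S t w))"
  unfolding simple_integral_def[of ?Z] real_scaleR_def sum_distrib_right
  using cell by (intro lintegral_sum sq_integrable_mult l2_martingale_sq[OF S t]) auto
 also have "... = 0" using cell by simp
 finally show ?thesis .
qed

lemma chain_noise_orthogonal:
 assumes ap: "approximates joint (chain_martingale gen \<alpha> i j) n u x J"
  and ap': "approximates joint W n' u' x' I" and t: "t \<in> {0..T}"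
 shows "(\<E> w. J t w * I t w) = 0"
proof -
 have si: "simple_integrand M joint T (n m) (u m) (x m)" "simple_integrand M joint T (n' m) (u' m) (x' m)" for m
  using ap ap' by (auto simp: approximates_def)
 have J: "sq_integrable M (simple_integral (chain_martingale gen \<alpha> i j) (n m) (u m) (x m) t)" for m
 proof (rule l2_martingale_sq[OF simple_integral_martingale[OF filtration_joint _ chain_l2_martingale _ si(1)] t])
  show "subalgebra (joint s) (joint s)" for s by (simp add: subalgebra_def)
  show "sq_integrable M (\<lambda>w. chain_martingale gen \<alpha> i j (u m l) w)" if "l < n m" for l
   using chain_martingale_sq simple_integrand_grid[OF si(1), of l m] that by auto
 qed
 have "(\<lambda>m. (\<E> w. 1 * (simple_integral (chain_martingale gen \<alpha> i j) (n m) (u m) (x m) t w * simple_integral W (n' m) (u' m) (x' m) t w)))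
  \<longlonglongrightarrow> (\<E> w. 1 * (J t w * I t w))"
  by (rule sq_integrable_limit_mult[OF J _ _ simple_noise_sq[OF si(2) t], where C = 1])
   (use ap ap' t in \<open>auto simp: approximates_def\<close>)
 then have "(\<lambda>m. 0) \<longlonglongrightarrow> (\<E> w. J t w * I t w)"
  by (simp add: chain_noise_orthogonal_simple[OF si t])
 then show ?thesis by (simp add: LIMSEQ_const_iff)
qed

end

section \<open>Products with functions of the chain\<close>

lemma measurable_clock_continuous:
 fixes f :: "real => real"
 assumes "continuous_on {0..T} f"
 shows "f \<in> Bm (clock T)"
proof -
 have "f \<in> Bm (restrict_space borel {0..T})"
  by (rule borel_measurable_continuous_on_restrict[OF assms])
 then show ?thesis by (simp cong: measurable_cong_sets[OF sets_clock refl])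
qed

lemma set_integral_weighted_sum:
 fixes F :: "'k::finite => real => real"
 assumes "\<And>k. set_integrable lborel A (F k)"
 shows "(\<Sum>k\<in>UNIV. (LINT r:A|lborel. F k r) * c k) = (LINT r:A|lborel. (\<Sum>k\<in>UNIV. F k r * c k))"
proof -
 have "(\<Sum>k\<in>UNIV. (LINT r:A|lborel. F k r) * c k) = (\<Sum>k\<in>UNIV. (\<integral>r. (indicator A r * F k r) * c k \<partial>lborel))"
  unfolding set_lebesgue_integral_def real_scaleR_def by simp
 also have "... = (\<integral>r. (\<Sum>k\<in>UNIV. (indicator A r * F k r) * c k) \<partial>lborel)"
  using assms by (intro lintegral_sum[symmetric] integrable_mult_left) (simp add: set_integrable_def)
 also have "... = (LINT r:A|lborel. (\<Sum>k\<in>UNIV. F k r * c k))"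
  unfolding set_lebesgue_integral_def real_scaleR_def sum_distrib_left by (simp only: mult.assoc)
 finally show ?thesis .
qed

context regime_noise begin

lemma regime_function_decompose:
 fixes f :: "'s => real"
 assumes "w \<in> space M"
 shows "f (\<alpha> t w) = (\<Sum>j\<in>UNIV. f j * indicator (at_state t j) w)"
proof -
 have "(\<Sum>j\<in>UNIV. f j * indicator (at_state t j) w) = (\<Sum>j\<in>UNIV. if j = \<alpha> t w then f j else 0)"
  using assms by (intro sum.cong) (auto split: split_indicator)
 then show ?thesis by simp
qed

lemma regime_process_measurable:
 fixes f :: "real => 's => real"
 assumes "\<And>j. continuous_on {0..T} (\<lambda>t. f t j)"
 shows "(\<lambda>z. f (fst z) (\<alpha> (fst z) (snd z))) \<in> Bm Q"
proof -
 have [measurable]: "(\<lambda>t. f t j) \<in> Bm (clock T)" for j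
  by (rule measurable_clock_continuous[OF assms])
 have [measurable]: "(\<lambda>z. indicator (at_state (fst z) j) (snd z) :: real) \<in> Bm Q" for j
  by (rule at_state_process)
 have "(\<lambda>z. \<Sum>j\<in>UNIV. f (fst z) j * indicator (at_state (fst z) j) (snd z)) \<in> Bm Q"
  by (intro borel_measurable_sum borel_measurable_times) measurable
 then show ?thesis
  by (rule measurable_cong[THEN iffD1, rotated])
   (rule regime_function_decompose[symmetric], auto simp: space_pair_measure)
qed

lemma regime_function_bounded:
 fixes f :: "real => 's => real"
 assumes "\<And>j. continuous_on {0..T} (\<lambda>t. f t j)"
 obtains C where "\<And>t j. t \<in> {0..T} ==> \<bar>f t j\<bar> <= C"
proof -
 have "\<exists>c. \<forall>t\<in>{0..T}. \<bar>f t j\<bar> <= c" for j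
  using compact_imp_bounded[OF compact_continuous_image[OF assms compact_Icc]] by (auto simp: bounded_iff)
 then obtain c where c: "\<And>t j. t \<in> {0..T} ==> \<bar>f t j\<bar> <= c j" by metis
 obtain L where "\<And>j. c j <= L" using finite_uniform_bound[of c] by blast
 then show ?thesis using that c by (meson order_trans)
qed

lemma regime_function_chain:
 fixes f :: "'s => real"
 assumes "0 <= t" "t <= s"
 shows "(\<lambda>w. f (\<alpha> t w)) \<in> Bm (chain s)"
 by (rule measurable_compose[OF chain_measurable[OF assms]]) simp

text \<open>The semigroup formula is averaged over the state at time s with the weights
  \<open>c\<close>; these depend on s and \<open>h\<close> only, so they pass through the time
  integral.\<close>

lemma expectation_dynkin:
 fixes g g' :: "real => 's => real"
 assumes g: "\<And>r j. r \<in> {0..T} ==> ((\<lambda>r. g r j) has_real_derivative g' r j) (at r within {0..T})"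
  and g': "\<And>j. continuous_on {0..T} (\<lambda>r. g' r j)"
  and st: "0 <= s" "s <= t" "t <= T" and h: "h \<in> Bm (joint s)" "integrable M h"
 defines "L \<equiv> \<lambda>r j. g' r j + (\<Sum>l\<in>UNIV. gen j l * g r l)"
 shows "(\<E> w. h w * g t (\<alpha> t w)) = (\<E> w. h w * g s (\<alpha> s w))
  + (\<integral>r. indicator {s..t} r * (\<E> w. h w * L r (\<alpha> r w)) \<partial>clock T)"
proof -
 define c where "c k = (\<E> w. h w * indicator (at_state s k) w)" for k
 have gc: "continuous_on {0..T} (\<lambda>r. g r j)" for j using g by (intro DERIV_continuous_on)
 have Lc: "continuous_on {s..t} (\<lambda>r. L r j)" for j
 proof (rule continuous_on_subset[of "{0..T}"])
  show "continuous_on {0..T} (\<lambda>r. L r j)" unfolding L_def by (intro continuous_intros gc g')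
 qed (use st in auto)
 have pc: "continuous_on {s..t} (\<lambda>r. transition (r - s) k j)" for k j
  by (rule continuous_on_compose2[OF semi.p_continuous]) (auto intro!: continuous_intros)
 have si: "set_integrable lborel {s..t} (\<lambda>r. \<Sum>j\<in>UNIV. transition (r - s) k j * L r j)" for k
  by (rule borel_integrable_atLeastAtMost') (intro continuous_intros pc Lc)
 have "(\<E> w. h w * g t (\<alpha> t w)) = (\<Sum>k\<in>UNIV. (\<Sum>j\<in>UNIV. transition (t - s) k j * g t j) * c k)"
  unfolding c_def by (rule expectation_transition_function[OF st h])
 also have "... = (\<Sum>k\<in>UNIV. g s k * c k) + (\<Sum>k\<in>UNIV. (LINT r:{s..t}|lborel. (\<Sum>j\<in>UNIV. transition (r - s) k j * L r j)) * c k)"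
 proof -
  have dyn: "(\<Sum>j\<in>UNIV. transition (t - s) k j * g t j) = g s k + (LINT r:{s..t}|lborel. (\<Sum>j\<in>UNIV. transition (r - s) k j * L r j))" for k
   unfolding L_def by (rule semi.semigroup_dynkin[OF st g g'])
  show ?thesis unfolding dyn by (simp only: distrib_right sum.distrib)
 qed
 also have "(\<Sum>k\<in>UNIV. g s k * c k) = (\<E> w. h w * g s (\<alpha> s w))"
  unfolding c_def using st by (intro expectation_state_function(1)[symmetric] h(2)) auto
 also have "(\<Sum>k\<in>UNIV. (LINT r:{s..t}|lborel. (\<Sum>j\<in>UNIV. transition (r - s) k j * L r j)) * c k)
  = (LINT r:{s..t}|lborel. (\<Sum>k\<in>UNIV. (\<Sum>j\<in>UNIV. transition (r - s) k j * L r j) * c k))"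
  by (rule set_integral_weighted_sum[OF si])
 also have "... = (\<integral>r. indicator {s..t} r * (\<Sum>k\<in>UNIV. (\<Sum>j\<in>UNIV. transition (r - s) k j * L r j) * c k) \<partial>clock T)"
  using st by (intro set_integral_clock_Icc) auto
 also have "... = (\<integral>r. indicator {s..t} r * (\<E> w. h w * L r (\<alpha> r w)) \<partial>clock T)"
 proof (rule lintegral_cong[OF refl])
  fix r
  show "indicator {s..t} r * (\<Sum>k\<in>UNIV. (\<Sum>j\<in>UNIV. transition (r - s) k j * L r j) * c k)
   = indicator {s..t} r * (\<E> w. h w * L r (\<alpha> r w))"
  proof (cases "r \<in> {s..t}")
   case True
   then have "(\<E> w. h w * L r (\<alpha> r w)) = (\<Sum>k\<in>UNIV. (\<Sum>j\<in>UNIV. transition (r - s) k j * L r j) * c k)"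
    unfolding c_def using st by (intro expectation_transition_function h) auto
   then show ?thesis by simp
  qed simp
 qed
 finally show ?thesis .
qed

lemma expectation_initial_state:
 fixes f :: "'s => real"
 shows "(\<E> w. f (\<alpha> 0 w)) = f i0"
proof -
 have "AE w in M. \<alpha> 0 w = i0" using markov by (simp add: markov_chain_def)
 moreover have "(\<lambda>w. f (\<alpha> 0 w)) \<in> Bm M"
  using T_pos by (intro measurable_compose[OF \<alpha>_measurable]) auto
 ultimately have "(\<E> w. f (\<alpha> 0 w)) = (\<E> w. f i0)"
  by (intro integral_cong_AE) (auto elim: eventually_mono)
 then show ?thesis by (simp add: prob_space)
qed

text \<open>No covariation between the chain and \<open>V\<close> arises: given the whole path of the chain, the
 expectation of \<open>V\<close> is absolutely continuous in time.\<close>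

lemma expectation_regime_product:
 fixes g g' :: "real => 's => real"
 assumes g: "\<And>r j. r \<in> {0..T} ==> ((\<lambda>r. g r j) has_real_derivative g' r j) (at r within {0..T})"
  and g': "\<And>j. continuous_on {0..T} (\<lambda>r. g' r j)"
  and U: "integrable Q (case_prod U)" "\<And>s. s \<in> {0..T} ==> U s \<in> Bm (joint s)"
  and V: "integrable Q (case_prod V)"
  and rep: "\<And>t y C. t \<in> {0..T} ==> y \<in> Bm (chain T) ==> (\<And>w. w \<in> space M ==> \<bar>y w\<bar> <= C) ==>
   (\<E> w. y w * V t w) = v0 * expectation y + mean_integral t (\<lambda>s w. y w * U s w)"
  and t: "t \<in> {0..T}"
 defines "L \<equiv> \<lambda>r j. g' r j + (\<Sum>l\<in>UNIV. gen j l * g r l)"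
 shows "(\<E> w. g t (\<alpha> t w) * V t w) = g 0 i0 * v0
  + mean_integral t (\<lambda>s w. g s (\<alpha> s w) * U s w + L s (\<alpha> s w) * V s w)"
proof -
 interpret cc: pair_sigma_finite "clock T" "clock T" ..
 have gc: "continuous_on {0..T} (\<lambda>r. g r j)" for j using g by (intro DERIV_continuous_on)
 have Lc: "continuous_on {0..T} (\<lambda>r. L r j)" for j unfolding L_def by (intro continuous_intros gc g')
 obtain Cg where Cg: "\<And>t j. t \<in> {0..T} ==> \<bar>g t j\<bar> <= Cg" using regime_function_bounded[of g, OF gc] by blast
 obtain CL where CL: "\<And>t j. t \<in> {0..T} ==> \<bar>L t j\<bar> <= CL" using regime_function_bounded[of L, OF Lc] by blast
 have Um: "(\<lambda>z. U (fst z) (snd z)) \<in> Bm Q" using U(1) by (auto simp: case_prod_unfold)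
 have gm: "(\<lambda>z. g (fst z) (\<alpha> (fst z) (snd z))) \<in> Bm Q" by (rule regime_process_measurable[OF gc])
 have Lm: "(\<lambda>z. L (fst z) (\<alpha> (fst z) (snd z))) \<in> Bm Q" by (rule regime_process_measurable[OF Lc])
 have bmult: "integrable Q (\<lambda>(s, w). h s w * Z s w)"
  if Z: "integrable Q (case_prod Z)" and m: "(\<lambda>z. h (fst z) (snd z)) \<in> Bm Q"
   and C: "\<And>s w. s \<in> {0..T} ==> \<bar>h s w\<bar> <= C" for h Z :: "real => 'w => real" and C
 proof (rule lint_bound[of _ "\<lambda>z. C * case_prod Z z"])
  show "integrable Q (\<lambda>z. C * case_prod Z z)" using Z by simp
  have "case_prod Z \<in> Bm Q" using Z by auto
  then show "(\<lambda>(s, w). h s w * Z s w) \<in> Bm Q" using m by (simp add: case_prod_unfold)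
  show "AE z in Q. norm (case z of (s, w) => h s w * Z s w) <= norm (C * case_prod Z z)"
  proof (rule AE_I2)
   fix z assume "z \<in> space Q"
   then have "\<bar>h (fst z) (snd z)\<bar> <= \<bar>C\<bar>" using C[of "fst z" "snd z"] by (auto simp: space_pair_measure)
   then show "norm (case z of (s, w) => h s w * Z s w) <= norm (C * case_prod Z z)"
    by (auto simp: case_prod_unfold abs_mult intro!: mult_right_mono)
  qed
 qed
 have igU: "integrable Q (\<lambda>(s, w). g s (\<alpha> s w) * U s w)" by (rule bmult[OF U(1) gm Cg])
 have iLV: "integrable Q (\<lambda>(s, w). L s (\<alpha> s w) * V s w)" by (rule bmult[OF V Lm CL])
 have EU: "integrable (clock T) (\<lambda>s. (\<E> w. \<bar>U s w\<bar>))"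
  using U(1) by (intro pair.integrable_fst) (simp add: case_prod_unfold)
 define e where "e s r = (\<E> w. U s w * L r (\<alpha> r w))" for s r
 have em: "(\<lambda>x. e (fst x) (snd x)) \<in> Bm (clock T \<Otimes>\<^sub>M clock T)"
  unfolding e_def
 proof (rule borel_measurable_lebesgue_integral)
  have "(\<lambda>x. U (fst (fst (fst x), snd x)) (snd (fst (fst x), snd x))) \<in> Bm ((clock T \<Otimes>\<^sub>M clock T) \<Otimes>\<^sub>M M)"
   by (rule measurable_compose[OF _ Um]) measurable
  moreover have "(\<lambda>x. L (fst (snd (fst x), snd x)) (\<alpha> (fst (snd (fst x), snd x)) (snd (snd (fst x), snd x)))) \<in> Bm ((clock T \<Otimes>\<^sub>M clock T) \<Otimes>\<^sub>M M)"
   by (rule measurable_compose[OF _ Lm]) measurable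
  ultimately show "(\<lambda>(x, w). U (fst x) w * L (snd x) (\<alpha> (snd x) w)) \<in> Bm ((clock T \<Otimes>\<^sub>M clock T) \<Otimes>\<^sub>M M)"
   by (simp add: case_prod_unfold)
 qed
 have eb: "\<bar>e s r\<bar> <= CL * (\<E> w. \<bar>U s w\<bar>)" if "integrable M (U s)" "r \<in> {0..T}" for s r
 proof -
  have "\<bar>e s r\<bar> <= (\<E> w. \<bar>U s w * L r (\<alpha> r w)\<bar>)" unfolding e_def by (rule integral_abs_bound)
  also have "... <= (\<E> w. CL * \<bar>U s w\<bar>)"
  proof (rule integral_mono)
   show "integrable M (\<lambda>w. \<bar>U s w * L r (\<alpha> r w)\<bar>)"
    by (intro integrable_abs expectation_state_function(2)[OF that(2,1)])
   show "integrable M (\<lambda>w. CL * \<bar>U s w\<bar>)" using that(1) by simp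
   show "\<bar>U s w * L r (\<alpha> r w)\<bar> <= CL * \<bar>U s w\<bar>" for w
    using mult_right_mono[OF CL[OF that(2), of "\<alpha> r w"], of "\<bar>U s w\<bar>"] by (simp add: abs_mult mult.commute)
  qed
  finally show ?thesis by simp
 qed
 have CL0: "0 <= CL" using CL[of 0 i0] T_pos by (auto intro: order_trans[OF abs_ge_zero])
 have sections: "AE s in clock T. integrable M (U s)" by (rule pair.AE_integrable_fst[OF U(1)])
 \<comment> \<open>Under the expectation with \<open>U s\<close>, replacing the value of
   \<open>g\<close> at time t by that at time s costs the integral of \<open>e s r\<close> over r
   from s to t. Integrating over s gives a double integral of \<open>H\<close>, whose order is then
   exchanged.\<close>
 define H where "H s r = indicator {0..t} s * (indicator {s..t} r * e s r)" for s r
 have indm: "indicator {s..t} r = (if s <= r \<and> r <= t then 1 else (0::real))" for s r :: real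
  by (auto split: split_indicator)
 have Hm: "(\<lambda>x. H (fst x) (snd x)) \<in> Bm (clock T \<Otimes>\<^sub>M clock T)"
  unfolding H_def indm using em by measurable
 have Hi: "integrable (clock T \<Otimes>\<^sub>M clock T) (case_prod H)"
 proof -
  have bound: "\<bar>H s r\<bar> <= CL * (\<E> w. \<bar>U s w\<bar>)" if "integrable M (U s)" "r \<in> {0..T}" for s r
   using eb[OF that] CL0 by (auto simp: H_def abs_mult split: split_indicator)
  have sec: "(\<lambda>r. H s r) \<in> Bm (clock T)" if "s \<in> {0..T}" for s
   using measurable_compose[OF measurable_Pair1'[of s "clock T" "clock T"] Hm] that by simp
  show ?thesis
  proof (rule cc.Fubini_integrable)
   show "case_prod H \<in> Bm (clock T \<Otimes>\<^sub>M clock T)" using Hm by (simp add: case_prod_unfold)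
   show "AE s in clock T. integrable (clock T) (\<lambda>r. case_prod H (s, r))"
    using sections AE_space
   proof eventually_elim
    case (elim s)
    then show ?case using sec[of s] bound[of s]
     by (intro clock.integrable_const_bound[where B = "CL * (\<E> w. \<bar>U s w\<bar>)"]) auto
   qed
   show "integrable (clock T) (\<lambda>s. \<integral>r. norm (case_prod H (s, r)) \<partial>clock T)"
   proof (rule lint_bound[of _ "\<lambda>s. T * (CL * (\<E> w. \<bar>U s w\<bar>))"])
    show "integrable (clock T) (\<lambda>s. T * (CL * (\<E> w. \<bar>U s w\<bar>)))" using EU by simp
    show "(\<lambda>s. \<integral>r. norm (case_prod H (s, r)) \<partial>clock T) \<in> Bm (clock T)"
     using Hm by (intro clock.borel_measurable_lebesgue_integral) (simp add: case_prod_unfold)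
    show "AE s in clock T. norm (\<integral>r. norm (case_prod H (s, r)) \<partial>clock T) <= norm (T * (CL * (\<E> w. \<bar>U s w\<bar>)))"
     using sections AE_space
    proof eventually_elim
     case (elim s)
     have "(\<integral>r. norm (H s r) \<partial>clock T) <= (\<integral>r. CL * (\<E> w. \<bar>U s w\<bar>) \<partial>clock T)"
     proof (rule integral_mono)
      show "integrable (clock T) (\<lambda>r. norm (H s r))"
       using sec[of s] bound[of s] elim
       by (intro clock.integrable_const_bound[where B = "CL * (\<E> w. \<bar>U s w\<bar>)"]) auto
     qed (use bound[of s] elim in auto)
     also have "... = T * (CL * (\<E> w. \<bar>U s w\<bar>))" by (simp add: measure_clock)
     finally have "(\<integral>r. norm (H s r) \<partial>clock T) <= T * (CL * (\<E> w. \<bar>U s w\<bar>))" .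
     then show ?case by (auto simp: integral_nonneg_AE intro: order_trans[OF _ abs_ge_self])
    qed
   qed
  qed
 qed
 \<comment> \<open>The representation of \<open>V\<close> is used a second time, now at time r with
   the weight \<open>L r\<close> of the chain. The part with \<open>v0\<close> that it produces
   cancels the drift of the mean of \<open>g\<close> found in \<open>main1\<close>.\<close>
 have inner: "(\<integral>s. H s r \<partial>clock T) = indicator {0..t} r * ((\<E> w. L r (\<alpha> r w) * V r w) - v0 * (\<E> w. L r (\<alpha> r w)))"
  if r: "r \<in> {0..T}" for r
 proof -
  have iLU: "integrable Q (\<lambda>(s, w). L r (\<alpha> r w) * U s w)"
   using CL[OF r] measurable_compose[OF \<alpha>_measurable[OF r], of "L r"] by (intro bmult[OF U(1), of _ CL]) auto
  have "(\<integral>s. H s r \<partial>clock T) = (\<integral>s. indicator {0..t} r * (indicator {0..r} s * e s r) \<partial>clock T)"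
   using r t by (intro lintegral_cong) (auto simp: H_def split: split_indicator)
  also have "... = indicator {0..t} r * mean_integral r (\<lambda>s w. L r (\<alpha> r w) * U s w)"
   unfolding mean_integral_fst[OF iLU] by (simp add: e_def mult.commute)
  also have "mean_integral r (\<lambda>s w. L r (\<alpha> r w) * U s w) = (\<E> w. L r (\<alpha> r w) * V r w) - v0 * (\<E> w. L r (\<alpha> r w))"
   using rep[OF r regime_function_chain[of r T "L r"], of CL] CL[OF r] r by simp
  finally show ?thesis .
 qed
 have main1: "(\<E> w. g t (\<alpha> t w)) = g 0 i0 + (\<integral>r. indicator {0..t} r * (\<E> w. L r (\<alpha> r w)) \<partial>clock T)"
 proof -
  have "(\<E> w. 1 * g t (\<alpha> t w)) = (\<E> w. 1 * g 0 (\<alpha> 0 w))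
   + (\<integral>r. indicator {0..t} r * (\<E> w. 1 * L r (\<alpha> r w)) \<partial>clock T)"
   unfolding L_def using t by (intro expectation_dynkin g g') auto
  then show ?thesis unfolding mult_1_left expectation_initial_state .
 qed
 have main2: "mean_integral t (\<lambda>s w. g t (\<alpha> t w) * U s w)
  = mean_integral t (\<lambda>s w. g s (\<alpha> s w) * U s w) + (\<integral>s. (\<integral>r. H s r \<partial>clock T) \<partial>clock T)"
 proof -
  have igU': "integrable Q (\<lambda>(s, w). g t (\<alpha> t w) * U s w)"
   using Cg[OF t] measurable_compose[OF \<alpha>_measurable[OF t], of "g t"] by (intro bmult[OF U(1), of _ Cg]) auto
  have i1: "integrable (clock T) (\<lambda>s. indicator {0..t} s * (\<E> w. g s (\<alpha> s w) * U s w))"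
   by (intro clock_integrable_upto pair.integrable_fst[OF igU])
  have i2: "integrable (clock T) (\<lambda>s. \<integral>r. H s r \<partial>clock T)" by (rule cc.integrable_fst[OF Hi])
  have "mean_integral t (\<lambda>s w. g t (\<alpha> t w) * U s w) = (\<integral>s. indicator {0..t} s * (\<E> w. g t (\<alpha> t w) * U s w) \<partial>clock T)"
   by (rule mean_integral_fst[OF igU'])
  also have "... = (\<integral>s. indicator {0..t} s * (\<E> w. g s (\<alpha> s w) * U s w) + (\<integral>r. H s r \<partial>clock T) \<partial>clock T)"
  proof (rule integral_cong_AE)
   show "(\<lambda>s. indicator {0..t} s * (\<E> w. g t (\<alpha> t w) * U s w)) \<in> Bm (clock T)"
    by (rule borel_measurable_integrable[OF clock_integrable_upto[OF pair.integrable_fst[OF igU']]])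
   show "(\<lambda>s. indicator {0..t} s * (\<E> w. g s (\<alpha> s w) * U s w) + (\<integral>r. H s r \<partial>clock T)) \<in> Bm (clock T)"
    by (rule borel_measurable_add[OF borel_measurable_integrable[OF i1] borel_measurable_integrable[OF i2]])
   show "AE s in clock T. indicator {0..t} s * (\<E> w. g t (\<alpha> t w) * U s w)
    = indicator {0..t} s * (\<E> w. g s (\<alpha> s w) * U s w) + (\<integral>r. H s r \<partial>clock T)"
    using sections AE_space
   proof eventually_elim
    case (elim s)
    then have s: "s \<in> {0..T}" by simp
    show ?case
    proof (cases "s <= t")
     case True
     have "(\<E> w. U s w * g t (\<alpha> t w)) = (\<E> w. U s w * g s (\<alpha> s w))
      + (\<integral>r. indicator {s..t} r * e s r \<partial>clock T)"
      unfolding e_def L_def using s t True by (intro expectation_dynkin[OF g g'] U(2) elim(1)) auto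
     moreover have "(\<integral>r. H s r \<partial>clock T) = (\<integral>r. indicator {s..t} r * e s r \<partial>clock T)"
      using True s by (simp add: H_def)
     ultimately show ?thesis using True s by (simp add: mult.commute)
    next
     case False
     then show ?thesis by (simp add: H_def)
    qed
   qed
  qed
  also have "... = mean_integral t (\<lambda>s w. g s (\<alpha> s w) * U s w) + (\<integral>s. (\<integral>r. H s r \<partial>clock T) \<partial>clock T)"
   using i1 i2 by (simp add: mean_integral_fst[OF igU])
  finally show ?thesis .
 qed
 have main3: "(\<integral>s. (\<integral>r. H s r \<partial>clock T) \<partial>clock T) = mean_integral t (\<lambda>s w. L s (\<alpha> s w) * V s w)
  - v0 * (\<integral>r. indicator {0..t} r * (\<E> w. L r (\<alpha> r w)) \<partial>clock T)"
 proof -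
  have i1: "integrable (clock T) (\<lambda>r. indicator {0..t} r * (\<E> w. L r (\<alpha> r w) * V r w))"
   by (intro clock_integrable_upto pair.integrable_fst[OF iLV])
  have iL: "integrable Q (\<lambda>(s, w). L s (\<alpha> s w))"
   using Lm CL by (intro Q.integrable_const_bound[where B = CL]) (auto simp: case_prod_unfold space_pair_measure)
  have i2: "integrable (clock T) (\<lambda>r. indicator {0..t} r * (\<E> w. L r (\<alpha> r w)))"
   by (intro clock_integrable_upto pair.integrable_fst[OF iL])
  have "(\<integral>s. (\<integral>r. H s r \<partial>clock T) \<partial>clock T) = (\<integral>r. (\<integral>s. H s r \<partial>clock T) \<partial>clock T)"
   by (rule cc.Fubini_integral[OF Hi, symmetric])
  also have "... = (\<integral>r. indicator {0..t} r * (\<E> w. L r (\<alpha> r w) * V r w) - v0 * (indicator {0..t} r * (\<E> w. L r (\<alpha> r w))) \<partial>clock T)"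
   by (intro lintegral_cong refl) (simp add: inner right_diff_distrib mult.left_commute)
  also have "... = (\<integral>r. indicator {0..t} r * (\<E> w. L r (\<alpha> r w) * V r w) \<partial>clock T)
    - v0 * (\<integral>r. indicator {0..t} r * (\<E> w. L r (\<alpha> r w)) \<partial>clock T)"
   using i1 i2 by simp
  finally show ?thesis by (simp add: mean_integral_fst[OF iLV])
 qed
 have "(\<E> w. g t (\<alpha> t w) * V t w) = v0 * (\<E> w. g t (\<alpha> t w)) + mean_integral t (\<lambda>s w. g t (\<alpha> t w) * U s w)"
  by (rule rep[OF t regime_function_chain]) (use t Cg[OF t] in auto)
 then show ?thesis
  unfolding main1 main2 main3 mean_integral_add[OF igU iLV] by (simp add: algebra_simps)
qed

end

section \<open>Projections onto the filtration of the chain\<close>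

context regime_noise begin

definition projects_at :: "real => ('w => real) => ('w => real) => bool" where
 "projects_at s a h \<longleftrightarrow> sq_integrable M a \<and> sq_integrable M h \<and> h \<in> Bm (chain s) \<and>
   (\<forall>\<zeta>. \<zeta> \<in> Bm (chain s) --> sq_integrable M \<zeta> -->
    (\<E> w. \<zeta> w * a w) = (\<E> w. \<zeta> w * h w))"

text \<open>The projection property is asked at almost every time, since a square-integrable process
  is square integrable at a fixed time only for almost all times.\<close>

definition projects :: "(real => 'w => real) => (real => 'w => real) => bool" where
 "projects a h \<longleftrightarrow> sq_process a \<and> sq_process h \<and>
   (\<forall>s\<in>{0..T}. a s \<in> Bm (joint s)) \<and> (\<forall>s\<in>{0..T}. h s \<in> Bm (chain s)) \<and>
   (AE s in clock T. projects_at s (a s) (h s))"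

lemma projects_at_cond_exp:
 assumes s: "s \<in> {0..T}" and a: "sq_integrable M a" and h: "h \<in> Bm (chain s)"
  and eq: "AE w in M. h w = real_cond_exp M (chain s) a w"
 shows "projects_at s a h" and "(\<E> w. (h w)\<^sup>2) <= (\<E> w. (a w)\<^sup>2)"
proof -
 have sub: "subalgebra M (chain s)" using s by (intro subalgebra_chain) auto
 have hM: "h \<in> Bm M" by (rule measurable_from_subalg[OF sub h])
 note ce = sq_integrable_cond_exp[OF sub a]
 have hsq: "sq_integrable M h"
  by (rule sq_integrable_cong_AE[OF ce(1) hM]) (use eq in \<open>auto elim: eventually_mono\<close>)
 have "(\<E> w. z w * a w) = (\<E> w. z w * h w)"
  if "z \<in> Bm (chain s)" "sq_integrable M z" for z
 proof -
  have "(\<E> w. z w * h w) = (\<E> w. z w * real_cond_exp M (chain s) a w)"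
   using that(2) hM ce(1) eq by (intro integral_cong_AE) (auto simp: sq_integrable_def elim: eventually_mono)
  then show ?thesis using ce(3)[OF that] by simp
 qed
 then show "projects_at s a h" using a hsq h by (simp add: projects_at_def)
 have "(\<E> w. (h w)\<^sup>2) = (\<E> w. (real_cond_exp M (chain s) a w)\<^sup>2)"
  using hM ce(1) eq by (intro integral_cong_AE) (auto simp: sq_integrable_def elim: eventually_mono)
 then show "(\<E> w. (h w)\<^sup>2) <= (\<E> w. (a w)\<^sup>2)" using ce(2) by simp
qed

text \<open>Self-adjointness and idempotence of the orthogonal projection, with a weight that is
  known to the chain and therefore commutes with it.\<close>

lemma projects_at_swap:
 assumes a: "projects_at s a ah" and b: "projects_at s b bh" and s: "s \<in> {0..T}"
  and h: "h \<in> Bm (chain s)" "\<And>w. w \<in> space M ==> \<bar>h w\<bar> <= C"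
 shows "(\<E> w. h w * (a w * bh w)) = (\<E> w. h w * (ah w * b w))"
  and "(\<E> w. h w * (a w * bh w)) = (\<E> w. h w * (ah w * bh w))"
proof -
 have hM: "h \<in> Bm M"
  using s by (intro measurable_from_subalg[OF subalgebra_chain h(1)]) auto
 have b1: "(\<lambda>w. h w * bh w) \<in> Bm (chain s)" "(\<lambda>w. h w * ah w) \<in> Bm (chain s)"
  using a b h by (auto simp: projects_at_def)
 have b2: "sq_integrable M (\<lambda>w. h w * bh w)" "sq_integrable M (\<lambda>w. h w * ah w)"
  using a b by (auto simp: projects_at_def intro: sq_integrable_bounded_mult[OF _ hM h(2)])
 have 1: "(\<E> w. (h w * bh w) * a w) = (\<E> w. (h w * bh w) * ah w)"
  using a b1(1) b2(1) unfolding projects_at_def by blast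
 have 2: "(\<E> w. (h w * ah w) * b w) = (\<E> w. (h w * ah w) * bh w)"
  using b b1(2) b2(2) unfolding projects_at_def by blast
 show "(\<E> w. h w * (a w * bh w)) = (\<E> w. h w * (ah w * b w))"
  "(\<E> w. h w * (a w * bh w)) = (\<E> w. h w * (ah w * bh w))"
  using 1 2 by (simp_all only: mult_ac)
qed

lemma regime_sq_process:
 fixes f :: "real => 's => real"
 assumes "\<And>j. continuous_on {0..T} (\<lambda>t. f t j)" and "sq_process a"
 shows "sq_process (\<lambda>t w. f t (\<alpha> t w) * a t w)"
proof -
 obtain C where "\<And>t j. t \<in> {0..T} ==> \<bar>f t j\<bar> <= C" using regime_function_bounded[of f, OF assms(1)] by blast
 then show ?thesis
  by (intro sq_process_bounded_mult[OF assms(2), where C = C])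
   (use regime_process_measurable[of f, OF assms(1)] in \<open>auto simp: case_prod_unfold\<close>)
qed

lemma mean_integral_swap:
 fixes f :: "real => 's => real"
 assumes f: "\<And>j. continuous_on {0..T} (\<lambda>t. f t j)" and a: "projects a ah" and b: "projects b bh"
 shows "mean_integral t (\<lambda>s w. f s (\<alpha> s w) * (a s w * bh s w)) = mean_integral t (\<lambda>s w. f s (\<alpha> s w) * (ah s w * b s w))"
proof (rule mean_integral_cong)
 obtain C where C: "\<And>t j. t \<in> {0..T} ==> \<bar>f t j\<bar> <= C" using regime_function_bounded[of f, OF f] by blast
 have sq: "sq_process a" "sq_process ah" "sq_process b" "sq_process bh" using a b by (auto simp: projects_def)
 show "integrable Q (\<lambda>(s, w). f s (\<alpha> s w) * (a s w * bh s w))"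
  using sq_process_mult[OF regime_sq_process[of f, OF f sq(1)] sq(4)] by (simp only: mult.assoc)
 show "integrable Q (\<lambda>(s, w). f s (\<alpha> s w) * (ah s w * b s w))"
  using sq_process_mult[OF regime_sq_process[of f, OF f sq(2)] sq(3)] by (simp only: mult.assoc)
 have "AE s in clock T. projects_at s (a s) (ah s)" "AE s in clock T. projects_at s (b s) (bh s)"
  using a b by (auto simp: projects_def)
 then show "AE s in clock T. s <= t --> (\<E> w. f s (\<alpha> s w) * (a s w * bh s w))
   = (\<E> w. f s (\<alpha> s w) * (ah s w * b s w))"
  using AE_space
 proof eventually_elim
  case (elim s)
  then have "s \<in> {0..T}" by simp
  then show ?case
   using projects_at_swap(1)[OF elim(1,2), of "\<lambda>w. f s (\<alpha> s w)" C] regime_function_chain[of s s "f s"] C[of s] by simp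
 qed
qed

text \<open>The noise integral is a martingale for the filtration that knows the whole chain and
  starts at 0, so it is orthogonal to functions of the chain. In the drift, testing
  \<open>b s\<close> with a function of the chain up to t is the same as testing with its projection
  onto the chain up to s, hence \<open>b s\<close> may be replaced by \<open>bh s\<close>. So the
  difference \<open>D\<close> of the two sides is orthogonal to the chain up to t, and it remains to
  see that it is orthogonal to itself.\<close>

lemma projected_drift:
 assumes b: "projects b bh" and I: "l2_martingale (\<lambda>s. mixed s T) I" "AE w in M. I 0 w = 0"
  and t: "t \<in> {0..T}" and xeq: "AE w in M. x t w = x0 + running b t w + I t w"
  and pr: "projects_at t (x t) (xh t)"
 shows "AE w in M. xh t w = x0 + running bh t w"
proof -
 have sq: "sq_process b" "sq_process bh" using b by (auto simp: projects_def)
 have xsq: "sq_integrable M (x t)" "sq_integrable M (xh t)" "xh t \<in> Bm (chain t)"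
  and xp: "\<And>y. y \<in> Bm (chain t) ==> sq_integrable M y ==>
    (\<E> w. y w * x t w) = (\<E> w. y w * xh t w)"
  using pr by (auto simp: projects_at_def)
 note rb = running_sq_bound(1)[OF sq(1) t] and rbh = running_sq_bound(1)[OF sq(2) t]
 have c: "sq_integrable M (\<lambda>w. x0)" by (rule sq_integrable_const)
 have It: "sq_integrable M (I t)" by (rule l2_martingale_sq[OF I(1) t])
 define D where "D w = xh t w - (x0 + running bh t w)" for w
 have Dsq: "sq_integrable M D" unfolding D_def by (intro sq_integrable_diff sq_integrable_add xsq c rbh)
 have orth: "(\<E> w. y w * D w) = 0" if y: "y \<in> Bm (chain t)" "sq_integrable M y" for y
 proof -
  have yT: "y \<in> Bm (chain T)"
   using t by (intro measurable_larger[OF y(1) _ chain_filtration_mono]) auto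
  have "(\<E> w. y w * I t w) = (\<E> w. y w * I 0 w)"
   using t by (intro l2_martingale_orth[OF I(1)] y(2) measurable_larger[OF yT _ chain_subset_mixed]) auto
  also have "... = 0" by (rule integral_eq_zero_AE) (use I(2) in \<open>auto elim: eventually_mono\<close>)
  finally have I0: "(\<E> w. y w * I t w) = 0" .
  have drift: "mean_integral t (\<lambda>s w. y w * b s w) = mean_integral t (\<lambda>s w. y w * bh s w)"
  proof (rule mean_integral_cong)
   show "integrable Q (\<lambda>(s, w). y w * b s w)" by (rule sq_process_mult[OF sq_process_const[OF y(2)] sq(1)])
   show "integrable Q (\<lambda>(s, w). y w * bh s w)" by (rule sq_process_mult[OF sq_process_const[OF y(2)] sq(2)])
   have "AE s in clock T. projects_at s (b s) (bh s)" using b by (auto simp: projects_def)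
   then show "AE s in clock T. s <= t --> (\<E> w. y w * b s w) = (\<E> w. y w * bh s w)"
    using AE_space
   proof eventually_elim
    case (elim s)
    then have s: "s \<in> {0..T}" by simp
    have sub: "subalgebra M (chain s)" using s by (intro subalgebra_chain) auto
    have p: "sq_integrable M (b s)" "sq_integrable M (bh s)" "bh s \<in> Bm (chain s)"
     using elim by (auto simp: projects_at_def)
    define z where "z = real_cond_exp M (chain s) y"
    have z: "z \<in> Bm (chain s)" "sq_integrable M z"
     unfolding z_def using sq_integrable_cond_exp(1)[OF sub y(2)] by auto
    have "(\<E> w. b s w * y w) = (\<E> w. b s w * z w)"
     unfolding z_def using b s by (intro expectation_adapted_chain p yT y(2)) (auto simp: projects_def)
    also have "... = (\<E> w. z w * bh s w)"
     using elim(1) z unfolding projects_at_def by (simp add: mult.commute)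
    also have "... = (\<E> w. bh s w * y w)"
     using sq_integrable_cond_exp(3)[OF sub y(2) p(3,2)] by (simp add: z_def mult.commute)
    finally show ?case by (simp add: mult.commute)
   qed
  qed
  have "(\<E> w. y w * x t w) = (\<E> w. y w * x0 + y w * running b t w + y w * I t w)"
   using y(2) xsq(1) rb It xeq
   by (intro integral_cong_AE) (auto simp: sq_integrable_def algebra_simps elim: eventually_mono)
  also have "... = (\<E> w. y w * x0) + (\<E> w. y w * running b t w) + (\<E> w. y w * I t w)"
   using sq_integrable_mult[OF y(2) c] sq_integrable_mult[OF y(2) rb] sq_integrable_mult[OF y(2) It] by simp
  also have "... = (\<E> w. y w * x0) + (\<E> w. y w * running bh t w)"
   by (simp add: I0 expectation_running[OF sq(1) y(2) t] expectation_running[OF sq(2) y(2) t] drift)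
  finally have "(\<E> w. y w * xh t w) = (\<E> w. y w * x0) + (\<E> w. y w * running bh t w)"
   using xp[OF y] by simp
  moreover have "(\<E> w. y w * D w) = (\<E> w. y w * xh t w)
    - ((\<E> w. y w * x0) + (\<E> w. y w * running bh t w))"
   unfolding D_def right_diff_distrib distrib_left
   using sq_integrable_mult[OF y(2) c] sq_integrable_mult[OF y(2) rbh] sq_integrable_mult[OF y(2) xsq(2)] by simp
  ultimately show ?thesis by simp
 qed
 \<comment> \<open>Orthogonality is used for each \<open>bh s\<close> with s <= t and integrated in
   s by Fubini. Each \<open>bh s\<close> is a function of the chain, but joint measurability of
   \<open>bh\<close> is known only for the full sigma-algebra, so the integral cannot be fed to
   \<open>orth\<close> directly.\<close>
 have Dr: "(\<E> w. D w * running bh t w) = 0"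
 proof -
  have int: "integrable Q (\<lambda>(s, w). D w * bh s w)" by (rule sq_process_mult[OF sq_process_const[OF Dsq] sq(2)])
  have "mean_integral t (\<lambda>s w. D w * bh s w) = mean_integral t (\<lambda>s w. 0)"
  proof (rule mean_integral_cong[OF int])
   have "AE s in clock T. projects_at s (b s) (bh s)" using b by (auto simp: projects_def)
   then show "AE s in clock T. s <= t --> (\<E> w. D w * bh s w) = (\<E> w. 0)"
   proof eventually_elim
    case (elim s)
    show ?case
    proof
     assume "s <= t"
     have bhs: "bh s \<in> Bm (chain s)" using elim unfolding projects_at_def by blast
     have "bh s \<in> Bm (chain t)"
      by (rule measurable_larger[OF bhs _ chain_filtration_mono]) (use \<open>s <= t\<close> in auto)
     moreover have "sq_integrable M (bh s)" using elim unfolding projects_at_def by blast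
     ultimately have "(\<E> w. bh s w * D w) = 0" by (rule orth)
     then show "(\<E> w. D w * bh s w) = (\<E> w. 0)" by (simp only: mult.commute lebesgue_integral_const) simp
    qed
   qed
  qed (simp add: case_prod_unfold)
  then show ?thesis using expectation_running[OF sq(2) Dsq t] by (simp add: mean_integral_def)
 qed
 have "(\<E> w. (D w)\<^sup>2) = (\<E> w. xh t w * D w - (x0 * D w + D w * running bh t w))"
  by (intro lintegral_cong) (auto simp: D_def power2_eq_square algebra_simps)
 also have "... = (\<E> w. xh t w * D w) - ((\<E> w. x0 * D w) + (\<E> w. D w * running bh t w))"
  using sq_integrable_mult[OF xsq(2) Dsq] sq_integrable_mult[OF c Dsq] sq_integrable_mult[OF Dsq rbh] by simp
 also have "... = 0" using orth[OF xsq(3,2)] orth[of "\<lambda>w. x0", OF _ c] Dr by simp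
 finally have "(\<E> w. (D w)\<^sup>2) = 0" .
 then have "AE w in M. (D w)\<^sup>2 = 0"
  using Dsq by (subst (asm) integral_nonneg_eq_0_iff_AE) (auto simp: sq_integrable_def)
 then show ?thesis by eventually_elim (simp add: D_def)
qed

end

section \<open>Algebra of the follower's adjoint system\<close>

lemmas matrix_expand = matrix_vector_mult_add_rdistrib matrix_vector_mult_diff_rdistrib
 matrix_vector_right_distrib matrix_vector_mult_diff_distrib matrix_vector_mult_uminus_left
 matrix_vector_mult_uminus_right matrix_vector_mul_assoc[symmetric] matrix_transpose_mul
 transpose_add transpose_diff transpose_transpose

text \<open>The Riccati expression without the coupling of the regimes. The coupling is split off,
  here and in \<open>drift2\<close>, because it cancels against the generator term in
  \<open>vector_regime_product\<close>.\<close>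

definition drift1 ::
 "('s::finite, 'n::finite, 'm1::finite, 'm2::finite) lq_data => (real => 's => real^'n^'n) => real => 's => real^'n^'n" where
 "drift1 d P t i = P t i ** cA d i + transpose (cA d i) ** P t i
      + transpose (cC d i) ** P t i ** cC d i + cQ1 d i
      - transpose (S1 d P t i) ** matrix_inv (N1_tilde d P t i) ** S1 d P t i"

definition drift2 ::
 "('s::finite, 'n::finite, 'm1::finite, 'm2::finite) lq_data => (real => 's => real^'n^'n) =>
   (real => 's => real^'n^'n) => real => 's => real^'n^'n" where
 "drift2 d P Ph t i = Ph t i ** (cA d i + cAh d i) + transpose (cA d i + cAh d i) ** Ph t i
      + P t i ** cAh d i + transpose (cAh d i) ** P t i
      + transpose (cC d i) ** P t i ** cCh d i
      + transpose (cCh d i) ** P t i ** cC d i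
      + transpose (cCh d i) ** P t i ** cCh d i + cQ1h d i
      - transpose (S1 d P t i) ** matrix_inv (N1_tilde d P t i) ** S1h d P Ph t i
      - transpose (S1h d P Ph t i) ** matrix_inv (N1_tilde d P t i) ** S1 d P t i
      - transpose (S1h d P Ph t i) ** matrix_inv (N1_tilde d P t i) ** S1h d P Ph t i"

text \<open>The first-order condition of the follower: with p and q the two bracketed expressions it
  reads B1^T p + D1^T q + N1 u = 0. Collecting the terms in u turns it into the linear equation for
  \<open>N1_tilde\<close> that defines u.\<close>

lemma stationarity:
 fixes d :: "('s::finite, 'n::finite, 'm1::finite, 'm2::finite) lq_data"
 assumes N: "pos_def (N1_tilde d P t i)"
  and u: "u = - (matrix_inv (N1_tilde d P t i) *v (S1 d P t i *v x + S1h d P Ph t i *v xh + \<Phi>))"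
  and \<Phi>: "\<Phi> = transpose (cB1 d i) *v f + transpose (cD1 d i) *v h + (transpose (cD1 d i) ** P t i ** cD2 d i) *v u2"
 shows "transpose (cB1 d i) *v (P t i *v x + Ph t i *v xh + f)
  + transpose (cD1 d i) *v (P t i *v (cC d i *v x + cCh d i *v xh + cD1 d i *v u + cD2 d i *v u2) + h)
  = - (cN1 d i *v u)"
proof -
 have "N1_tilde d P t i *v u = - (S1 d P t i *v x + S1h d P Ph t i *v xh + \<Phi>)"
  unfolding u matrix_vector_mult_uminus_right matrix_vector_mul_assoc pos_def_matrix_inv(1)[OF N] by simp
 then have "N1_tilde d P t i *v u + (S1 d P t i *v x + S1h d P Ph t i *v xh + \<Phi>) = 0" by simp
 then show ?thesis
  unfolding \<Phi> S1_def S1h_def N1_tilde_def matrix_expand by (simp add: algebra_simps eq_neg_iff_add_eq_0)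
qed

text \<open>The drift of the adjoint equation, after the coupling through the generator has
  cancelled. The terms with \<open>P\<close> and \<open>Ph\<close> acting on drifts, those with
  \<open>drift1\<close> and \<open>drift2\<close>, and the driver of the backward equation together
  form the drift of p = P x + Ph xh + f. A trailing h marks the projected quantity, and x is
  projected to xh.\<close>

lemma adjoint_identity:
 fixes d :: "('s::finite, 'n::finite, 'm1::finite, 'm2::finite) lq_data"
 assumes P: "symmetric_matrix (P t i)" and R: "symmetric_matrix (matrix_inv (N1_tilde d P t i))"
  and Ph: "symmetric_matrix (Ph t i)"
  and u: "u = - (matrix_inv (N1_tilde d P t i) *v (S1 d P t i *v x + S1h d P Ph t i *v xh + \<Phi>))"
  and uh: "uh = - (matrix_inv (N1_tilde d P t i) *v (S1 d P t i *v xh + S1h d P Ph t i *v xh + \<Phi>h))"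
  and \<Phi>: "\<Phi> = transpose (cB1 d i) *v f + transpose (cD1 d i) *v y + (transpose (cD1 d i) ** P t i ** cD2 d i) *v u2"
  and \<Phi>h: "\<Phi>h = transpose (cB1 d i) *v fh + transpose (cD1 d i) *v yh + (transpose (cD1 d i) ** P t i ** cD2 d i) *v u2h"
 shows "transpose (cA d i) *v (P t i *v x + Ph t i *v xh + f)
  + transpose (cC d i) *v (P t i *v (cC d i *v x + cCh d i *v xh + cD1 d i *v u + cD2 d i *v u2) + y)
  + transpose (cAh d i) *v (P t i *v xh + Ph t i *v xh + fh)
  + transpose (cCh d i) *v (P t i *v (cC d i *v xh + cCh d i *v xh + cD1 d i *v uh + cD2 d i *v u2h) + yh)
  + P t i *v (cA d i *v x + cAh d i *v xh + cB1 d i *v u + cB2 d i *v u2)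
  + Ph t i *v (cA d i *v xh + cAh d i *v xh + cB1 d i *v uh + cB2 d i *v u2h)
  - drift1 d P t i *v x - drift2 d P Ph t i *v xh
  - (transpose (bbA d P t i) *v f + transpose (bbAh d P Ph t i) *v fh
   + transpose (bbC d P t i) *v y + transpose (bbCh d P Ph t i) *v yh
   + transpose (bbF2 d P t i) *v u2 + transpose (bbF2h d P Ph t i) *v u2h)
  = - (cQ1 d i *v x + cQ1h d i *v xh)"
 unfolding u uh \<Phi> \<Phi>h drift1_def drift2_def bbA_def bbAh_def bbC_def bbCh_def bbF2_def bbF2h_def
  S1_def S1h_def S2_def S2h_def matrix_expand P[unfolded symmetric_matrix_def] Ph[unfolded symmetric_matrix_def]
  R[unfolded symmetric_matrix_def]
 by (simp add: algebra_simps)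

text \<open>Here f and h are the values of \<open>\<phi>\<close> and \<open>\<theta>\<close>.
  Pairing them with the closed-loop state reproduces the driver of the backward equation tested with
  x and xh; what survives is the square in \<open>\<Phi>\<close> and the terms in u2 alone.\<close>

lemma value_identity:
 fixes d :: "('s::finite, 'n::finite, 'm1::finite, 'm2::finite) lq_data"
 assumes P: "symmetric_matrix (P t i)" and R: "symmetric_matrix (matrix_inv (N1_tilde d P t i))"
  and Ph: "symmetric_matrix (Ph t i)"
  and u: "u = - (matrix_inv (N1_tilde d P t i) *v (S1 d P t i *v x + S1h d P Ph t i *v xh + \<Phi>))"
  and \<Phi>: "\<Phi> = transpose (cB1 d i) *v f + transpose (cD1 d i) *v h + (transpose (cD1 d i) ** P t i ** cD2 d i) *v u2"
 shows "(transpose (cB2 d i) *v (P t i *v x + Ph t i *v xh + f)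
   + transpose (cD2 d i) *v (P t i *v (cC d i *v x + cCh d i *v xh + cD1 d i *v u + cD2 d i *v u2) + h)) \<bullet> u2
  + f \<bullet> (cA d i *v x + cAh d i *v xh + cB1 d i *v u + cB2 d i *v u2)
  + h \<bullet> (cC d i *v x + cCh d i *v xh + cD1 d i *v u + cD2 d i *v u2)
  = (transpose (bbA d P t i) *v f + transpose (bbC d P t i) *v h + transpose (bbF2 d P t i) *v u2) \<bullet> x
  + (transpose (bbAh d P Ph t i) *v f + transpose (bbCh d P Ph t i) *v h + transpose (bbF2h d P Ph t i) *v u2) \<bullet> xh
  - (matrix_inv (N1_tilde d P t i) *v \<Phi>) \<bullet> \<Phi> + ((transpose (cD2 d i) ** P t i ** cD2 d i) *v u2) \<bullet> u2
  + 2 * ((transpose (cB2 d i) *v f + transpose (cD2 d i) *v h) \<bullet> u2)"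
proof -
 define w where "w = matrix_inv (N1_tilde d P t i) *v \<Phi>"
 \<comment> \<open>Separating the feedback part from \<open>w\<close> lets the feedback be absorbed
   into the closed-loop coefficients.\<close>
 have u': "u = - (matrix_inv (N1_tilde d P t i) *v (S1 d P t i *v x + S1h d P Ph t i *v xh)) - w"
  unfolding u w_def matrix_expand by simp
 have w\<Phi>: "w \<bullet> \<Phi> = w \<bullet> (transpose (cB1 d i) *v f) + w \<bullet> (transpose (cD1 d i) *v h)
   + w \<bullet> ((transpose (cD1 d i) ** P t i ** cD2 d i) *v u2)"
  unfolding \<Phi> inner_add_right ..
 have tr: "a \<bullet> (transpose X *v b) = (X *v a) \<bullet> b" "(transpose X *v b) \<bullet> a = b \<bullet> (X *v a)"
  for X :: "real^'k::finite^'l::finite" and a b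
  by (metis inner_matrix_vector_left) (metis inner_matrix_vector_left inner_commute)
 note sm = inner_symmetric_matrix[OF P] inner_symmetric_matrix[OF Ph]
 have F: "(transpose (bbF2 d P t i) *v u2) \<bullet> x = (bbF2 d P t i *v x) \<bullet> u2"
  "(transpose (bbF2h d P Ph t i) *v u2) \<bullet> xh = (bbF2h d P Ph t i *v xh) \<bullet> u2"
  by (simp_all only: tr inner_commute[of u2])
 note A = tr(2)[of "bbA d P t i"] tr(2)[of "bbAh d P Ph t i"] tr(2)[of "bbC d P t i"] tr(2)[of "bbCh d P Ph t i"]
 show ?thesis
  unfolding inner_add_left A F
  unfolding bbA_def bbAh_def bbC_def bbCh_def bbF2_def bbF2h_def S2_def S2h_def w_def[symmetric] w\<Phi> u'
   matrix_expand P[unfolded symmetric_matrix_def]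
   inner_add_left inner_add_right inner_diff_left inner_diff_right inner_minus_left inner_minus_right tr sm
  by (simp add: inner_commute algebra_simps)
qed

section \<open>Vector-valued processes\<close>

lemma matrix_form_sum:
 fixes A :: "real^'n^'m"
 shows "(A *v x) \<bullet> y = (\<Sum>i\<in>UNIV. \<Sum>j\<in>UNIV. A $ i $ j * (x $ j * y $ i))"
 unfolding matrix_vector_mult_def inner_vec_def
 by (simp add: sum_distrib_left sum_distrib_right mult_ac)

context horizon begin

definition sq_vector_process :: "(real => 'w => real^'n) => bool" where
 "sq_vector_process x \<longleftrightarrow> (\<forall>j. sq_process (\<lambda>t w. x t w $ j))"

lemma sq_vector_processD: "sq_vector_process x ==> sq_process (\<lambda>t w. x t w $ j)"
 by (simp add: sq_vector_process_def)

lemma sq_vector_process_add: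
 "sq_vector_process x ==> sq_vector_process y ==> sq_vector_process (\<lambda>t w. x t w + y t w)"
 unfolding sq_vector_process_def vector_add_component by (intro allI sq_process_add) blast+

lemma sq_process_zero: "sq_process (\<lambda>t w. 0)"
 unfolding sq_process_def using sq_integrable_zero by (simp add: case_prod_unfold)

lemma sq_vector_process_uminus:
 assumes "sq_vector_process x"
 shows "sq_vector_process (\<lambda>t w. - x t w)"
 unfolding sq_vector_process_def vector_uminus_component
 using sq_process_diff[OF sq_process_zero sq_vector_processD[OF assms]] by simp

lemma sq_vector_process_inner:
 assumes "sq_vector_process x" "sq_vector_process y"
 shows "integrable Q (\<lambda>(t, w). x t w \<bullet> y t w)"
proof -
 have "integrable Q (\<lambda>z. \<Sum>j\<in>UNIV. x (fst z) (snd z) $ j * y (fst z) (snd z) $ j)"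
  by (intro lint_sum
    sq_process_mult[OF sq_vector_processD[OF assms(1)] sq_vector_processD[OF assms(2)], unfolded case_prod_unfold])
 then show ?thesis by (simp add: inner_vec_def case_prod_unfold)
qed

lemma sq_vector_process_measurable:
 assumes "sq_vector_process x"
 shows "(\<lambda>z. x (fst z) (snd z)) \<in> Bm Q"
proof -
 have "(\<lambda>z. x (fst z) (snd z) $ j) \<in> Bm Q" for j
  using sq_process_measurable[OF sq_vector_processD[OF assms, of j]] by (simp add: case_prod_unfold)
 then show ?thesis
  by (subst borel_measurable_euclidean_space) (auto simp: Basis_vec_def inner_axis)
qed

lemma L2_space_iff:
 fixes x :: "real => 'w => real^'n"
 shows "x \<in> L2_space M F T \<longleftrightarrow> sq_vector_process x \<and> adapted F T x"
proof -
 have 1: "sq_vector_process x" if m: "(\<lambda>z. x (fst z) (snd z)) \<in> Bm Q" and e: "time_energy M T x < \<infinity>"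
 proof -
  have fin: "(\<integral>\<^sup>+z. ennreal ((norm (x (fst z) (snd z)))\<^sup>2) \<partial>Q) < \<infinity>" using e time_energy_eq[OF m] by simp
  have "integrable Q (\<lambda>z. (norm (x (fst z) (snd z)))\<^sup>2)"
   using m fin by (intro integrableI_nonneg) auto
  then have "integrable Q (\<lambda>z. (x (fst z) (snd z) $ j)\<^sup>2)" for j
  proof (rule lint_bound)
   show "(\<lambda>z. (x (fst z) (snd z) $ j)\<^sup>2) \<in> Bm Q"
    by (intro borel_measurable_power borel_measurable_component m)
   show "AE z in Q. norm ((x (fst z) (snd z) $ j)\<^sup>2) <= norm ((norm (x (fst z) (snd z)))\<^sup>2)"
    by (intro AE_I2) (simp add: component_le_norm_cart abs_le_square_iff[symmetric])
  qed
  then show ?thesis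
   using borel_measurable_component[OF m]
   by (simp add: sq_vector_process_def sq_process_def sq_integrable_def case_prod_unfold)
 qed
 have 2: "time_energy M T x < \<infinity>" if "sq_vector_process x"
 proof -
  have "integrable Q (\<lambda>z. (norm (x (fst z) (snd z)))\<^sup>2)"
   using sq_vector_process_inner[OF that that] by (simp add: power2_norm_eq_inner case_prod_unfold)
  then show ?thesis
   unfolding time_energy_eq[OF sq_vector_process_measurable[OF that]]
   by (simp add: nn_integral_eq_integral)
 qed
 show ?thesis
  using 1 2 sq_vector_process_measurable[of x]
  unfolding L2_space_def mem_Collect_eq jointly_measurable_iff case_prod_unfold by blast
qed

text \<open>True almost surely only: if one component fails to be integrable along a path, the
  vector integral is 0 by convention although the other components may integrate to something
  else.\<close>

lemma vector_set_integral_component: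
 fixes v :: "real => 'w => real^'n"
 assumes v: "sq_vector_process v" and st: "0 <= s" "t <= T"
 shows "AE w in M. \<forall>j. (LINT r:{s..t}|lborel. v r w) $ j = (LINT r:{s..t}|lborel. v r w $ j)"
proof -
 have "AE w in M. \<forall>j. integrable (clock T) (\<lambda>s. v s w $ j)"
 proof (subst AE_all_countable, intro allI)
  fix j
  show "AE w in M. integrable (clock T) (\<lambda>s. v s w $ j)"
   using sq_process_sections(2)[OF sq_vector_processD[OF v, of j]]
   by eventually_elim (rule sq_integrable_imp_integrable[OF finite_measure_clock])
 qed
 then show ?thesis
 proof eventually_elim
  case (elim w)
  have comp: "set_integrable lborel {s..t} (\<lambda>r. v r w $ j)" for j
  proof -
   have "set_integrable lborel {0..T} (\<lambda>r. v r w $ j)"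
    using elim unfolding clock_def set_integrable_def by (subst integrable_restrict_space[symmetric]) auto
   then show ?thesis by (rule set_integrable_subset) (use st in auto)
  qed
  have "integrable lborel (\<lambda>r. indicator {s..t} r *\<^sub>R ((v r w $ j) *\<^sub>R (axis j 1 :: real^'n)))" for j
   using integrable_scaleR_left[OF comp[of j, unfolded set_integrable_def], of "axis j 1 :: real^'n"] by simp
  then have "set_integrable lborel {s..t} (\<lambda>r. \<Sum>j\<in>UNIV. (v r w $ j) *\<^sub>R (axis j 1 :: real^'n))"
   unfolding set_integrable_def scaleR_sum_right by (intro lint_sum)
  moreover have "(\<Sum>j\<in>UNIV. (v r w $ j) *\<^sub>R (axis j 1 :: real^'n)) = v r w" for r
   by (simp add: vec_eq_iff axis_def if_distrib cong: if_cong)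
  ultimately have "integrable lborel (\<lambda>r. indicator {s..t} r *\<^sub>R v r w)" by (simp add: set_integrable_def)
  from integral_bounded_linear[OF bounded_linear_vec_nth this] show ?case
   unfolding set_lebesgue_integral_def by simp
 qed
qed

lemma mean_integral_pointwise:
 assumes "\<And>s w. s \<in> {0..T} ==> w \<in> space M ==> f s w = g s w"
 shows "mean_integral t f = mean_integral t g"
 unfolding mean_integral_def
 by (rule lintegral_cong) (use assms in \<open>auto simp: space_pair_measure\<close>)

lemma mean_integral_sum:
 assumes "\<And>i. i \<in> I ==> integrable Q (\<lambda>(s, w). f i s w)"
 shows "mean_integral t (\<lambda>s w. \<Sum>i\<in>I. f i s w) = (\<Sum>i\<in>I. mean_integral t (f i))"
 unfolding mean_integral_def sum_distrib_left
 by (rule lintegral_sum) (rule integrable_upto, use assms in simp)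

lemma mean_integral_diff:
 assumes "integrable Q (case_prod f)" "integrable Q (case_prod g)"
 shows "mean_integral t (\<lambda>s w. f s w - g s w) = mean_integral t f - mean_integral t g"
 unfolding mean_integral_def right_diff_distrib
 by (rule lintegral_diff) (intro integrable_upto assms)+

lemma mean_integral_cmult: "mean_integral t (\<lambda>s w. c * f s w) = c * mean_integral t f"
 unfolding mean_integral_def by (simp add: mult.left_commute)

end

section \<open>Product formulas for Ito processes\<close>

context regime_noise begin

text \<open>The approximating integrands are part of the definition because the isometry for two
  different processes is proved by passing to the limit along both sequences.\<close>

definition ito_process ::
 "real => (real => 'w => real) => (real => 'w => real) => (real => 'w => real) => bool" where
 "ito_process x0 b k X \<longleftrightarrow> sq_process b \<and> sq_process k \<and> sq_process X \<and>
   (\<forall>s\<in>{0..T}. b s \<in> Bm (joint s) \<and> k s \<in> Bm (joint s) \<and> X s \<in> Bm (joint s)) \<and>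
   (\<exists>n \<tau> \<xi> I. approximates joint W n \<tau> \<xi> I \<and>
    (\<lambda>m. time_energy M T (\<lambda>t w. simple_process (n m) (\<tau> m) (\<xi> m) t w - k t w)) \<longlonglongrightarrow> 0 \<and>
    (\<forall>t\<in>{0..T}. AE w in M. X t w = x0 + running b t w + I t w))"

lemma noise_integral_martingale:
 assumes "approximates joint W n u x I"
 shows "l2_martingale (\<lambda>s. mixed s T) I" "AE w in M. I 0 w = 0" "l2_martingale joint I"
proof -
 have ap: "approximates joint (\<lambda>t w. W t w - W 0 w) n u x I" using assms by (simp add: approximates_W_shift)
 show 1: "l2_martingale (\<lambda>s. mixed s T) I" "AE w in M. I 0 w = 0"
  using approximates_martingale[OF filtration_enlarged joint_subalgebra_enlarged W_shifted_martingale ap] by auto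
 show "l2_martingale joint I"
  unfolding l2_martingale_def
 proof (intro conjI allI impI ballI)
  show "sq_integrable M (I t)" if "t \<in> {0..T}" for t by (rule l2_martingale_sq[OF 1(1) that])
  fix s t and h :: "'w => real" assume st: "0 <= s" "s <= t" "t <= T" and h: "h \<in> Bm (joint s)" "sq_integrable M h"
  have "h \<in> Bm (mixed s T)"
   using st by (intro measurable_from_subalg[OF joint_subalgebra_enlarged h(1)]) auto
  then show "(\<E> w. h w * (I t w - I s w)) = 0"
   using 1(1) st h(2) unfolding l2_martingale_def by blast
 qed
qed

lemma l2_martingale_scaled:
 assumes I: "l2_martingale (\<lambda>s. mixed s T) I"
  and z: "z \<in> Bm (chain T)" "\<And>w. w \<in> space M ==> \<bar>z w\<bar> <= C"
 shows "l2_martingale (\<lambda>s. mixed s T) (\<lambda>t w. z w * I t w)"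
 unfolding l2_martingale_def
proof (intro conjI allI impI ballI)
 have zM: "z \<in> Bm M" by (rule measurable_from_subalg[OF subalgebra_chain z(1)]) simp
 show "sq_integrable M (\<lambda>w. z w * I t w)" if "t \<in> {0..T}" for t
  by (rule sq_integrable_bounded_mult[OF l2_martingale_sq[OF I that] zM z(2)])
 fix s t and h :: "'w => real" assume st: "0 <= s" "s <= t" "t <= T"
  and h: "h \<in> Bm (mixed s T)" "sq_integrable M h"
 have "z \<in> Bm (mixed s T)" by (rule measurable_larger[OF z(1) _ chain_subset_mixed]) simp
 then have "(\<lambda>w. z w * h w) \<in> Bm (mixed s T)" using h(1) by simp
 moreover have "sq_integrable M (\<lambda>w. z w * h w)" by (rule sq_integrable_bounded_mult[OF h(2) zM z(2)])
 ultimately have "(\<E> w. (z w * h w) * (I t w - I s w)) = 0"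
  using I st unfolding l2_martingale_def by blast
 then show "(\<E> w. h w * (z w * I t w - z w * I s w)) = 0"
  by (simp add: algebra_simps)
qed

lemma ito_process_sq:
 assumes X: "ito_process x0 b k X" and t: "t \<in> {0..T}"
 shows "sq_integrable M (X t)"
proof -
 from X obtain n u x I where ap: "approximates joint W n u x I"
  and eq: "AE w in M. X t w = x0 + running b t w + I t w" and b: "sq_process b" and m: "X t \<in> Bm (joint t)"
  using t unfolding ito_process_def by blast
 have c: "sq_integrable M (\<lambda>w. x0)" by (rule sq_integrable_const)
 have sq: "sq_integrable M (\<lambda>w. x0 + running b t w + I t w)"
  by (intro sq_integrable_add c running_sq_bound(1)[OF b t] l2_martingale_sq[OF noise_integral_martingale(1)[OF ap] t])
 have "X t \<in> Bm M" using t by (intro measurable_from_subalg[OF subalgebra_joint m]) auto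
 then show ?thesis by (rule sq_integrable_cong_AE[OF sq]) (use eq in \<open>auto elim: eventually_mono\<close>)
qed

lemma running_cmult: "running (\<lambda>s w. z w * b s w) t w = (z w :: real) * running b t w"
 unfolding running_def by simp

text \<open>The weight \<open>z\<close> is known at time 0 to the filtration enlarged by the chain,
  so \<open>z\<close> times \<open>X\<close> is again of the form required by
  \<open>expectation_product\<close>, with initial value, drift and martingale part multiplied by
  \<open>z\<close>.\<close>

lemma ito_product:
 assumes X: "ito_process x0 b k X" and Y: "ito_process y0 c l Y"
  and z: "z \<in> Bm (chain T)" "\<And>w. w \<in> space M ==> \<bar>z w\<bar> <= C" and t: "t \<in> {0..T}"
 shows "(\<E> w. z w * (X t w * Y t w)) = x0 * y0 * expectation z
  + mean_integral t (\<lambda>s w. z w * (b s w * Y s w + X s w * c s w + k s w * l s w))"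
proof -
 from X obtain n u x I where ap: "approximates joint W n u x I"
  and lim: "(\<lambda>m. time_energy M T (\<lambda>t w. simple_process (n m) (u m) (x m) t w - k t w)) \<longlonglongrightarrow> 0"
  and eq: "\<And>t. t \<in> {0..T} ==> AE w in M. X t w = x0 + running b t w + I t w"
  and sq: "sq_process b" "sq_process k" "sq_process X" and m: "\<And>s. s \<in> {0..T} ==> b s \<in> Bm (joint s)"
  unfolding ito_process_def by blast
 from Y obtain n' u' x' I' where ap': "approximates joint W n' u' x' I'"
  and lim': "(\<lambda>m. time_energy M T (\<lambda>t w. simple_process (n' m) (u' m) (x' m) t w - l t w)) \<longlonglongrightarrow> 0"
  and eq': "\<And>t. t \<in> {0..T} ==> AE w in M. Y t w = y0 + running c t w + I' t w"
  and sq': "sq_process c" "sq_process l" "sq_process Y" and m': "\<And>s. s \<in> {0..T} ==> c s \<in> Bm (joint s)"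
  unfolding ito_process_def by blast
 have zM: "z \<in> Bm M" by (rule measurable_from_subalg[OF subalgebra_chain z(1)]) simp
 have zsq: "sq_integrable M z" by (rule sq_integrable_bounded[OF finite_measure_axioms zM z(2)])
 have zmix: "z \<in> Bm (mixed s T)" for s
  by (rule measurable_larger[OF z(1) _ chain_subset_mixed]) simp
 have zQ: "(\<lambda>(t, w). z w) \<in> Bm Q" using zM by simp
 have scale: "sq_process (\<lambda>s w. z w * f s w)" if "sq_process f" for f
  by (rule sq_process_bounded_mult[OF that zQ z(2)])
 have enl: "f \<in> Bm (mixed s T)" if "f \<in> Bm (joint s)" "s \<in> {0..T}" for f :: "'w => real" and s
  by (rule measurable_from_subalg[OF joint_subalgebra_enlarged[OF that(2)] that(1)])
 have c0: "sq_integrable M (\<lambda>w. y0)" by (rule sq_integrable_const)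
 have main: "(\<E> w. (z w * X t w) * Y t w) = (\<E> w. (z w * x0) * y0)
  + mean_integral t (\<lambda>s w. (z w * b s w) * Y s w + (z w * X s w) * c s w)
  + (\<E> w. (z w * I t w) * I' t w)"
 proof (rule expectation_product[where H = "\<lambda>s. mixed s T"])
  show "sq_process (\<lambda>s w. z w * b s w)" "sq_process (\<lambda>s w. z w * X s w)" by (intro scale sq)+
  show "sq_process c" "sq_process Y" by (rule sq')+
  show "(\<lambda>w. z w * b s w) \<in> Bm (mixed s T)" "c s \<in> Bm (mixed s T)" if "s \<in> {0..T}" for s
   using zmix enl[OF m[OF that] that] enl[OF m'[OF that] that] by simp_all
  show "sq_integrable M (\<lambda>w. z w * x0)" using sq_integrable_cmult[OF zsq, of x0] by (simp add: mult.commute)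
  show "sq_integrable M (\<lambda>w. y0)" by (rule c0)
  show "(\<lambda>w. z w * x0) \<in> Bm (mixed 0 T)" "(\<lambda>w. y0) \<in> Bm (mixed 0 T)"
   using zmix by simp_all
  show "l2_martingale (\<lambda>s. mixed s T) (\<lambda>t w. z w * I t w)"
   by (rule l2_martingale_scaled[OF noise_integral_martingale(1)[OF ap] z])
  show "AE w in M. z w * I 0 w = 0" using noise_integral_martingale(2)[OF ap] by eventually_elim simp
  show "l2_martingale (\<lambda>s. mixed s T) I'" "AE w in M. I' 0 w = 0" by (rule noise_integral_martingale[OF ap'])+
  show "AE w in M. z w * X t w = z w * x0 + running (\<lambda>s w. z w * b s w) t w + z w * I t w" if "t \<in> {0..T}" for t
   using eq[OF that] by eventually_elim (simp add: running_cmult distrib_left)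
  show "AE w in M. Y t w = y0 + running c t w + I' t w" if "t \<in> {0..T}" for t by (rule eq'[OF that])
 qed (rule t)
 have mart: "(\<E> w. (z w * I t w) * I' t w) = mean_integral t (\<lambda>s w. z w * (k s w * l s w))"
  unfolding mult.assoc by (rule ito_isometry[OF ap sq(2) lim ap' sq'(2) lim' z t])
 have start: "(\<E> w. (z w * x0) * y0) = x0 * y0 * expectation z" by simp
 have "mean_integral t (\<lambda>s w. z w * (b s w * Y s w + X s w * c s w + k s w * l s w))
  = mean_integral t (\<lambda>s w. (z w * b s w * Y s w + z w * X s w * c s w) + z w * (k s w * l s w))"
  by (rule mean_integral_pointwise) (simp add: algebra_simps)
 also have "... = mean_integral t (\<lambda>s w. z w * b s w * Y s w + z w * X s w * c s w) + mean_integral t (\<lambda>s w. z w * (k s w * l s w))"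
 proof (rule mean_integral_add)
  show "integrable Q (\<lambda>(s, w). z w * b s w * Y s w + z w * X s w * c s w)"
   using lint_add[OF sq_process_mult[OF scale[OF sq(1)] sq'(3)] sq_process_mult[OF scale[OF sq(3)] sq'(1)]]
   by (simp add: case_prod_unfold)
  show "integrable Q (\<lambda>(s, w). z w * (k s w * l s w))"
   using sq_process_mult[OF scale[OF sq(2)] sq'(2)] by (simp only: mult.assoc)
 qed
 finally have split: "mean_integral t (\<lambda>s w. z w * (b s w * Y s w + X s w * c s w + k s w * l s w))
  = mean_integral t (\<lambda>s w. z w * b s w * Y s w + z w * X s w * c s w) + mean_integral t (\<lambda>s w. z w * (k s w * l s w))" .
 have "(\<E> w. z w * (X t w * Y t w)) = (\<E> w. (z w * X t w) * Y t w)"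
  by (simp only: mult.assoc)
 then show ?thesis unfolding split main mart start by linarith
qed

lemma ito_regime_product:
 fixes g g' :: "real => 's => real"
 assumes g: "\<And>r j. r \<in> {0..T} ==> ((\<lambda>r. g r j) has_real_derivative g' r j) (at r within {0..T})"
  and g': "\<And>j. continuous_on {0..T} (\<lambda>r. g' r j)"
  and X: "ito_process x0 b k X" and Y: "ito_process y0 c l Y" and t: "t \<in> {0..T}"
 shows "(\<E> w. g t (\<alpha> t w) * (X t w * Y t w)) = g 0 i0 * (x0 * y0)
  + mean_integral t (\<lambda>s w. g s (\<alpha> s w) * (b s w * Y s w + X s w * c s w + k s w * l s w)
   + (g' s (\<alpha> s w) + (\<Sum>r\<in>UNIV. gen (\<alpha> s w) r * g s r)) * (X s w * Y s w))"
proof (rule expectation_regime_product[OF g g' _ _ _ _ t])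
 have sq: "sq_process b" "sq_process k" "sq_process X" "sq_process c" "sq_process l" "sq_process Y"
  and m: "\<And>s. s \<in> {0..T} ==> b s \<in> Bm (joint s)" "\<And>s. s \<in> {0..T} ==> k s \<in> Bm (joint s)"
   "\<And>s. s \<in> {0..T} ==> X s \<in> Bm (joint s)" "\<And>s. s \<in> {0..T} ==> c s \<in> Bm (joint s)"
   "\<And>s. s \<in> {0..T} ==> l s \<in> Bm (joint s)" "\<And>s. s \<in> {0..T} ==> Y s \<in> Bm (joint s)"
  using X Y by (auto simp: ito_process_def)
 show "integrable Q (\<lambda>(s, w). b s w * Y s w + X s w * c s w + k s w * l s w)"
  using lint_add[OF lint_add[OF sq_process_mult[OF sq(1,6)] sq_process_mult[OF sq(3,4)]] sq_process_mult[OF sq(2,5)]]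
  by (simp add: case_prod_unfold)
 show "integrable Q (\<lambda>(s, w). X s w * Y s w)" by (rule sq_process_mult[OF sq(3,6)])
 show "(\<lambda>w. b s w * Y s w + X s w * c s w + k s w * l s w) \<in> Bm (joint s)" if "s \<in> {0..T}" for s
  by (intro borel_measurable_add borel_measurable_times m that)
 show "(\<E> w. z w * (X t w * Y t w)) = x0 * y0 * expectation z
  + mean_integral t (\<lambda>s w. z w * (b s w * Y s w + X s w * c s w + k s w * l s w))"
  if "t \<in> {0..T}" "z \<in> Bm (chain T)" "\<And>w. w \<in> space M ==> \<bar>z w\<bar> <= C" for t z C
  by (rule ito_product[OF X Y that(2,3,1)])
qed

end

section \<open>Vector processes weighted by matrix functions of the chain\<close>

context regime_noise begin

definition vector_ito_process ::
 "real^'n => (real => 'w => real^'n) => (real => 'w => real^'n) => (real => 'w => real^'n) => bool" where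
 "vector_ito_process x0 b k X \<longleftrightarrow>
   (\<forall>j. ito_process (x0 $ j) (\<lambda>t w. b t w $ j) (\<lambda>t w. k t w $ j) (\<lambda>t w. X t w $ j))"

lemma vector_ito_processD:
 "vector_ito_process x0 b k X ==> ito_process (x0 $ j) (\<lambda>t w. b t w $ j) (\<lambda>t w. k t w $ j) (\<lambda>t w. X t w $ j)"
 by (simp add: vector_ito_process_def)

lemma vector_regime_product:
 fixes \<Theta> \<Theta>' :: "real => 's => real^'n^'n"
 assumes \<Theta>: "\<And>r j. r \<in> {0..T} ==> ((\<lambda>r. \<Theta> r j) has_vector_derivative \<Theta>' r j) (at r within {0..T})"
  and \<Theta>': "\<And>j. continuous_on {0..T} (\<lambda>r. \<Theta>' r j)"
  and X: "vector_ito_process x0 b k X" and Y: "vector_ito_process y0 c l Y" and t: "t \<in> {0..T}"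
 shows "(\<E> w. (\<Theta> t (\<alpha> t w) *v X t w) \<bullet> Y t w) = (\<Theta> 0 i0 *v x0) \<bullet> y0
  + mean_integral t (\<lambda>s w. (\<Theta> s (\<alpha> s w) *v b s w) \<bullet> Y s w + (\<Theta> s (\<alpha> s w) *v X s w) \<bullet> c s w
   + (\<Theta> s (\<alpha> s w) *v k s w) \<bullet> l s w
   + ((\<Theta>' s (\<alpha> s w) + (\<Sum>r\<in>UNIV. gen (\<alpha> s w) r *\<^sub>R \<Theta> s r)) *v X s w) \<bullet> Y s w)"
proof -
 define g where "g i j r m = \<Theta> r m $ i $ j" for i j r m
 define g' where "g' i j r m = \<Theta>' r m $ i $ j" for i j r m
 define L where "L i j r m = g' i j r m + (\<Sum>p\<in>UNIV. gen m p * g i j r p)" for i j r m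
 define F where "F i j s w = g i j s (\<alpha> s w) * (b s w $ j * Y s w $ i + X s w $ j * c s w $ i + k s w $ j * l s w $ i)
  + L i j s (\<alpha> s w) * (X s w $ j * Y s w $ i)" for i j s w
 have dg: "((\<lambda>r. g i j r m) has_real_derivative g' i j r m) (at r within {0..T})" if "r \<in> {0..T}" for i j r m
  unfolding has_real_derivative_iff_has_vector_derivative g_def g'_def
  by (intro bounded_linear.has_vector_derivative[OF bounded_linear_vec_nth] \<Theta> that)
 have cg': "continuous_on {0..T} (\<lambda>r. g' i j r m)" for i j m unfolding g'_def by (intro continuous_intros \<Theta>')
 have cg: "continuous_on {0..T} (\<lambda>r. g i j r m)" for i j m using dg by (intro DERIV_continuous_on)
 have cL: "continuous_on {0..T} (\<lambda>r. L i j r m)" for i j m unfolding L_def by (intro continuous_intros cg cg')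
 have sq: "sq_process (\<lambda>t w. b t w $ j)" "sq_process (\<lambda>t w. k t w $ j)" "sq_process (\<lambda>t w. X t w $ j)"
   "sq_process (\<lambda>t w. c t w $ j)" "sq_process (\<lambda>t w. l t w $ j)" "sq_process (\<lambda>t w. Y t w $ j)" for j
  using vector_ito_processD[OF X, of j] vector_ito_processD[OF Y, of j] by (auto simp: ito_process_def)
 have mean_F: "(\<E> w. g i j t (\<alpha> t w) * (X t w $ j * Y t w $ i)) = g i j 0 i0 * (x0 $ j * y0 $ i) + mean_integral t (F i j)" for i j
  unfolding F_def L_def
  by (rule ito_regime_product[OF dg cg' vector_ito_processD[OF X] vector_ito_processD[OF Y] t])
 have FQ: "integrable Q (\<lambda>(s, w). F i j s w)" for i j
 proof -
  have "integrable Q (\<lambda>z. (g i j (fst z) (\<alpha> (fst z) (snd z)) * b (fst z) (snd z) $ j) * Y (fst z) (snd z) $ i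
   + (g i j (fst z) (\<alpha> (fst z) (snd z)) * X (fst z) (snd z) $ j) * c (fst z) (snd z) $ i
   + (g i j (fst z) (\<alpha> (fst z) (snd z)) * k (fst z) (snd z) $ j) * l (fst z) (snd z) $ i
   + (L i j (fst z) (\<alpha> (fst z) (snd z)) * X (fst z) (snd z) $ j) * Y (fst z) (snd z) $ i)"
   by (intro lint_add sq_process_mult[unfolded case_prod_unfold] regime_sq_process sq cg cL)
  then show ?thesis unfolding F_def case_prod_unfold by (simp add: algebra_simps)
 qed
 have gM: "integrable M (\<lambda>w. g i j t (\<alpha> t w) * (X t w $ j * Y t w $ i))" for i j
 proof -
  obtain C where C: "\<And>t m. t \<in> {0..T} ==> \<bar>g i j t m\<bar> <= C" using regime_function_bounded[of "g i j", OF cg] by blast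
  have "(\<lambda>w. g i j t (\<alpha> t w)) \<in> Bm M" by (rule measurable_compose[OF \<alpha>_measurable[OF t]]) simp
  from sq_integrable_mult[OF sq_integrable_bounded_mult[OF ito_process_sq[OF vector_ito_processD[OF X] t] this C[OF t]]
   ito_process_sq[OF vector_ito_processD[OF Y] t]]
  show ?thesis by (simp only: mult.assoc)
 qed
 have "(\<E> w. (\<Theta> t (\<alpha> t w) *v X t w) \<bullet> Y t w)
  = (\<E> w. \<Sum>i\<in>UNIV. \<Sum>j\<in>UNIV. g i j t (\<alpha> t w) * (X t w $ j * Y t w $ i))"
  by (simp only: matrix_form_sum g_def)
 also have "... = (\<Sum>i\<in>UNIV. \<Sum>j\<in>UNIV. (\<E> w. g i j t (\<alpha> t w) * (X t w $ j * Y t w $ i)))"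
  by (subst lintegral_sum, intro lint_sum gM,
    intro sum.cong refl lintegral_sum gM)
 also have "... = (\<Sum>i\<in>UNIV. \<Sum>j\<in>UNIV. g i j 0 i0 * (x0 $ j * y0 $ i)) + (\<Sum>i\<in>UNIV. \<Sum>j\<in>UNIV. mean_integral t (F i j))"
  by (simp only: mean_F sum.distrib)
 also have "(\<Sum>i\<in>UNIV. \<Sum>j\<in>UNIV. g i j 0 i0 * (x0 $ j * y0 $ i)) = (\<Theta> 0 i0 *v x0) \<bullet> y0"
  by (simp only: matrix_form_sum g_def)
 also have "(\<Sum>i\<in>UNIV. \<Sum>j\<in>UNIV. mean_integral t (F i j)) = (\<Sum>i\<in>UNIV. mean_integral t (\<lambda>s w. \<Sum>j\<in>UNIV. F i j s w))"
  by (intro sum.cong refl mean_integral_sum[symmetric] FQ)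
 also have "... = mean_integral t (\<lambda>s w. \<Sum>i\<in>UNIV. \<Sum>j\<in>UNIV. F i j s w)"
  using FQ by (intro mean_integral_sum[symmetric]) (simp add: case_prod_unfold)
 also have "... = mean_integral t (\<lambda>s w. (\<Theta> s (\<alpha> s w) *v b s w) \<bullet> Y s w + (\<Theta> s (\<alpha> s w) *v X s w) \<bullet> c s w
   + (\<Theta> s (\<alpha> s w) *v k s w) \<bullet> l s w
   + ((\<Theta>' s (\<alpha> s w) + (\<Sum>r\<in>UNIV. gen (\<alpha> s w) r *\<^sub>R \<Theta> s r)) *v X s w) \<bullet> Y s w)"
  unfolding matrix_form_sum F_def L_def g_def g'_def distrib_left sum.distrib vector_add_component sum_component
   vector_scaleR_component real_scaleR_def by (simp only: add.assoc)
 finally show ?thesis .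
qed

section \<open>Projections of vector processes\<close>

lemma projects_at_add:
 assumes "projects_at s a ah" "projects_at s b bh"
 shows "projects_at s (\<lambda>w. a w + b w) (\<lambda>w. ah w + bh w)"
 unfolding projects_at_def
proof (intro conjI allI impI)
 have sq: "sq_integrable M a" "sq_integrable M ah" "sq_integrable M b" "sq_integrable M bh"
  and m: "ah \<in> Bm (chain s)" "bh \<in> Bm (chain s)"
  using assms unfolding projects_at_def by blast+
 show "sq_integrable M (\<lambda>w. a w + b w)" "sq_integrable M (\<lambda>w. ah w + bh w)" by (intro sq_integrable_add sq)+
 show "(\<lambda>w. ah w + bh w) \<in> Bm (chain s)" by (intro borel_measurable_add m)
 fix z :: "'w => real" assume z: "z \<in> Bm (chain s)" "sq_integrable M z"
 have "(\<E> w. z w * a w) = (\<E> w. z w * ah w)" "(\<E> w. z w * b w) = (\<E> w. z w * bh w)"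
  using assms z unfolding projects_at_def by blast+
 then show "(\<E> w. z w * (a w + b w)) = (\<E> w. z w * (ah w + bh w))"
  unfolding distrib_left
  by (simp add: sq_integrable_mult[OF z(2) sq(1)] sq_integrable_mult[OF z(2) sq(2)]
    sq_integrable_mult[OF z(2) sq(3)] sq_integrable_mult[OF z(2) sq(4)])
qed

lemma projects_at_scale:
 assumes a: "projects_at s a ah" and s: "s \<in> {0..T}"
  and h: "h \<in> Bm (chain s)" "\<And>w. w \<in> space M ==> \<bar>h w\<bar> <= C"
 shows "projects_at s (\<lambda>w. h w * a w) (\<lambda>w. h w * ah w)"
 unfolding projects_at_def
proof (intro conjI allI impI)
 have sq: "sq_integrable M a" "sq_integrable M ah" and m: "ah \<in> Bm (chain s)"
  using a unfolding projects_at_def by blast+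
 have hM: "h \<in> Bm M" using s by (intro measurable_from_subalg[OF subalgebra_chain h(1)]) auto
 show "sq_integrable M (\<lambda>w. h w * a w)" "sq_integrable M (\<lambda>w. h w * ah w)"
  by (rule sq_integrable_bounded_mult[OF _ hM h(2)], rule sq, assumption)+
 show "(\<lambda>w. h w * ah w) \<in> Bm (chain s)" by (intro borel_measurable_times h m)
 fix z :: "'w => real" assume z: "z \<in> Bm (chain s)" "sq_integrable M z"
 have "(\<lambda>w. h w * z w) \<in> Bm (chain s)" by (intro borel_measurable_times h z)
 moreover have "sq_integrable M (\<lambda>w. h w * z w)" by (rule sq_integrable_bounded_mult[OF z(2) hM h(2)])
 ultimately have "(\<E> w. (h w * z w) * a w) = (\<E> w. (h w * z w) * ah w)"
  using a unfolding projects_at_def by blast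
 then show "(\<E> w. z w * (h w * a w)) = (\<E> w. z w * (h w * ah w))"
  by (simp only: mult_ac)
qed

lemma chain_measurable_joint: "f \<in> Bm (chain s) ==> f \<in> Bm (joint s)" for f :: "'w => real"
 unfolding joint_eq_mixed by (rule measurable_larger[OF _ _ chain_subset_mixed]) simp_all

lemma projects_add:
 assumes "projects a ah" "projects b bh"
 shows "projects (\<lambda>t w. a t w + b t w) (\<lambda>t w. ah t w + bh t w)"
 unfolding projects_def
proof (intro conjI ballI)
 show "sq_process (\<lambda>t w. a t w + b t w)" "sq_process (\<lambda>t w. ah t w + bh t w)"
  using assms by (intro sq_process_add; simp add: projects_def)+
 show "(\<lambda>w. a s w + b s w) \<in> Bm (joint s)" "(\<lambda>w. ah s w + bh s w) \<in> Bm (chain s)" if "s \<in> {0..T}" for s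
  using assms that by (intro borel_measurable_add; simp add: projects_def)+
 have "AE s in clock T. projects_at s (a s) (ah s)" "AE s in clock T. projects_at s (b s) (bh s)"
  using assms by (simp_all add: projects_def)
 then show "AE s in clock T. projects_at s (\<lambda>w. a s w + b s w) (\<lambda>w. ah s w + bh s w)"
  by eventually_elim (rule projects_at_add)
qed

lemma projects_scale:
 fixes f :: "real => 's => real"
 assumes f: "\<And>j. continuous_on {0..T} (\<lambda>t. f t j)" and a: "projects a ah"
 shows "projects (\<lambda>t w. f t (\<alpha> t w) * a t w) (\<lambda>t w. f t (\<alpha> t w) * ah t w)"
 unfolding projects_def
proof (intro conjI ballI)
 have sq: "sq_process a" "sq_process ah" and m: "\<And>s. s \<in> {0..T} ==> a s \<in> Bm (joint s)"
   "\<And>s. s \<in> {0..T} ==> ah s \<in> Bm (chain s)"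
   and p: "AE s in clock T. projects_at s (a s) (ah s)"
  using a by (simp_all add: projects_def)
 show "sq_process (\<lambda>t w. f t (\<alpha> t w) * a t w)" "sq_process (\<lambda>t w. f t (\<alpha> t w) * ah t w)"
  by (intro regime_sq_process f sq)+
 have fc: "(\<lambda>w. f s (\<alpha> s w)) \<in> Bm (chain s)" if "s \<in> {0..T}" for s
  using that by (intro regime_function_chain) auto
 show "(\<lambda>w. f s (\<alpha> s w) * a s w) \<in> Bm (joint s)" if "s \<in> {0..T}" for s
  by (intro borel_measurable_times m chain_measurable_joint fc that)
 show "(\<lambda>w. f s (\<alpha> s w) * ah s w) \<in> Bm (chain s)" if "s \<in> {0..T}" for s
  by (intro borel_measurable_times m fc that)
 obtain C where C: "\<And>t j. t \<in> {0..T} ==> \<bar>f t j\<bar> <= C" using regime_function_bounded[of f, OF f] by blast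
 show "AE s in clock T. projects_at s (\<lambda>w. f s (\<alpha> s w) * a s w) (\<lambda>w. f s (\<alpha> s w) * ah s w)"
  using p AE_space
 proof eventually_elim
  case (elim s)
  then have s: "s \<in> {0..T}" by simp
  show ?case by (rule projects_at_scale[OF elim(1) s fc[OF s] C[OF s]])
 qed
qed

lemma projects_zero: "projects (\<lambda>t w. 0) (\<lambda>t w. 0)"
 unfolding projects_def projects_at_def using sq_process_zero by (simp add: sq_integrable_zero)

lemma projects_sum:
 "finite J ==> (\<And>j. j \<in> J ==> projects (a j) (ah j)) ==> projects (\<lambda>t w. \<Sum>j\<in>J. a j t w) (\<lambda>t w. \<Sum>j\<in>J. ah j t w)"
proof (induction J rule: finite_induct)
 case empty then show ?case using projects_zero by simp
next
 case (insert j J)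
 have "projects (a j) (ah j)" "projects (\<lambda>t w. \<Sum>j\<in>J. a j t w) (\<lambda>t w. \<Sum>j\<in>J. ah j t w)"
  using insert.IH insert.prems by blast+
 from projects_add[OF this] show ?case unfolding sum.insert[OF insert.hyps(1,2)] .
qed

definition vector_projects :: "(real => 'w => real^'n) => (real => 'w => real^'n) => bool" where
 "vector_projects x xh \<longleftrightarrow> (\<forall>j. projects (\<lambda>t w. x t w $ j) (\<lambda>t w. xh t w $ j))"

lemma vector_projects_add:
 "vector_projects a ah ==> vector_projects b bh ==> vector_projects (\<lambda>t w. a t w + b t w) (\<lambda>t w. ah t w + bh t w)"
 unfolding vector_projects_def vector_add_component by (intro allI projects_add) blast+

lemma vector_projects_matrix:
 fixes \<Theta> :: "real => 's => real^'n^'m"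
 assumes \<Theta>: "\<And>j. continuous_on {0..T} (\<lambda>t. \<Theta> t j)" and x: "vector_projects x xh"
 shows "vector_projects (\<lambda>t w. \<Theta> t (\<alpha> t w) *v x t w) (\<lambda>t w. \<Theta> t (\<alpha> t w) *v xh t w)"
 unfolding vector_projects_def
proof
 fix i
 have "projects (\<lambda>t w. \<Sum>j\<in>UNIV. \<Theta> t (\<alpha> t w) $ i $ j * x t w $ j) (\<lambda>t w. \<Sum>j\<in>UNIV. \<Theta> t (\<alpha> t w) $ i $ j * xh t w $ j)"
  using x by (intro projects_sum finite projects_scale[of "\<lambda>t m. \<Theta> t m $ i $ j" for j] continuous_intros \<Theta>) (simp add: vector_projects_def)
 then show "projects (\<lambda>t w. (\<Theta> t (\<alpha> t w) *v x t w) $ i) (\<lambda>t w. (\<Theta> t (\<alpha> t w) *v xh t w) $ i)"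
  by (simp add: matrix_vector_mult_def)
qed

lemma vector_projects_uminus:
 assumes "vector_projects a ah"
 shows "vector_projects (\<lambda>t w. - a t w) (\<lambda>t w. - ah t w)"
 unfolding vector_projects_def vector_uminus_component
 using assms projects_scale[of "\<lambda>t j. - 1"] by (simp add: vector_projects_def)

lemma vector_projects_sq:
 assumes "vector_projects x xh"
 shows "sq_vector_process x" "sq_vector_process xh"
 using assms by (simp_all add: vector_projects_def projects_def sq_vector_process_def)

lemma projects_self:
 assumes "projects a ah"
 shows "projects ah ah"
proof -
 have "AE s in clock T. projects_at s (a s) (ah s)" using assms unfolding projects_def by blast
 then have "AE s in clock T. projects_at s (ah s) (ah s)"
  by (rule eventually_mono) (simp only: projects_at_def, blast)
 moreover have "\<forall>s\<in>{0..T}. ah s \<in> Bm (chain s)" "sq_process ah" using assms unfolding projects_def by blast+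
 ultimately show ?thesis unfolding projects_def using chain_measurable_joint by blast
qed

lemma vector_projects_self: "vector_projects x xh ==> vector_projects xh xh"
 unfolding vector_projects_def using projects_self by blast

lemma vector_projects_swap:
 assumes a: "vector_projects a ah" and b: "vector_projects b bh"
 shows "mean_integral t (\<lambda>s w. a s w \<bullet> bh s w) = mean_integral t (\<lambda>s w. ah s w \<bullet> b s w)"
proof -
 have p: "projects (\<lambda>t w. a t w $ j) (\<lambda>t w. ah t w $ j)" "projects (\<lambda>t w. b t w $ j) (\<lambda>t w. bh t w $ j)" for j
  using a b by (simp_all add: vector_projects_def)
 have sq: "sq_process (\<lambda>t w. a t w $ j)" "sq_process (\<lambda>t w. ah t w $ j)" "sq_process (\<lambda>t w. b t w $ j)" "sq_process (\<lambda>t w. bh t w $ j)" for j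
  using p[of j] by (simp_all add: projects_def)
 have "mean_integral t (\<lambda>s w. \<Sum>j\<in>UNIV. a s w $ j * bh s w $ j) = (\<Sum>j\<in>UNIV. mean_integral t (\<lambda>s w. a s w $ j * bh s w $ j))"
  by (intro mean_integral_sum sq_process_mult sq)
 also have "... = (\<Sum>j\<in>UNIV. mean_integral t (\<lambda>s w. ah s w $ j * b s w $ j))"
  using mean_integral_swap[of "\<lambda>t m. 1", OF _ p] by simp
 also have "... = mean_integral t (\<lambda>s w. \<Sum>j\<in>UNIV. ah s w $ j * b s w $ j)"
  by (intro mean_integral_sum[symmetric] sq_process_mult sq)
 finally show ?thesis by (simp add: inner_vec_def)
qed

text \<open>\<open>chain_projection\<close> makes its claim only at times where the whole vector is
  integrable; square integrability of all components provides this.\<close>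

lemma chain_projection_projects_at:
 fixes x xh :: "real => 'w => real^'n"
 assumes p: "chain_projection M T \<alpha> x xh" and t: "t \<in> {0..T}" and sq: "\<And>j. sq_integrable M (\<lambda>w. x t w $ j)"
 shows "projects_at t (\<lambda>w. x t w $ j) (\<lambda>w. xh t w $ j)"
  and "(\<E> w. (xh t w $ j)\<^sup>2) <= (\<E> w. (x t w $ j)\<^sup>2)"
proof -
 have "integrable M (\<lambda>w. \<Sum>j\<in>UNIV. (x t w $ j) *\<^sub>R (axis j 1 :: real^'n))"
  using sq_imp_integrable[OF sq] by (intro lint_sum integrable_scaleR_left) simp
 moreover have "(\<Sum>j\<in>UNIV. (x t w $ j) *\<^sub>R (axis j 1 :: real^'n)) = x t w" for w
  by (simp add: vec_eq_iff axis_def if_distrib cong: if_cong)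
 ultimately have int: "integrable M (x t)" by simp
 have ad: "xh t \<in> Bm (chain t)" and eq: "AE w in M. \<forall>m. xh t w $ m = real_cond_exp M (chain t) (\<lambda>w. x t w $ m) w"
  using p t int by (auto simp: chain_projection_def adapted_def)
 have e: "AE w in M. xh t w $ j = real_cond_exp M (chain t) (\<lambda>w. x t w $ j) w" using eq by eventually_elim simp
 show "projects_at t (\<lambda>w. x t w $ j) (\<lambda>w. xh t w $ j)" "(\<E> w. (xh t w $ j)\<^sup>2) <= (\<E> w. (x t w $ j)\<^sup>2)"
  by (rule projects_at_cond_exp[OF t sq borel_measurable_component[OF ad] e])+
qed

text \<open>The hatted process is square integrable because at almost every time Jensen bounds its
  second moment by that of \<open>x\<close>, and Tonelli integrates the bound over time.\<close>

lemma chain_projection_projects: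
 fixes x xh :: "real => 'w => real^'n"
 assumes x: "sq_vector_process x" "adapted joint T x" and p: "chain_projection M T \<alpha> x xh"
 shows "vector_projects x xh"
 unfolding vector_projects_def projects_def
proof (intro allI conjI ballI)
 fix j
 have hm: "(\<lambda>z. xh (fst z) (snd z)) \<in> Bm Q"
  using p by (simp add: chain_projection_def jointly_measurable_iff case_prod_unfold)
 show xj: "sq_process (\<lambda>t w. x t w $ j)" by (rule sq_vector_processD[OF x(1)])
 show "(\<lambda>w. x s w $ j) \<in> Bm (joint s)" if "s \<in> {0..T}" for s
  using x(2) that by (intro borel_measurable_component) (simp add: adapted_def)
 show "(\<lambda>w. xh s w $ j) \<in> Bm (chain s)" if "s \<in> {0..T}" for s
  using p that by (intro borel_measurable_component) (simp add: chain_projection_def adapted_def)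
 have sec: "AE s in clock T. \<forall>j. sq_integrable M (\<lambda>w. x s w $ j)"
  by (subst AE_all_countable, intro allI sq_process_sections(1) sq_vector_processD x)
 then show "AE s in clock T. projects_at s (\<lambda>w. x s w $ j) (\<lambda>w. xh s w $ j)"
  using AE_space
 proof eventually_elim
  case (elim s)
  show ?case by (rule chain_projection_projects_at[OF p]) (use elim in auto)
 qed
 have "(\<integral>\<^sup>+z. ennreal ((xh (fst z) (snd z) $ j)\<^sup>2) \<partial>Q) = (\<integral>\<^sup>+s. \<integral>\<^sup>+w. ennreal ((xh s w $ j)\<^sup>2) \<partial>M \<partial>clock T)"
  using borel_measurable_component[OF hm] by (subst nn_integral_fst[symmetric]) auto
 also have "... <= (\<integral>\<^sup>+s. \<integral>\<^sup>+w. ennreal ((x s w $ j)\<^sup>2) \<partial>M \<partial>clock T)"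
 proof (rule nn_integral_mono_AE)
  show "AE s in clock T. (\<integral>\<^sup>+w. ennreal ((xh s w $ j)\<^sup>2) \<partial>M) <= (\<integral>\<^sup>+w. ennreal ((x s w $ j)\<^sup>2) \<partial>M)"
   using sec AE_space
  proof eventually_elim
   case (elim s)
   note pr = chain_projection_projects_at[OF p _ elim(1)[rule_format], of j]
   have s: "s \<in> {0..T}" using elim(2) by simp
   have "integrable M (\<lambda>w. (xh s w $ j)\<^sup>2)" "integrable M (\<lambda>w. (x s w $ j)\<^sup>2)"
    using pr(1)[OF s] by (auto simp: projects_at_def sq_integrable_def)
   then show ?case using pr(2)[OF s] by (simp add: nn_integral_eq_integral ennreal_leI)
  qed
 qed
 also have "... = (\<integral>\<^sup>+z. ennreal ((x (fst z) (snd z) $ j)\<^sup>2) \<partial>Q)"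
  using sq_process_measurable[OF xj] by (subst nn_integral_fst[symmetric]) (auto simp: case_prod_unfold)
 also have "... < \<infinity>"
  using xj by (simp add: sq_process_def sq_integrable_def case_prod_unfold nn_integral_eq_integral)
 finally have fin: "(\<integral>\<^sup>+z. ennreal ((xh (fst z) (snd z) $ j)\<^sup>2) \<partial>Q) < \<infinity>" .
 have "(\<lambda>z. xh (fst z) (snd z) $ j) \<in> Bm Q" by (rule borel_measurable_component[OF hm])
 then show "sq_process (\<lambda>t w. xh t w $ j)"
  unfolding sq_process_def sq_integrable_def case_prod_unfold
  using fin by (intro conjI integrableI_nonneg) auto
qed

end

section \<open>The state equation and the backward equation\<close>

context horizon begin

lemma l2_martingale_add:
 assumes X: "l2_martingale H X" and Y: "l2_martingale H Y"
 shows "l2_martingale H (\<lambda>t w. X t w + Y t w)"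
 unfolding l2_martingale_def
proof (intro conjI ballI allI impI)
 show "sq_integrable M (\<lambda>w. X t w + Y t w)" if "t \<in> {0..T}" for t
  by (intro sq_integrable_add l2_martingale_sq[OF X that] l2_martingale_sq[OF Y that])
 fix s t and h :: "'w => real" assume st: "0 <= s" "s <= t" "t <= T" and h: "h \<in> Bm (H s)" "sq_integrable M h"
 have s: "s \<in> {0..T}" "t \<in> {0..T}" using st by auto
 have "(\<E> w. h w * (X t w + Y t w - (X s w + Y s w)))
  = (\<E> w. h w * (X t w - X s w) + h w * (Y t w - Y s w))"
  by (simp only: algebra_simps)
 also have "... = (\<E> w. h w * (X t w - X s w)) + (\<E> w. h w * (Y t w - Y s w))"
  by (intro lintegral_add sq_integrable_mult[OF h(2)] sq_integrable_diff
    l2_martingale_sq[OF X] l2_martingale_sq[OF Y] s)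
 also have "... = 0" using X Y st h unfolding l2_martingale_def by simp
 finally show "(\<E> w. h w * (X t w + Y t w - (X s w + Y s w))) = 0" .
qed

lemma l2_martingale_sum:
 "finite K ==> (\<And>k. k \<in> K ==> l2_martingale H (Z k)) ==> l2_martingale H (\<lambda>t w. \<Sum>k\<in>K. Z k t w)"
proof (induction K rule: finite_induct)
 case empty
 show ?case by (simp add: l2_martingale_def sq_integrable_zero)
next
 case (insert k K)
 have "l2_martingale H (Z k)" "l2_martingale H (\<lambda>t w. \<Sum>k\<in>K. Z k t w)"
  using insert.IH insert.prems by blast+
 from l2_martingale_add[OF this] show ?case unfolding sum.insert[OF insert.hyps(1,2)] .
qed

end

context regime_noise begin

lemma L2_add:
 fixes x y :: "real => 'w => real^'n"
 shows "x \<in> L2 ==> y \<in> L2 ==> (\<lambda>t w. x t w + y t w) \<in> L2"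
 unfolding L2_space_iff adapted_def by (auto intro!: sq_vector_process_add borel_measurable_add)

lemma L2_uminus:
 fixes x :: "real => 'w => real^'n"
 shows "x \<in> L2 ==> (\<lambda>t w. - x t w) \<in> L2"
 unfolding L2_space_iff adapted_def by (auto intro!: sq_vector_process_uminus borel_measurable_uminus)

lemma borel_measurable_vecI:
 fixes f :: "'a => real^'n"
 assumes "\<And>j. (\<lambda>x. f x $ j) \<in> Bm N"
 shows "f \<in> Bm N"
 using assms by (subst borel_measurable_euclidean_space) (auto simp: Basis_vec_def inner_axis)

lemma L2_matrix:
 fixes \<Theta> :: "real => 's => real^'n^'m"
 assumes \<Theta>: "\<And>j. continuous_on {0..T} (\<lambda>t. \<Theta> t j)" and x: "x \<in> L2"
 shows "(\<lambda>t w. \<Theta> t (\<alpha> t w) *v x t w) \<in> L2"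
 unfolding L2_space_iff
proof
 have sq: "sq_process (\<lambda>t w. x t w $ j)" for j using x by (simp add: L2_space_iff sq_vector_processD)
 have "sq_process (\<lambda>t w. \<Sum>j\<in>UNIV. \<Theta> t (\<alpha> t w) $ i $ j * x t w $ j)" for i
  by (intro sq_process_sum regime_sq_process[of "\<lambda>t m. \<Theta> t m $ i $ j" for j] continuous_intros \<Theta> sq)
 then show "sq_vector_process (\<lambda>t w. \<Theta> t (\<alpha> t w) *v x t w)"
  by (simp add: sq_vector_process_def matrix_vector_mult_def)
 show "adapted joint T (\<lambda>t w. \<Theta> t (\<alpha> t w) *v x t w)"
  unfolding adapted_def
 proof (intro ballI borel_measurable_vecI)
  fix t i assume t: "t \<in> {0..T}"
  have "(\<lambda>w. \<Theta> t (\<alpha> t w) $ i $ j) \<in> Bm (joint t)" for j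
   using t by (intro chain_measurable_joint regime_function_chain[of t t "\<lambda>m. \<Theta> t m $ i $ j"]) auto
  moreover have "(\<lambda>w. x t w $ j) \<in> Bm (joint t)" for j
   using x t by (intro borel_measurable_component) (simp add: L2_space_iff adapted_def)
  ultimately show "(\<lambda>w. (\<Theta> t (\<alpha> t w) *v x t w) $ i) \<in> Bm (joint t)"
   unfolding matrix_vector_mult_def vec_lambda_beta by (intro borel_measurable_sum borel_measurable_times)
 qed
qed

lemma L2_coefficient:
 fixes A :: "'s => real^'n^'m"
 shows "x \<in> L2 ==> (\<lambda>t w. A (\<alpha> t w) *v x t w) \<in> L2"
 by (rule L2_matrix[of "\<lambda>t. A"]) (rule continuous_on_const)

lemma vector_projects_L2:
 fixes x xh :: "real => 'w => real^'n"
 assumes "vector_projects x xh"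
 shows "x \<in> L2" "xh \<in> L2"
proof -
 have "\<forall>t\<in>{0..T}. (\<lambda>w. x t w $ j) \<in> Bm (joint t)" "\<forall>t\<in>{0..T}. (\<lambda>w. xh t w $ j) \<in> Bm (joint t)" for j
  using assms chain_measurable_joint unfolding vector_projects_def projects_def by blast+
 then show "x \<in> L2" "xh \<in> L2"
  unfolding L2_space_iff adapted_def using vector_projects_sq[OF assms] by (auto intro!: borel_measurable_vecI)
qed

lemma L2_projects:
 fixes x xh :: "real => 'w => real^'n"
 assumes "x \<in> L2" and p: "chain_projection M T \<alpha> x xh"
 shows "vector_projects x xh"
 by (rule chain_projection_projects[OF _ _ p]) (use assms(1) in \<open>simp_all add: L2_space_iff\<close>)

lemma noise_integral_component:
 fixes k :: "real => 'w => real^'n"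
 assumes "has_ito_integral M joint T W k I" and k: "sq_vector_process k"
 obtains n u x where "approximates joint W n u x (\<lambda>t w. I t w $ j)"
  "(\<lambda>m. time_energy M T (\<lambda>t w. simple_process (n m) (u m) (x m) t w - k t w $ j)) \<longlonglongrightarrow> 0"
proof (rule stochastic_integral_component[OF assms(1)[unfolded has_ito_integral_def]])
 fix n u x assume ap: "\<And>j. approximates joint W n u (\<lambda>m l w. x m l w $ j) (\<lambda>t w. I t w $ j)"
  and lim: "(\<lambda>m. time_energy M T (\<lambda>t w. simple_process (n m) (u m) (x m) t w - k t w)) \<longlonglongrightarrow> 0"
 have "(\<lambda>m. time_energy M T (\<lambda>t w. simple_process (n m) (u m) (\<lambda>l w. x m l w $ j) t w - k t w $ j)) \<longlonglongrightarrow> 0"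
 proof (rule tendsto_zero_ennreal_mono[OF _ lim])
  fix m
  show "time_energy M T (\<lambda>t w. simple_process (n m) (u m) (\<lambda>l w. x m l w $ j) t w - k t w $ j)
   <= time_energy M T (\<lambda>t w. simple_process (n m) (u m) (x m) t w - k t w)"
   unfolding time_energy_def
  proof (intro nn_integral_mono mult_right_mono ennreal_leI power_mono)
   fix t w
   have "simple_process (n m) (u m) (\<lambda>l w. x m l w $ j) t w - k t w $ j = (simple_process (n m) (u m) (x m) t w - k t w) $ j"
    by (simp add: simple_process_def)
   then show "norm (simple_process (n m) (u m) (\<lambda>l w. x m l w $ j) t w - k t w $ j)
    <= norm (simple_process (n m) (u m) (x m) t w - k t w)"
    using component_le_norm_cart[of "simple_process (n m) (u m) (x m) t w - k t w" j] by simp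
  qed auto
 qed
 then show thesis by (rule that[OF ap])
qed

lemma vector_ito_processI:
 fixes X b k :: "real => 'w => real^'n"
 assumes L2: "X \<in> L2" "b \<in> L2" "k \<in> L2"
  and I: "has_ito_integral M joint T W k I"
  and eq: "\<And>t. t \<in> {0..T} ==> AE w in M. X t w = x0 + (LINT s:{0..t}|lborel. b s w) + I t w"
 shows "vector_ito_process x0 b k X"
 unfolding vector_ito_process_def ito_process_def
proof (intro allI conjI ballI)
 fix j
 have L: "sq_vector_process X" "sq_vector_process b" "sq_vector_process k"
   "adapted joint T X" "adapted joint T b" "adapted joint T k"
  using L2 by (simp_all add: L2_space_iff)
 show "sq_process (\<lambda>t w. b t w $ j)" "sq_process (\<lambda>t w. k t w $ j)" "sq_process (\<lambda>t w. X t w $ j)"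
  by (rule sq_vector_processD, rule L)+
 show "(\<lambda>w. b s w $ j) \<in> Bm (joint s)" "(\<lambda>w. k s w $ j) \<in> Bm (joint s)"
  "(\<lambda>w. X s w $ j) \<in> Bm (joint s)" if "s \<in> {0..T}" for s
  using L(4-6) that by (auto intro: borel_measurable_component simp: adapted_def)
 obtain n u x where ap: "approximates joint W n u x (\<lambda>t w. I t w $ j)"
  "(\<lambda>m. time_energy M T (\<lambda>t w. simple_process (n m) (u m) (x m) t w - k t w $ j)) \<longlonglongrightarrow> 0"
  by (rule noise_integral_component[OF I L(3)])
 have "AE w in M. X t w $ j = x0 $ j + running (\<lambda>t w. b t w $ j) t w + I t w $ j" if t: "t \<in> {0..T}" for t
 proof -
  have "AE w in M. \<forall>j. (LINT r:{0..t}|lborel. b r w) $ j = (LINT r:{0..t}|lborel. b r w $ j)"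
   using t by (intro vector_set_integral_component[OF L(2)]) auto
  then show ?thesis using eq[OF t] by eventually_elim (simp add: running_def)
 qed
 then show "\<exists>n u x Ia. approximates joint W n u x Ia \<and>
   (\<lambda>m. time_energy M T (\<lambda>t w. simple_process (n m) (u m) (x m) t w - k t w $ j)) \<longlonglongrightarrow> 0 \<and>
   (\<forall>t\<in>{0..T}. AE w in M. X t w $ j = x0 $ j + running (\<lambda>t w. b t w $ j) t w + Ia t w)"
  using ap by blast
qed

lemma approximates_zero: "approximates joint W (\<lambda>m. 0) (\<lambda>m l. 0) (\<lambda>m l w. 0) (\<lambda>t w. 0)"
 using T_pos by (simp add: approximates_def simple_integrand_def simple_integral_def)

text \<open>Averaging out the noise leaves no diffusion: the hatted state is an Ito process with
  zero integrand, so its product with another state has no covariation term.\<close>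

lemma projected_ito_process:
 fixes x b k :: "real => 'w => real^'n"
 assumes x: "vector_ito_process x0 b k x" and p: "chain_projection M T \<alpha> x xh" and xL: "x \<in> L2"
  and b: "vector_projects b bh"
 shows "vector_ito_process x0 bh (\<lambda>t w. 0) xh"
 unfolding vector_ito_process_def ito_process_def
proof (intro allI conjI ballI)
 fix j
 have L2: "xh \<in> L2" "bh \<in> L2"
  using vector_projects_L2[OF L2_projects[OF xL p]] vector_projects_L2[OF b] by auto
 then have L: "sq_vector_process xh" "sq_vector_process bh" "adapted joint T xh" "adapted joint T bh"
  by (simp_all add: L2_space_iff)
 show "sq_process (\<lambda>t w. bh t w $ j)" "sq_process (\<lambda>t w. xh t w $ j)"
  by (rule sq_vector_processD, rule L)+
 show "sq_process (\<lambda>t w. 0 $ j)" using sq_process_zero by simp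
 show "(\<lambda>w. bh s w $ j) \<in> Bm (joint s)" "(\<lambda>w. 0 $ j) \<in> Bm (joint s)"
  "(\<lambda>w. xh s w $ j) \<in> Bm (joint s)" if "s \<in> {0..T}" for s
  using L(3,4) that by (auto intro: borel_measurable_component simp: adapted_def)
 obtain n u y I where ap: "approximates joint W n u y I"
  and eq: "\<And>t. t \<in> {0..T} ==> AE w in M. x t w $ j = x0 $ j + running (\<lambda>t w. b t w $ j) t w + I t w"
  using vector_ito_processD[OF x, of j] unfolding ito_process_def by blast
 have "AE w in M. xh t w $ j = x0 $ j + running (\<lambda>t w. bh t w $ j) t w + 0" if t: "t \<in> {0..T}" for t
 proof -
  have pr: "projects_at t (\<lambda>w. x t w $ j) (\<lambda>w. xh t w $ j)"
   by (rule chain_projection_projects_at(1)[OF p t ito_process_sq[OF vector_ito_processD[OF x] t]])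
  have "projects (\<lambda>t w. b t w $ j) (\<lambda>t w. bh t w $ j)" using b by (simp add: vector_projects_def)
  from projected_drift[where x = "\<lambda>t w. x t w $ j" and xh = "\<lambda>t w. xh t w $ j", OF this noise_integral_martingale(1,2)[OF ap] t eq[OF t] pr]
  show ?thesis by simp
 qed
 moreover have "(\<lambda>m. time_energy M T (\<lambda>t w. simple_process 0 (\<lambda>l. 0) (\<lambda>l w. 0) t w - 0 $ j)) \<longlonglongrightarrow> (0 :: ennreal)"
  by (simp add: simple_process_def time_energy_def)
 ultimately show "\<exists>n u y I. approximates joint W n u y I \<and>
   (\<lambda>m. time_energy M T (\<lambda>t w. simple_process (n m) (u m) (y m) t w - 0 $ j)) \<longlonglongrightarrow> 0 \<and>
   (\<forall>t\<in>{0..T}. AE w in M. xh t w $ j = x0 $ j + running (\<lambda>t w. bh t w $ j) t w + I t w)"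
  using approximates_zero by (intro exI[of _ "\<lambda>m. 0"] exI[of _ "\<lambda>m l. 0"] exI[of _ "\<lambda>m l w. 0"] exI[of _ "\<lambda>t w. 0"]) simp
qed

text \<open>At time 0 noise and chain are almost surely constant, so the generating events are
  almost surely decided, and being decided is preserved by complements and countable unions.\<close>

lemma initial_trivial:
 assumes A: "A \<in> sets (joint 0)"
 shows "\<exists>b. AE w in M. (w \<in> A) = b"
proof -
 define G where "G = {W s -` B \<inter> space M | s B. 0 <= s \<and> s <= 0 \<and> B \<in> sets borel} \<union> {\<alpha> s -` B \<inter> space M | s B. 0 <= s \<and> s <= 0}"
 have "sets (joint 0) \<subseteq> sigma_sets (space M) G"
  unfolding joint_eq_mixed sets_mixed_filtration sets_noise_filtration sets_chain_filtration
  by (rule sigma_sets_mono) (auto simp: G_def intro: sigma_sets_mono'[THEN subsetD, rotated])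
 then have "A \<in> sigma_sets (space M) G" using A by blast
 then show ?thesis
 proof (induction rule: sigma_sets.induct)
  case (Basic a)
  have W0: "AE w in M. W 0 w = 0" using brownian by (simp add: standard_brownian_motion_def)
  have \<alpha>0: "AE w in M. \<alpha> 0 w = i0" using markov by (simp add: markov_chain_def)
  from Basic consider B where "a = W 0 -` B \<inter> space M" | B where "a = \<alpha> 0 -` B \<inter> space M"
   unfolding G_def by (auto simp: antisym_conv)
  then show ?case
  proof cases
   case 1
   have "AE w in M. (w \<in> a) = (0 \<in> B)" using W0 AE_space by eventually_elim (simp add: 1)
   then show ?thesis by blast
  next
   case 2
   have "AE w in M. (w \<in> a) = (i0 \<in> B)" using \<alpha>0 AE_space by eventually_elim (simp add: 2)
   then show ?thesis by blast
  qed
 next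
  case Empty show ?case by (rule exI[of _ False]) simp
 next
  case (Compl a)
  then obtain b where "AE w in M. (w \<in> a) = b" by blast
  then have "AE w in M. (w \<in> space M - a) = (\<not> b)" using AE_space by eventually_elim simp
  then show ?case by blast
 next
  case (Union a)
  then obtain b where "\<And>i. AE w in M. (w \<in> a i) = b i" by metis
  then have "AE w in M. \<forall>i :: nat. (w \<in> a i) = b i" by (simp add: AE_all_countable)
  then have "AE w in M. (w \<in> \<Union> (range a)) = (\<exists>i. b i)" by eventually_elim simp
  then show ?case by blast
 qed
qed

text \<open>This makes the initial value of the backward equation a constant vector. It is constant
  almost surely only, which is why the value formula stands under an almost-everywhere
  quantifier.\<close>

lemma initial_constant:
 assumes h: "h \<in> Bm (joint 0)" "sq_integrable M h"
 shows "AE w in M. h w = expectation h"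
proof -
 define e where "e = expectation h"
 have c: "sq_integrable M (\<lambda>w. e)" by (rule sq_integrable_const)
 have Z: "sq_integrable M (\<lambda>w. h w - e)" by (intro sq_integrable_diff h(2) c)
 have sub: "subalgebra M (joint 0)" using T_pos by (intro subalgebra_joint) simp
 have int: "integrable M h" "integrable M (\<lambda>w. h w - e)"
  using sq_imp_integrable h(2) Z by auto
 have mean: "(\<E> w. h w - e) = 0" using int(1) by (simp add: prob_space e_def)
 have "(\<E> w. indicator A w * (h w - e)) = 0" if A: "A \<in> sets (joint 0)" for A
 proof -
  obtain b where b: "AE w in M. (w \<in> A) = b" using initial_trivial[OF A] by blast
  have Ae: "A \<in> events" using A sub by (auto simp: subalgebra_def)
  have "(\<E> w. indicator A w * (h w - e)) = (\<E> w. of_bool b * (h w - e))"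
  proof (rule integral_cong_AE)
   show "AE w in M. indicator A w * (h w - e) = of_bool b * (h w - e)"
    using b by eventually_elim (auto simp: indicator_def)
  qed (use Ae int in auto)
  also have "... = 0" using mean by simp
  finally show ?thesis .
 qed
 from orthogonal_to_subalgebra[OF sub Z this] have orth: "(\<E> w. (h w - e) * (h w - e)) = 0"
  using h(1) Z by simp
 have "AE w in M. (h w - e)\<^sup>2 = 0"
  using Z orth by (subst integral_nonneg_eq_0_iff_AE[symmetric]) (auto simp: sq_integrable_def power2_eq_square)
 then show ?thesis by eventually_elim (simp add: e_def)
qed

end

section \<open>Duality between the backward equation and Ito processes\<close>

context regime_noise begin

text \<open>The expected product of \<open>\<phi>\<close> and \<open>Y\<close> is computed between 0
  and T. At T it vanishes with \<open>\<phi>\<close>. The martingale parts meet only through the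
  noise: the integrals against the jumps of the chain are orthogonal to the noise integral in
  \<open>Y\<close>, and the Ito isometry gives the term in \<open>\<theta>\<close> and
  \<open>k\<close>.\<close>

lemma bsde_duality_component:
 fixes \<phi> \<theta> f :: "real => 'w => real"
 assumes sq: "sq_process \<phi>" "sq_process \<theta>" "sq_process f"
  and ad: "\<And>s. s \<in> {0..T} ==> f s \<in> Bm (joint s)" "\<phi> 0 \<in> Bm (joint 0)"
  and I: "approximates joint W n u x I"
   "(\<lambda>m. time_energy M T (\<lambda>t w. simple_process (n m) (u m) (x m) t w - \<theta> t w)) \<longlonglongrightarrow> 0"
  and J: "\<And>i j. \<exists>n u x. approximates joint (chain_martingale gen \<alpha> i j) n u x (J i j)"
  and V: "\<And>t w. V t w = (\<Sum>i\<in>UNIV. \<Sum>j\<in>UNIV. J i j t w)"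
  and eq: "\<And>t. t \<in> {0..T} ==> AE w in M. \<phi> t w = (LINT s:{t..T}|lborel. f s w) - (I T w - I t w) - (V T w - V t w)"
 shows "AE w in M. \<phi> 0 w = expectation (\<phi> 0)"
  and "ito_process y0 b k Y ==>
   expectation (\<phi> 0) * y0 + mean_integral T (\<lambda>s w. \<phi> s w * b s w + \<theta> s w * k s w - f s w * Y s w) = 0"
proof -
 have T: "0 \<in> {0..T}" "T \<in> {0..T}" using T_pos by auto
 have Jm: "l2_martingale joint (J i j)" "AE w in M. J i j 0 w = 0" for i j
 proof -
  obtain n u x where ap: "approximates joint (chain_martingale gen \<alpha> i j) n u x (J i j)" using J by blast
  have sub: "subalgebra (joint s) (joint s)" for s by (simp add: subalgebra_def)
  show "l2_martingale joint (J i j)" "AE w in M. J i j 0 w = 0"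
   by (rule approximates_martingale[OF filtration_joint sub chain_l2_martingale ap])+
 qed
 have Vm: "l2_martingale joint V"
  using l2_martingale_sum[OF finite l2_martingale_sum[OF finite Jm(1)]] by (simp add: V[abs_def])
 have V0: "AE w in M. V 0 w = 0"
 proof -
  have "AE w in M. \<forall>i j. J i j 0 w = 0" using Jm(2) by (simp add: AE_all_countable)
  then show ?thesis by eventually_elim (simp add: V)
 qed
 note Im = noise_integral_martingale[OF I(1)]
 have IVm: "l2_martingale joint (\<lambda>t w. I t w + V t w)" by (rule l2_martingale_add[OF Im(3) Vm])
 have eq0: "AE w in M. \<phi> 0 w = running f T w - (I T w + V T w)"
  using eq[OF T(1)] Im(2) V0 by eventually_elim (simp add: running_def)
 have "\<phi> 0 \<in> Bm M" using T_pos by (intro measurable_from_subalg[OF subalgebra_joint ad(2)]) simp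
 then have \<phi>0: "sq_integrable M (\<phi> 0)"
 proof (rule sq_integrable_cong_AE[rotated])
  show "sq_integrable M (\<lambda>w. running f T w - (I T w + V T w))"
   by (intro sq_integrable_diff running_sq_bound(1)[OF sq(3) T(2)] l2_martingale_sq[OF IVm T(2)])
  show "AE w in M. running f T w - (I T w + V T w) = \<phi> 0 w" using eq0 by eventually_elim simp
 qed
 show const: "AE w in M. \<phi> 0 w = expectation (\<phi> 0)" by (rule initial_constant[OF ad(2) \<phi>0])
 have sec: "AE w in M. integrable (clock T) (\<lambda>s. f s w)"
  using sq_process_sections(2)[OF sq(3)] by eventually_elim (rule sq_integrable_imp_integrable[OF finite_measure_clock])
 \<comment> \<open>Subtracting the equation at 0 from that at t cancels the values at
   \<open>T\<close> and leaves a forward equation. Its initial value is known at time 0, as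
   \<open>expectation_product\<close> demands.\<close>
 have forward: "AE w in M. \<phi> t w = \<phi> 0 w + running (\<lambda>s w. - f s w) t w + (I t w + V t w)" if t: "t \<in> {0..T}" for t
  using eq[OF t] eq0 sec
 proof eventually_elim
  case (elim w)
  have "running f T w = running f t w + (LINT s:{t..T}|lborel. f s w)"
   unfolding running_def using t by (intro running_additive[OF elim(3)]) auto
  moreover have "running (\<lambda>s w. - f s w) t w = - running f t w"
   by (simp add: running_def set_lebesgue_integral_def)
  ultimately show ?case using elim(1,2) by simp
 qed
 have terminal: "AE w in M. \<phi> T w = 0"
 proof -
  have "(LINT s:{T..T}|lborel. f s w) = 0" for w
  proof -
   have "AE s in lborel. indicator {T..T} s *\<^sub>R f s w = 0"
    using AE_lborel_singleton[of T] by eventually_elim simp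
   then show ?thesis unfolding set_lebesgue_integral_def by (rule integral_eq_zero_AE)
  qed
  then show ?thesis using eq[OF T(2)] by simp
 qed
 assume Y: "ito_process y0 b k Y"
 then obtain n' u' x' I' where ap': "approximates joint W n' u' x' I'"
  and lim': "(\<lambda>m. time_energy M T (\<lambda>t w. simple_process (n' m) (u' m) (x' m) t w - k t w)) \<longlonglongrightarrow> 0"
  and eq': "\<And>t. t \<in> {0..T} ==> AE w in M. Y t w = y0 + running b t w + I' t w"
  and sq': "sq_process b" "sq_process k" "sq_process Y" and m': "\<And>s. s \<in> {0..T} ==> b s \<in> Bm (joint s)"
  unfolding ito_process_def by blast
 note Im' = noise_integral_martingale[OF ap']
 have c0: "sq_integrable M (\<lambda>w. y0)" by (rule sq_integrable_const)
 have nf: "sq_process (\<lambda>s w. - f s w)" using sq_process_cmult[OF sq(3), of "-1"] by simp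
 have prod: "(\<E> w. Y T w * \<phi> T w) = (\<E> w. y0 * \<phi> 0 w)
  + mean_integral T (\<lambda>s w. b s w * \<phi> s w + Y s w * - f s w) + (\<E> w. I' T w * (I T w + V T w))"
 proof (rule expectation_product[where H = joint])
  show "sq_process b" "sq_process Y" by (rule sq')+
  show "sq_process (\<lambda>s w. - f s w)" "sq_process \<phi>" by (rule nf, rule sq)
  show "b s \<in> Bm (joint s)" "(\<lambda>w. - f s w) \<in> Bm (joint s)" if "s \<in> {0..T}" for s
   using m'[OF that] ad(1)[OF that] by simp_all
  show "sq_integrable M (\<lambda>w. y0)" "sq_integrable M (\<phi> 0)" by (rule c0, rule \<phi>0)
  show "(\<lambda>w. y0) \<in> Bm (joint 0)" "\<phi> 0 \<in> Bm (joint 0)" by simp (rule ad(2))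
  show "l2_martingale joint I'" "AE w in M. I' 0 w = 0" by (rule Im')+
  show "l2_martingale joint (\<lambda>t w. I t w + V t w)" by (rule IVm)
  show "AE w in M. I 0 w + V 0 w = 0" using Im(2) V0 by eventually_elim simp
  show "AE w in M. Y t w = y0 + running b t w + I' t w" if "t \<in> {0..T}" for t by (rule eq'[OF that])
  show "AE w in M. \<phi> t w = \<phi> 0 w + running (\<lambda>s w. - f s w) t w + (I t w + V t w)" if "t \<in> {0..T}" for t
   by (rule forward[OF that])
 qed (rule T(2))
 have noise_part: "(\<E> w. I' T w * I T w) = mean_integral T (\<lambda>s w. k s w * \<theta> s w)"
  using ito_isometry[OF ap' sq'(2) lim' I(1) sq(2) I(2), of "\<lambda>w. 1" 1 T] T by simp
 have chain_part: "(\<E> w. I' T w * V T w) = 0"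
 proof -
  have int: "integrable M (\<lambda>w. I' T w * J i j T w)" for i j
   by (intro sq_integrable_mult l2_martingale_sq[OF Im'(1) T(2)] l2_martingale_sq[OF Jm(1) T(2)])
  have z: "(\<E> w. I' T w * J i j T w) = 0" for i j
  proof -
   obtain n u x where ap: "approximates joint (chain_martingale gen \<alpha> i j) n u x (J i j)" using J by blast
   show ?thesis using chain_noise_orthogonal[OF ap ap' T(2)] by (simp only: mult.commute)
  qed
  have "(\<E> w. I' T w * V T w) = (\<E> w. \<Sum>i\<in>UNIV. \<Sum>j\<in>UNIV. I' T w * J i j T w)"
   by (simp only: V sum_distrib_left)
  also have "... = (\<Sum>i\<in>UNIV. \<Sum>j\<in>UNIV. (\<E> w. I' T w * J i j T w))"
   by (subst lintegral_sum, intro lint_sum int,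
     intro sum.cong refl lintegral_sum int)
  also have "... = 0" by (simp add: z)
  finally show ?thesis .
 qed
 have mart: "(\<E> w. I' T w * (I T w + V T w)) = mean_integral T (\<lambda>s w. k s w * \<theta> s w)"
 proof -
  have "(\<E> w. I' T w * (I T w + V T w)) = (\<E> w. I' T w * I T w) + (\<E> w. I' T w * V T w)"
   unfolding distrib_left
   by (intro lintegral_add sq_integrable_mult l2_martingale_sq[OF Im(3) T(2)] l2_martingale_sq[OF Im'(3) T(2)] l2_martingale_sq[OF Vm T(2)])
  then show ?thesis using noise_part chain_part by simp
 qed
 have left: "(\<E> w. Y T w * \<phi> T w) = 0"
  by (rule integral_eq_zero_AE) (use terminal in \<open>auto elim: eventually_mono\<close>)
 have "integrable Q (\<lambda>(s, w). b s w * \<phi> s w + Y s w * - f s w)"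
  using lint_add[OF sq_process_mult[OF sq'(1) sq(1)] sq_process_mult[OF sq'(3) nf]]
  by (simp add: case_prod_unfold)
 from mean_integral_add[OF this sq_process_mult[OF sq'(2) sq(2)], of T]
 have "mean_integral T (\<lambda>s w. b s w * \<phi> s w + Y s w * - f s w + k s w * \<theta> s w)
  = mean_integral T (\<lambda>s w. b s w * \<phi> s w + Y s w * - f s w) + mean_integral T (\<lambda>s w. k s w * \<theta> s w)" .
 moreover have "mean_integral T (\<lambda>s w. b s w * \<phi> s w + Y s w * - f s w + k s w * \<theta> s w)
  = mean_integral T (\<lambda>s w. \<phi> s w * b s w + \<theta> s w * k s w - f s w * Y s w)"
  by (rule mean_integral_pointwise) (simp add: algebra_simps)
 ultimately show "expectation (\<phi> 0) * y0 + mean_integral T (\<lambda>s w. \<phi> s w * b s w + \<theta> s w * k s w - f s w * Y s w) = 0"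
  using prod left mart by (simp add: mult.commute)
qed

lemma bsde_duality:
 fixes \<phi> \<theta> f :: "real => 'w => real^'n"
 assumes L2: "\<phi> \<in> L2" "\<theta> \<in> L2" "f \<in> L2"
  and I: "has_ito_integral M joint T W \<theta> I" and J: "has_chain_integral M joint T gen \<alpha> h V"
  and eq: "\<And>t. t \<in> {0..T} ==> AE w in M. \<phi> t w = (LINT s:{t..T}|lborel. f s w) - (I T w - I t w) - (V T w - V t w)"
 obtains v where "AE w in M. \<phi> 0 w = v"
  "\<And>y0 b k Y. vector_ito_process y0 b k Y ==>
   v \<bullet> y0 + mean_integral T (\<lambda>s w. \<phi> s w \<bullet> b s w + \<theta> s w \<bullet> k s w - f s w \<bullet> Y s w) = 0"
proof
 define v where "v = (\<chi> j. (\<E> w. \<phi> 0 w $ j))"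
 have L: "sq_vector_process \<phi>" "sq_vector_process \<theta>" "sq_vector_process f"
   "adapted joint T \<phi>" "adapted joint T f"
  using L2 by (simp_all add: L2_space_iff)
 obtain K where K: "\<And>i j. has_stochastic_integral M joint T (jump_energy M T \<alpha> i j) (chain_martingale gen \<alpha> i j) (h i j) (K i j)"
  and VK: "V = (\<lambda>t w. \<Sum>i\<in>UNIV. \<Sum>j\<in>UNIV. K i j t w)"
  using J unfolding has_chain_integral_def by blast
 have comp: "(AE w in M. \<phi> 0 w $ c = (\<E> w. \<phi> 0 w $ c)) \<and>
  (\<forall>y0 b k Y. ito_process y0 b k Y --> (\<E> w. \<phi> 0 w $ c) * y0
   + mean_integral T (\<lambda>s w. \<phi> s w $ c * b s w + \<theta> s w $ c * k s w - f s w $ c * Y s w) = 0)" for c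
 proof -
  obtain n u x where ap: "approximates joint W n u x (\<lambda>t w. I t w $ c)"
   "(\<lambda>m. time_energy M T (\<lambda>t w. simple_process (n m) (u m) (x m) t w - \<theta> t w $ c)) \<longlonglongrightarrow> 0"
   by (rule noise_integral_component[OF I L(2)])
  have J': "\<exists>n u x. approximates joint (chain_martingale gen \<alpha> i j) n u x (\<lambda>t w. K i j t w $ c)" for i j
   by (rule stochastic_integral_component[OF K[of i j]]) blast
  have V': "V t w $ c = (\<Sum>i\<in>UNIV. \<Sum>j\<in>UNIV. K i j t w $ c)" for t w by (simp add: VK)
  have eq': "AE w in M. \<phi> t w $ c = (LINT s:{t..T}|lborel. f s w $ c) - (I T w $ c - I t w $ c) - (V T w $ c - V t w $ c)"
   if t: "t \<in> {0..T}" for t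
  proof -
   have "AE w in M. \<forall>j. (LINT r:{t..T}|lborel. f r w) $ j = (LINT r:{t..T}|lborel. f r w $ j)"
    using t by (intro vector_set_integral_component[OF L(3)]) auto
   then show ?thesis using eq[OF t] by eventually_elim simp
  qed
  have fm: "(\<lambda>w. f s w $ c) \<in> Bm (joint s)" if "s \<in> {0..T}" for s
   using L(5) that by (intro borel_measurable_component) (simp add: adapted_def)
  have \<phi>m: "(\<lambda>w. \<phi> 0 w $ c) \<in> Bm (joint 0)"
   using L(4) T_pos by (intro borel_measurable_component) (simp add: adapted_def)
  note res = bsde_duality_component[where \<phi> = "\<lambda>t w. \<phi> t w $ c" and \<theta> = "\<lambda>t w. \<theta> t w $ c" and f = "\<lambda>t w. f t w $ c"
    and I = "\<lambda>t w. I t w $ c" and V = "\<lambda>t w. V t w $ c" and J = "\<lambda>i j t w. K i j t w $ c",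
    OF sq_vector_processD[OF L(1)] sq_vector_processD[OF L(2)] sq_vector_processD[OF L(3)] fm \<phi>m ap J' V' eq']
  show ?thesis using res by blast
 qed
 have "AE w in M. \<forall>c. \<phi> 0 w $ c = v $ c" using comp by (simp add: AE_all_countable v_def)
 then show "AE w in M. \<phi> 0 w = v" by eventually_elim (simp add: vec_eq_iff)
 fix y0 and b k Y :: "real => 'w => real^'n" assume Y: "vector_ito_process y0 b k Y"
 define D where "D c s w = \<phi> s w $ c * b s w $ c + \<theta> s w $ c * k s w $ c - f s w $ c * Y s w $ c" for c s w
 have sqY: "sq_process (\<lambda>t w. b t w $ c)" "sq_process (\<lambda>t w. k t w $ c)" "sq_process (\<lambda>t w. Y t w $ c)" for c
  using vector_ito_processD[OF Y, of c] by (simp_all add: ito_process_def)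
 have DQ: "integrable Q (\<lambda>(s, w). D c s w)" for c
  unfolding D_def case_prod_unfold
  by (intro lint_add lint_diff
    sq_process_mult[unfolded case_prod_unfold] sq_vector_processD L sqY)
 have "v $ c * y0 $ c + mean_integral T (D c) = 0" for c
  using comp[of c] vector_ito_processD[OF Y, of c] unfolding D_def v_def by simp
 then have "0 = (\<Sum>c\<in>UNIV. v $ c * y0 $ c + mean_integral T (D c))" by simp
 also have "... = v \<bullet> y0 + mean_integral T (\<lambda>s w. \<Sum>c\<in>UNIV. D c s w)"
  by (simp add: sum.distrib inner_vec_def mean_integral_sum[OF DQ])
 also have "(\<lambda>s w. \<Sum>c\<in>UNIV. D c s w) = (\<lambda>s w. \<phi> s w \<bullet> b s w + \<theta> s w \<bullet> k s w - f s w \<bullet> Y s w)"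
  by (simp add: D_def inner_vec_def sum.distrib sum_subtractf)
 finally show "v \<bullet> y0 + mean_integral T (\<lambda>s w. \<phi> s w \<bullet> b s w + \<theta> s w \<bullet> k s w - f s w \<bullet> Y s w) = 0" by simp
qed

end

section \<open>The follower's problem\<close>

text \<open>Nonnegativity of the form at a - b. Convexity of the cost enters the comparison of
  controls in this shape.\<close>

lemma psd_polarization:
 fixes X :: "real^'n^'n"
 assumes X: "pos_semidef X"
 shows "2 * ((X *v a) \<bullet> b) <= (X *v a) \<bullet> a + (X *v b) \<bullet> b"
proof -
 have "(X *v b) \<bullet> a = (X *v a) \<bullet> b"
  using X inner_symmetric_matrix[of X b a] by (simp add: pos_semidef_def inner_commute)
 moreover have "0 <= (X *v (a - b)) \<bullet> (a - b)" using X unfolding pos_semidef_def by blast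
 ultimately show ?thesis by (simp add: matrix_vector_mult_diff_distrib inner_diff_left inner_diff_right)
qed

context horizon begin

lemma mean_integral_paths:
 assumes F: "integrable Q (\<lambda>(t, w). F t w)"
 shows "integrable M (\<lambda>w. LINT t:{0..T}|lborel. F t w)"
  and "(\<E> w. LINT t:{0..T}|lborel. F t w) = mean_integral T F"
proof -
 show "integrable M (\<lambda>w. LINT t:{0..T}|lborel. F t w)"
  using pair.integrable_snd[OF F] by (simp add: integral_clock)
 have "(\<E> w. LINT t:{0..T}|lborel. F t w) = integral\<^sup>L Q (\<lambda>(t, w). F t w)"
  using pair.integral_snd[OF F] by (simp add: integral_clock)
 also have "... = mean_integral T F"
  unfolding mean_integral_def by (rule lintegral_cong) (auto simp: space_pair_measure)
 finally show "(\<E> w. LINT t:{0..T}|lborel. F t w) = mean_integral T F" .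
qed

lemma mean_integral_mono:
 assumes "integrable Q (\<lambda>(t, w). F t w)" "integrable Q (\<lambda>(t, w). G t w)"
  and "\<And>t w. t \<in> {0..T} ==> w \<in> space M ==> F t w <= G t w"
 shows "mean_integral T F <= mean_integral T G"
 unfolding mean_integral_def
 using integrable_upto[OF assms(1)] integrable_upto[OF assms(2)] assms(3)
 by (intro integral_mono) (auto simp: space_pair_measure intro!: mult_left_mono)

definition mean_inner :: "(real => 'w => real^'n) => (real => 'w => real^'n) => real" where
 "mean_inner a b = mean_integral T (\<lambda>t w. a t w \<bullet> b t w)"

lemma mean_inner_cong:
 assumes "\<And>t w. t \<in> {0..T} ==> w \<in> space M ==> a t w \<bullet> b t w = c t w \<bullet> e t w"
 shows "mean_inner a b = mean_inner c e"
 unfolding mean_inner_def by (rule mean_integral_pointwise[OF assms])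

lemma L2_inner:
 fixes a b :: "real => 'w => real^'n"
 shows "a \<in> L2_space M F T ==> b \<in> L2_space M F T ==> integrable Q (\<lambda>(t, w). a t w \<bullet> b t w)"
 by (intro sq_vector_process_inner) (simp_all add: L2_space_iff)

lemma mean_inner_add_left:
 fixes a b c :: "real => 'w => real^'n"
 assumes "a \<in> L2_space M F T" "b \<in> L2_space M F T" "c \<in> L2_space M F T"
 shows "mean_inner (\<lambda>t w. a t w + b t w) c = mean_inner a c + mean_inner b c"
 unfolding mean_inner_def inner_add_left
 by (rule mean_integral_add[OF L2_inner[OF assms(1,3)] L2_inner[OF assms(2,3)]])

lemma mean_inner_add_right:
 fixes a b c :: "real => 'w => real^'n"
 assumes "a \<in> L2_space M F T" "b \<in> L2_space M F T" "c \<in> L2_space M F T"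
 shows "mean_inner c (\<lambda>t w. a t w + b t w) = mean_inner c a + mean_inner c b"
 unfolding mean_inner_def inner_add_right
 by (rule mean_integral_add[OF L2_inner[OF assms(3,1)] L2_inner[OF assms(3,2)]])

lemma mean_inner_uminus_left: "mean_inner (\<lambda>t w. - a t w) c = - mean_inner a c"
 unfolding mean_inner_def mean_integral_def by simp

end

context regime_noise begin

lemma mean_inner_swap:
 "vector_projects a ah ==> vector_projects b bh ==> mean_inner a bh = mean_inner ah b"
 unfolding mean_inner_def by (rule vector_projects_swap)

lemma terminal_form_sum:
 fixes G :: "'s => real^'n^'n" and a c :: "'w => real^'n"
 assumes t: "t \<in> {0..T}" and a: "\<And>j. sq_integrable M (\<lambda>w. a w $ j)" and c: "\<And>j. sq_integrable M (\<lambda>w. c w $ j)"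
 shows "integrable M (\<lambda>w. (G (\<alpha> t w) *v a w) \<bullet> c w)"
  and "(\<E> w. (G (\<alpha> t w) *v a w) \<bullet> c w)
   = (\<Sum>i\<in>UNIV. \<Sum>j\<in>UNIV. (\<E> w. G (\<alpha> t w) $ i $ j * (a w $ j * c w $ i)))"
proof -
 have int: "integrable M (\<lambda>w. G (\<alpha> t w) $ i $ j * (a w $ j * c w $ i))" for i j
 proof -
  obtain C where C: "\<And>m. \<bar>G m $ i $ j\<bar> <= C" using finite_uniform_bound[of "\<lambda>m. \<bar>G m $ i $ j\<bar>"] by blast
  have "(\<lambda>w. G (\<alpha> t w) $ i $ j) \<in> Bm M"
   by (rule measurable_compose[OF \<alpha>_measurable[OF t], of "\<lambda>m. G m $ i $ j"]) simp
  from sq_integrable_mult[OF sq_integrable_bounded_mult[OF a this C] c] show ?thesis by (simp only: mult.assoc)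
 qed
 show "integrable M (\<lambda>w. (G (\<alpha> t w) *v a w) \<bullet> c w)"
  unfolding matrix_form_sum by (intro lint_sum int)
 show "(\<E> w. (G (\<alpha> t w) *v a w) \<bullet> c w)
   = (\<Sum>i\<in>UNIV. \<Sum>j\<in>UNIV. (\<E> w. G (\<alpha> t w) $ i $ j * (a w $ j * c w $ i)))"
  unfolding matrix_form_sum
  by (subst lintegral_sum, intro lint_sum int,
    intro sum.cong refl lintegral_sum int)
qed

lemma terminal_form_projection:
 fixes G :: "'s => real^'n^'n" and a ah c ch :: "'w => real^'n"
 assumes t: "t \<in> {0..T}"
  and a: "\<And>j. projects_at t (\<lambda>w. a w $ j) (\<lambda>w. ah w $ j)" and c: "\<And>j. projects_at t (\<lambda>w. c w $ j) (\<lambda>w. ch w $ j)"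
 shows "(\<E> w. (G (\<alpha> t w) *v ah w) \<bullet> ch w) = (\<E> w. (G (\<alpha> t w) *v ah w) \<bullet> c w)"
proof -
 have sq: "sq_integrable M (\<lambda>w. ah w $ j)" "sq_integrable M (\<lambda>w. c w $ j)" "sq_integrable M (\<lambda>w. ch w $ j)" for j
  using a[of j] c[of j] unfolding projects_at_def by blast+
 have "(\<E> w. G (\<alpha> t w) $ i $ j * (c w $ i * ah w $ j)) = (\<E> w. G (\<alpha> t w) $ i $ j * (ch w $ i * ah w $ j))" for i j
 proof -
  obtain C where C: "\<And>m. \<bar>G m $ i $ j\<bar> <= C" using finite_uniform_bound[of "\<lambda>m. \<bar>G m $ i $ j\<bar>"] by blast
  have "(\<lambda>w. G (\<alpha> t w) $ i $ j) \<in> Bm (chain t)"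
   using t by (intro regime_function_chain[of t t "\<lambda>m. G m $ i $ j"]) auto
  from projects_at_swap(2)[OF c a t this C] show ?thesis .
 qed
 then show ?thesis
  unfolding terminal_form_sum(2)[OF t sq(1,3)] terminal_form_sum(2)[OF t sq(1,2)]
  by (simp only: mult.commute[of "ah _ $ _"])
qed

end

locale follower = regime_noise M T W \<alpha> gen i0
 for M :: "'w measure" and T W and \<alpha> :: "real => 'w => 's::finite" and gen i0 +
 fixes d :: "('s, 'n::finite, 'm1::finite, 'm2::finite) lq_data" and P Ph :: "real => 's => real^'n^'n"
 assumes psd: "\<And>i. pos_semidef (cQ1 d i)" "\<And>i. pos_semidef (cQ1h d i)" "\<And>i. pos_def (cN1 d i)"
   "\<And>i. pos_semidef (cG1 d i)" "\<And>i. pos_semidef (cG1h d i)"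
  and riccati: "riccati1 d gen T P" "riccati2 d gen T P Ph"
begin

abbreviation R :: "real => 's => real^'m1^'m1" where "R t i \<equiv> matrix_inv (N1_tilde d P t i)"

lemma gen_off_diagonal: "i \<noteq> j ==> 0 <= gen i j" by (rule semi.gen_nonneg)

lemma N1_tilde_pos: "t \<in> {0..T} ==> pos_def (N1_tilde d P t i)"
 by (rule N1_tilde_coercive(1)[OF T_pos riccati(1) gen_off_diagonal psd(1,3,4)])

lemma symmetric_coefficients:
 assumes "t \<in> {0..T}"
 shows "symmetric_matrix (P t i)" "symmetric_matrix (Ph t i)" "symmetric_matrix (R t i)"
 using assms riccati pos_def_matrix_inv(3)[OF N1_tilde_pos[OF assms]]
 by (simp_all add: riccati1_def riccati2_def pos_def_def)

lemma riccati_terminal: "P T i = cG1 d i" "Ph T i = cG1h d i"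
 using riccati by (simp_all add: riccati1_def riccati2_def)

lemma gen_sum_difference: "(\<Sum>j\<in>UNIV. gen i j *\<^sub>R (X j - X i)) = (\<Sum>j\<in>UNIV. gen i j *\<^sub>R X j)"
 for X :: "'s => real^'n^'n"
proof -
 have "(\<Sum>j\<in>UNIV. gen i j *\<^sub>R X i) = (\<Sum>j\<in>UNIV. gen i j) *\<^sub>R X i" by (simp only: scaleR_sum_left)
 then show ?thesis using semi.gen_row_sum[of i] by (simp add: scaleR_diff_right sum_subtractf)
qed

lemma riccati_derivative:
 assumes "t \<in> {0..T}"
 shows "((\<lambda>s. P s i) has_vector_derivative - (drift1 d P t i + (\<Sum>j\<in>UNIV. gen i j *\<^sub>R P t j))) (at t within {0..T})"
  and "((\<lambda>s. Ph s i) has_vector_derivative - (drift2 d P Ph t i + (\<Sum>j\<in>UNIV. gen i j *\<^sub>R Ph t j))) (at t within {0..T})"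
 using riccati assms unfolding riccati1_def riccati2_def drift1_def drift2_def gen_sum_difference by blast+

end

section \<open>Pairing two Ito processes through a Riccati solution\<close>

context regime_noise begin

lemma vector_ito_process_L2:
 fixes X b k :: "real => 'w => real^'n"
 assumes "vector_ito_process x0 b k X"
 shows "X \<in> L2" "b \<in> L2" "k \<in> L2"
 using assms unfolding L2_space_iff adapted_def vector_ito_process_def ito_process_def sq_vector_process_def
 by (auto intro!: borel_measurable_vecI)

text \<open>The generator sum in the derivative of \<Theta> cancels the one that the chain
  contributes to the expected product, so only \<open>D\<close> remains. It is applied with
  \<open>P\<close> and \<open>drift1\<close>, and with \<open>Ph\<close> and
  \<open>drift2\<close>.\<close>

lemma regime_duality:
 fixes \<Theta> D :: "real => 's => real^'n^'n"
 assumes \<Theta>: "\<And>t i. t \<in> {0..T} ==>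
   ((\<lambda>s. \<Theta> s i) has_vector_derivative - (D t i + (\<Sum>j\<in>UNIV. gen i j *\<^sub>R \<Theta> t j))) (at t within {0..T})"
  and c\<Theta>: "\<And>i. continuous_on {0..T} (\<lambda>t. \<Theta> t i)" and cD: "\<And>i. continuous_on {0..T} (\<lambda>t. D t i)"
  and X: "vector_ito_process x0 b k X" and Y: "vector_ito_process y0 c l Y"
 shows "(\<E> w. (\<Theta> T (\<alpha> T w) *v X T w) \<bullet> Y T w) = (\<Theta> 0 i0 *v x0) \<bullet> y0
  + mean_inner (\<lambda>t w. \<Theta> t (\<alpha> t w) *v b t w) Y + mean_inner (\<lambda>t w. \<Theta> t (\<alpha> t w) *v X t w) c
  + mean_inner (\<lambda>t w. \<Theta> t (\<alpha> t w) *v k t w) l - mean_inner (\<lambda>t w. D t (\<alpha> t w) *v X t w) Y"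
proof -
 note LX = vector_ito_process_L2[OF X] and LY = vector_ito_process_L2[OF Y]
 have cont: "continuous_on {0..T} (\<lambda>t. - (D t i + (\<Sum>j\<in>UNIV. gen i j *\<^sub>R \<Theta> t j)))" for i
  by (intro continuous_intros cD c\<Theta>)
 have T: "T \<in> {0..T}" using T_pos by simp
 have cancel: "- (D t i + S) + S = - D t i" for t i S by simp
 note L = L2_matrix[of \<Theta>, OF c\<Theta>] L2_matrix[of D, OF cD]
 have i1: "integrable Q (\<lambda>(s, w). (\<Theta> s (\<alpha> s w) *v b s w) \<bullet> Y s w)" by (intro L2_inner[where F = joint] L LX LY)
 have i2: "integrable Q (\<lambda>(s, w). (\<Theta> s (\<alpha> s w) *v X s w) \<bullet> c s w)" by (intro L2_inner[where F = joint] L LX LY)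
 have i3: "integrable Q (\<lambda>(s, w). (\<Theta> s (\<alpha> s w) *v k s w) \<bullet> l s w)" by (intro L2_inner[where F = joint] L LX LY)
 have i4: "integrable Q (\<lambda>(s, w). (D s (\<alpha> s w) *v X s w) \<bullet> Y s w)" by (intro L2_inner[where F = joint] L LX LY)
 have i12: "integrable Q (\<lambda>(s, w). (\<Theta> s (\<alpha> s w) *v b s w) \<bullet> Y s w + (\<Theta> s (\<alpha> s w) *v X s w) \<bullet> c s w)"
  by (rule integrable_Q_add[OF i1 i2])
 have i123: "integrable Q (\<lambda>(s, w). (\<Theta> s (\<alpha> s w) *v b s w) \<bullet> Y s w + (\<Theta> s (\<alpha> s w) *v X s w) \<bullet> c s w + (\<Theta> s (\<alpha> s w) *v k s w) \<bullet> l s w)"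
  by (rule integrable_Q_add[OF i12 i3])
 have "mean_integral T (\<lambda>s w. (\<Theta> s (\<alpha> s w) *v b s w) \<bullet> Y s w + (\<Theta> s (\<alpha> s w) *v X s w) \<bullet> c s w
   + (\<Theta> s (\<alpha> s w) *v k s w) \<bullet> l s w
   + ((- (D s (\<alpha> s w) + (\<Sum>j\<in>UNIV. gen (\<alpha> s w) j *\<^sub>R \<Theta> s j)) + (\<Sum>j\<in>UNIV. gen (\<alpha> s w) j *\<^sub>R \<Theta> s j)) *v X s w) \<bullet> Y s w)
  = mean_integral T (\<lambda>s w. ((\<Theta> s (\<alpha> s w) *v b s w) \<bullet> Y s w + (\<Theta> s (\<alpha> s w) *v X s w) \<bullet> c s w
   + (\<Theta> s (\<alpha> s w) *v k s w) \<bullet> l s w) - (D s (\<alpha> s w) *v X s w) \<bullet> Y s w)"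
  unfolding cancel matrix_vector_mult_uminus_left inner_minus_left by (simp only: diff_conv_add_uminus)
 also have "... = mean_inner (\<lambda>t w. \<Theta> t (\<alpha> t w) *v b t w) Y + mean_inner (\<lambda>t w. \<Theta> t (\<alpha> t w) *v X t w) c
  + mean_inner (\<lambda>t w. \<Theta> t (\<alpha> t w) *v k t w) l - mean_inner (\<lambda>t w. D t (\<alpha> t w) *v X t w) Y"
  unfolding mean_inner_def mean_integral_diff[OF i123 i4] mean_integral_add[OF i12 i3] mean_integral_add[OF i1 i2] ..
 finally show ?thesis
  using vector_regime_product[where \<Theta> = \<Theta>, OF \<Theta> cont X Y T] by simp
qed

end

context follower begin

lemma cont_P: "continuous_on {0..T} (\<lambda>t. P t i)" and cont_Ph: "continuous_on {0..T} (\<lambda>t. Ph t i)"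
 unfolding continuous_on_eq_continuous_within
 using has_vector_derivative_continuous[OF riccati_derivative(1)] has_vector_derivative_continuous[OF riccati_derivative(2)]
 by blast+

lemma cont_N1_tilde: "continuous_on {0..T} (\<lambda>t. N1_tilde d P t i)"
 unfolding N1_tilde_def
 by (intro continuous_on_add continuous_on_const continuous_on_matrix_mult continuous_on_transpose cont_P)

lemma cont_R: "continuous_on {0..T} (\<lambda>t. R t i)"
proof -
 obtain c where "0 < c" "\<And>t i v. t \<in> {0..T} ==> c * (v \<bullet> v) <= (N1_tilde d P t i *v v) \<bullet> v"
  using N1_tilde_coercive(2)[OF T_pos riccati(1) gen_off_diagonal psd(1,3,4)] by blast
 then show ?thesis by (intro continuous_on_matrix_inv[OF cont_N1_tilde N1_tilde_pos])
qed

lemmas cont_basic = continuous_on_const continuous_on_add continuous_on_diff continuous_on_minus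
 continuous_on_matrix_mult continuous_on_transpose cont_P cont_Ph cont_R

lemma cont_S: "continuous_on {0..T} (\<lambda>t. S1 d P t i)" "continuous_on {0..T} (\<lambda>t. S1h d P Ph t i)"
 "continuous_on {0..T} (\<lambda>t. S2 d P t i)" "continuous_on {0..T} (\<lambda>t. S2h d P Ph t i)"
 unfolding S1_def S1h_def S2_def S2h_def by (intro cont_basic)+

lemma cont_bb: "continuous_on {0..T} (\<lambda>t. bbA d P t i)" "continuous_on {0..T} (\<lambda>t. bbAh d P Ph t i)"
 "continuous_on {0..T} (\<lambda>t. bbC d P t i)" "continuous_on {0..T} (\<lambda>t. bbCh d P Ph t i)"
 "continuous_on {0..T} (\<lambda>t. bbF2 d P t i)" "continuous_on {0..T} (\<lambda>t. bbF2h d P Ph t i)"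
 unfolding bbA_def bbAh_def bbC_def bbCh_def bbF2_def bbF2h_def by (intro cont_basic cont_S)+

lemma cont_drift: "continuous_on {0..T} (\<lambda>t. drift1 d P t i)" "continuous_on {0..T} (\<lambda>t. drift2 d P Ph t i)"
 unfolding drift1_def drift2_def by (intro cont_basic cont_S)+

lemmas cont = cont_basic cont_S cont_bb cont_drift

definition "bsde_driver u2 u2h \<phi> \<phi>h \<theta> \<theta>h = (\<lambda>s w. transpose (bbA d P s (\<alpha> s w)) *v \<phi> s w
       + transpose (bbAh d P Ph s (\<alpha> s w)) *v \<phi>h s w
       + transpose (bbC d P s (\<alpha> s w)) *v \<theta> s w
       + transpose (bbCh d P Ph s (\<alpha> s w)) *v \<theta>h s w
       + transpose (bbF2 d P s (\<alpha> s w)) *v u2 s w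
       + transpose (bbF2h d P Ph s (\<alpha> s w)) *v u2h s w)"

lemma bsde_driver_L2:
 assumes "u2 \<in> L2" "u2h \<in> L2" "f \<in> L2"
  "fh \<in> L2" "y \<in> L2" "yh \<in> L2"
 shows "bsde_driver u2 u2h f fh y yh \<in> L2"
 unfolding bsde_driver_def
 by (intro L2_add L2_matrix[of "\<lambda>t i. transpose (bbA d P t i)"] L2_matrix[of "\<lambda>t i. transpose (bbAh d P Ph t i)"]
   L2_matrix[of "\<lambda>t i. transpose (bbC d P t i)"] L2_matrix[of "\<lambda>t i. transpose (bbCh d P Ph t i)"]
   L2_matrix[of "\<lambda>t i. transpose (bbF2 d P t i)"] L2_matrix[of "\<lambda>t i. transpose (bbF2h d P Ph t i)"] cont assms)

definition state_drift ::
 "(real => 'w => real^'m1) => (real => 'w => real^'m2) => (real => 'w => real^'n) => (real => 'w => real^'n) =>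
   real => 'w => real^'n" where
 "state_drift u1 u2 y yh t w = cA d (\<alpha> t w) *v y t w + cAh d (\<alpha> t w) *v yh t w
         + cB1 d (\<alpha> t w) *v u1 t w + cB2 d (\<alpha> t w) *v u2 t w"

definition state_diffusion ::
 "(real => 'w => real^'m1) => (real => 'w => real^'m2) => (real => 'w => real^'n) => (real => 'w => real^'n) =>
   real => 'w => real^'n" where
 "state_diffusion u1 u2 y yh t w = cC d (\<alpha> t w) *v y t w + cCh d (\<alpha> t w) *v yh t w
         + cD1 d (\<alpha> t w) *v u1 t w + cD2 d (\<alpha> t w) *v u2 t w"

lemma state_coefficients_L2:
 assumes "y \<in> L2" "yh \<in> L2" "u1 \<in> L2" "u2 \<in> L2"
 shows "state_drift u1 u2 y yh \<in> L2" "state_diffusion u1 u2 y yh \<in> L2"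
 unfolding state_drift_def[abs_def] state_diffusion_def[abs_def]
 by (intro L2_add L2_coefficient assms)+

lemma state_coefficients_projects:
 assumes "vector_projects y yh" "vector_projects u1 u1h" "vector_projects u2 u2h"
 shows "vector_projects (state_drift u1 u2 y yh) (state_drift u1h u2h yh yh)"
  "vector_projects (state_diffusion u1 u2 y yh) (state_diffusion u1h u2h yh yh)"
 unfolding state_drift_def[abs_def] state_diffusion_def[abs_def]
 by (intro vector_projects_add vector_projects_matrix[of "\<lambda>t. cA d"] vector_projects_matrix[of "\<lambda>t. cAh d"]
   vector_projects_matrix[of "\<lambda>t. cB1 d"] vector_projects_matrix[of "\<lambda>t. cB2 d"]
   vector_projects_matrix[of "\<lambda>t. cC d"] vector_projects_matrix[of "\<lambda>t. cCh d"]
   vector_projects_matrix[of "\<lambda>t. cD1 d"] vector_projects_matrix[of "\<lambda>t. cD2 d"]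
   continuous_on_const assms vector_projects_self[OF assms(1)])+

lemma state_process:
 assumes st: "is_state M T W \<alpha> d x0 u1 u2 y yh" and u: "u1 \<in> L2" "u2 \<in> L2"
 shows "y \<in> L2" "chain_projection M T \<alpha> y yh" "vector_projects y yh" "yh \<in> L2"
  "vector_ito_process x0 (state_drift u1 u2 y yh) (state_diffusion u1 u2 y yh) y"
proof -
 show y: "y \<in> L2" and p: "chain_projection M T \<alpha> y yh" using st by (simp_all add: is_state_def)
 show pr: "vector_projects y yh" by (rule L2_projects[OF y p])
 show yh: "yh \<in> L2" by (rule vector_projects_L2(2)[OF pr])
 obtain I where I: "has_ito_integral M joint T W (state_diffusion u1 u2 y yh) I"
  and eq: "\<And>t. t \<in> {0..T} ==> AE w in M. y t w = x0 + (LINT s:{0..t}|lborel. state_drift u1 u2 y yh s w) + I t w"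
  using st unfolding is_state_def state_drift_def state_diffusion_def[abs_def] by blast
 show "vector_ito_process x0 (state_drift u1 u2 y yh) (state_diffusion u1 u2 y yh) y"
  by (rule vector_ito_processI[OF y state_coefficients_L2[OF y yh u] I eq])
qed

end

text \<open>The backward equation enters through the identity \<open>backward\<close> only;
  \<open>v\<close> stands for the almost sure value of \<open>\<phi>\<close> at time 0.\<close>

locale follower_response = follower M T W \<alpha> gen i0 d P Ph
 for M :: "'w measure" and T W and \<alpha> :: "real => 'w => 's::finite" and gen i0
  and d :: "('s, 'n::finite, 'm1::finite, 'm2::finite) lq_data" and P Ph +
 fixes x0 v :: "real^'n" and u2 u2h :: "real => 'w => real^'m2" and \<phi> \<phi>h \<theta> \<theta>h x xh :: "real => 'w => real^'n"
  and u1s \<Phi> :: "real => 'w => real^'m1" and f :: "real => 'w => real^'n"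
 assumes u2: "u2 \<in> L2" "vector_projects u2 u2h"
  and \<phi>: "\<phi> \<in> L2" "vector_projects \<phi> \<phi>h"
  and \<theta>: "\<theta> \<in> L2" "vector_projects \<theta> \<theta>h"
  and f: "f = bsde_driver u2 u2h \<phi> \<phi>h \<theta> \<theta>h"
  and backward: "\<And>y0 b k Y. vector_ito_process y0 b k Y ==>
   v \<bullet> y0 + mean_integral T (\<lambda>s w. \<phi> s w \<bullet> b s w + \<theta> s w \<bullet> k s w - f s w \<bullet> Y s w) = 0"
  and \<Phi>: "\<Phi> = follower_offset \<alpha> d P u2 \<phi> \<theta>"
  and u1s: "u1s = (\<lambda>t w. - (R t (\<alpha> t w) *v
      (S1 d P t (\<alpha> t w) *v x t w + S1h d P Ph t (\<alpha> t w) *v xh t w + \<Phi> t w)))"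
  and state: "is_state M T W \<alpha> d x0 u1s u2 x xh"
begin

definition "\<Phi>h = follower_offset \<alpha> d P u2h \<phi>h \<theta>h"

text \<open>The projection of \<open>u1s\<close>: the coefficients depend on the chain alone, so
  each process is replaced by its hat, while \<open>xh\<close> is its own projection. Hence
  \<open>xh\<close> occurs twice.\<close>

definition "u1h = (\<lambda>t w. - (R t (\<alpha> t w) *v
      (S1 d P t (\<alpha> t w) *v xh t w + S1h d P Ph t (\<alpha> t w) *v xh t w + \<Phi>h t w)))"

definition "p t w = P t (\<alpha> t w) *v x t w + Ph t (\<alpha> t w) *v xh t w + \<phi> t w"

definition "q t w = P t (\<alpha> t w) *v state_diffusion u1s u2 x xh t w + \<theta> t w"

definition "ph t w = P t (\<alpha> t w) *v xh t w + Ph t (\<alpha> t w) *v xh t w + \<phi>h t w"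

definition "qh t w = P t (\<alpha> t w) *v state_diffusion u1h u2h xh xh t w + \<theta>h t w"

lemma x_projects: "x \<in> L2" "vector_projects x xh" "xh \<in> L2"
proof -
 show x: "x \<in> L2" using state by (simp add: is_state_def)
 show pr: "vector_projects x xh" using state L2_projects[OF x] by (simp add: is_state_def)
 show "xh \<in> L2" by (rule vector_projects_L2(2)[OF pr])
qed

lemma \<Phi>_projects: "vector_projects \<Phi> \<Phi>h"
 unfolding \<Phi> \<Phi>h_def follower_offset_def[abs_def]
 by (intro vector_projects_add vector_projects_matrix[of "\<lambda>t i. transpose (cB1 d i)"]
   vector_projects_matrix[of "\<lambda>t i. transpose (cD1 d i)"]
   vector_projects_matrix[of "\<lambda>t i. transpose (cD1 d i) ** P t i ** cD2 d i"] cont u2 \<phi> \<theta>)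

lemma u1s_projects: "vector_projects u1s u1h"
 unfolding u1s u1h_def
 by (intro vector_projects_uminus vector_projects_add vector_projects_matrix[of R]
   vector_projects_matrix[of "S1 d P"] vector_projects_matrix[of "S1h d P Ph"] cont
   x_projects \<Phi>_projects vector_projects_self[OF x_projects(2)])

lemma u1s_L2: "u1s \<in> L2" by (rule vector_projects_L2(1)[OF u1s_projects])

lemma hats_L2: "u2h \<in> L2" "\<phi>h \<in> L2" "\<theta>h \<in> L2" "u1h \<in> L2"
 by (rule vector_projects_L2(2), rule u2 \<phi> \<theta> u1s_projects)+

lemma x_ito: "vector_ito_process x0 (state_drift u1s u2 x xh) (state_diffusion u1s u2 x xh) x"
 by (rule state_process(5)[OF state u1s_L2 u2(1)])

lemma xh_ito: "vector_ito_process x0 (state_drift u1h u2h xh xh) (\<lambda>t w. 0) xh"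
 by (rule projected_ito_process[OF x_ito _ x_projects(1) state_coefficients_projects(1)[OF x_projects(2) u1s_projects u2(2)]])
  (use state in \<open>simp add: is_state_def\<close>)

lemma pq_projects: "vector_projects p ph" "vector_projects q qh"
 unfolding p_def[abs_def] ph_def[abs_def] q_def[abs_def] qh_def[abs_def]
 by (intro vector_projects_add vector_projects_matrix[of P] vector_projects_matrix[of Ph] cont \<phi> \<theta> x_projects
   vector_projects_self[OF x_projects(2)] state_coefficients_projects u1s_projects u2)+

lemma pq_L2: "p \<in> L2" "q \<in> L2" "ph \<in> L2" "qh \<in> L2"
 using vector_projects_L2 pq_projects by blast+

lemma f_L2: "f \<in> L2"
 unfolding f by (intro bsde_driver_L2 \<phi> \<theta> u2 hats_L2)

lemma backward_duality:
 assumes "vector_ito_process y0 b k Y"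
 shows "v \<bullet> y0 + mean_inner \<phi> b + mean_inner \<theta> k - mean_inner f Y = 0"
proof -
 note Y = vector_ito_process_L2[OF assms]
 note i1 = L2_inner[OF \<phi>(1) Y(2)] and i2 = L2_inner[OF \<theta>(1) Y(3)] and i3 = L2_inner[OF f_L2 Y(1)]
 have i12: "integrable Q (\<lambda>(s, w). \<phi> s w \<bullet> b s w + \<theta> s w \<bullet> k s w)"
  by (rule integrable_Q_add[OF i1 i2])
 show ?thesis
  using backward[OF assms] unfolding mean_inner_def mean_integral_diff[OF i12 i3] mean_integral_add[OF i1 i2] by simp
qed

text \<open>The transposed coefficients act on the test process: the hatted ones are moved from \<open>yh\<close> to
 \<open>y\<close> by projecting the adjoint process instead.\<close>

lemma adjoint_drift:
 fixes y yh a ah :: "real => 'w => real^'n" and u1 :: "real => 'w => real^'m1"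
 assumes y: "vector_projects y yh" and u1: "u1 \<in> L2" and a: "vector_projects a ah"
 shows "mean_inner a (state_drift u1 u2 y yh) = mean_inner (\<lambda>t w. transpose (cA d (\<alpha> t w)) *v a t w) y
  + mean_inner (\<lambda>t w. transpose (cAh d (\<alpha> t w)) *v ah t w) y
  + mean_inner (\<lambda>t w. transpose (cB1 d (\<alpha> t w)) *v a t w) u1
  + mean_inner (\<lambda>t w. transpose (cB2 d (\<alpha> t w)) *v a t w) u2" (is ?drift)
  and "mean_inner a (state_diffusion u1 u2 y yh) = mean_inner (\<lambda>t w. transpose (cC d (\<alpha> t w)) *v a t w) y
  + mean_inner (\<lambda>t w. transpose (cCh d (\<alpha> t w)) *v ah t w) y
  + mean_inner (\<lambda>t w. transpose (cD1 d (\<alpha> t w)) *v a t w) u1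
  + mean_inner (\<lambda>t w. transpose (cD2 d (\<alpha> t w)) *v a t w) u2" (is ?diffusion)
proof -
 have yL: "y \<in> L2" "yh \<in> L2" and aL: "a \<in> L2"
  using vector_projects_L2[OF y] vector_projects_L2[OF a] by auto
 have swap: "mean_inner (\<lambda>t w. transpose (X (\<alpha> t w)) *v a t w) yh = mean_inner (\<lambda>t w. transpose (X (\<alpha> t w)) *v ah t w) y"
  for X :: "'s => real^'n^'n"
  by (rule mean_inner_swap[OF vector_projects_matrix[of "\<lambda>t i. transpose (X i)", OF _ a] y]) (rule continuous_on_const)
 have move: "mean_inner a (\<lambda>t w. X (\<alpha> t w) *v z t w) = mean_inner (\<lambda>t w. transpose (X (\<alpha> t w)) *v a t w) z"
  for X :: "'s => real^'k::finite^'n" and z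
  by (rule mean_inner_cong) (metis inner_commute inner_matrix_vector_left)
 show ?drift unfolding state_drift_def[abs_def]
  by (simp only: mean_inner_add_right[where F = joint] L2_add L2_coefficient yL aL u1 u2(1) move swap)
 show ?diffusion unfolding state_diffusion_def[abs_def]
  by (simp only: mean_inner_add_right[where F = joint] L2_add L2_coefficient yL aL u1 u2(1) move swap)
qed

text \<open>The initial values of the three pairings of \<open>P x\<close>, \<open>Ph xh\<close> and
  \<open>\<phi>\<close> with a state, plus the contribution of the leader. A competing state enters
  neither, as it starts at the same \<open>x0\<close> and has the same \<open>u2\<close>.\<close>

definition "\<kappa> = ((P 0 i0 + Ph 0 i0) *v x0) \<bullet> x0 + v \<bullet> x0
 + mean_inner (\<lambda>t w. transpose (cB2 d (\<alpha> t w)) *v p t w + transpose (cD2 d (\<alpha> t w)) *v q t w) u2"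

text \<open>\<open>E1\<close>, \<open>E2\<close> and \<open>E3\<close> pair the three summands of
  \<open>p\<close> with the competing state. After the transposed coefficients have been moved to
  \<open>p\<close> and \<open>q\<close>, everything tested with \<open>y\<close> collapses by
  \<open>adjoint_identity\<close> to the running state weights, and everything tested with
  \<open>u1\<close> by \<open>stationarity\<close> to the control weight. The initial values and the
  terms with \<open>u2\<close> are left over.\<close>

lemma cost_duality:
 assumes st: "is_state M T W \<alpha> d x0 u1 u2 y yh" and u1: "u1 \<in> L2"
 shows "(\<E> w. (cG1 d (\<alpha> T w) *v x T w) \<bullet> y T w) + (\<E> w. (cG1h d (\<alpha> T w) *v xh T w) \<bullet> yh T w)
  + mean_inner (\<lambda>t w. cQ1 d (\<alpha> t w) *v x t w) y + mean_inner (\<lambda>t w. cQ1h d (\<alpha> t w) *v xh t w) yh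
  + mean_inner (\<lambda>t w. cN1 d (\<alpha> t w) *v u1s t w) u1 = \<kappa>"
proof -
 note Y = state_process[OF st u1 u2(1)]
 have T: "T \<in> {0..T}" using T_pos by simp
 define b where "b = state_drift u1s u2 x xh"
 define bh where "bh = state_drift u1h u2h xh xh"
 define s where "s = state_diffusion u1s u2 x xh"
 define c where "c = state_drift u1 u2 y yh"
 define e where "e = state_diffusion u1 u2 y yh"
 define Px where "Px t w = P t (\<alpha> t w) *v x t w" for t w
 define Phx where "Phx t w = Ph t (\<alpha> t w) *v xh t w" for t w
 define Ps where "Ps t w = P t (\<alpha> t w) *v s t w" for t w
 define w1 where "w1 t w = transpose (cA d (\<alpha> t w)) *v p t w" for t w
 define w2 where "w2 t w = transpose (cC d (\<alpha> t w)) *v q t w" for t w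
 define w3 where "w3 t w = transpose (cAh d (\<alpha> t w)) *v ph t w" for t w
 define w4 where "w4 t w = transpose (cCh d (\<alpha> t w)) *v qh t w" for t w
 define w5 where "w5 t w = P t (\<alpha> t w) *v b t w" for t w
 define w6 where "w6 t w = Ph t (\<alpha> t w) *v bh t w" for t w
 define w7 where "w7 t w = drift1 d P t (\<alpha> t w) *v x t w" for t w
 define w8 where "w8 t w = drift2 d P Ph t (\<alpha> t w) *v xh t w" for t w
 define Qx where "Qx t w = cQ1 d (\<alpha> t w) *v x t w" for t w
 define Qhx where "Qhx t w = cQ1h d (\<alpha> t w) *v xh t w" for t w
 define Bp where "Bp t w = transpose (cB1 d (\<alpha> t w)) *v p t w" for t w
 define Dq where "Dq t w = transpose (cD1 d (\<alpha> t w)) *v q t w" for t w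
 define Bp2 where "Bp2 t w = transpose (cB2 d (\<alpha> t w)) *v p t w" for t w
 define Dq2 where "Dq2 t w = transpose (cD2 d (\<alpha> t w)) *v q t w" for t w
 note abs_defs = Px_def[abs_def] Phx_def[abs_def] Ps_def[abs_def] w1_def[abs_def] w2_def[abs_def] w3_def[abs_def]
  w4_def[abs_def] w5_def[abs_def] w6_def[abs_def] w7_def[abs_def] w8_def[abs_def] Qx_def[abs_def] Qhx_def[abs_def]
  Bp_def[abs_def] Dq_def[abs_def] Bp2_def[abs_def] Dq2_def[abs_def]
 have base: "b \<in> L2" "bh \<in> L2" "s \<in> L2" "c \<in> L2" "e \<in> L2"
  unfolding b_def bh_def s_def c_def e_def
  by (intro state_coefficients_L2 x_projects u1s_L2 u2 u1 hats_L2 Y)+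
 have L: "Px \<in> L2" "Phx \<in> L2" "Ps \<in> L2"
  "w1 \<in> L2" "w2 \<in> L2" "w3 \<in> L2" "w4 \<in> L2"
  "w5 \<in> L2" "w6 \<in> L2" "w7 \<in> L2" "w8 \<in> L2"
  "Qx \<in> L2" "Qhx \<in> L2" "Bp \<in> L2" "Dq \<in> L2"
  "Bp2 \<in> L2" "Dq2 \<in> L2"
  unfolding abs_defs
  by (intro L2_coefficient L2_coefficient[of _ "\<lambda>i. transpose (_ d i)"] L2_matrix[of P] L2_matrix[of Ph] L2_matrix[of "drift1 d P"]
    L2_matrix[of "drift2 d P Ph"] cont base pq_L2 x_projects)+
 have E1: "(\<E> w. (cG1 d (\<alpha> T w) *v x T w) \<bullet> y T w)
  = (P 0 i0 *v x0) \<bullet> x0 + mean_inner w5 y + mean_inner Px c + mean_inner Ps e - mean_inner w7 y"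
  using regime_duality[of P "drift1 d P", OF riccati_derivative(1) cont_P cont_drift(1) x_ito Y(5)]
  unfolding riccati_terminal abs_defs b_def[symmetric] s_def[symmetric] c_def[symmetric] e_def[symmetric] .
 \<comment> \<open>The hatted state has no diffusion, so the diffusion \<open>e\<close> of the
   competing state finds no partner.\<close>
 have zero: "mean_inner (\<lambda>t w. Ph t (\<alpha> t w) *v 0) e = 0"
  by (simp add: mean_inner_def mean_integral_def)
 have E2: "(\<E> w. (cG1h d (\<alpha> T w) *v xh T w) \<bullet> y T w)
  = (Ph 0 i0 *v x0) \<bullet> x0 + mean_inner w6 y + mean_inner Phx c - mean_inner w8 y"
  using regime_duality[of Ph "drift2 d P Ph", OF riccati_derivative(2) cont_Ph cont_drift(2) xh_ito Y(5)]
  unfolding riccati_terminal abs_defs bh_def[symmetric] c_def[symmetric] e_def[symmetric] zero by simp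
 have E3: "v \<bullet> x0 + mean_inner \<phi> c + mean_inner \<theta> e - mean_inner f y = 0"
  unfolding c_def e_def by (rule backward_duality[OF Y(5)])
 have terminal: "(\<E> w. (cG1h d (\<alpha> T w) *v xh T w) \<bullet> yh T w) = (\<E> w. (cG1h d (\<alpha> T w) *v xh T w) \<bullet> y T w)"
 proof (rule terminal_form_projection[OF T])
  show "projects_at T (\<lambda>w. x T w $ j) (\<lambda>w. xh T w $ j)" for j
   using state ito_process_sq[OF vector_ito_processD[OF x_ito] T]
   by (intro chain_projection_projects_at(1)[OF _ T]) (auto simp: is_state_def)
  show "projects_at T (\<lambda>w. y T w $ j) (\<lambda>w. yh T w $ j)" for j
   by (rule chain_projection_projects_at(1)[OF Y(2) T ito_process_sq[OF vector_ito_processD[OF Y(5)] T]])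
 qed
 have p_split: "mean_inner p c = mean_inner Px c + mean_inner Phx c + mean_inner \<phi> c"
 proof -
  have "p = (\<lambda>t w. Px t w + Phx t w + \<phi> t w)" by (simp add: fun_eq_iff p_def Px_def Phx_def)
  then show ?thesis by (simp add: mean_inner_add_left[where F = joint] L2_add L base \<phi>)
 qed
 have q_split: "mean_inner q e = mean_inner Ps e + mean_inner \<theta> e"
 proof -
  have "q = (\<lambda>t w. Ps t w + \<theta> t w)" by (simp add: fun_eq_iff q_def Ps_def s_def)
  then show ?thesis by (simp add: mean_inner_add_left[where F = joint] L2_add L base \<theta>)
 qed
 have p_adj: "mean_inner p c = mean_inner w1 y + mean_inner w3 y + mean_inner Bp u1 + mean_inner Bp2 u2"
  unfolding c_def abs_defs by (rule adjoint_drift(1)[OF Y(3) u1 pq_projects(1)])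
 have q_adj: "mean_inner q e = mean_inner w2 y + mean_inner w4 y + mean_inner Dq u1 + mean_inner Dq2 u2"
  unfolding e_def abs_defs by (rule adjoint_drift(2)[OF Y(3) u1 pq_projects(2)])
 have adjoint: "mean_inner (\<lambda>t w. w1 t w + w2 t w + w3 t w + w4 t w + w5 t w + w6 t w + - w7 t w + - w8 t w + - f t w) y
  = mean_inner (\<lambda>t w. - (Qx t w + Qhx t w)) y"
 proof (rule mean_inner_cong)
  fix t w assume t: "t \<in> {0..T}"
  have "w1 t w + w2 t w + w3 t w + w4 t w + w5 t w + w6 t w - w7 t w - w8 t w - f t w = - (Qx t w + Qhx t w)"
   unfolding w1_def w2_def w3_def w4_def w5_def w6_def w7_def w8_def Qx_def Qhx_def p_def q_def ph_def qh_def
    b_def bh_def f bsde_driver_def state_drift_def state_diffusion_def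
   by (rule adjoint_identity[where d = d and P = P and Ph = Ph and t = t and i = "\<alpha> t w", OF symmetric_coefficients(1)[OF t] symmetric_coefficients(3)[OF t] symmetric_coefficients(2)[OF t],
      where \<Phi> = "\<Phi> t w" and \<Phi>h = "\<Phi>h t w"])
    (simp_all add: u1s u1h_def \<Phi> \<Phi>h_def follower_offset_def)
  then show "(w1 t w + w2 t w + w3 t w + w4 t w + w5 t w + w6 t w + - w7 t w + - w8 t w + - f t w) \<bullet> y t w
   = - (Qx t w + Qhx t w) \<bullet> y t w" by simp
 qed
 have adjoint': "mean_inner w1 y + mean_inner w2 y + mean_inner w3 y + mean_inner w4 y + mean_inner w5 y + mean_inner w6 y
  - mean_inner w7 y - mean_inner w8 y - mean_inner f y = - (mean_inner Qx y + mean_inner Qhx y)"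
  using adjoint
  by (simp add: mean_inner_add_left[where F = joint] mean_inner_uminus_left L2_add L2_uminus L f_L2 Y
    del: minus_add_distrib add_uminus_conv_diff)
 have control: "mean_inner Bp u1 + mean_inner Dq u1 = - mean_inner (\<lambda>t w. cN1 d (\<alpha> t w) *v u1s t w) u1"
 proof -
  have "mean_inner (\<lambda>t w. Bp t w + Dq t w) u1 = mean_inner (\<lambda>t w. - (cN1 d (\<alpha> t w) *v u1s t w)) u1"
  proof (rule mean_inner_cong)
   fix t w assume t: "t \<in> {0..T}"
   have "Bp t w + Dq t w = - (cN1 d (\<alpha> t w) *v u1s t w)"
    unfolding Bp_def Dq_def p_def q_def state_diffusion_def
    by (rule stationarity[OF N1_tilde_pos[OF t], where \<Phi> = "\<Phi> t w"]) (simp_all add: u1s \<Phi> follower_offset_def)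
   then show "(Bp t w + Dq t w) \<bullet> u1 t w = - (cN1 d (\<alpha> t w) *v u1s t w) \<bullet> u1 t w" by simp
  qed
  then show ?thesis by (simp add: mean_inner_add_left[where F = joint] mean_inner_uminus_left L u1)
 qed
 have Qh_swap: "mean_inner Qhx yh = mean_inner Qhx y"
  unfolding abs_defs
  by (rule mean_inner_swap[OF vector_projects_matrix[of "\<lambda>t. cQ1h d", OF continuous_on_const vector_projects_self[OF x_projects(2)]] Y(3)])
 have \<kappa>': "\<kappa> = (P 0 i0 *v x0) \<bullet> x0 + (Ph 0 i0 *v x0) \<bullet> x0 + v \<bullet> x0 + mean_inner Bp2 u2 + mean_inner Dq2 u2"
  using mean_inner_add_left[OF L(16,17) u2(1)]
  unfolding \<kappa>_def abs_defs by (simp add: matrix_vector_mult_add_rdistrib inner_add_left)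
 show ?thesis
  using E1 E2 E3 terminal p_split q_split p_adj q_adj adjoint' control Qh_swap
  unfolding \<kappa>' Qx_def[abs_def, symmetric] Qhx_def[abs_def, symmetric] by linarith
qed

end

section \<open>Convexity of the running and terminal costs\<close>

context regime_noise begin

lemma mean_inner_polarization:
 fixes X :: "'s => real^'k::finite^'k" and a b :: "real => 'w => real^'k"
 assumes X: "\<And>i. pos_semidef (X i)" and a: "a \<in> L2" and b: "b \<in> L2"
 shows "2 * mean_inner (\<lambda>t w. X (\<alpha> t w) *v a t w) b
  <= mean_inner (\<lambda>t w. X (\<alpha> t w) *v a t w) a + mean_inner (\<lambda>t w. X (\<alpha> t w) *v b t w) b"
proof -
 note i1 = L2_inner[OF L2_coefficient[of a X, OF a] b] and i2 = L2_inner[OF L2_coefficient[of a X, OF a] a]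
  and i3 = L2_inner[OF L2_coefficient[of b X, OF b] b]
 have "mean_integral T (\<lambda>t w. 2 * ((X (\<alpha> t w) *v a t w) \<bullet> b t w))
  <= mean_integral T (\<lambda>t w. (X (\<alpha> t w) *v a t w) \<bullet> a t w + (X (\<alpha> t w) *v b t w) \<bullet> b t w)"
 proof (rule mean_integral_mono)
  show "integrable Q (\<lambda>(t, w). 2 * ((X (\<alpha> t w) *v a t w) \<bullet> b t w))"
   using i1 by (simp add: case_prod_unfold)
  show "integrable Q (\<lambda>(t, w). (X (\<alpha> t w) *v a t w) \<bullet> a t w + (X (\<alpha> t w) *v b t w) \<bullet> b t w)"
   by (rule integrable_Q_add[OF i2 i3])
 qed (rule psd_polarization[OF X])
 then show ?thesis unfolding mean_inner_def mean_integral_cmult mean_integral_add[OF i2 i3] .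
qed

lemma terminal_polarization:
 fixes G :: "'s => real^'n^'n" and a b :: "'w => real^'n"
 assumes G: "\<And>i. pos_semidef (G i)" and t: "t \<in> {0..T}"
  and a: "\<And>j. sq_integrable M (\<lambda>w. a w $ j)" and b: "\<And>j. sq_integrable M (\<lambda>w. b w $ j)"
 shows "2 * (\<E> w. (G (\<alpha> t w) *v a w) \<bullet> b w)
  <= (\<E> w. (G (\<alpha> t w) *v a w) \<bullet> a w) + (\<E> w. (G (\<alpha> t w) *v b w) \<bullet> b w)"
proof -
 note i1 = terminal_form_sum(1)[OF t a b, of G] and i2 = terminal_form_sum(1)[OF t a a, of G]
  and i3 = terminal_form_sum(1)[OF t b b, of G]
 have "(\<E> w. 2 * ((G (\<alpha> t w) *v a w) \<bullet> b w))
  <= (\<E> w. (G (\<alpha> t w) *v a w) \<bullet> a w + (G (\<alpha> t w) *v b w) \<bullet> b w)"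
  using i1 i2 i3 psd_polarization[OF G] by (intro integral_mono) auto
 then show ?thesis using i2 i3 by simp
qed

end

context follower_response begin

text \<open>Membership in \<open>L2_space\<close> controls a process at almost every time only; at
  \<open>T\<close> itself square integrability comes from the Ito representation of the
  state.\<close>

lemma terminal_sq:
 assumes st: "is_state M T W \<alpha> d x0 u1 u2 y yh" and u1: "u1 \<in> L2"
 shows "sq_integrable M (\<lambda>w. y T w $ j)" "sq_integrable M (\<lambda>w. yh T w $ j)"
proof -
 have T: "T \<in> {0..T}" using T_pos by simp
 note Y = state_process[OF st u1 u2(1)]
 have sq: "sq_integrable M (\<lambda>w. y T w $ j)" for j by (rule ito_process_sq[OF vector_ito_processD[OF Y(5)] T])
 then show "sq_integrable M (\<lambda>w. y T w $ j)" .
 show "sq_integrable M (\<lambda>w. yh T w $ j)"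
  using chain_projection_projects_at(1)[OF Y(2) T sq, of j] unfolding projects_at_def by blast
qed

lemma follower_cost_eq:
 assumes st: "is_state M T W \<alpha> d x0 u1 u2 y yh" and u1: "u1 \<in> L2"
 shows "2 * follower_cost M T \<alpha> d y yh u1
  = (\<E> w. (cG1 d (\<alpha> T w) *v y T w) \<bullet> y T w) + (\<E> w. (cG1h d (\<alpha> T w) *v yh T w) \<bullet> yh T w)
  + mean_inner (\<lambda>t w. cQ1 d (\<alpha> t w) *v y t w) y + mean_inner (\<lambda>t w. cQ1h d (\<alpha> t w) *v yh t w) yh
  + mean_inner (\<lambda>t w. cN1 d (\<alpha> t w) *v u1 t w) u1"
proof -
 have T: "T \<in> {0..T}" using T_pos by simp
 note Y = state_process[OF st u1 u2(1)]
 note sq = terminal_sq[OF st u1]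
 note i1 = L2_inner[OF L2_coefficient[OF Y(1), of "cQ1 d"] Y(1)] and i2 = L2_inner[OF L2_coefficient[OF Y(4), of "cQ1h d"] Y(4)]
  and i3 = L2_inner[OF L2_coefficient[OF u1, of "cN1 d"] u1]
 note t1 = terminal_form_sum(1)[OF T sq(1) sq(1), of "cG1 d"] and t2 = terminal_form_sum(1)[OF T sq(2) sq(2), of "cG1h d"]
 have i12: "integrable Q (\<lambda>(t, w). (cQ1 d (\<alpha> t w) *v y t w) \<bullet> y t w + (cQ1h d (\<alpha> t w) *v yh t w) \<bullet> yh t w)"
  by (rule integrable_Q_add[OF i1 i2])
 have i123: "integrable Q (\<lambda>(t, w). (cQ1 d (\<alpha> t w) *v y t w) \<bullet> y t w + (cQ1h d (\<alpha> t w) *v yh t w) \<bullet> yh t w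
   + (cN1 d (\<alpha> t w) *v u1 t w) \<bullet> u1 t w)"
  by (rule integrable_Q_add[OF i12 i3])
 show ?thesis
  unfolding follower_cost_def mean_inner_def
  using mean_integral_paths[OF i123] t1 t2 mean_integral_add[OF i12 i3] mean_integral_add[OF i1 i2] by simp
qed

lemma follower_cost_response: "2 * follower_cost M T \<alpha> d x xh u1s = \<kappa>"
 using follower_cost_eq[OF state u1s_L2] cost_duality[OF state u1s_L2] by simp

text \<open>The five polarization inequalities add up to: twice the bilinear form of candidate and
  competitor is at most the sum of twice their costs. That form equals \<kappa>, which is also twice
  the cost of the candidate, so \<kappa> is at most twice the cost of the competitor.\<close>

lemma response_optimal:
 assumes st: "is_state M T W \<alpha> d x0 u1 u2 y yh" and u1: "u1 \<in> L2"
 shows "follower_cost M T \<alpha> d x xh u1s <= follower_cost M T \<alpha> d y yh u1"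
proof -
 have T: "T \<in> {0..T}" using T_pos by simp
 note Y = state_process[OF st u1 u2(1)]
 note terminal_polarization[of "cG1 d", OF psd(4) T terminal_sq(1)[OF state u1s_L2] terminal_sq(1)[OF st u1]]
  terminal_polarization[of "cG1h d", OF psd(5) T terminal_sq(2)[OF state u1s_L2] terminal_sq(2)[OF st u1]]
  mean_inner_polarization[of "cQ1 d", OF psd(1) x_projects(1) Y(1)]
  mean_inner_polarization[of "cQ1h d", OF psd(2) x_projects(3) Y(4)]
  mean_inner_polarization[of "cN1 d", OF pos_def_imp_semidef[OF psd(3)] u1s_L2 u1]
 then show ?thesis
  using follower_cost_eq[OF state u1s_L2] follower_cost_eq[OF st u1] cost_duality[OF st u1] follower_cost_response
  by linarith
qed

text \<open>Twice the cost is \<kappa>, which contains \<open>v \<bullet> x0\<close> once.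
  Evaluating its term with \<open>u2\<close> by duality of \<open>\<phi>\<close> with
  \<open>x\<close> brings a second copy, so this term has coefficient 1 in the cost while the others
  keep 1/2.\<close>

lemma response_value:
 "follower_cost M T \<alpha> d x xh u1s = 1/2 * (((P 0 i0 + Ph 0 i0) *v x0) \<bullet> x0) + v \<bullet> x0
   + 1/2 * (LINT w|M. (LINT t:{0..T}|lborel.
       - (norm (psd_sqrt (R t (\<alpha> t w)) *v \<Phi> t w))\<^sup>2
       + ((transpose (cD2 d (\<alpha> t w)) ** P t (\<alpha> t w) ** cD2 d (\<alpha> t w)) *v u2 t w) \<bullet> u2 t w
       + 2 * ((transpose (cB2 d (\<alpha> t w)) *v \<phi> t w
           + transpose (cD2 d (\<alpha> t w)) *v \<theta> t w) \<bullet> u2 t w)))"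
proof -
 define b where "b = state_drift u1s u2 x xh"
 define s where "s = state_diffusion u1s u2 x xh"
 define z where "z t w = transpose (cB2 d (\<alpha> t w)) *v p t w + transpose (cD2 d (\<alpha> t w)) *v q t w" for t w
 define f1 where "f1 t w = transpose (bbA d P t (\<alpha> t w)) *v \<phi> t w + transpose (bbC d P t (\<alpha> t w)) *v \<theta> t w
   + transpose (bbF2 d P t (\<alpha> t w)) *v u2 t w" for t w
 \<comment> \<open>The driver contains \<open>f2h\<close>, with hatted processes tested against
   \<open>x\<close>. Moving the hat onto \<open>x\<close> gives \<open>f2\<close> tested against
   \<open>xh\<close>, the shape in which \<open>value_identity\<close> applies at a fixed time and
   path.\<close>
 define f2 where "f2 t w = transpose (bbAh d P Ph t (\<alpha> t w)) *v \<phi> t w + transpose (bbCh d P Ph t (\<alpha> t w)) *v \<theta> t w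
   + transpose (bbF2h d P Ph t (\<alpha> t w)) *v u2 t w" for t w
 define f2h where "f2h t w = transpose (bbAh d P Ph t (\<alpha> t w)) *v \<phi>h t w + transpose (bbCh d P Ph t (\<alpha> t w)) *v \<theta>h t w
   + transpose (bbF2h d P Ph t (\<alpha> t w)) *v u2h t w" for t w
 define r where "r t w = R t (\<alpha> t w) *v \<Phi> t w" for t w
 define g where "g t w = (transpose (cD2 d (\<alpha> t w)) ** P t (\<alpha> t w) ** cD2 d (\<alpha> t w)) *v u2 t w" for t w
 define h where "h t w = transpose (cB2 d (\<alpha> t w)) *v \<phi> t w + transpose (cD2 d (\<alpha> t w)) *v \<theta> t w" for t w
 note abs_defs = z_def[abs_def] f1_def[abs_def] r_def[abs_def] g_def[abs_def] h_def[abs_def]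
 have base: "b \<in> L2" "s \<in> L2" "\<Phi> \<in> L2"
  unfolding b_def s_def by (intro state_coefficients_L2 x_projects u1s_L2 u2 vector_projects_L2(1)[OF \<Phi>_projects])+
 have L: "z \<in> L2" "f1 \<in> L2" "r \<in> L2" "g \<in> L2" "h \<in> L2"
  unfolding abs_defs
  by (intro L2_add L2_coefficient[of _ "\<lambda>i. transpose (_ d i)"] L2_matrix[of "\<lambda>t i. transpose (bbA d P t i)"]
   L2_matrix[of "\<lambda>t i. transpose (bbC d P t i)"] L2_matrix[of "\<lambda>t i. transpose (bbF2 d P t i)"] L2_matrix[of R]
   L2_matrix[of "\<lambda>t i. transpose (cD2 d i) ** P t i ** cD2 d i"] cont base pq_L2 \<phi> \<theta> u2)+
 have f2: "vector_projects f2 f2h"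
  unfolding f2_def[abs_def] f2h_def[abs_def]
  by (intro vector_projects_add vector_projects_matrix[of "\<lambda>t i. transpose (bbAh d P Ph t i)"]
   vector_projects_matrix[of "\<lambda>t i. transpose (bbCh d P Ph t i)"] vector_projects_matrix[of "\<lambda>t i. transpose (bbF2h d P Ph t i)"]
   cont \<phi> \<theta> u2)
 note f2L = vector_projects_L2[OF f2]
 have dual: "v \<bullet> x0 + mean_inner \<phi> b + mean_inner \<theta> s - mean_inner f x = 0"
  unfolding b_def s_def by (rule backward_duality[OF x_ito])
 have "f = (\<lambda>t w. f1 t w + f2h t w)" unfolding f bsde_driver_def by (simp add: fun_eq_iff f1_def f2h_def)
 then have fx: "mean_inner f x = mean_inner f1 x + mean_inner f2 xh"
  using mean_inner_swap[OF f2 x_projects(2)] by (simp add: mean_inner_add_left[where F = joint] L f2L x_projects)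
 have identity: "z t w \<bullet> u2 t w + \<phi> t w \<bullet> b t w + \<theta> t w \<bullet> s t w
   = f1 t w \<bullet> x t w + f2 t w \<bullet> xh t w - r t w \<bullet> \<Phi> t w + g t w \<bullet> u2 t w + 2 * (h t w \<bullet> u2 t w)" if t: "t \<in> {0..T}" for t w
  unfolding z_def b_def s_def f1_def f2_def r_def g_def h_def p_def q_def state_drift_def state_diffusion_def
  by (rule value_identity[where d = d and P = P and Ph = Ph and t = t and i = "\<alpha> t w",
     OF symmetric_coefficients(1)[OF t] symmetric_coefficients(3)[OF t] symmetric_coefficients(2)[OF t]])
   (simp_all add: u1s \<Phi> follower_offset_def)
 define Z where "Z t w = - (norm (psd_sqrt (R t (\<alpha> t w)) *v \<Phi> t w))\<^sup>2 + g t w \<bullet> u2 t w + 2 * (h t w \<bullet> u2 t w)" for t w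
 have Z: "Z t w = (z t w \<bullet> u2 t w + \<phi> t w \<bullet> b t w + \<theta> t w \<bullet> s t w) - (f1 t w \<bullet> x t w + f2 t w \<bullet> xh t w)"
  if t: "t \<in> {0..T}" for t w
  using identity[OF t, of w] norm_psd_sqrt_vector[OF pos_def_matrix_inv(3)[OF N1_tilde_pos[OF t]], of "\<alpha> t w" "\<Phi> t w"]
  by (simp add: Z_def r_def)
 note j1 = L2_inner[OF L(1) u2(1)] and j2 = L2_inner[OF \<phi>(1) base(1)] and j3 = L2_inner[OF \<theta>(1) base(2)]
  and j4 = L2_inner[OF L(2) x_projects(1)] and j5 = L2_inner[OF f2L(1) x_projects(3)]
 have j12: "integrable Q (\<lambda>(t, w). z t w \<bullet> u2 t w + \<phi> t w \<bullet> b t w)"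
  by (rule integrable_Q_add[OF j1 j2])
 have j123: "integrable Q (\<lambda>(t, w). z t w \<bullet> u2 t w + \<phi> t w \<bullet> b t w + \<theta> t w \<bullet> s t w)"
  by (rule integrable_Q_add[OF j12 j3])
 have j45: "integrable Q (\<lambda>(t, w). f1 t w \<bullet> x t w + f2 t w \<bullet> xh t w)"
  by (rule integrable_Q_add[OF j4 j5])
 have j: "integrable Q (\<lambda>(t, w). (z t w \<bullet> u2 t w + \<phi> t w \<bullet> b t w + \<theta> t w \<bullet> s t w) - (f1 t w \<bullet> x t w + f2 t w \<bullet> xh t w))"
  using lint_diff[OF j123 j45] by (simp add: case_prod_unfold)
 have "(LINT w|M. (LINT t:{0..T}|lborel. Z t w))
  = (LINT w|M. (LINT t:{0..T}|lborel. (z t w \<bullet> u2 t w + \<phi> t w \<bullet> b t w + \<theta> t w \<bullet> s t w) - (f1 t w \<bullet> x t w + f2 t w \<bullet> xh t w)))"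
  by (intro lintegral_cong refl set_lebesgue_integral_cong) (auto intro: Z)
 also have "... = mean_inner z u2 + mean_inner \<phi> b + mean_inner \<theta> s - (mean_inner f1 x + mean_inner f2 xh)"
  unfolding mean_integral_paths(2)[OF j] mean_integral_diff[OF j123 j45] mean_integral_add[OF j12 j3]
   mean_integral_add[OF j1 j2] mean_integral_add[OF j4 j5] mean_inner_def ..
 finally have "(LINT w|M. (LINT t:{0..T}|lborel. Z t w)) = mean_inner z u2 - v \<bullet> x0" using dual fx by linarith
 moreover have "2 * follower_cost M T \<alpha> d x xh u1s = ((P 0 i0 + Ph 0 i0) *v x0) \<bullet> x0 + v \<bullet> x0 + mean_inner z u2"
  unfolding follower_cost_response \<kappa>_def z_def ..
 ultimately show ?thesis unfolding Z_def g_def h_def by linarith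
qed

end

theorem lemma3p3:
  fixes M :: "'w measure" and T :: real
    and W :: "real \<Rightarrow> 'w \<Rightarrow> real" and \<alpha> :: "real \<Rightarrow> 'w \<Rightarrow> 's::finite"
    and gen :: "'s \<Rightarrow> 's \<Rightarrow> real" and i0 :: 's
    and d :: "('s, 'n::finite, 'm1::finite, 'm2::finite) lq_data" and x0 :: "real^'n"
    and P1 P1h :: "real \<Rightarrow> 's \<Rightarrow> real^'n^'n"
    and u1s :: "real \<Rightarrow> 'w \<Rightarrow> real^'m1" and u2 :: "real \<Rightarrow> 'w \<Rightarrow> real^'m2"
    and x xh \<phi> \<theta> :: "real \<Rightarrow> 'w \<Rightarrow> real^'n"
    and \<eta> :: "'s \<Rightarrow> 's \<Rightarrow> real \<Rightarrow> 'w \<Rightarrow> real^'n"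
    and \<Phi> :: "real \<Rightarrow> 'w \<Rightarrow> real^'m1"
  assumes "prob_space M" and "0 < T"
    and "standard_brownian_motion M T W"
    and "markov_chain M T gen i0 \<alpha>"
    and "prob_space.indep_set M (sets (noise_filtration M W T)) (sets (chain_filtration M \<alpha> T))"
    and A1: "\<And>i. pos_semidef (cQ1 d i)" "\<And>i. pos_semidef (cQ1h d i)" "\<And>i. pos_def (cN1 d i)"
        "\<And>i. pos_semidef (cG1 d i)" "\<And>i. pos_semidef (cG1h d i)"
    and "riccati1 d gen T P1"
    and "riccati2 d gen T P1 P1h"
    and "u2 \<in> L2_space M (joint_filtration M W \<alpha>) T"
    and "is_bsde_solution M T W gen \<alpha> d P1 P1h u2 \<phi> \<theta> \<eta>"
    and \<Phi>_def: "\<Phi> = follower_offset \<alpha> d P1 u2 \<phi> \<theta>"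
    and u1s_def: "u1s = (\<lambda>t \<omega>. - (matrix_inv (N1_tilde d P1 t (\<alpha> t \<omega>)) *v
           (S1 d P1 t (\<alpha> t \<omega>) *v x t \<omega> + S1h d P1 P1h t (\<alpha> t \<omega>) *v xh t \<omega> + \<Phi> t \<omega>)))"
    and "is_state M T W \<alpha> d x0 u1s u2 x xh"
  shows "u1s \<in> L2_space M (joint_filtration M W \<alpha>) T
    \<and> (\<forall>u1 \<in> L2_space M (joint_filtration M W \<alpha>) T. \<forall>y yh.
         is_state M T W \<alpha> d x0 u1 u2 y yh \<longrightarrow>
           follower_cost M T \<alpha> d x xh u1s \<le> follower_cost M T \<alpha> d y yh u1)
    \<and> (AE \<omega>0 in M. follower_cost M T \<alpha> d x xh u1s =
         1/2 * (((P1 0 i0 + P1h 0 i0) *v x0) \<bullet> x0) + \<phi> 0 \<omega>0 \<bullet> x0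
         + 1/2 * (LINT \<omega>|M. (LINT t:{0..T}|lborel.
             - (norm (psd_sqrt (matrix_inv (N1_tilde d P1 t (\<alpha> t \<omega>))) *v \<Phi> t \<omega>))\<^sup>2
             + ((transpose (cD2 d (\<alpha> t \<omega>)) ** P1 t (\<alpha> t \<omega>) ** cD2 d (\<alpha> t \<omega>)) *v u2 t \<omega>) \<bullet> u2 t \<omega>
             + 2 * ((transpose (cB2 d (\<alpha> t \<omega>)) *v \<phi> t \<omega>
                     + transpose (cD2 d (\<alpha> t \<omega>)) *v \<theta> t \<omega>) \<bullet> u2 t \<omega>))))"
proof -
 interpret prob_space M by fact
 interpret follower M T W \<alpha> gen i0 d P1 P1h by unfold_locales fact+
 obtain \<phi>h \<theta>h u2h I J where hats: "chain_projection M T \<alpha> \<phi> \<phi>h" "chain_projection M T \<alpha> \<theta> \<theta>h" "chain_projection M T \<alpha> u2 u2h"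
  and I: "has_ito_integral M joint T W \<theta> I" and J: "has_chain_integral M joint T gen \<alpha> \<eta> J"
  and eq: "\<And>t. t \<in> {0..T} ==> AE w in M. \<phi> t w =
      (LINT s:{t..T}|lborel.
        transpose (bbA d P1 s (\<alpha> s w)) *v \<phi> s w
       + transpose (bbAh d P1 P1h s (\<alpha> s w)) *v \<phi>h s w
       + transpose (bbC d P1 s (\<alpha> s w)) *v \<theta> s w
       + transpose (bbCh d P1 P1h s (\<alpha> s w)) *v \<theta>h s w
       + transpose (bbF2 d P1 s (\<alpha> s w)) *v u2 s w
       + transpose (bbF2h d P1 P1h s (\<alpha> s w)) *v u2h s w)
      - (I T w - I t w) - (J T w - J t w)"
  and sol: "\<phi> \<in> L2" "\<theta> \<in> L2"
  using \<open>is_bsde_solution M T W gen \<alpha> d P1 P1h u2 \<phi> \<theta> \<eta>\<close> unfolding is_bsde_solution_def S2_space_def by blast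
 define f where "f = bsde_driver u2 u2h \<phi> \<phi>h \<theta> \<theta>h"
 have u2: "u2 \<in> L2" by fact
 note pr = L2_projects[OF sol(1) hats(1)] L2_projects[OF sol(2) hats(2)] L2_projects[OF u2 hats(3)]
 have fL: "f \<in> L2"
  unfolding f_def by (rule bsde_driver_L2[OF u2 vector_projects_L2(2)[OF pr(3)] sol(1) vector_projects_L2(2)[OF pr(1)]
    sol(2) vector_projects_L2(2)[OF pr(2)]])
 have eq': "AE w in M. \<phi> t w = (LINT s:{t..T}|lborel. f s w) - (I T w - I t w) - (J T w - J t w)" if "t \<in> {0..T}" for t
  unfolding f_def bsde_driver_def by (rule eq[OF that])
 obtain v where v: "AE w in M. \<phi> 0 w = v"
  and dual: "\<And>y0 b k Y. vector_ito_process y0 b k Y ==>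
   v \<bullet> y0 + mean_integral T (\<lambda>s w. \<phi> s w \<bullet> b s w + \<theta> s w \<bullet> k s w - f s w \<bullet> Y s w) = 0"
  using bsde_duality[OF sol fL I J eq'] by blast
 interpret follower_response M T W \<alpha> gen i0 d P1 P1h x0 v u2 u2h \<phi> \<phi>h \<theta> \<theta>h x xh u1s \<Phi> f
  by unfold_locales (fact u2 pr sol f_def dual \<Phi>_def u1s_def \<open>is_state M T W \<alpha> d x0 u1s u2 x xh\<close>)+
 show ?thesis
 proof (intro conjI ballI allI impI)
  show "u1s \<in> L2" by (rule u1s_L2)
  show "follower_cost M T \<alpha> d x xh u1s <= follower_cost M T \<alpha> d y yh u1"
   if "u1 \<in> L2" "is_state M T W \<alpha> d x0 u1 u2 y yh" for u1 y yh
   by (rule response_optimal[OF that(2,1)])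
  show "AE w0 in M. follower_cost M T \<alpha> d x xh u1s =
     1/2 * (((P1 0 i0 + P1h 0 i0) *v x0) \<bullet> x0) + \<phi> 0 w0 \<bullet> x0
     + 1/2 * (LINT w|M. (LINT t:{0..T}|lborel.
       - (norm (psd_sqrt (matrix_inv (N1_tilde d P1 t (\<alpha> t w))) *v \<Phi> t w))\<^sup>2
       + ((transpose (cD2 d (\<alpha> t w)) ** P1 t (\<alpha> t w) ** cD2 d (\<alpha> t w)) *v u2 t w) \<bullet> u2 t w
       + 2 * ((transpose (cB2 d (\<alpha> t w)) *v \<phi> t w
           + transpose (cD2 d (\<alpha> t w)) *v \<theta> t w) \<bullet> u2 t w)))"
   using v by eventually_elim (simp only: response_value)
 qed
qed

end
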